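(* Let $L_1,L_2>0$, let $m\in\mathbb{N}=\{1,2,\dots\}$, and let $u(y)=\big(\sin(2\pi y/L_2)\big)^m$. There exists $\varepsilon_0'>0$, independent of $\nu$, such that for every $0<\nu<1$, every $g\in L^2(\mathbb{T}^2)$ and every $t\ge 0$, $$\|e^{-tH_\nu}g_{\neq}\|_{L^2}\le e^{-\lambda_\nu' t+\pi/2}\,\|g_{\neq}\|_{L^2},\qquad \lambda_\nu'=\varepsilon_0'\,\nu^{\frac{\max\{2,m\}}{\max\{2,m\}+4}},$$ where $H_\nu=\nu\Delta^2+u(y)\partial_x$.
   Context: $\mathbb{T}^2$ denotes the two-dimensional torus obtained from $[0,L_1]\times[0,L_2]$ with periodic boundary conditions, with coordinates $(x,y)$. For $g\in L^2(\mathbb{T}^2)$, $$\langle g\rangle(y)=\frac1{L_1}\int_0^{L_1}g(x,y)\,dx,\qquad g_{\neq}(x,y)=g(x,y)-\langle g\rangle(y).$$ $H_\nu=\nu\Delta^2+u(y)\partial_x$ is viewed as an unbounded operator on $L^2(\mathbb{T}^2)$, and $e^{-tH_\nu}$ is the semigroup generated by $-H_\nu$, i.e. the solution operator of $\partial_t g+u(y)\partial_x g+\nu\Delta^2 g=0$. *)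

theory Defs
  imports "HOL-Analysis.Analysis"
begin

section \<open>The space of square-integrable functions on the torus\<close>

text \<open>
  The torus is represented by its fundamental domain, and elements of
  \<open>L\<^sup>2\<close> by complex-valued functions on the plane, of which only the restriction to the
  fundamental domain matters. Equality in \<open>L\<^sup>2\<close> is equality almost everywhere.
\<close>

definition torus :: "real \<Rightarrow> real \<Rightarrow> (real \<times> real) measure" where
  "torus L1 L2 = restrict_space lborel ({0..L1} \<times> {0..L2})"

definition L2_torus :: "real \<Rightarrow> real \<Rightarrow> (real \<times> real \<Rightarrow> complex) set" where
  "L2_torus L1 L2 =
     {g. g \<in> borel_measurable (torus L1 L2) \<and> integrable (torus L1 L2) (\<lambda>z. (cmod (g z))\<^sup>2)}"

definition L2_norm :: "real \<Rightarrow> real \<Rightarrow> (real \<times> real \<Rightarrow> complex) \<Rightarrow> real" where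
  "L2_norm L1 L2 g = sqrt (\<integral>z. (cmod (g z))\<^sup>2 \<partial>torus L1 L2)"

definition x_mean :: "real \<Rightarrow> (real \<times> real \<Rightarrow> complex) \<Rightarrow> real \<Rightarrow> complex" where
  "x_mean L1 g y = (1 / L1) *\<^sub>R (LINT x:{0..L1}|lborel. g (x, y))"

definition nonzero_modes ::
    "real \<Rightarrow> (real \<times> real \<Rightarrow> complex) \<Rightarrow> real \<times> real \<Rightarrow> complex" where
  "nonzero_modes L1 g = (\<lambda>(x, y). g (x, y) - x_mean L1 g y)"


section \<open>Weak derivatives on the torus\<close>

definition partial_x :: "(real \<times> real \<Rightarrow> complex) \<Rightarrow> real \<times> real \<Rightarrow> complex" where
  "partial_x f z = frechet_derivative f (at z) (1, 0)"

definition partial_y :: "(real \<times> real \<Rightarrow> complex) \<Rightarrow> real \<times> real \<Rightarrow> complex" where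
  "partial_y f z = frechet_derivative f (at z) (0, 1)"

definition laplacian :: "(real \<times> real \<Rightarrow> complex) \<Rightarrow> real \<times> real \<Rightarrow> complex" where
  "laplacian f z = partial_x (partial_x f) z + partial_y (partial_y f) z"

primrec Ck :: "nat \<Rightarrow> (real \<times> real \<Rightarrow> complex) \<Rightarrow> bool" where
  "Ck 0 f \<longleftrightarrow> continuous_on UNIV f"
| "Ck (Suc k) f \<longleftrightarrow> (\<forall>z. f differentiable (at z)) \<and> Ck k (partial_x f) \<and> Ck k (partial_y f)"

text \<open>Smooth functions on the torus, as smooth doubly periodic functions on the plane.\<close>

definition test_functions :: "real \<Rightarrow> real \<Rightarrow> (real \<times> real \<Rightarrow> complex) set" where
  "test_functions L1 L2 =
     {\<phi>. (\<forall>k. Ck k \<phi>) \<and> (\<forall>x y. \<phi> (x + L1, y) = \<phi> (x, y) \<and> \<phi> (x, y + L2) = \<phi> (x, y))}"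

definition weak_partial_x ::
    "real \<Rightarrow> real \<Rightarrow> (real \<times> real \<Rightarrow> complex) \<Rightarrow> (real \<times> real \<Rightarrow> complex) \<Rightarrow> bool" where
  "weak_partial_x L1 L2 g p \<longleftrightarrow>
     (\<forall>\<phi>\<in>test_functions L1 L2.
        (\<integral>z. p z * \<phi> z \<partial>torus L1 L2) = - (\<integral>z. g z * partial_x \<phi> z \<partial>torus L1 L2))"

definition weak_bilaplacian ::
    "real \<Rightarrow> real \<Rightarrow> (real \<times> real \<Rightarrow> complex) \<Rightarrow> (real \<times> real \<Rightarrow> complex) \<Rightarrow> bool" where
  "weak_bilaplacian L1 L2 g q \<longleftrightarrow>
     (\<forall>\<phi>\<in>test_functions L1 L2.
        (\<integral>z. q z * \<phi> z \<partial>torus L1 L2) = (\<integral>z. g z * laplacian (laplacian \<phi>) z \<partial>torus L1 L2))"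


section \<open>Semigroups of operators and their generators\<close>

text \<open>
  Unbounded operators are represented by their graphs: \<open>A g h\<close> means that
  \<open>g\<close> lies in the domain of \<open>A\<close> and that \<open>h\<close> represents \<open>A g\<close>.
\<close>

definition C0_semigroup ::
    "real \<Rightarrow> real \<Rightarrow> (real \<Rightarrow> (real \<times> real \<Rightarrow> complex) \<Rightarrow> (real \<times> real \<Rightarrow> complex)) \<Rightarrow> bool" where
  "C0_semigroup L1 L2 S \<longleftrightarrow>
     (\<forall>t\<ge>0. \<forall>f\<in>L2_torus L1 L2. S t f \<in> L2_torus L1 L2) \<and>
     (\<forall>t\<ge>0. \<forall>f\<in>L2_torus L1 L2. \<forall>g\<in>L2_torus L1 L2. \<forall>a b.
        AE z in torus L1 L2. S t (\<lambda>w. a * f w + b * g w) z = a * S t f z + b * S t g z) \<and>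
     (\<forall>t\<ge>0. \<exists>C. \<forall>f\<in>L2_torus L1 L2. L2_norm L1 L2 (S t f) \<le> C * L2_norm L1 L2 f) \<and>
     (\<forall>f\<in>L2_torus L1 L2. AE z in torus L1 L2. S 0 f z = f z) \<and>
     (\<forall>s\<ge>0. \<forall>t\<ge>0. \<forall>f\<in>L2_torus L1 L2. AE z in torus L1 L2. S (s + t) f z = S s (S t f) z) \<and>
     (\<forall>f\<in>L2_torus L1 L2. ((\<lambda>t. L2_norm L1 L2 (\<lambda>z. S t f z - f z)) \<longlongrightarrow> 0) (at_right 0))"

definition generator ::
    "real \<Rightarrow> real \<Rightarrow> (real \<Rightarrow> (real \<times> real \<Rightarrow> complex) \<Rightarrow> (real \<times> real \<Rightarrow> complex)) \<Rightarrow>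
     (real \<times> real \<Rightarrow> complex) \<Rightarrow> (real \<times> real \<Rightarrow> complex) \<Rightarrow> bool" where
  "generator L1 L2 S g h \<longleftrightarrow>
     g \<in> L2_torus L1 L2 \<and> h \<in> L2_torus L1 L2 \<and>
     ((\<lambda>t. L2_norm L1 L2 (\<lambda>z. (1 / t) *\<^sub>R (S t g z - g z) - h z)) \<longlongrightarrow> 0) (at_right 0)"

text \<open>
  The operator \<open>\<nu> \<Delta>\<^sup>2 + u(y) \<partial>\<^sub>x\<close> with its natural domain: all \<open>g\<close> in \<open>L\<^sup>2\<close> whose
  distributional \<open>\<partial>\<^sub>x g\<close> and \<open>\<Delta>\<^sup>2 g\<close> are in \<open>L\<^sup>2\<close>. By elliptic regularity on the torus this is the
  Sobolev space \<open>H\<^sup>4\<close>.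
\<close>

definition H_op ::
    "real \<Rightarrow> real \<Rightarrow> (real \<Rightarrow> real) \<Rightarrow> real \<Rightarrow>
     (real \<times> real \<Rightarrow> complex) \<Rightarrow> (real \<times> real \<Rightarrow> complex) \<Rightarrow> bool" where
  "H_op L1 L2 u \<nu> g h \<longleftrightarrow>
     g \<in> L2_torus L1 L2 \<and> h \<in> L2_torus L1 L2 \<and>
     (\<exists>p\<in>L2_torus L1 L2. \<exists>q\<in>L2_torus L1 L2.
        weak_partial_x L1 L2 g p \<and> weak_bilaplacian L1 L2 g q \<and>
        (AE z in torus L1 L2. h z = \<nu> *\<^sub>R q z + u (snd z) *\<^sub>R p z))"

text \<open>\<open>S t\<close> plays the role of \<open>e\<^bsup>-tH\<^esup>\<close>: the generator of \<open>S\<close> is \<open>-H\<close>, with equality of domains.\<close>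

definition semigroup_generated_by_minus ::
    "real \<Rightarrow> real \<Rightarrow> ((real \<times> real \<Rightarrow> complex) \<Rightarrow> (real \<times> real \<Rightarrow> complex) \<Rightarrow> bool) \<Rightarrow>
     (real \<Rightarrow> (real \<times> real \<Rightarrow> complex) \<Rightarrow> (real \<times> real \<Rightarrow> complex)) \<Rightarrow> bool" where
  "semigroup_generated_by_minus L1 L2 H S \<longleftrightarrow>
     C0_semigroup L1 L2 S \<and> (\<forall>g h. generator L1 L2 S g (\<lambda>z. - h z) \<longleftrightarrow> H g h)"

end

theory Submission
  imports Defs
begin

text \<open>
  On Fourier coefficients in \<open>x\<close> the equation decouples, and for a frequency \<open>\<kappa> \<noteq> 0\<close> everything rests
  on a resolvent bound \<open>\<Psi> \<parallel>w\<parallel> \<le> \<parallel>\<nu> (\<kappa>\<^sup>2 - \<partial>\<^sub>y\<^sup>2)\<^sup>2 w + \<i> \<kappa> (u - c) w\<parallel>\<close>, uniform in the real number \<open>c\<close>, with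
  \<open>\<Psi>\<close> of order \<open>\<nu> powr (p / (p + 4))\<close> and \<open>p = max 2 m\<close>. Pairing with \<open>\<psi> w\<close>, where \<open>\<psi>\<close> is a smoothed
  sign of \<open>u - c\<close> at scale \<open>\<delta>\<close>, controls \<open>w\<close> at distance \<open>\<delta>\<close> from the level set \<open>{u = c}\<close>, where \<open>\<bar>u - c\<bar>\<close> is
  at least of order \<open>\<delta> ^ p\<close>; the remaining set has measure \<open>O(\<delta>)\<close> and is absorbed by a sup bound. The two
  effects \<open>\<nu> \<delta> powr (-4)\<close> and \<open>\<delta> ^ p\<close> balance at \<open>\<delta> = \<nu> powr (1 / (p + 4))\<close>. Multiplying the
  solution by \<open>sin (\<pi> t / T)\<close> and expanding in time, the resolvent bound shows that the energy drops by
  the factor 4 in time \<open>2 \<pi> / \<Psi>\<close>.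
  A semigroup with the prescribed generator acts on trigonometric polynomials through these
  equations, and a density argument gives the estimate on all of \<open>L\<^sup>2\<close>.
\<close>

section \<open>Square-integrable functions and orthonormal systems\<close>

text \<open>The semigroup is known only through its generator and a bound at each single time, so
  local uniform boundedness has to be derived, and only scalar Fourier coefficients are
  differentiated in time. Each row of fixed \<open>x\<close>-frequency is an infinite system: an
  unbounded real diagonal part plus the convolution \<open>sin_conv\<close> of range
  \<open>m\<close>. Passages from finitely many coefficients of a row to \<open>l^2\<close> use the
  tent \<open>cutoff R\<close>: it commutes with the diagonal part and its commutator with the
  convolution is \<open>O(1/R)\<close>, so no decay of the coefficients has to be established.

  The zero frequency feels no shear; \<open>nonzero_modes\<close> removes it, and the others satisfy
  \<open>2 * pi / L1 \<le> \<bar>\<kappa>\<bar>\<close>, which makes the constants uniform. The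
  multiplier must have exactly the sign of \<open>u - c\<close>, also when the level set meets
  critical points of \<open>u\<close>; it is a product of two \<open>tanh\<close> of sines because
  the sign of \<open>u - c\<close> is that of a product of two sines. Cutting time into blocks loses
  a factor 2, which is affordable since \<open>2 \<le> exp (pi / 2)\<close>.\<close>

definition square_integrable :: "'a measure \<Rightarrow> ('a \<Rightarrow> complex) set" where
  "square_integrable M =
     {f. f \<in> borel_measurable M \<and> integrable M (\<lambda>z. (cmod (f z))\<^sup>2)}"

definition norm2 :: "'a measure \<Rightarrow> ('a \<Rightarrow> complex) \<Rightarrow> real" where
  "norm2 M f = sqrt (\<integral>z. (cmod (f z))\<^sup>2 \<partial>M)"

lemma square_integrableI:
  "\<lbrakk>f \<in> borel_measurable M; integrable M (\<lambda>z. (cmod (f z))\<^sup>2)\<rbrakk> \<Longrightarrow> f \<in> square_integrable M"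
  by (simp add: square_integrable_def)

lemma square_integrableD:
  assumes "f \<in> square_integrable M"
  shows "f \<in> borel_measurable M" "integrable M (\<lambda>z. (cmod (f z))\<^sup>2)"
  using assms by (auto simp: square_integrable_def)

lemma norm2_nonneg [simp]: "0 \<le> norm2 M f"
  by (simp add: norm2_def)

lemma norm2_power2: "(norm2 M f)\<^sup>2 = (\<integral>z. (cmod (f z))\<^sup>2 \<partial>M)"
  by (simp add: norm2_def)

lemma norm2_cong_AE:
  assumes "AE z in M. f z = g z" "f \<in> borel_measurable M" "g \<in> borel_measurable M"
  shows "norm2 M f = norm2 M g"
  unfolding norm2_def using assms
  by (intro arg_cong[where f=sqrt] integral_cong_AE) auto

lemma integrable_square_bound:
  assumes "f \<in> borel_measurable M" "integrable M g" "\<And>z. (cmod (f z))\<^sup>2 \<le> g z"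
  shows "f \<in> square_integrable M"
proof (rule square_integrableI)
  show "integrable M (\<lambda>z. (cmod (f z))\<^sup>2)"
    using assms(1) order_trans[OF assms(3) abs_ge_self]
    by (intro Bochner_Integration.integrable_bound[OF assms(2)]) auto
qed fact

lemma square_integrable_scale:
  assumes "f \<in> square_integrable M" shows "(\<lambda>z. c * f z) \<in> square_integrable M"
  using square_integrableD[OF assms]
  by (intro square_integrableI) (auto simp: norm_mult power_mult_distrib)

lemma norm2_scale: "norm2 M (\<lambda>z. c * f z) = cmod c * norm2 M f"
  by (simp add: norm2_def norm_mult power_mult_distrib real_sqrt_mult)

lemma square_integrable_cnj:
  assumes "f \<in> square_integrable M" shows "(\<lambda>z. cnj (f z)) \<in> square_integrable M"
  using square_integrableD[OF assms]
  by (intro square_integrableI borel_measurable_continuous_on[where f=cnj]) (auto intro: continuous_intros)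

lemma norm2_cnj [simp]: "norm2 M (\<lambda>z. cnj (f z)) = norm2 M f"
  by (simp add: norm2_def)

lemma square_integrable_zero [simp]: "(\<lambda>z. 0) \<in> square_integrable M"
  by (simp add: square_integrable_def)

lemma norm2_zero [simp]: "norm2 M (\<lambda>z. 0) = 0"
  by (simp add: norm2_def)

lemma cmod_add_square_le: "(cmod (a + b))\<^sup>2 \<le> 2 * (cmod a)\<^sup>2 + 2 * (cmod b)\<^sup>2"
proof -
  have "(cmod (a + b))\<^sup>2 \<le> (cmod a + cmod b)\<^sup>2"
    by (intro power_mono norm_triangle_ineq) auto
  also have "\<dots> \<le> 2 * (cmod a)\<^sup>2 + 2 * (cmod b)\<^sup>2"
    using sum_squares_bound[of "cmod a" "cmod b"] by (simp add: power2_sum)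
  finally show ?thesis .
qed

lemma square_integrable_add:
  assumes "f \<in> square_integrable M" "g \<in> square_integrable M"
  shows "(\<lambda>z. f z + g z) \<in> square_integrable M"
  by (rule integrable_square_bound[where g="\<lambda>z. 2 * (cmod (f z))\<^sup>2 + 2 * (cmod (g z))\<^sup>2"])
    (use square_integrableD[OF assms(1)] square_integrableD[OF assms(2)] cmod_add_square_le in auto)

lemma square_integrable_minus:
  assumes "f \<in> square_integrable M" shows "(\<lambda>z. - f z) \<in> square_integrable M"
  using square_integrable_scale[OF assms, of "-1"] by simp

lemma square_integrable_diff:
  assumes "f \<in> square_integrable M" "g \<in> square_integrable M"
  shows "(\<lambda>z. f z - g z) \<in> square_integrable M"
  using square_integrable_add[OF assms(1) square_integrable_minus[OF assms(2)]] by simp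

lemma square_integrable_sum:
  assumes "\<And>i. i \<in> I \<Longrightarrow> f i \<in> square_integrable M"
  shows "(\<lambda>z. \<Sum>i\<in>I. f i z) \<in> square_integrable M"
  using assms
  by (induction I rule: infinite_finite_induct) (auto intro: square_integrable_add)

lemma integrable_mult_square_integrable:
  assumes "f \<in> square_integrable M" "g \<in> square_integrable M"
  shows "integrable M (\<lambda>z. f z * g z)"
proof (rule Bochner_Integration.integrable_bound[where f="\<lambda>z. (cmod (f z))\<^sup>2 + (cmod (g z))\<^sup>2"])
  show "AE z in M. norm (f z * g z) \<le> norm ((cmod (f z))\<^sup>2 + (cmod (g z))\<^sup>2)"
  proof (rule AE_I2)
    fix z
    have "2 * cmod (f z) * cmod (g z) \<le> (cmod (f z))\<^sup>2 + (cmod (g z))\<^sup>2"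
      by (rule sum_squares_bound)
    moreover have "0 \<le> cmod (f z) * cmod (g z)" by simp
    ultimately have "cmod (f z) * cmod (g z) \<le> (cmod (f z))\<^sup>2 + (cmod (g z))\<^sup>2" by linarith
    then show "norm (f z * g z) \<le> norm ((cmod (f z))\<^sup>2 + (cmod (g z))\<^sup>2)"
      by (simp add: norm_mult)
  qed
qed (use square_integrableD[OF assms(1)] square_integrableD[OF assms(2)] in auto)

lemma quadratic_nonneg_discriminant:
  fixes a X b :: real
  assumes "a \<ge> 0" and *: "\<And>t. 0 \<le> a * t\<^sup>2 - 2 * X * t + b"
  shows "X\<^sup>2 \<le> a * b"
proof (cases "a = 0")
  case True
  have "X = 0"
  proof (rule ccontr)
    assume "X \<noteq> 0"
    \<comment> \<open>At this point the remaining linear polynomial takes the value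
      \<open>-1\<close>.\<close>
    with *[of "(b + 1) / (2 * X)"] True show False by simp
  qed
  with True show ?thesis by simp
next
  case False
  with assms(1) have "a > 0" by simp
  \<comment> \<open>\<open>X / a\<close> is the minimiser of the quadratic.\<close>
  have "0 \<le> a * (X / a)\<^sup>2 - 2 * X * (X / a) + b" by (rule *)
  with \<open>a > 0\<close> show ?thesis by (simp add: power2_eq_square field_simps)
qed

text \<open>Integrating \<open>(t * cmod (f z) - cmod (g z))\<^sup>2\<close> gives a nonnegative
  real quadratic in \<open>t\<close>. Working with moduli avoids choosing a complex phase, and the
  triangle inequality uses exactly this form.\<close>

lemma norm2_Cauchy_Schwarz_abs:
  assumes f: "f \<in> square_integrable M" and g: "g \<in> square_integrable M"
  shows "(\<integral>z. cmod (f z) * cmod (g z) \<partial>M) \<le> norm2 M f * norm2 M g"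
proof -
  have int: "integrable M (\<lambda>z. cmod (f z) * cmod (g z))"
    using integrable_norm[OF integrable_mult_square_integrable[OF f g]] by (simp add: norm_mult)
  let ?X = "\<integral>z. cmod (f z) * cmod (g z) \<partial>M"
  have "?X\<^sup>2 \<le> (norm2 M f)\<^sup>2 * (norm2 M g)\<^sup>2"
  proof (rule quadratic_nonneg_discriminant)
    fix t :: real
    have "0 \<le> (\<integral>z. (t * cmod (f z) - cmod (g z))\<^sup>2 \<partial>M)" by simp
    also have "\<dots> = (\<integral>z. t\<^sup>2 * (cmod (f z))\<^sup>2 - 2 * t * (cmod (f z) * cmod (g z)) + (cmod (g z))\<^sup>2 \<partial>M)"
      by (intro Bochner_Integration.integral_cong) (auto simp: power2_diff algebra_simps power_mult_distrib)
    also have "\<dots> = t\<^sup>2 * (norm2 M f)\<^sup>2 - 2 * t * ?X + (norm2 M g)\<^sup>2"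
      using int square_integrableD(2)[OF f] square_integrableD(2)[OF g]
      by (simp add: norm2_power2)
    finally show "0 \<le> (norm2 M f)\<^sup>2 * t\<^sup>2 - 2 * ?X * t + (norm2 M g)\<^sup>2"
      by (simp add: mult.commute mult.left_commute)
  qed simp
  then show ?thesis
    by (metis norm2_nonneg mult_nonneg_nonneg power2_le_imp_le power_mult_distrib)
qed

lemma norm2_Cauchy_Schwarz:
  assumes f: "f \<in> square_integrable M" and g: "g \<in> square_integrable M"
  shows "cmod (\<integral>z. f z * g z \<partial>M) \<le> norm2 M f * norm2 M g"
proof -
  have "cmod (\<integral>z. f z * g z \<partial>M) \<le> (\<integral>z. cmod (f z * g z) \<partial>M)"
    by (rule integral_norm_bound)
  also have "\<dots> = (\<integral>z. cmod (f z) * cmod (g z) \<partial>M)" by (simp add: norm_mult)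
  also have "\<dots> \<le> norm2 M f * norm2 M g" by (rule norm2_Cauchy_Schwarz_abs[OF f g])
  finally show ?thesis .
qed

lemma norm2_triangle:
  assumes f: "f \<in> square_integrable M" and g: "g \<in> square_integrable M"
  shows "norm2 M (\<lambda>z. f z + g z) \<le> norm2 M f + norm2 M g"
proof (rule power2_le_imp_le)
  have int: "integrable M (\<lambda>z. cmod (f z) * cmod (g z))"
    using integrable_norm[OF integrable_mult_square_integrable[OF f g]] by (simp add: norm_mult)
  have "(norm2 M (\<lambda>z. f z + g z))\<^sup>2 = (\<integral>z. (cmod (f z + g z))\<^sup>2 \<partial>M)" by (rule norm2_power2)
  also have "\<dots> \<le> (\<integral>z. (cmod (f z))\<^sup>2 + 2 * (cmod (f z) * cmod (g z)) + (cmod (g z))\<^sup>2 \<partial>M)"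
  proof (rule integral_mono)
    show "integrable M (\<lambda>z. (cmod (f z + g z))\<^sup>2)"
      using square_integrableD(2)[OF square_integrable_add[OF f g]] .
    fix z
    have "(cmod (f z + g z))\<^sup>2 \<le> (cmod (f z) + cmod (g z))\<^sup>2"
      by (intro power_mono norm_triangle_ineq) auto
    then show "(cmod (f z + g z))\<^sup>2 \<le> (cmod (f z))\<^sup>2 + 2 * (cmod (f z) * cmod (g z)) + (cmod (g z))\<^sup>2"
      by (simp add: power2_sum algebra_simps)
  qed (use int square_integrableD(2)[OF f] square_integrableD(2)[OF g] in simp)
  also have "\<dots> = (norm2 M f)\<^sup>2 + 2 * (\<integral>z. cmod (f z) * cmod (g z) \<partial>M) + (norm2 M g)\<^sup>2"
    using int square_integrableD(2)[OF f] square_integrableD(2)[OF g] by (simp add: norm2_power2)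
  also have "\<dots> \<le> (norm2 M f + norm2 M g)\<^sup>2"
    using norm2_Cauchy_Schwarz_abs[OF f g] by (simp add: power2_sum)
  finally show "(norm2 M (\<lambda>z. f z + g z))\<^sup>2 \<le> (norm2 M f + norm2 M g)\<^sup>2" .
qed simp

lemma norm2_triangle_diff:
  assumes f: "f \<in> square_integrable M" and g: "g \<in> square_integrable M"
  shows "norm2 M (\<lambda>z. f z - g z) \<le> norm2 M f + norm2 M g"
  using norm2_triangle[OF f square_integrable_minus[OF g]] by (simp add: norm2_def)

lemma norm2_minus_commute: "norm2 M (\<lambda>z. f z - g z) = norm2 M (\<lambda>z. g z - f z)"
  by (simp add: norm2_def norm_minus_commute)

lemma norm2_triangle3:
  assumes "f \<in> square_integrable M" "g \<in> square_integrable M" "h \<in> square_integrable M"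
  shows "norm2 M (\<lambda>z. f z - h z) \<le> norm2 M (\<lambda>z. f z - g z) + norm2 M (\<lambda>z. g z - h z)"
  using norm2_triangle[OF square_integrable_diff[OF assms(1,2)] square_integrable_diff[OF assms(2,3)]]
  by simp

lemma norm2_reverse_triangle:
  assumes f: "f \<in> square_integrable M" and g: "g \<in> square_integrable M"
  shows "\<bar>norm2 M f - norm2 M g\<bar> \<le> norm2 M (\<lambda>z. f z - g z)"
  using norm2_triangle[OF square_integrable_diff[OF f g] g]
    norm2_triangle[OF square_integrable_diff[OF g f] f] norm2_minus_commute[of M f g]
  by simp

text \<open>Riesz--Fischer: with summable norms, the series of absolute values is itself square integrable,
  which gives both pointwise convergence almost everywhere and a dominating function.\<close>

lemma norm2_sum_abs_le:
  fixes d :: "nat \<Rightarrow> 'a \<Rightarrow> complex"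
  assumes "\<And>i. d i \<in> square_integrable M"
  shows "norm2 M (\<lambda>z. complex_of_real (\<Sum>i<n. cmod (d i z))) \<le> (\<Sum>i<n. norm2 M (d i))"
    and "(\<lambda>z. complex_of_real (\<Sum>i<n. cmod (d i z))) \<in> square_integrable M"
proof -
  have A: "(\<lambda>z. complex_of_real (cmod (d i z))) \<in> square_integrable M" for i
    using square_integrableD[OF assms[of i]] by (intro square_integrableI) auto
  show B: "(\<lambda>z. complex_of_real (\<Sum>i<n. cmod (d i z))) \<in> square_integrable M" for n
    using square_integrable_sum[of "{..<n}", OF A] by simp
  show "norm2 M (\<lambda>z. complex_of_real (\<Sum>i<n. cmod (d i z))) \<le> (\<Sum>i<n. norm2 M (d i))"
  proof (induction n)
    case (Suc n)
    have "norm2 M (\<lambda>z. complex_of_real (\<Sum>i<Suc n. cmod (d i z)))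
        \<le> norm2 M (\<lambda>z. complex_of_real (\<Sum>i<n. cmod (d i z))) + norm2 M (\<lambda>z. complex_of_real (cmod (d n z)))"
      using norm2_triangle[OF B[of n] A[of n]] by simp
    moreover have "norm2 M (\<lambda>z. complex_of_real (cmod (d n z))) = norm2 M (d n)"
      by (simp add: norm2_def)
    ultimately show ?case using Suc by simp
  qed simp
qed

lemma square_integrable_complete:
  assumes d: "\<And>i. d i \<in> square_integrable M" and sm: "summable (\<lambda>i. norm2 M (d i))"
  shows "\<exists>f\<in>square_integrable M. (\<lambda>n. norm2 M (\<lambda>z. (\<Sum>i<n. d i z) - f z)) \<longlonglongrightarrow> 0"
proof -
  have dm [measurable]: "d i \<in> borel_measurable M" for i using square_integrableD(1)[OF d] .
  define K where "K = (\<Sum>i. norm2 M (d i))"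
  define g where "g n z = (\<Sum>i<n. cmod (d i z))" for n z
  have g_meas [measurable]: "g n \<in> borel_measurable M" for n unfolding g_def by measurable
  have g_mono: "g n z \<le> g (Suc n) z" and g_nonneg: "0 \<le> g n z" for n z
    by (auto simp: g_def intro: sum_nonneg)
  have incg: "incseq (\<lambda>n. g n z)" for z using g_mono by (intro incseq_SucI)
  have g_int: "integrable M (\<lambda>z. (g n z)\<^sup>2)" for n
    using square_integrableD(2)[OF norm2_sum_abs_le(2)[where d=d, OF d, of n]]
    by (simp add: g_def norm_of_real del: of_real_sum)
  have g_le: "(\<integral>z. (g n z)\<^sup>2 \<partial>M) \<le> K\<^sup>2" for n
  proof -
    have "(\<integral>z. (g n z)\<^sup>2 \<partial>M) = (norm2 M (\<lambda>z. complex_of_real (g n z)))\<^sup>2"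
      by (simp add: norm2_power2)
    also have "\<dots> \<le> K\<^sup>2"
    proof (intro power_mono)
      have "norm2 M (\<lambda>z. complex_of_real (g n z)) \<le> (\<Sum>i<n. norm2 M (d i))"
        unfolding g_def by (rule norm2_sum_abs_le(1)[OF d])
      also have "\<dots> \<le> K" unfolding K_def by (rule sum_le_suminf[OF sm]) auto
      finally show "norm2 M (\<lambda>z. complex_of_real (g n z)) \<le> K" .
    qed simp
    finally show ?thesis .
  qed
  \<comment> \<open>The supremum is taken in \<open>ennreal\<close>, so monotone convergence applies
    before any series is known to converge; where \<open>G\<close> is finite the series converges
    absolutely.\<close>
  define G where "G z = (SUP n. ennreal ((g n z)\<^sup>2))" for z
  have "(\<integral>\<^sup>+z. G z \<partial>M) = (SUP n. \<integral>\<^sup>+z. ennreal ((g n z)\<^sup>2) \<partial>M)"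
    unfolding G_def
  proof (rule nn_integral_monotone_convergence_SUP)
    show "incseq (\<lambda>n z. ennreal ((g n z)\<^sup>2))"
      using g_mono g_nonneg by (intro incseq_SucI le_funI ennreal_leI power_mono) auto
  qed simp
  also have "\<dots> \<le> ennreal (K\<^sup>2)"
  proof (rule SUP_least)
    fix n
    show "(\<integral>\<^sup>+z. ennreal ((g n z)\<^sup>2) \<partial>M) \<le> ennreal (K\<^sup>2)"
      using nn_integral_eq_integral[OF g_int] g_le by (auto intro: ennreal_leI)
  qed
  finally have G_fin: "(\<integral>\<^sup>+z. G z \<partial>M) < \<infinity>" by (rule le_less_trans) simp
  have [measurable]: "G \<in> borel_measurable M" unfolding G_def by measurable
  have AEfin: "AE z in M. G z < \<infinity>"
    using nn_integral_PInf_AE[of G M] G_fin by (auto simp: less_top)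
  have conv: "summable (\<lambda>i. cmod (d i z))" and G_eq: "ennreal ((\<Sum>i. cmod (d i z))\<^sup>2) = G z" if "G z < \<infinity>" for z
  proof -
    obtain c where c: "G z = ennreal c" "c \<ge> 0" using \<open>G z < \<infinity>\<close> by (cases "G z") auto
    have le: "(g n z)\<^sup>2 \<le> c" for n
    proof -
      have "ennreal ((g n z)\<^sup>2) \<le> ennreal c" unfolding c(1)[symmetric] G_def by (rule SUP_upper) simp
      then show ?thesis using c(2) by simp
    qed
    have "g n z \<le> sqrt c" for n using le[of n] by (rule real_le_rsqrt)
    then show S: "summable (\<lambda>i. cmod (d i z))"
      by (intro summableI_nonneg_bounded[where x="sqrt c"]) (auto simp: g_def)
    have lim: "(\<lambda>n. g n z) \<longlonglongrightarrow> (\<Sum>i. cmod (d i z))"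
      unfolding g_def by (rule summable_LIMSEQ[OF S])
    have "(\<lambda>n. ennreal ((g n z)\<^sup>2)) \<longlonglongrightarrow> ennreal ((\<Sum>i. cmod (d i z))\<^sup>2)"
      by (intro tendsto_intros lim)
    moreover have "(\<lambda>n. ennreal ((g n z)\<^sup>2)) \<longlonglongrightarrow> G z"
      unfolding G_def using g_mono g_nonneg
      by (intro LIMSEQ_SUP incseq_SucI ennreal_leI power_mono) auto
    ultimately show "ennreal ((\<Sum>i. cmod (d i z))\<^sup>2) = G z" by (rule LIMSEQ_unique)
  qed
  define h where "h z = (\<Sum>i. cmod (d i z))" for z
  have h_meas [measurable]: "h \<in> borel_measurable M" unfolding h_def by measurable
  have h_int: "integrable M (\<lambda>z. (h z)\<^sup>2)"
  proof (rule integrableI_bounded)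
    have "(\<integral>\<^sup>+z. ennreal (norm ((h z)\<^sup>2)) \<partial>M) = (\<integral>\<^sup>+z. G z \<partial>M)"
      by (rule nn_integral_cong_AE) (use AEfin G_eq in \<open>auto simp: h_def\<close>)
    with G_fin show "(\<integral>\<^sup>+z. ennreal (norm ((h z)\<^sup>2)) \<partial>M) < \<infinity>" by simp
  qed measurable
  define f where "f z = (\<Sum>i. d i z)" for z
  have f_meas [measurable]: "f \<in> borel_measurable M" unfolding f_def by measurable
  have AE1: "AE z in M. (\<lambda>n. (cmod ((\<Sum>i<n. d i z) - f z))\<^sup>2) \<longlonglongrightarrow> 0"
    using AEfin
  proof eventually_elim
    case (elim z)
    have "(\<lambda>n. (cmod ((\<Sum>i<n. d i z) - f z))\<^sup>2) \<longlonglongrightarrow> (cmod (f z - f z))\<^sup>2"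
      unfolding f_def
      by (intro tendsto_intros summable_LIMSEQ summable_norm_cancel[OF conv[OF elim]])
    then show ?case by simp
  qed
  have bnd: "AE z in M. norm ((cmod ((\<Sum>i<n. d i z) - f z))\<^sup>2) \<le> 4 * (h z)\<^sup>2" for n
    using AEfin
  proof eventually_elim
    case (elim z)
    note S = conv[OF elim]
    have "cmod (f z) \<le> h z" unfolding f_def h_def by (rule summable_norm[OF S])
    moreover have "cmod (\<Sum>i<n. d i z) \<le> h z"
      unfolding h_def by (rule order_trans[OF norm_sum sum_le_suminf[OF S]]) auto
    ultimately have "cmod ((\<Sum>i<n. d i z) - f z) \<le> 2 * h z"
      by (intro order_trans[OF norm_triangle_ineq4]) simp
    then have "(cmod ((\<Sum>i<n. d i z) - f z))\<^sup>2 \<le> (2 * h z)\<^sup>2" by (intro power_mono) auto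
    then show ?case by (simp add: power_mult_distrib)
  qed
  have fin: "f \<in> square_integrable M"
  proof (rule square_integrableI)
    have *: "AE z in M. norm ((cmod (f z))\<^sup>2) \<le> norm (4 * (h z)\<^sup>2)" using bnd[of 0] by simp
    show "integrable M (\<lambda>z. (cmod (f z))\<^sup>2)"
      by (rule Bochner_Integration.integrable_bound[OF _ _ *]) (simp_all add: h_int)
  qed simp
  have "(\<lambda>n. \<integral>z. (cmod ((\<Sum>i<n. d i z) - f z))\<^sup>2 \<partial>M) \<longlonglongrightarrow> (\<integral>z. 0 \<partial>M)"
    by (rule integral_dominated_convergence[OF _ _ _ AE1 bnd]) (simp_all add: h_int)
  then have "(\<lambda>n. norm2 M (\<lambda>z. (\<Sum>i<n. d i z) - f z)) \<longlonglongrightarrow> sqrt 0"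
    unfolding norm2_def by (intro tendsto_intros) simp
  with fin show ?thesis by auto
qed

lemma norm2_diff_power2:
  assumes f: "f \<in> square_integrable M" and g: "g \<in> square_integrable M"
  shows "(norm2 M (\<lambda>z. f z - g z))\<^sup>2
    = (norm2 M f)\<^sup>2 + (norm2 M g)\<^sup>2 - 2 * Re (\<integral>z. f z * cnj (g z) \<partial>M)"
proof -
  have I: "integrable M (\<lambda>z. f z * cnj (g z))"
    by (rule integrable_mult_square_integrable[OF f square_integrable_cnj[OF g]])
  have "(cmod (f z - g z))\<^sup>2 = (cmod (f z))\<^sup>2 + (cmod (g z))\<^sup>2 - 2 * Re (f z * cnj (g z))" for z
    by (simp add: cmod_power2 power2_diff algebra_simps)
  then have "(norm2 M (\<lambda>z. f z - g z))\<^sup>2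
     = (\<integral>z. (cmod (f z))\<^sup>2 + (cmod (g z))\<^sup>2 - 2 * Re (f z * cnj (g z)) \<partial>M)"
    by (simp add: norm2_power2)
  also have "\<dots> = (norm2 M f)\<^sup>2 + (norm2 M g)\<^sup>2 - 2 * Re (\<integral>z. f z * cnj (g z) \<partial>M)"
    using integral_Re[OF I] square_integrableD(2)[OF f] square_integrableD(2)[OF g] integrable_Re[OF I]
    by (simp add: norm2_power2 del: times_complex.sel)
  finally show ?thesis .
qed

section \<open>Orthonormal systems: Bessel's inequality, Parseval's identity, density of partial
  sums\<close>

locale orthonormal_system =
  fixes M :: "'a measure" and e :: "'i \<Rightarrow> 'a \<Rightarrow> complex"
  assumes e_sq: "e i \<in> square_integrable M"
    and orthonormal: "(\<integral>z. e i z * cnj (e j z) \<partial>M) = (if i = j then 1 else 0)"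
begin

definition coeff :: "('a \<Rightarrow> complex) \<Rightarrow> 'i \<Rightarrow> complex" where
  "coeff f i = (\<integral>z. f z * cnj (e i z) \<partial>M)"

definition partial_sum :: "('i \<Rightarrow> complex) \<Rightarrow> 'i set \<Rightarrow> 'a \<Rightarrow> complex" where
  "partial_sum c F z = (\<Sum>i\<in>F. c i * e i z)"

lemma partial_sum_sq: "partial_sum c F \<in> square_integrable M"
  unfolding partial_sum_def[abs_def]
  by (intro square_integrable_sum square_integrable_scale e_sq)

lemma integrable_coeff: "f \<in> square_integrable M \<Longrightarrow> integrable M (\<lambda>z. f z * cnj (e i z))"
  by (intro integrable_mult_square_integrable square_integrable_cnj e_sq)

lemma integral_partial_sum:
  assumes f: "f \<in> square_integrable M"
  shows "(\<integral>z. f z * cnj (partial_sum c F z) \<partial>M) = (\<Sum>i\<in>F. cnj (c i) * coeff f i)"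
proof -
  have "(\<integral>z. f z * cnj (partial_sum c F z) \<partial>M) = (\<integral>z. (\<Sum>i\<in>F. cnj (c i) * (f z * cnj (e i z))) \<partial>M)"
    unfolding partial_sum_def
    by (intro Bochner_Integration.integral_cong) (auto simp: sum_distrib_left algebra_simps)
  also have "\<dots> = (\<Sum>i\<in>F. cnj (c i) * coeff f i)"
    unfolding coeff_def
    by (subst Bochner_Integration.integral_sum) (auto simp: integrable_coeff[OF f])
  finally show ?thesis .
qed

lemma coeff_partial_sum:
  assumes "finite F"
  shows "coeff (partial_sum c F) j = (if j \<in> F then c j else 0)"
proof -
  have "coeff (partial_sum c F) j = (\<integral>z. (\<Sum>i\<in>F. c i * (e i z * cnj (e j z))) \<partial>M)"
    unfolding coeff_def partial_sum_def
    by (intro Bochner_Integration.integral_cong) (simp_all add: sum_distrib_right mult.assoc)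
  also have "\<dots> = (\<Sum>i\<in>F. c i * (if i = j then 1 else 0))"
    by (subst Bochner_Integration.integral_sum) (auto simp: integrable_coeff[OF e_sq] orthonormal)
  also have "\<dots> = (if j \<in> F then c j else 0)"
    using assms by (simp add: if_distrib[of "\<lambda>x. _ * x"] cong: if_cong)
  finally show ?thesis .
qed

lemma norm2_partial_sum:
  assumes "finite F"
  shows "(norm2 M (partial_sum c F))\<^sup>2 = (\<Sum>i\<in>F. (cmod (c i))\<^sup>2)"
proof -
  have "complex_of_real ((norm2 M (partial_sum c F))\<^sup>2)
      = (\<integral>z. partial_sum c F z * cnj (partial_sum c F z) \<partial>M)"
    unfolding norm2_power2 integral_complex_of_real[symmetric]
    by (intro Bochner_Integration.integral_cong) (simp_all only: complex_norm_square)
  also have "\<dots> = (\<Sum>i\<in>F. complex_of_real ((cmod (c i))\<^sup>2))"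
    unfolding integral_partial_sum[OF partial_sum_sq] using assms
    by (intro sum.cong) (simp_all only: coeff_partial_sum complex_norm_square if_True mult.commute)
  finally show ?thesis by (metis of_real_eq_iff of_real_sum)
qed

lemma norm2_diff_partial_sum:
  assumes f: "f \<in> square_integrable M" and F: "finite F"
  shows "(norm2 M (\<lambda>z. f z - partial_sum (coeff f) F z))\<^sup>2
    = (norm2 M f)\<^sup>2 - (\<Sum>i\<in>F. (cmod (coeff f i))\<^sup>2)"
proof -
  have "Re (\<integral>z. f z * cnj (partial_sum (coeff f) F z) \<partial>M) = (\<Sum>i\<in>F. (cmod (coeff f i))\<^sup>2)"
    unfolding integral_partial_sum[OF f] Re_sum
    by (intro sum.cong) (simp_all add: cmod_power2, simp_all add: power2_eq_square)
  then show ?thesis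
    using norm2_diff_power2[OF f partial_sum_sq, of "coeff f" F] norm2_partial_sum[OF F, of "coeff f"] by simp
qed

lemma Bessel:
  assumes f: "f \<in> square_integrable M" and F: "finite F"
  shows "(\<Sum>i\<in>F. (cmod (coeff f i))\<^sup>2) \<le> (norm2 M f)\<^sup>2"
  using norm2_diff_partial_sum[OF assms] by (metis diff_ge_0_iff_ge zero_le_power2)

lemma norm2_e: "norm2 M (e i) = 1"
proof -
  have "complex_of_real ((norm2 M (e i))\<^sup>2) = (\<integral>z. e i z * cnj (e i z) \<partial>M)"
    unfolding norm2_power2 integral_complex_of_real[symmetric]
    by (intro Bochner_Integration.integral_cong) (simp_all only: complex_norm_square)
  then have "complex_of_real ((norm2 M (e i))\<^sup>2) = of_real 1" by (simp add: orthonormal)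
  then show ?thesis by (metis norm2_nonneg of_real_eq_iff power2_eq_1_iff real_sqrt_abs real_sqrt_one abs_of_nonneg)
qed

lemma coeff_diff_le:
  assumes "f \<in> square_integrable M" "g \<in> square_integrable M"
  shows "cmod (coeff f i - coeff g i) \<le> norm2 M (\<lambda>z. f z - g z)"
proof -
  have "coeff f i - coeff g i = (\<integral>z. (f z - g z) * cnj (e i z) \<partial>M)"
    unfolding coeff_def using integrable_coeff[OF assms(1)] integrable_coeff[OF assms(2)]
    by (simp add: algebra_simps)
  also have "cmod \<dots> \<le> norm2 M (\<lambda>z. f z - g z) * norm2 M (\<lambda>z. cnj (e i z))"
    by (intro norm2_Cauchy_Schwarz square_integrable_diff assms square_integrable_cnj e_sq)
  finally show ?thesis by (simp add: norm2_e)
qed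

end

text \<open>Totality is assumed as uniqueness of coefficients; together with completeness of the
  space it yields Parseval's identity.\<close>

locale total_orthonormal_system = orthonormal_system +
  assumes total: "\<lbrakk>f \<in> square_integrable M; \<And>i. coeff f i = 0\<rbrakk> \<Longrightarrow> AE z in M. f z = 0"
begin

text \<open>Bessel makes the squares summable. Partial sums over a suitable increasing sequence of
  finite sets have summable increments, so Riesz--Fischer provides a limit; its coefficients are
  those of \<open>f\<close>, and totality identifies it with \<open>f\<close>. The index type is
  arbitrary, hence unordered sums.\<close>

theorem Parseval:
  assumes f: "f \<in> square_integrable M"
  shows "((\<lambda>i. (cmod (coeff f i))\<^sup>2) has_sum (norm2 M f)\<^sup>2) UNIV"
proof -
  define c where "c = coeff f"
  define a where "a i = (cmod (c i))\<^sup>2" for i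
  have a_nonneg: "a i \<ge> 0" for i by (simp add: a_def)
  have bes: "sum a F \<le> (norm2 M f)\<^sup>2" if "finite F" for F
    unfolding a_def c_def by (rule Bessel[OF f that])
  have sum: "a summable_on UNIV"
    by (rule nonneg_bdd_above_summable_on) (auto intro!: bdd_aboveI2[where M="(norm2 M f)\<^sup>2"] bes a_nonneg)
  define s where "s = infsum a UNIV"
  have hs: "(a has_sum s) UNIV" using sum by (simp add: s_def)
  have le_s: "sum a F \<le> s" if "finite F" for F
    unfolding s_def by (rule finite_sum_le_infsum[OF sum that]) (auto simp: a_nonneg)
  \<comment> \<open>The tolerance \<open>(1/4)^n\<close> concerns squared norms; its root
    \<open>(1/2)^n\<close> bounds the increments and is summable.\<close>
  have "\<exists>G. finite G \<and> s - (1/4)^n < sum a G" for n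
  proof -
    have "\<forall>\<^sub>F F in finite_subsets_at_top UNIV. s - (1/4)^n < sum a F"
      using hs unfolding has_sum_def by (rule order_tendstoD) simp
    then show ?thesis unfolding eventually_finite_subsets_at_top by blast
  qed
  then obtain G where G: "\<And>n. finite (G n)" "\<And>n. s - (1/4)^n < sum a (G n)" by metis
  \<comment> \<open>Unions make the sets nested, so that an increment is a partial sum over a
    difference of index sets.\<close>
  define F where "F n = (\<Union>i\<le>n. G i)" for n
  have F: "finite (F n)" and Fmono: "F n \<subseteq> F (Suc n)" for n unfolding F_def using G(1) by (auto intro: le_SucI)
  have Fs: "s - (1/4)^n < sum a (F n)" for n
    by (rule less_le_trans[OF G(2)]) (intro sum_mono2 F, auto simp: F_def a_nonneg)
  define P where "P n = partial_sum c (F n)" for n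
  have P_sq: "P n \<in> square_integrable M" for n unfolding P_def by (rule partial_sum_sq)
  define d where "d n z = P (Suc n) z - P n z" for n z
  have d_sq: "d n \<in> square_integrable M" for n
    unfolding d_def[abs_def] by (intro square_integrable_diff P_sq)
  have d_norm: "norm2 M (d n) \<le> (1/2)^n" for n
  proof (rule power2_le_imp_le)
    have "d n = partial_sum c (F (Suc n) - F n)"
      by (simp add: fun_eq_iff d_def P_def partial_sum_def sum_diff[OF F Fmono])
    then have "(norm2 M (d n))\<^sup>2 = sum a (F (Suc n) - F n)"
      using norm2_partial_sum[of "F (Suc n) - F n" c] F by (simp add: a_def)
    also have "\<dots> = sum a (F (Suc n)) - sum a (F n)" by (rule sum_diff[OF F Fmono])
    also have "\<dots> \<le> (1/4)^n" using Fs[of n] le_s[OF F, of "Suc n"] by linarith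
    also have "\<dots> = ((1/2)^n)\<^sup>2" by (simp add: power_divide power_mult[symmetric] mult.commute power2_eq_square flip: power_mult_distrib)
    finally show "(norm2 M (d n))\<^sup>2 \<le> ((1/2)^n)\<^sup>2" .
  qed simp
  have "summable (\<lambda>n. norm2 M (d n))"
    by (rule summable_comparison_test[where g="\<lambda>n. (1/2)^n"]) (auto simp: d_norm)
  from square_integrable_complete[OF d_sq this] obtain h where
    h: "h \<in> square_integrable M" and lim: "(\<lambda>n. norm2 M (\<lambda>z. (\<Sum>i<n. d i z) - h z)) \<longlonglongrightarrow> 0" by blast
  define h' where "h' z = h z + P 0 z" for z
  have h': "h' \<in> square_integrable M" unfolding h'_def[abs_def] by (intro square_integrable_add h P_sq)
  have tele: "(\<Sum>i<n. d i z) = P n z - P 0 z" for n z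
    unfolding d_def by (rule sum_lessThan_telescope)
  have lim': "(\<lambda>n. norm2 M (\<lambda>z. P n z - h' z)) \<longlonglongrightarrow> 0"
    using lim by (simp add: tele h'_def algebra_simps)
  have ch: "coeff h' i = c i" for i
  proof -
    \<comment> \<open>Either \<open>i\<close> lies in \<open>F n\<close> and the coefficient is
      exact, or adding \<open>i\<close> to \<open>F n\<close> must keep the sum below
      \<open>s\<close>, which forces \<open>a i \<le> (1/4)^n\<close>.\<close>
    have A: "cmod (c i - coeff (P n) i) \<le> (1/2)^n" for n
    proof (cases "i \<in> F n")
      case True then show ?thesis by (simp add: P_def coeff_partial_sum F)
    next
      case False
      have "a i + sum a (F n) \<le> s" using le_s[of "insert i (F n)"] F False by simp
      then have "a i \<le> (1/4)^n" using Fs[of n] by linarith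
      also have "\<dots> = ((1/2)^n)\<^sup>2" by (simp add: power_divide power_mult[symmetric] mult.commute power2_eq_square flip: power_mult_distrib)
      finally have "cmod (c i) \<le> (1/2)^n" unfolding a_def by (rule power2_le_imp_le) simp
      then show ?thesis by (simp add: P_def coeff_partial_sum F False)
    qed
    have "(\<lambda>n. (1/2)^n + norm2 M (\<lambda>z. P n z - h' z)) \<longlonglongrightarrow> 0 + 0"
      by (intro tendsto_add lim' LIMSEQ_power_zero) simp
    moreover have "cmod (c i - coeff h' i) \<le> (1/2)^n + norm2 M (\<lambda>z. P n z - h' z)" for n
      using A[of n] coeff_diff_le[OF P_sq h', of n i]
        norm_triangle_ineq[of "c i - coeff (P n) i" "coeff (P n) i - coeff h' i"] by simp
    ultimately have "cmod (c i - coeff h' i) \<le> 0 + 0"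
      by (intro LIMSEQ_le_const[of _ "0 + 0"]) auto
    then show ?thesis by simp
  qed
  have "AE z in M. f z - h' z = 0"
  proof (rule total)
    show "(\<lambda>z. f z - h' z) \<in> square_integrable M" by (rule square_integrable_diff[OF f h'])
    show "coeff (\<lambda>z. f z - h' z) i = 0" for i
      using ch[of i] integrable_coeff[OF f] integrable_coeff[OF h']
      by (simp add: coeff_def c_def left_diff_distrib)
  qed
  then have eq: "norm2 M (\<lambda>z. f z - P n z) = norm2 M (\<lambda>z. P n z - h' z)" for n
    using square_integrableD(1)[OF f] square_integrableD(1)[OF h'] square_integrableD(1)[OF P_sq[of n]]
    by (subst norm2_minus_commute[of M "P n" h']) (intro norm2_cong_AE, auto)
  have "(norm2 M f)\<^sup>2 - s \<le> (norm2 M (\<lambda>z. P n z - h' z))\<^sup>2" for n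
    using norm2_diff_partial_sum[OF f F, of n] eq[of n] le_s[OF F, of n]
    by (simp add: P_def c_def a_def)
  moreover have "(\<lambda>n. (norm2 M (\<lambda>z. P n z - h' z))\<^sup>2) \<longlonglongrightarrow> 0\<^sup>2" by (intro tendsto_intros lim')
  ultimately have "(norm2 M f)\<^sup>2 - s \<le> 0\<^sup>2" using LIMSEQ_le_const by blast
  moreover have "s \<le> (norm2 M f)\<^sup>2"
    unfolding s_def by (rule infsum_le_finite_sums[OF sum]) (use bes in auto)
  ultimately have "s = (norm2 M f)\<^sup>2" by simp
  with hs show ?thesis by (simp add: a_def[abs_def] c_def)
qed

lemma partial_sums_dense:
  assumes f: "f \<in> square_integrable M" and "\<epsilon> > 0"
  shows "\<exists>F. finite F \<and> norm2 M (\<lambda>z. f z - partial_sum (coeff f) F z) < \<epsilon>"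
proof -
  have "\<forall>\<^sub>F F in finite_subsets_at_top UNIV. (norm2 M f)\<^sup>2 - \<epsilon>\<^sup>2 < (\<Sum>i\<in>F. (cmod (coeff f i))\<^sup>2)"
    using Parseval[OF f] unfolding has_sum_def by (rule order_tendstoD) (use \<open>\<epsilon> > 0\<close> in simp)
  then obtain F where "finite F" "(norm2 M f)\<^sup>2 - \<epsilon>\<^sup>2 < (\<Sum>i\<in>F. (cmod (coeff f i))\<^sup>2)"
    unfolding eventually_finite_subsets_at_top by blast
  with norm2_diff_partial_sum[OF f this(1)] \<open>\<epsilon> > 0\<close>
  have "finite F \<and> norm2 M (\<lambda>z. f z - partial_sum (coeff f) F z) < \<epsilon>"
    by (auto intro: power_less_imp_less_base[where n=2])
  then show ?thesis by blast
qed

end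

section \<open>Fourier analysis on the torus\<close>

lemma torus_L2: "L2_torus L1 L2 = square_integrable (torus L1 L2)"
  by (simp add: L2_torus_def square_integrable_def)

lemma torus_norm: "L2_norm L1 L2 = norm2 (torus L1 L2)"
  by (simp add: L2_norm_def norm2_def fun_eq_iff)

lemma rect_sets [measurable]: "({0..L1} \<times> {0..L2} :: (real \<times> real) set) \<in> sets borel"
  by (intro borel_closed closed_Times) auto

lemma integrable_torus_iff:
  fixes f :: "real \<times> real \<Rightarrow> 'b::{banach, second_countable_topology}"
  shows "integrable (torus L1 L2) f \<longleftrightarrow>
    integrable lborel (\<lambda>z. indicator ({0..L1} \<times> {0..L2}) z *\<^sub>R f z)"
  unfolding torus_def by (subst integrable_restrict_space) auto

lemma integral_torus:
  fixes f :: "real \<times> real \<Rightarrow> 'b::{banach, second_countable_topology}"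
  shows "integral\<^sup>L (torus L1 L2) f = (\<integral>z. indicator ({0..L1} \<times> {0..L2}) z *\<^sub>R f z \<partial>lborel)"
  unfolding torus_def by (subst integral_restrict_space) auto

lemma borel_measurable_torus_continuous:
  fixes f :: "real \<times> real \<Rightarrow> 'b::{banach, second_countable_topology}"
  assumes "continuous_on UNIV f" shows "f \<in> borel_measurable (torus L1 L2)"
  unfolding torus_def
  by (intro measurable_restrict_space1) (simp add: borel_measurable_continuous_onI assms)

lemma integrable_torus_continuous:
  fixes f :: "real \<times> real \<Rightarrow> 'b::euclidean_space"
  assumes "continuous_on UNIV f" shows "integrable (torus L1 L2) f"
  unfolding integrable_torus_iff
  by (intro borel_integrable_compact compact_Times continuous_on_subset[OF assms]) auto

lemma square_integrable_torus_continuous: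
  assumes "continuous_on UNIV f" shows "f \<in> square_integrable (torus L1 L2)"
  using assms
  by (intro square_integrableI borel_measurable_torus_continuous integrable_torus_continuous)
    (auto intro!: continuous_intros)

lemma integral_torus_iterated:
  fixes f :: "real \<times> real \<Rightarrow> 'b::euclidean_space"
  assumes "integrable (torus L1 L2) f"
  shows "integral\<^sup>L (torus L1 L2) f = (LINT x:{0..L1}|lborel. LINT y:{0..L2}|lborel. f (x, y))"
proof -
  have I: "integrable (lborel \<Otimes>\<^sub>M lborel) (\<lambda>z. indicator ({0..L1} \<times> {0..L2}) z *\<^sub>R f z)"
    using assms by (simp add: integrable_torus_iff lborel_prod)
  have "integral\<^sup>L (torus L1 L2) f =
      (\<integral>x. \<integral>y. indicator ({0..L1} \<times> {0..L2}) (x, y) *\<^sub>R f (x, y) \<partial>lborel \<partial>lborel)"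
    unfolding integral_torus lborel_prod[symmetric] by (rule lborel_pair.integral_fst'[OF I, symmetric])
  then show ?thesis
    by (simp add: set_lebesgue_integral_def indicator_times scaleR_scaleR[symmetric] del: scaleR_scaleR)
qed

text \<open>With the \<open>x\<close>-integral inside, this order serves integration by parts in
  \<open>x\<close> and the treatment of \<open>x_mean\<close>.\<close>

lemma integral_torus_iterated':
  fixes f :: "real \<times> real \<Rightarrow> 'b::euclidean_space"
  assumes "integrable (torus L1 L2) f"
  shows "integral\<^sup>L (torus L1 L2) f = (LINT y:{0..L2}|lborel. LINT x:{0..L1}|lborel. f (x, y))"
proof -
  have I: "integrable (lborel \<Otimes>\<^sub>M lborel) (\<lambda>(x, y). indicator ({0..L1} \<times> {0..L2}) (x, y) *\<^sub>R f (x, y))"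
    using assms by (simp add: integrable_torus_iff lborel_prod case_prod_unfold)
  have "integral\<^sup>L (torus L1 L2) f =
      (\<integral>y. \<integral>x. indicator ({0..L1} \<times> {0..L2}) (x, y) *\<^sub>R f (x, y) \<partial>lborel \<partial>lborel)"
    unfolding integral_torus lborel_prod[symmetric]
    by (subst lborel_pair.integral_snd[OF I]) (simp add: case_prod_unfold)
  also have "\<dots> = (\<integral>y. indicator {0..L2} y *\<^sub>R (\<integral>x. indicator {0..L1} x *\<^sub>R f (x, y) \<partial>lborel) \<partial>lborel)"
    by (intro Bochner_Integration.integral_cong)
      (simp_all add: indicator_times mult.commute[of "indicator {0..L1} _"]
        scaleR_scaleR[symmetric] del: scaleR_scaleR)
  finally show ?thesis by (simp add: set_lebesgue_integral_def)
qed

section \<open>Waves on an interval and modes on the torus\<close>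

definition wave :: "real \<Rightarrow> int \<Rightarrow> real \<Rightarrow> complex" where
  "wave L k x = cis (2 * pi * of_int k / L * x)"

lemma wave_0 [simp]: "wave L 0 x = 1"
  by (simp add: wave_def)

lemma wave_add: "wave L (j + k) x = wave L j x * wave L k x"
  by (simp add: wave_def cis_mult add_divide_distrib distrib_right distrib_left)

lemma cnj_wave: "cnj (wave L k x) = wave L (- k) x"
  by (simp add: wave_def cis_cnj)

lemma cmod_wave [simp]: "cmod (wave L k x) = 1"
  by (simp add: wave_def)

lemma wave_continuous [continuous_intros]: "continuous_on A g \<Longrightarrow> continuous_on A (\<lambda>x. wave L k (g x))"
  unfolding wave_def cis_conv_exp
  by (intro continuous_on_exp continuous_on_mult continuous_on_const continuous_on_of_real)

lemma wave_has_vector_derivative: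
  "(wave L k has_vector_derivative \<i> * of_real (2 * pi * of_int k / L) * wave L k x) (at x within A)"
proof -
  define c where "c = 2 * pi * of_int k / L"
  have "((\<lambda>z. exp (\<i> * of_real c * z)) has_field_derivative
      \<i> * of_real c * exp (\<i> * of_real c * of_real x)) (at (of_real x))"
    by (auto intro!: derivative_eq_intros)
  from has_vector_derivative_real_field[OF this, of A]
  moreover have "wave L k = (\<lambda>y. exp (\<i> * of_real c * of_real y))"
    by (simp add: fun_eq_iff wave_def cis_conv_exp c_def mult.assoc)
  ultimately show ?thesis by (simp only: c_def[symmetric])
qed

lemma wave_period: "L \<noteq> 0 \<Longrightarrow> wave L k (x + L) = wave L k x"
  using cis_multiple_2pi[of "real_of_int k"]
  by (simp add: wave_def distrib_left cis_mult[symmetric] mult.assoc)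

lemma wave_L: "L \<noteq> 0 \<Longrightarrow> wave L k L = 1"
  using wave_period[of L k 0] by (simp add: wave_def)

lemma set_integral_continuous:
  fixes f :: "real \<Rightarrow> 'b::euclidean_space"
  assumes "continuous_on {a..b} f"
  shows "set_integrable lborel {a..b} f" "(LINT x:{a..b}|lborel. f x) = integral {a..b} f"
proof -
  show "set_integrable lborel {a..b} f"
    unfolding set_integrable_def by (intro borel_integrable_compact assms) auto
  then show "(LINT x:{a..b}|lborel. f x) = integral {a..b} f"
    by (rule set_borel_integral_eq_integral(2))
qed

lemma integral_wave:
  assumes "L > 0"
  shows "(LINT x:{0..L}|lborel. wave L k x) = (if k = 0 then of_real L else 0)"
proof -
  have c: "continuous_on {0..L} (wave L k)" by (intro continuous_intros continuous_on_id)
  let ?c = "\<i> * of_real (2 * pi * of_int k / L)"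
  have "integral {0..L} (wave L k) = (if k = 0 then of_real L else 0)"
  proof (cases "k = 0")
    case True then show ?thesis using assms by (simp add: wave_def[abs_def] scaleR_conv_of_real)
  next
    case False
    then have "?c \<noteq> 0" using assms by simp
    have "((\<lambda>x. ?c * wave L k x) has_integral (wave L k L - wave L k 0)) {0..L}"
      using assms by (intro fundamental_theorem_of_calculus wave_has_vector_derivative) auto
    then have "((\<lambda>x. ?c * wave L k x) has_integral 0) {0..L}"
      using assms by (simp add: wave_L) (simp add: wave_def)
    from has_integral_mult_right[OF this, of "1 / ?c"] \<open>?c \<noteq> 0\<close>
    have "(wave L k has_integral 0) {0..L}" by simp
    with False show ?thesis by (simp add: integral_unique)
  qed
  then show ?thesis using set_integral_continuous(2)[OF c] by simp
qed

definition mode :: "real \<Rightarrow> real \<Rightarrow> int \<Rightarrow> int \<Rightarrow> real \<times> real \<Rightarrow> complex" where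
  "mode L1 L2 k l z = wave L1 k (fst z) * wave L2 l (snd z)"

lemma mode_continuous [continuous_intros]: "continuous_on A (mode L1 L2 k l)"
  unfolding mode_def[abs_def] by (intro continuous_intros)

lemma mode_add: "mode L1 L2 (j + k) (l + n) z = mode L1 L2 j l z * mode L1 L2 k n z"
  by (simp add: mode_def wave_add)

lemma cnj_mode: "cnj (mode L1 L2 k l z) = mode L1 L2 (- k) (- l) z"
  by (simp add: mode_def cnj_wave)

lemma cmod_mode [simp]: "cmod (mode L1 L2 k l z) = 1"
  by (simp add: mode_def norm_mult)

lemma mode_sq: "mode L1 L2 k l \<in> square_integrable (torus L1 L2)"
  by (intro square_integrable_torus_continuous continuous_intros)

lemma integral_torus_product:
  fixes f g :: "real \<Rightarrow> complex"
  assumes "continuous_on UNIV f" "continuous_on UNIV g"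
  shows "(\<integral>z. f (fst z) * g (snd z) \<partial>torus L1 L2)
    = (LINT x:{0..L1}|lborel. f x) * (LINT y:{0..L2}|lborel. g y)"
proof -
  have "continuous_on UNIV (\<lambda>z. f (fst z) * g (snd z))"
    by (intro continuous_intros continuous_on_compose2[OF assms(1)] continuous_on_compose2[OF assms(2)]) auto
  then show ?thesis
    by (subst integral_torus_iterated) (auto intro: integrable_torus_continuous)
qed

lemma integral_mode:
  assumes "L1 > 0" "L2 > 0"
  shows "(\<integral>z. mode L1 L2 k l z \<partial>torus L1 L2) = (if k = 0 \<and> l = 0 then of_real (L1 * L2) else 0)"
  unfolding mode_def
  by (subst integral_torus_product)
    (auto simp: integral_wave assms intro!: continuous_intros)

text \<open>Generated inductively instead of as indexed sums, so that closure under products follows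
  by rule induction without index bookkeeping.\<close>

inductive_set trig_polys :: "real \<Rightarrow> real \<Rightarrow> (real \<times> real \<Rightarrow> complex) set" for L1 L2 where
  mode: "mode L1 L2 k l \<in> trig_polys L1 L2"
| add: "\<lbrakk>f \<in> trig_polys L1 L2; g \<in> trig_polys L1 L2\<rbrakk> \<Longrightarrow> (\<lambda>z. f z + g z) \<in> trig_polys L1 L2"
| scale: "f \<in> trig_polys L1 L2 \<Longrightarrow> (\<lambda>z. c * f z) \<in> trig_polys L1 L2"

lemma trig_polys_mult:
  assumes "f \<in> trig_polys L1 L2" "g \<in> trig_polys L1 L2"
  shows "(\<lambda>z. f z * g z) \<in> trig_polys L1 L2"
  using assms(1)
proof induction
  case (mode k l)
  show ?case using assms(2)
  proof induction
    case (mode k' l')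
    then show ?case using trig_polys.mode[of L1 L2 "k + k'" "l + l'"] by (simp add: mode_add[abs_def])
  next
    case (add f g)
    then show ?case using trig_polys.add[OF add.IH] by (simp add: distrib_left)
  next
    case (scale f c)
    then show ?case using trig_polys.scale[OF scale.IH, of c] by (simp add: mult.left_commute)
  qed
next
  case (add f1 f2)
  then show ?case using trig_polys.add[OF add.IH] by (simp add: distrib_right)
next
  case (scale f c)
  then show ?case using trig_polys.scale[OF scale.IH, of c] by (simp add: mult.assoc)
qed

lemma trig_polys_const: "(\<lambda>z. c) \<in> trig_polys L1 L2"
  using trig_polys.scale[OF trig_polys.mode[of L1 L2 0 0], of c] by (simp add: mode_def)

text \<open>Wraps the closed rectangle onto a product of two circles, identifying opposite sides.
  Stone--Weierstrass is applied on this compact image, where polynomials pull back to trigonometric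
  polynomials.\<close>

definition circle_pair :: "real \<Rightarrow> real \<Rightarrow> real \<times> real \<Rightarrow> complex \<times> complex" where
  "circle_pair L1 L2 z = (wave L1 1 (fst z), wave L2 1 (snd z))"

lemma circle_pair_continuous [continuous_intros]: "continuous_on A (circle_pair L1 L2)"
  unfolding circle_pair_def[abs_def] by (intro continuous_intros)

lemma complex_Re_Im_wave:
  "complex_of_real (Re (wave L 1 x)) = (1/2) * wave L 1 x + (1/2) * wave L (-1) x"
  "complex_of_real (Im (wave L 1 x)) = (-\<i>/2) * wave L 1 x + (\<i>/2) * wave L (-1) x"
  using cnj_wave[of L 1 x, symmetric] by (simp_all add: complex_eq_iff)

text \<open>Real polynomial functions are generated by constants and linear functionals, and a
  functional on pairs of complex numbers is a combination of four coordinates: the real and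
  imaginary parts of the two waves.\<close>

lemma trig_polys_real_polynomial:
  assumes "real_polynomial_function p"
  shows "(\<lambda>z. complex_of_real (p (circle_pair L1 L2 z))) \<in> trig_polys L1 L2"
  using assms
proof induction
  case (linear f)
  interpret f: bounded_linear f by fact
  have W: "(\<lambda>z. wave L1 k (fst z)) \<in> trig_polys L1 L2" "(\<lambda>z. wave L2 k (snd z)) \<in> trig_polys L1 L2" for k
    using trig_polys.mode[of L1 L2 k 0] trig_polys.mode[of L1 L2 0 k] by (simp_all add: mode_def[abs_def])
  have R: "(\<lambda>z. complex_of_real (Re (wave L1 1 (fst z)))) \<in> trig_polys L1 L2"
    "(\<lambda>z. complex_of_real (Im (wave L1 1 (fst z)))) \<in> trig_polys L1 L2"
    "(\<lambda>z. complex_of_real (Re (wave L2 1 (snd z)))) \<in> trig_polys L1 L2"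
    "(\<lambda>z. complex_of_real (Im (wave L2 1 (snd z)))) \<in> trig_polys L1 L2"
    unfolding complex_Re_Im_wave by (intro trig_polys.add trig_polys.scale W)+
  have dec: "(w :: complex \<times> complex) = Re (fst w) *\<^sub>R (1, 0) + (Im (fst w) *\<^sub>R (\<i>, 0) + (Re (snd w) *\<^sub>R (0, 1) + Im (snd w) *\<^sub>R (0, \<i>)))" for w
    by (cases w) (auto simp: complex_eq_iff)
  have *: "f w = f (1, 0) * Re (fst w) + (f (\<i>, 0) * Im (fst w) + (f (0, 1) * Re (snd w) + f (0, \<i>) * Im (snd w)))" for w
    by (subst dec) (simp only: f.add f.scaleR real_scaleR_def mult.commute)
  have "complex_of_real (f (circle_pair L1 L2 z)) =
     complex_of_real (f (1, 0)) * complex_of_real (Re (wave L1 1 (fst z)))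
       + (complex_of_real (f (\<i>, 0)) * complex_of_real (Im (wave L1 1 (fst z)))
       + (complex_of_real (f (0, 1)) * complex_of_real (Re (wave L2 1 (snd z)))
       + complex_of_real (f (0, \<i>)) * complex_of_real (Im (wave L2 1 (snd z)))))" for z
    using arg_cong[OF *[of "circle_pair L1 L2 z"], of complex_of_real]
    by (simp only: circle_pair_def fst_conv snd_conv of_real_add of_real_mult)
  moreover have "(\<lambda>z. complex_of_real (f (1, 0)) * complex_of_real (Re (wave L1 1 (fst z)))
       + (complex_of_real (f (\<i>, 0)) * complex_of_real (Im (wave L1 1 (fst z)))
       + (complex_of_real (f (0, 1)) * complex_of_real (Re (wave L2 1 (snd z)))
       + complex_of_real (f (0, \<i>)) * complex_of_real (Im (wave L2 1 (snd z)))))) \<in> trig_polys L1 L2"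
    by (intro trig_polys.add trig_polys.scale R)
  ultimately show ?case by presburger
next
  case (const c)
  show ?case by (rule trig_polys_const)
next
  case (add f g)
  then show ?case using trig_polys.add by simp
next
  case (mult f g)
  then show ?case using trig_polys_mult by simp
qed

lemma wave_inj:
  assumes "L > 0" "x \<in> {0..<L}" "y \<in> {0..<L}" "wave L 1 x = wave L 1 y"
  shows "x = y"
proof -
  have "cos (2 * pi / L * x) = cos (2 * pi / L * y)" "sin (2 * pi / L * x) = sin (2 * pi / L * y)"
    using assms(4) by (simp_all add: wave_def complex_eq_iff)
  then obtain n :: int where "2 * pi / L * x = 2 * pi / L * y + 2 * pi * n"
    using sin_cos_eq_iff[of "2 * pi / L * x" "2 * pi / L * y"] by auto
  then have "2 * pi / L * (x - y - n * L) = 0" using assms(1) by (simp add: field_simps)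
  then have eq: "x - y = n * L" using assms(1) by simp
  have "\<bar>x - y\<bar> < L" using assms(2,3) by auto
  then have "\<bar>real_of_int n\<bar> * L < 1 * L" unfolding eq abs_mult using assms(1) by simp
  then have "\<bar>real_of_int n\<bar> < 1" using assms(1) by (simp only: mult_less_cancel_right_pos)
  then have "n = 0" by linarith
  with eq show ?thesis by simp
qed

lemma circle_pair_inj:
  assumes "L1 > 0" "L2 > 0" "z \<in> {0..<L1} \<times> {0..<L2}" "w \<in> {0..<L1} \<times> {0..<L2}"
    "circle_pair L1 L2 z = circle_pair L1 L2 w"
  shows "z = w"
  using assms wave_inj[of L1 "fst z" "fst w"] wave_inj[of L2 "snd z" "snd w"]
  by (auto simp: circle_pair_def prod_eq_iff mem_Times_iff)

lemma integral_trig_polys_zero: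
  assumes f: "integrable (torus L1 L2) f"
    and zero: "\<And>k l. (\<integral>z. f z * mode L1 L2 k l z \<partial>torus L1 L2) = 0"
    and p: "p \<in> trig_polys L1 L2"
  shows "integrable (torus L1 L2) (\<lambda>z. f z * p z) \<and> (\<integral>z. f z * p z \<partial>torus L1 L2) = 0"
  using p
proof induction
  case (mode k l)
  have "integrable (torus L1 L2) (\<lambda>z. f z * mode L1 L2 k l z)"
    using f borel_measurable_torus_continuous[OF mode_continuous[of UNIV L1 L2 k l], of L1 L2]
    by (intro Bochner_Integration.integrable_bound[OF f]) (auto simp: norm_mult)
  with zero show ?case by simp
next
  case (add g h)
  then show ?case by (simp add: distrib_left)
next
  case (scale g c)
  then show ?case by (simp add: mult.left_commute[of _ c])
qed

text \<open>The discarded edges are null sets, and on the half-open rectangle that remains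
  \<open>circle_pair\<close> is injective.\<close>

lemma AE_torus_interior:
  "AE z in torus L1 L2. z \<in> {0..<L1} \<times> {0..<L2}"
proof -
  have "AE z in lborel. fst (z :: real \<times> real) \<noteq> L1 \<and> snd z \<noteq> L2"
  proof -
    have "{L1} \<times> UNIV \<union> UNIV \<times> {L2} \<in> null_sets (lborel \<Otimes>\<^sub>M lborel)"
      by (intro null_sets.Un lborel.times_in_null_sets1 lborel_pair.P.times_in_null_sets1
        lborel.times_in_null_sets2) auto
    then have "{L1} \<times> UNIV \<union> UNIV \<times> {L2} \<in> null_sets (lborel :: (real \<times> real) measure)"
      by (simp add: lborel_prod)
    from AE_not_in[OF this] show ?thesis by eventually_elim auto
  qed
  then have "AE z in lborel. z \<in> {0..L1} \<times> {0..L2} \<longrightarrow> z \<in> {0..<L1} \<times> {0..<L2}"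
    by eventually_elim (auto simp: mem_Times_iff)
  then show ?thesis unfolding torus_def
    by (subst AE_restrict_space_iff) auto
qed

text \<open>The indicator of the image \<open>K\<close> of \<open>C\<close> is the pointwise limit
  of the continuous functions \<open>q n\<close>; each is approximated within
  \<open>1 / real (Suc n)\<close> by a polynomial, whose pullback integrates to zero against
  \<open>f\<close>. Dominated convergence concludes. Since \<open>C\<close> avoids the far edges,
  injectivity turns membership of the image point in \<open>K\<close> into membership in
  \<open>C\<close> almost everywhere.\<close>

lemma integral_compact_zero:
  assumes L: "L1 > 0" "L2 > 0" and f: "integrable (torus L1 L2) f"
    and zero: "\<And>k l. (\<integral>z. f z * mode L1 L2 k l z \<partial>torus L1 L2) = 0"
    and C: "compact C" "C \<subseteq> {0..<L1} \<times> {0..<L2}"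
  shows "(\<integral>z. f z * indicator C z \<partial>torus L1 L2) = 0"
proof (cases "C = {}")
  case False
  let ?\<Phi> = "circle_pair L1 L2"
  define K where "K = ?\<Phi> ` C"
  have K: "closed K" unfolding K_def
    by (intro compact_imp_closed compact_continuous_image C continuous_intros)
  define S where "S = ?\<Phi> ` ({0..L1} \<times> {0..L2})"
  have S: "compact S" unfolding S_def
    by (intro compact_continuous_image continuous_intros compact_Times) auto
  define q where "q n w = max 0 (1 - real n * infdist w K)" for n w
  have q01: "0 \<le> q n w" "q n w \<le> 1" for n w by (auto simp: q_def infdist_nonneg)
  have "\<forall>n. \<exists>p. real_polynomial_function p \<and> (\<forall>w\<in>S. \<bar>q n w - p w\<bar> < 1 / real (Suc n))"
  proof
    fix n
    have "continuous_on S (q n)" unfolding q_def[abs_def] by (intro continuous_intros)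
    then obtain p where "real_polynomial_function p" "\<And>w. w \<in> S \<Longrightarrow> \<bar>q n w - p w\<bar> < 1 / real (Suc n)"
      by (rule Stone_Weierstrass_real_polynomial_function[OF S, where e="1 / real (Suc n)"]) simp_all
    then show "\<exists>p. real_polynomial_function p \<and> (\<forall>w\<in>S. \<bar>q n w - p w\<bar> < 1 / real (Suc n))"
      by blast
  qed
  from choice[OF this] obtain p where p: "\<And>n. real_polynomial_function (p n)"
    and pq: "\<And>n w. w \<in> S \<Longrightarrow> \<bar>q n w - p n w\<bar> < 1 / real (Suc n)" by blast
  have cont: "continuous_on UNIV (\<lambda>z. p n (?\<Phi> z))" for n
  proof -
    have "polynomial_function (p n)" using p[of n] by (simp add: real_polynomial_function_eq)
    then have "continuous_on UNIV (p n)" by (rule continuous_on_polymonial_function)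
    then show ?thesis by (rule continuous_on_compose2) (auto intro: continuous_intros)
  qed
  have zero': "(\<integral>z. f z * complex_of_real (p n (?\<Phi> z)) \<partial>torus L1 L2) = 0" for n
    using integral_trig_polys_zero[OF f zero trig_polys_real_polynomial[OF p]] by simp
  have lim: "(\<lambda>n. p n (?\<Phi> z)) \<longlonglongrightarrow> indicator K (?\<Phi> z)" if "z \<in> {0..L1} \<times> {0..L2}" for z
  proof -
    have zS: "?\<Phi> z \<in> S" using that by (auto simp: S_def)
    have "(\<lambda>n. q n (?\<Phi> z)) \<longlonglongrightarrow> indicator K (?\<Phi> z)"
    proof (cases "?\<Phi> z \<in> K")
      case True then show ?thesis by (simp add: q_def)
    next
      case False
      show ?thesis
      proof -
        have "K \<noteq> {}" using \<open>C \<noteq> {}\<close> by (simp add: K_def)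
        with False K have pos: "infdist (?\<Phi> z) K > 0"
          by (metis in_closed_iff_infdist_zero infdist_nonneg less_eq_real_def)
        obtain N :: nat where "1 / infdist (?\<Phi> z) K < real N" using reals_Archimedean2 by blast
        then have N: "1 < real N * infdist (?\<Phi> z) K" using pos by (simp add: field_simps)
        have "q n (?\<Phi> z) = 0" if "n \<ge> N" for n
        proof -
          have "real N * infdist (?\<Phi> z) K \<le> real n * infdist (?\<Phi> z) K"
            using that pos by (intro mult_right_mono) auto
          with N show ?thesis by (simp add: q_def)
        qed
        then have "\<forall>\<^sub>F n in sequentially. q n (?\<Phi> z) = 0" by (auto simp: eventually_sequentially)
        with False show ?thesis by (simp add: tendsto_eventually)
      qed
    qed
    moreover have "(\<lambda>n. p n (?\<Phi> z) - q n (?\<Phi> z)) \<longlonglongrightarrow> 0"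
    proof (rule tendsto_rabs_zero_cancel, rule tendsto_sandwich[of "\<lambda>_. 0"])
      show "\<forall>\<^sub>F n in sequentially. \<bar>p n (?\<Phi> z) - q n (?\<Phi> z)\<bar> \<le> 1 / real (Suc n)"
        using pq[OF zS] by (intro always_eventually allI less_imp_le) (simp add: abs_minus_commute)
      show "(\<lambda>n. 1 / real (Suc n)) \<longlonglongrightarrow> 0" by (rule LIMSEQ_Suc[OF lim_1_over_n])
    qed auto
    ultimately have "(\<lambda>n. (p n (?\<Phi> z) - q n (?\<Phi> z)) + q n (?\<Phi> z)) \<longlonglongrightarrow> 0 + indicator K (?\<Phi> z)"
      by (intro tendsto_add)
    then show ?thesis by simp
  qed
  have bnd: "\<bar>p n (?\<Phi> z)\<bar> \<le> 2" if "z \<in> {0..L1} \<times> {0..L2}" for n z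
  proof -
    have "\<bar>q n (?\<Phi> z) - p n (?\<Phi> z)\<bar> < 1 / real (Suc n)" using that by (intro pq) (auto simp: S_def)
    also have "1 / real (Suc n) \<le> 1" by simp
    finally show ?thesis using q01[of n "?\<Phi> z"] by linarith
  qed
  have sp: "space (torus L1 L2) = {0..L1} \<times> {0..L2}" by (simp add: torus_def space_restrict_space)
  have fm: "f \<in> borel_measurable (torus L1 L2)" using f by auto
  have "?\<Phi> \<in> measurable (torus L1 L2) borel"
    unfolding torus_def
    by (intro measurable_restrict_space1) (simp add: borel_measurable_continuous_onI circle_pair_continuous)
  then have "(\<lambda>z. indicator K (?\<Phi> z) :: real) \<in> borel_measurable (torus L1 L2)"
    by (rule measurable_compose) (simp add: borel_measurable_indicator K)
  then have km: "(\<lambda>z. f z * complex_of_real (indicator K (?\<Phi> z))) \<in> borel_measurable (torus L1 L2)"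
    using fm by simp
  have "(\<lambda>n. \<integral>z. f z * complex_of_real (p n (?\<Phi> z)) \<partial>torus L1 L2) \<longlonglongrightarrow>
      (\<integral>z. f z * complex_of_real (indicator K (?\<Phi> z)) \<partial>torus L1 L2)"
  proof (rule integral_dominated_convergence[where w="\<lambda>z. 2 * cmod (f z)"])
    show "integrable (torus L1 L2) (\<lambda>z. 2 * cmod (f z))" using f by auto
    show "(\<lambda>z. f z * complex_of_real (p n (?\<Phi> z))) \<in> borel_measurable (torus L1 L2)" for n
      using fm borel_measurable_torus_continuous[OF cont[of n], of L1 L2] by simp
    show "(\<lambda>z. f z * complex_of_real (indicator K (?\<Phi> z))) \<in> borel_measurable (torus L1 L2)" by (rule km)
    show "AE z in torus L1 L2. (\<lambda>n. f z * complex_of_real (p n (?\<Phi> z))) \<longlonglongrightarrow> f z * complex_of_real (indicator K (?\<Phi> z))"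
      by (rule AE_I2) (auto intro!: tendsto_intros lim simp: sp)
    show "AE z in torus L1 L2. norm (f z * complex_of_real (p n (?\<Phi> z))) \<le> 2 * cmod (f z)" for n
    proof (rule AE_I2)
      fix z assume "z \<in> space (torus L1 L2)"
      then show "norm (f z * complex_of_real (p n (?\<Phi> z))) \<le> 2 * cmod (f z)"
        using mult_left_mono[OF bnd[of z n], of "cmod (f z)"] by (simp only: sp norm_mult norm_of_real) simp
    qed
  qed
  then have "(\<integral>z. f z * complex_of_real (indicator K (?\<Phi> z)) \<partial>torus L1 L2) = 0"
    by (simp add: zero' LIMSEQ_const_iff)
  moreover have "(\<integral>z. f z * complex_of_real (indicator K (?\<Phi> z)) \<partial>torus L1 L2)
     = (\<integral>z. f z * indicator C z \<partial>torus L1 L2)"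
  proof (rule integral_cong_AE)
    show "AE z in torus L1 L2. f z * complex_of_real (indicator K (?\<Phi> z)) = f z * indicator C z"
      using AE_torus_interior
    proof eventually_elim
      case (elim z)
      then have "?\<Phi> z \<in> K \<longleftrightarrow> z \<in> C"
        unfolding K_def using circle_pair_inj[OF L elim] C(2) by blast
      then show ?case by (simp add: indicator_def)
    qed
    show "(\<lambda>z. f z * complex_of_real (indicator K (?\<Phi> z))) \<in> borel_measurable (torus L1 L2)" by (rule km)
    have "C \<in> sets borel" by (intro borel_closed compact_imp_closed C)
    then have "(indicator C :: real \<times> real \<Rightarrow> complex) \<in> borel_measurable (torus L1 L2)"
      unfolding torus_def by (intro measurable_restrict_space1) simp
    then show "(\<lambda>z. f z * indicator C z) \<in> borel_measurable (torus L1 L2)" using fm by simp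
  qed
  ultimately show ?thesis by simp
qed simp

lemma less_of_le_diff_inverse: "x \<le> L - 1 / (1 + real n) \<Longrightarrow> x < L"
  by (smt (verit) divide_pos_pos of_nat_0_le_iff)

text \<open>These rectangles are compact and stay away from the far edges, so intersecting a closed
  set with them gives sets to which \<open>integral_compact_zero\<close> applies.\<close>

lemma compact_exhaustion:
  fixes z :: "real \<times> real"
  shows "(\<lambda>n. indicator ({0..L1 - 1 / real (Suc n)} \<times> {0..L2 - 1 / real (Suc n)}) z :: complex)
    \<longlonglongrightarrow> indicator ({0..<L1} \<times> {0..<L2}) z"
proof (cases "z \<in> {0..<L1} \<times> {0..<L2}")
  case True
  define r where "r = min (L1 - fst z) (L2 - snd z)"
  have "r > 0" using True by (auto simp: r_def mem_Times_iff)
  then obtain N where N: "inverse (real (Suc N)) < r" using reals_Archimedean by blast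
  have "z \<in> {0..L1 - 1 / real (Suc n)} \<times> {0..L2 - 1 / real (Suc n)}" if "n \<ge> N" for n
  proof -
    have "1 / real (Suc n) \<le> 1 / real (Suc N)" using that by (intro divide_left_mono) auto
    then have "1 / real (Suc n) < r" using N by (simp add: inverse_eq_divide)
    then show ?thesis using True by (auto simp: r_def mem_Times_iff)
  qed
  then have "\<forall>\<^sub>F n in sequentially. (indicator ({0..L1 - 1 / real (Suc n)} \<times> {0..L2 - 1 / real (Suc n)}) z :: complex) = 1"
    unfolding eventually_sequentially by (intro exI[of _ N]) auto
  with True show ?thesis by (simp add: tendsto_eventually)
next
  case False
  have "z \<notin> {0..L1 - 1 / real (Suc n)} \<times> {0..L2 - 1 / real (Suc n)}" for n
  proof -
    show ?thesis using False by (auto simp: mem_Times_iff dest: less_of_le_diff_inverse)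
  qed
  with False show ?thesis by simp
qed

text \<open>Vanishing integrals over compact sets extend to closed sets by exhaustion and to Borel
  sets by a Dynkin argument; an integrable function with vanishing integrals over all Borel sets is
  zero almost everywhere.\<close>

theorem mode_total:
  assumes L: "L1 > 0" "L2 > 0" and f: "integrable (torus L1 L2) f"
    and zero: "\<And>k l. (\<integral>z. f z * mode L1 L2 k l z \<partial>torus L1 L2) = 0"
  shows "AE z in torus L1 L2. f z = 0"
proof -
  define g where "g z = indicator ({0..L1} \<times> {0..L2}) z *\<^sub>R f z" for z
  have g: "integrable lborel g" using f by (simp add: g_def[abs_def] integrable_torus_iff)
  have gA: "integrable lborel (\<lambda>z. indicator A z *\<^sub>R g z)" if "A \<in> sets borel" for A
    by (rule integrable_mult_indicator[OF _ g]) (use that in simp)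
  have closed: "(\<integral>z. indicator A z *\<^sub>R g z \<partial>lborel) = 0" if A: "closed A" for A
  proof -
    let ?Q = "\<lambda>n. {0..L1 - 1 / real (Suc n)} \<times> {0..L2 - 1 / real (Suc n)}"
    have fm: "f \<in> borel_measurable (torus L1 L2)" using f by auto
    have im: "(indicator B :: real \<times> real \<Rightarrow> complex) \<in> borel_measurable (torus L1 L2)" if "B \<in> sets borel" for B
      unfolding torus_def using that by (intro measurable_restrict_space1) simp
    have Qs: "?Q n \<in> sets borel" for n by (intro borel_closed closed_Times) auto
    have As: "A \<in> sets borel" using A by auto
    have "(\<lambda>n. \<integral>z. f z * indicator (A \<inter> ?Q n) z \<partial>torus L1 L2) \<longlonglongrightarrow> (\<integral>z. f z * indicator A z \<partial>torus L1 L2)"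
    proof (rule integral_dominated_convergence[where w="\<lambda>z. cmod (f z)"])
      show "AE z in torus L1 L2. (\<lambda>n. f z * indicator (A \<inter> ?Q n) z) \<longlonglongrightarrow> f z * indicator A z"
        using AE_torus_interior
      proof eventually_elim
        case (elim z)
        have "(\<lambda>n. f z * (indicator A z * indicator (?Q n) z)) \<longlonglongrightarrow> f z * (indicator A z * indicator ({0..<L1} \<times> {0..<L2}) z)"
          by (intro tendsto_intros compact_exhaustion)
        then show ?case using elim by (simp add: indicator_inter_arith)
      qed
      show "AE z in torus L1 L2. norm (f z * indicator (A \<inter> ?Q n) z) \<le> cmod (f z)" for n
        by (rule AE_I2) (simp add: norm_mult indicator_def)
      show "(\<lambda>z. f z * indicator A z) \<in> borel_measurable (torus L1 L2)"
        by (intro borel_measurable_times fm im As)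
      show "(\<lambda>z. f z * indicator (A \<inter> ?Q n) z) \<in> borel_measurable (torus L1 L2)" for n
        by (intro borel_measurable_times fm im sets.Int As Qs)
    qed (use f in auto)
    moreover have "(\<integral>z. f z * indicator (A \<inter> ?Q n) z \<partial>torus L1 L2) = 0" for n
    proof (rule integral_compact_zero[OF L f zero])
      show "A \<inter> ?Q n \<subseteq> {0..<L1} \<times> {0..<L2}" by (auto dest: less_of_le_diff_inverse)
      show "compact (A \<inter> ?Q n)" by (intro closed_Int_compact A compact_Times) auto
    qed
    ultimately have "(\<integral>z. f z * indicator A z \<partial>torus L1 L2) = 0" by (simp add: LIMSEQ_const_iff)
    moreover have "(\<integral>z. f z * indicator A z \<partial>torus L1 L2) = (\<integral>z. indicator A z *\<^sub>R g z \<partial>lborel)"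
      unfolding integral_torus g_def
      by (intro Bochner_Integration.integral_cong) (auto simp: indicator_def)
    ultimately show ?thesis by simp
  qed
  \<comment> \<open>Closed sets are stable under intersection and generate the Borel sets, so it is
    enough to treat complements and disjoint unions.\<close>
  have all: "(\<integral>z. indicator A z *\<^sub>R g z \<partial>lborel) = 0" if "A \<in> sets borel" for A
  proof -
    have "Int_stable (Collect closed :: (real \<times> real) set set)" by (auto simp: Int_stable_def)
    moreover have "(Collect closed :: (real \<times> real) set set) \<subseteq> Pow UNIV" by simp
    moreover have "A \<in> sigma_sets UNIV (Collect closed)" using that by (simp add: borel_eq_closed)
    ultimately show ?thesis
    proof (induction rule: sigma_sets_induct_disjoint)
      case (basic A) then show ?case by (simp add: closed)
    next
      case empty show ?case by simp
    next
      case (compl A)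
      then have A: "A \<in> sets borel" by (simp add: borel_eq_closed)
      have "(\<integral>z. indicator (UNIV - A) z *\<^sub>R g z \<partial>lborel) = (\<integral>z. indicator UNIV z *\<^sub>R g z - indicator A z *\<^sub>R g z \<partial>lborel)"
        by (intro Bochner_Integration.integral_cong) (auto simp: indicator_def)
      also have "\<dots> = 0"
        using Bochner_Integration.integral_diff[OF gA[of UNIV] gA[OF A]] closed[of UNIV] compl by simp
      finally show ?case .
    next
      case (union A)
      then have A: "A i \<in> sets lborel" for i by (auto simp: borel_eq_closed)
      have "(LINT z:(\<Union>i. A i)|lborel. g z) = (\<Sum>i. LINT z:A i|lborel. g z)"
      proof (rule lebesgue_integral_countable_add)
        show "set_integrable lborel (\<Union>i. A i) g"
          unfolding set_integrable_def using A by (intro gA) auto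
      qed (use A union(1) in \<open>auto simp: disjoint_family_on_def\<close>)
      then show ?case using union by (simp add: set_lebesgue_integral_def)
    qed
  qed
  have "AE z in lborel. g z = 0"
    by (rule sigma_finite_measure.density_zero[OF lborel.sigma_finite_measure_axioms g]) (use all in \<open>simp add: set_lebesgue_integral_def\<close>)
  then have "AE z in lborel. z \<in> {0..L1} \<times> {0..L2} \<longrightarrow> f z = 0"
    by eventually_elim (auto simp: g_def)
  then show ?thesis unfolding torus_def by (subst AE_restrict_space_iff) auto
qed

text \<open>Taken without the factor \<open>1 / (L1 * L2)\<close>, so the area reappears in
  Parseval's identity and in the approximating sums. The conjugated mode is written with negated
  indices.\<close>

definition mode_coeff :: "real \<Rightarrow> real \<Rightarrow> (real \<times> real \<Rightarrow> complex) \<Rightarrow> int \<Rightarrow> int \<Rightarrow> complex" where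
  "mode_coeff L1 L2 f k l = (\<integral>z. f z * mode L1 L2 (- k) (- l) z \<partial>torus L1 L2)"

lemma integrable_mode_mult:
  "f \<in> square_integrable (torus L1 L2) \<Longrightarrow> integrable (torus L1 L2) (\<lambda>z. f z * mode L1 L2 k l z)"
  by (rule integrable_mult_square_integrable[OF _ mode_sq])

lemma mode_mult_cnj: "mode L1 L2 k l z * cnj (mode L1 L2 k' l' z) = mode L1 L2 (k - k') (l - l') z"
  unfolding cnj_mode mode_add[symmetric] by simp

lemma square_integrable_torus_integrable:
  "f \<in> square_integrable (torus L1 L2) \<Longrightarrow> integrable (torus L1 L2) f"
  using integrable_mode_mult[of f L1 L2 0 0] by (simp add: mode_def)

section \<open>Fourier coefficients and trigonometric sums on a fixed torus\<close>

locale torus_lengths =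
  fixes L1 L2 :: real
  assumes L1_pos: "L1 > 0" and L2_pos: "L2 > 0"
begin

abbreviation "\<TT> \<equiv> torus L1 L2"

definition unit_mode :: "int \<times> int \<Rightarrow> real \<times> real \<Rightarrow> complex" where
  "unit_mode kl z = mode L1 L2 (fst kl) (snd kl) z / sqrt (L1 * L2)"

lemma area_pos: "L1 * L2 > 0"
  using L1_pos L2_pos by simp

sublocale fourier: total_orthonormal_system \<TT> unit_mode
proof unfold_locales
  show sq: "unit_mode i \<in> square_integrable \<TT>" for i
    unfolding unit_mode_def[abs_def] by (rule square_integrable_torus_continuous) (use area_pos in \<open>auto intro!: continuous_intros\<close>)
  define r where "r = sqrt (L1 * L2)"
  have s2: "complex_of_real r * complex_of_real r = complex_of_real (L1 * L2)"
    unfolding r_def using area_pos by (metis less_imp_le of_real_mult real_sqrt_mult_self abs_of_nonneg)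
  show ortho: "(\<integral>z. unit_mode i z * cnj (unit_mode j z) \<partial>\<TT>) = (if i = j then 1 else 0)" for i j
  proof -
    have "unit_mode i z * cnj (unit_mode j z) = mode L1 L2 (fst i - fst j) (snd i - snd j) z / complex_of_real (L1 * L2)" for z
      unfolding unit_mode_def mode_mult_cnj[symmetric] r_def[symmetric] s2[symmetric] by simp
    then show ?thesis
      using area_pos integral_mode[OF L1_pos L2_pos, of "fst i - fst j" "snd i - snd j"]
      by (auto simp: prod_eq_iff)
  qed
  interpret orthonormal_system \<TT> unit_mode by unfold_locales (fact sq, fact ortho)
  fix f assume f: "f \<in> square_integrable \<TT>" and z: "\<And>i. coeff f i = 0"
  show "AE z in \<TT>. f z = 0"
  proof (rule mode_total[OF L1_pos L2_pos square_integrable_torus_integrable[OF f]])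
    fix k l
    have "coeff f (- k, - l) = (\<integral>z. f z * mode L1 L2 k l z \<partial>\<TT>) / sqrt (L1 * L2)"
      unfolding coeff_def unit_mode_def by (simp add: cnj_mode)
    with z L1_pos L2_pos show "(\<integral>z. f z * mode L1 L2 k l z \<partial>\<TT>) = 0" by simp
  qed
qed

abbreviation "fc \<equiv> mode_coeff L1 L2"

lemma coeff_unit_mode: "fourier.coeff f (k, l) = fc f k l / sqrt (L1 * L2)"
  by (simp add: fourier.coeff_def mode_coeff_def unit_mode_def cnj_mode)

lemma mode_Parseval:
  assumes "f \<in> square_integrable \<TT>"
  shows "((\<lambda>(k, l). (cmod (fc f k l))\<^sup>2) has_sum (L1 * L2 * (norm2 \<TT> f)\<^sup>2)) UNIV"
proof -
  have "(\<lambda>(k, l). (cmod (fc f k l))\<^sup>2) = (\<lambda>i. (L1 * L2) * (cmod (fourier.coeff f i))\<^sup>2)"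
    using area_pos by (auto simp: fun_eq_iff coeff_unit_mode norm_divide power_divide)
  then show ?thesis using has_sum_cmult_right[OF fourier.Parseval[OF assms], of "L1 * L2"] by simp
qed

definition trig_sum :: "(int \<times> int) set \<Rightarrow> (int \<Rightarrow> int \<Rightarrow> complex) \<Rightarrow> real \<times> real \<Rightarrow> complex" where
  "trig_sum F c z = (\<Sum>(k, l)\<in>F. c k l * mode L1 L2 k l z)"

lemma trig_sum_sq: "trig_sum F c \<in> square_integrable \<TT>"
  unfolding trig_sum_def[abs_def] case_prod_unfold
  by (intro square_integrable_sum square_integrable_scale mode_sq)

lemma trig_sums_dense:
  assumes "f \<in> square_integrable \<TT>" "\<epsilon> > 0"
  shows "\<exists>F. finite F \<and> norm2 \<TT> (\<lambda>z. f z - trig_sum F (\<lambda>k l. fc f k l / (L1 * L2)) z) < \<epsilon>"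
proof -
  have s2: "complex_of_real (sqrt (L1 * L2)) * complex_of_real (sqrt (L1 * L2)) = complex_of_real (L1 * L2)"
    using area_pos by (metis less_imp_le of_real_mult real_sqrt_mult_self abs_of_nonneg)
  have "fourier.partial_sum (fourier.coeff f) F = trig_sum F (\<lambda>k l. fc f k l / (L1 * L2))" for F
    unfolding fourier.partial_sum_def trig_sum_def fun_eq_iff
    by (auto intro!: sum.cong simp: coeff_unit_mode unit_mode_def s2[simplified])
  then show ?thesis using fourier.partial_sums_dense[OF assms] by simp
qed

lemma fc_diff_le:
  assumes "f \<in> square_integrable \<TT>" "g \<in> square_integrable \<TT>"
  shows "cmod (fc f k l - fc g k l) \<le> sqrt (L1 * L2) * norm2 \<TT> (\<lambda>z. f z - g z)"
proof -
  have "fc f k l - fc g k l = sqrt (L1 * L2) * (fourier.coeff f (k, l) - fourier.coeff g (k, l))"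
    using L1_pos L2_pos by (simp add: coeff_unit_mode right_diff_distrib)
  then have "cmod (fc f k l - fc g k l) = sqrt (L1 * L2) * cmod (fourier.coeff f (k, l) - fourier.coeff g (k, l))"
    using area_pos by (simp add: norm_mult)
  then show ?thesis using fourier.coeff_diff_le[OF assms, of "(k, l)"] area_pos by simp
qed

lemma fc_add:
  assumes "f \<in> square_integrable \<TT>" "g \<in> square_integrable \<TT>"
  shows "fc (\<lambda>z. f z + g z) k l = fc f k l + fc g k l"
  using integrable_mode_mult[OF assms(1)] integrable_mode_mult[OF assms(2)]
  by (simp add: mode_coeff_def distrib_right)

lemma fc_diff:
  assumes "f \<in> square_integrable \<TT>" "g \<in> square_integrable \<TT>"
  shows "fc (\<lambda>z. f z - g z) k l = fc f k l - fc g k l"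
  using integrable_mode_mult[OF assms(1)] integrable_mode_mult[OF assms(2)]
  by (simp add: mode_coeff_def left_diff_distrib)

lemma fc_scale: "fc (\<lambda>z. c * f z) k l = c * fc f k l"
  by (simp add: mode_coeff_def mult.assoc)

lemma fc_trig_sum:
  fixes c :: "int \<Rightarrow> int \<Rightarrow> complex"
  assumes "finite F"
  shows "fc (trig_sum F c) k l = (if (k, l) \<in> F then L1 * L2 * c k l else 0)"
proof -
  have "fc (trig_sum F c) k l = (\<integral>z. (\<Sum>(k', l')\<in>F. c k' l' * mode L1 L2 (k' - k) (l' - l) z) \<partial>\<TT>)"
    unfolding mode_coeff_def trig_sum_def
    by (intro Bochner_Integration.integral_cong)
      (auto simp: sum_distrib_right mult.assoc case_prod_unfold mode_add[symmetric])
  also have "\<dots> = (\<Sum>(k', l')\<in>F. c k' l' * (if k' = k \<and> l' = l then complex_of_real (L1 * L2) else 0))"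
    unfolding case_prod_unfold
    by (subst Bochner_Integration.integral_sum)
      (auto simp: integral_mode[OF L1_pos L2_pos] intro!: square_integrable_torus_integrable mode_sq integrable_mult_right)
  also have "\<dots> = (\<Sum>p\<in>F. if p = (k, l) then c k l * (L1 * L2) else 0)"
    by (intro sum.cong) (auto split: if_split_asm)
  also have "\<dots> = (if (k, l) \<in> F then L1 * L2 * c k l else 0)"
    using assms by (simp add: mult.commute)
  finally show ?thesis .
qed

end

text \<open>The one-dimensional identity in time is read off from the torus of sides
  \<open>T\<close> and 1, for a function constant in the second variable. No periodicity of
  \<open>g\<close> enters, as Parseval is an \<open>L^2\<close> statement.\<close>

lemma wave_Parseval:
  fixes g :: "real \<Rightarrow> complex"
  assumes T: "T > 0" and g: "continuous_on {0..T} g"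
  shows "((\<lambda>n. (cmod (integral {0..T} (\<lambda>t. g t * wave T (- n) t)))\<^sup>2)
    has_sum (T * integral {0..T} (\<lambda>t. (cmod (g t))\<^sup>2))) UNIV"
proof -
  \<comment> \<open>Clamping the argument extends \<open>g\<close> continuously to the whole line
    without changing it on \<open>{0..T}\<close>.\<close>
  define h where "h t = g (max 0 (min T t))" for t
  have h: "continuous_on UNIV h"
    unfolding h_def by (rule continuous_on_compose2[OF g]) (use T in \<open>auto intro!: continuous_intros\<close>)
  have hg: "h t = g t" if "t \<in> {0..T}" for t using that by (auto simp: h_def)
  interpret torus_lengths T 1 using T by unfold_locales auto
  have hs: "(\<lambda>z. h (fst z)) \<in> square_integrable \<TT>"
    by (intro square_integrable_torus_continuous continuous_on_compose2[OF h] continuous_intros) auto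
  define G where "G n = integral {0..T} (\<lambda>t. g t * wave T (- n) t)" for n
  have G: "(LINT x:{0..T}|lborel. h x * wave T (- n) x) = G n" for n
    unfolding G_def
    by (subst set_integral_continuous(2))
      (auto intro!: continuous_intros continuous_on_subset[OF h] integral_cong simp: hg)
  have coef: "fc (\<lambda>z. h (fst z)) n l = (if l = 0 then G n else 0)" for n l
  proof -
    have "fc (\<lambda>z. h (fst z)) n l = (\<integral>z. (h (fst z) * wave T (- n) (fst z)) * wave 1 (- l) (snd z) \<partial>\<TT>)"
      by (simp add: mode_coeff_def mode_def mult.assoc)
    also have "\<dots> = G n * (if l = 0 then 1 else 0)"
      by (subst integral_torus_product) (auto intro!: continuous_intros h simp: G integral_wave)
    finally show ?thesis by simp
  qed
  have nrm: "(norm2 \<TT> (\<lambda>z. h (fst z)))\<^sup>2 = integral {0..T} (\<lambda>t. (cmod (g t))\<^sup>2)"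
  proof -
    have "complex_of_real ((norm2 \<TT> (\<lambda>z. h (fst z)))\<^sup>2) = (\<integral>z. complex_of_real ((cmod (h (fst z)))\<^sup>2) * 1 \<partial>\<TT>)"
      by (simp only: norm2_power2 integral_complex_of_real mult_1_right)
    also have "\<dots> = (LINT x:{0..T}|lborel. complex_of_real ((cmod (h x))\<^sup>2)) * (LINT y:{0..1::real}|lborel. 1)"
      by (rule integral_torus_product) (intro continuous_intros h)+
    also have "(LINT y:{0..1::real}|lborel. (1::complex)) = 1"
      by (subst set_integral_continuous(2)) auto
    also have "(LINT x:{0..T}|lborel. complex_of_real ((cmod (h x))\<^sup>2)) = integral {0..T} (\<lambda>t. complex_of_real ((cmod (g t))\<^sup>2))"
      by (subst set_integral_continuous(2))
        (auto intro!: continuous_intros continuous_on_subset[OF h] integral_cong simp: hg)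
    also have "\<dots> = complex_of_real (integral {0..T} (\<lambda>t. (cmod (g t))\<^sup>2))"
      by (intro integral_unique has_integral_of_real integrable_integral integrable_continuous_interval continuous_intros g)
    finally show ?thesis by (metis mult_1_right of_real_eq_iff)
  qed
  have "((\<lambda>(k, l). (cmod (fc (\<lambda>z. h (fst z)) k l))\<^sup>2) has_sum (T * integral {0..T} (\<lambda>t. (cmod (g t))\<^sup>2))) UNIV"
    using mode_Parseval[OF hs] by (simp add: nrm)
  \<comment> \<open>Only the row of zero second index contributes, so the double sum collapses to a
    sum over \<open>n\<close>.\<close>
  then have "((\<lambda>(k, l). (cmod (fc (\<lambda>z. h (fst z)) k l))\<^sup>2) has_sum (T * integral {0..T} (\<lambda>t. (cmod (g t))\<^sup>2))) (range (\<lambda>n. (n, 0)))"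
    by (rule has_sum_cong_neutral[THEN iffD1, rotated -1]) (auto simp: coef)
  then show ?thesis
    by (subst (asm) has_sum_reindex) (auto simp: inj_on_def o_def coef G_def)
qed

section \<open>A smooth sign of the shear relative to a level\<close>

text \<open>The gap is measured in squares because \<open>(sin x)^2 - (sin a)^2\<close> factors into
  two sines. For \<open>m \<ge> 2\<close> it forces the larger modulus to be at least
  \<open>\<delta>\<close>, and factoring out its power \<open>m - 2\<close> leaves the gap of
  squares; absolute values dispose of the signs.\<close>

lemma power_gap:
  fixes x s \<delta> :: real
  assumes x: "\<bar>x\<bar> \<le> 1" and s: "\<bar>s\<bar> \<le> 1" and \<delta>: "0 < \<delta>" "\<delta> \<le> 1" and m: "m \<ge> 1"
    and gap: "\<delta>\<^sup>2 \<le> \<bar>x\<^sup>2 - s\<^sup>2\<bar>"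
  shows "\<delta> ^ max 2 m / 2 \<le> \<bar>x ^ m - s ^ m\<bar>"
proof -
  have main: "\<delta> ^ max 2 m / 2 \<le> X ^ m - S ^ m"
    if "0 \<le> S" "S \<le> X" "X \<le> 1" and g: "\<delta>\<^sup>2 \<le> X\<^sup>2 - S\<^sup>2" for X S :: real
  proof (cases "m = 1")
    case True
    \<comment> \<open>For \<open>m = 1\<close> the exponent stays 2, as near a maximum of the sine;
      dividing by \<open>X + S \<le> 2\<close> is the origin of the factor \<open>1 / 2\<close> in
      the conclusion.\<close>
    have "\<delta>\<^sup>2 \<le> (X - S) * (X + S)" using g by (simp add: power2_eq_square algebra_simps)
    also have "\<dots> \<le> (X - S) * 2" using that by (intro mult_left_mono) auto
    finally show ?thesis using True by (simp add: power2_eq_square)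
  next
    case False
    with m have m2: "m = m - 2 + 2" by simp
    have "\<delta>\<^sup>2 \<le> X\<^sup>2" using g zero_le_power2[of S] by linarith
    then have X\<delta>: "\<delta> \<le> X" using that by (intro power2_le_imp_le[of \<delta> X]) linarith+
    have "\<delta> ^ m = \<delta> ^ (m - 2) * \<delta>\<^sup>2" by (metis m2 power_add)
    also have "\<dots> \<le> X ^ (m - 2) * (X\<^sup>2 - S\<^sup>2)"
      using X\<delta> \<delta> g that by (intro mult_mono power_mono) auto
    also have "\<dots> \<le> X ^ (m - 2) * X\<^sup>2 - S ^ (m - 2) * S\<^sup>2"
      using that by (simp add: right_diff_distrib) (intro mult_right_mono power_mono; simp)
    also have "\<dots> = X ^ m - S ^ m" by (metis m2 power_add)
    finally have "\<delta> ^ m \<le> X ^ m - S ^ m" .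
    moreover have "0 \<le> \<delta> ^ m" using \<delta> by simp
    moreover have "max 2 m = m" using False m by simp
    ultimately show ?thesis by simp
  qed
  have "\<delta> ^ max 2 m / 2 \<le> \<bar>\<bar>x\<bar> ^ m - \<bar>s\<bar> ^ m\<bar>"
  proof (cases "\<bar>s\<bar> \<le> \<bar>x\<bar>")
    case True
    then have "s\<^sup>2 \<le> x\<^sup>2" by (simp add: abs_le_square_iff)
    then have "\<delta> ^ max 2 m / 2 \<le> \<bar>x\<bar> ^ m - \<bar>s\<bar> ^ m" using True x gap by (intro main) auto
    then show ?thesis by linarith
  next
    case False
    then have "x\<^sup>2 \<le> s\<^sup>2" by (simp add: abs_le_square_iff)
    then have "\<delta> ^ max 2 m / 2 \<le> \<bar>s\<bar> ^ m - \<bar>x\<bar> ^ m" using False s gap by (intro main) auto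
    then show ?thesis by linarith
  qed
  also have "\<dots> = \<bar>\<bar>x ^ m\<bar> - \<bar>s ^ m\<bar>\<bar>" by (simp add: power_abs)
  also have "\<dots> \<le> \<bar>x ^ m - s ^ m\<bar>" by (rule abs_triangle_ineq3)
  finally show ?thesis .
qed

text \<open>Levels outside the range of \<open>x ^ m\<close> on \<open>[-1,1]\<close> are replaced by the nearest attained level.\<close>

lemma power_level:
  fixes c :: real
  assumes "m \<ge> 1"
  obtains s where "\<bar>s\<bar> \<le> 1"
    "c = s ^ m \<or> (s ^ m < c \<and> (\<forall>x. \<bar>x\<bar> \<le> 1 \<longrightarrow> x ^ m \<le> s ^ m)) \<or> (c < s ^ m \<and> (\<forall>x. \<bar>x\<bar> \<le> 1 \<longrightarrow> s ^ m \<le> x ^ m))"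
proof -
  have le1: "x ^ m \<le> 1" "- 1 \<le> x ^ m" if "\<bar>x\<bar> \<le> 1" for x :: real
    using power_le_one[of "\<bar>x\<bar>" m] that by (simp_all add: abs_le_iff power_abs[symmetric])
  consider "c > 1" | "c \<in> {-1..1}" "odd m" | "c < -1" "odd m" | "c \<in> {0..1}" "even m" | "c < 0" "even m" by force
  then show thesis
  proof cases
    case 1 then show ?thesis using le1 by (intro that[of 1]) auto
  next
    case 2
    have p: "root m c ^ m = c" using 2 by (simp add: odd_real_root_pow)
    have "\<bar>root m c\<bar> ^ m \<le> 1" using 2 by (simp add: power_abs[symmetric] p abs_le_iff)
    then have "\<bar>root m c\<bar> \<le> 1" using assms power_le_one_iff[of "\<bar>root m c\<bar>" m] by simp
    then show ?thesis using p by (intro that[of "root m c"]) auto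
  next
    case 3 then show ?thesis using le1 by (intro that[of "-1"]) auto
  next
    case 4
    have p: "root m c ^ m = c" using 4 assms by (simp add: real_root_pow_pos2)
    have "\<bar>root m c\<bar> ^ m \<le> 1" using 4 by (simp add: power_abs[symmetric] p abs_le_iff)
    then have "\<bar>root m c\<bar> \<le> 1" using assms power_le_one_iff[of "\<bar>root m c\<bar>" m] by simp
    then show ?thesis using p by (intro that[of "root m c"]) auto
  next
    case 5
    then show ?thesis using assms by (intro that[of 0]) (auto simp: zero_le_even_power power_0_left)
  qed
qed

text \<open>\<open>tanh\<close> keeps the sign of the sine exactly, is bounded away from zero once
  the sine has size comparable to \<open>\<delta>\<close>, and has derivatives in closed form that
  cost one power of \<open>1 / \<delta>\<close> each.\<close>

definition smooth_sign :: "real \<Rightarrow> real \<Rightarrow> real \<Rightarrow> real \<Rightarrow> real" where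
  "smooth_sign r b \<delta> y = tanh (sin (r * y + b) / \<delta>)"

definition smooth_sign' :: "real \<Rightarrow> real \<Rightarrow> real \<Rightarrow> real \<Rightarrow> real" where
  "smooth_sign' r b \<delta> y = (1 - (smooth_sign r b \<delta> y)\<^sup>2) * (r * cos (r * y + b) / \<delta>)"

definition smooth_sign'' :: "real \<Rightarrow> real \<Rightarrow> real \<Rightarrow> real \<Rightarrow> real" where
  "smooth_sign'' r b \<delta> y =
     - 2 * smooth_sign r b \<delta> y * smooth_sign' r b \<delta> y * (r * cos (r * y + b) / \<delta>)
     - (1 - (smooth_sign r b \<delta> y)\<^sup>2) * (r\<^sup>2 * sin (r * y + b) / \<delta>)"

lemma smooth_sign_deriv:
  "(smooth_sign r b \<delta> has_real_derivative smooth_sign' r b \<delta> y) (at y)"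
  unfolding smooth_sign_def[abs_def] smooth_sign'_def
  \<comment> \<open>For \<open>\<delta> = 0\<close> the quotient is 0 by convention and the function
    is constant, so the formula holds without a sign hypothesis.\<close>
  by (cases "\<delta> = 0") (auto intro!: derivative_eq_intros)

lemma smooth_sign'_deriv:
  "(smooth_sign' r b \<delta> has_real_derivative smooth_sign'' r b \<delta> y) (at y)"
  unfolding smooth_sign'_def[abs_def] smooth_sign''_def
  by (cases "\<delta> = 0")
    (auto intro!: derivative_eq_intros smooth_sign_deriv simp: smooth_sign'_def power2_eq_square field_simps)

lemma smooth_sign_continuous:
  "continuous_on A (smooth_sign r b \<delta>)" "continuous_on A (smooth_sign' r b \<delta>)"
  "continuous_on A (smooth_sign'' r b \<delta>)"
proof -
  show 0: "continuous_on A (smooth_sign r b \<delta>)" and 1: "continuous_on A (smooth_sign' r b \<delta>)"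
    using DERIV_continuous_on[of A, OF has_field_derivative_at_within[OF smooth_sign_deriv]]
      DERIV_continuous_on[of A, OF has_field_derivative_at_within[OF smooth_sign'_deriv]] by simp_all
  show "continuous_on A (smooth_sign'' r b \<delta>)"
    unfolding smooth_sign''_def[abs_def] divide_inverse by (intro continuous_intros 0 1)
qed

lemma smooth_sign_abs_le: "\<bar>smooth_sign r b \<delta> y\<bar> \<le> 1"
  unfolding smooth_sign_def using tanh_real_bounds[of "sin (r * y + b) / \<delta>"] by auto

lemma one_minus_square_le: "0 \<le> 1 - (smooth_sign r b \<delta> y)\<^sup>2" "1 - (smooth_sign r b \<delta> y)\<^sup>2 \<le> 1"
  using smooth_sign_abs_le[of r b \<delta> y] by (simp_all add: abs_square_le_1)

lemma smooth_sign'_abs_le: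
  assumes "\<delta> > 0" shows "\<bar>smooth_sign' r b \<delta> y\<bar> \<le> \<bar>r\<bar> / \<delta>"
proof -
  have "\<bar>smooth_sign' r b \<delta> y\<bar> = (1 - (smooth_sign r b \<delta> y)\<^sup>2) * (\<bar>r\<bar> * \<bar>cos (r * y + b)\<bar> / \<delta>)"
    unfolding smooth_sign'_def using one_minus_square_le[of r b \<delta> y] assms by (simp add: abs_mult)
  also have "\<dots> \<le> 1 * (\<bar>r\<bar> * 1 / \<delta>)"
    using assms one_minus_square_le by (intro mult_mono divide_right_mono mult_left_mono) auto
  finally show ?thesis by simp
qed

text \<open>Differentiating the cosine leaves a term of order \<open>1 / \<delta>\<close>, which
  \<open>\<delta> \<le> 1\<close> absorbs into the leading order; the constant is 2 + 1.\<close>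

lemma smooth_sign''_abs_le:
  assumes "\<delta> > 0" "\<delta> \<le> 1" shows "\<bar>smooth_sign'' r b \<delta> y\<bar> \<le> 3 * r\<^sup>2 / \<delta>\<^sup>2"
proof -
  have "\<bar>smooth_sign'' r b \<delta> y\<bar> \<le>
      2 * \<bar>smooth_sign r b \<delta> y\<bar> * \<bar>smooth_sign' r b \<delta> y\<bar> * (\<bar>r\<bar> * \<bar>cos (r * y + b)\<bar> / \<delta>)
      + (1 - (smooth_sign r b \<delta> y)\<^sup>2) * (r\<^sup>2 * \<bar>sin (r * y + b)\<bar> / \<delta>)"
    unfolding smooth_sign''_def
    by (rule order_trans[OF abs_triangle_ineq4])
      (use one_minus_square_le[of r b \<delta> y] assms in \<open>simp add: abs_mult\<close>)
  also have "\<dots> \<le> 2 * 1 * (\<bar>r\<bar> / \<delta>) * (\<bar>r\<bar> * 1 / \<delta>) + 1 * (r\<^sup>2 * 1 / \<delta>)"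
    using assms one_minus_square_le smooth_sign_abs_le smooth_sign'_abs_le[OF assms(1)]
    by (intro add_mono mult_mono divide_right_mono mult_left_mono mult_nonneg_nonneg) auto
  also have "\<dots> \<le> 3 * r\<^sup>2 / \<delta>\<^sup>2"
  proof -
    have "r\<^sup>2 / \<delta> \<le> r\<^sup>2 / \<delta>\<^sup>2"
      using assms by (intro divide_left_mono) (auto simp: power2_eq_square mult_le_cancel_left1)
    then show ?thesis by (simp add: power2_eq_square)
  qed
  finally show ?thesis .
qed

lemma smooth_sign_ge:
  assumes "\<delta> > 0" "\<delta> / 2 \<le> \<bar>sin (r * y + b)\<bar>"
  shows "tanh (1/2) \<le> \<bar>smooth_sign r b \<delta> y\<bar>"
proof -
  have "tanh (1/2) \<le> tanh (\<bar>sin (r * y + b) / \<delta>\<bar>)"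
    using assms by (simp add: field_simps abs_mult)
  then show ?thesis by (simp only: smooth_sign_def tanh_real_abs)
qed

lemma smooth_sign_sgn:
  assumes "\<delta> > 0" shows "sgn (smooth_sign r b \<delta> y) = sgn (sin (r * y + b))"
  using assms unfolding smooth_sign_def
  by (cases "sin (r * y + b)" "0 :: real" rule: linorder_cases)
    (auto simp: sgn_if divide_less_0_iff zero_less_divide_iff)

section \<open>Covering the set where a sine is small\<close>

lemma sin_ge_quarter:
  assumes "0 \<le> x" "x \<le> pi / 2" shows "x / 4 \<le> sin (x :: real)"
proof (cases "x \<le> pi / 3")
  case True
  \<comment> \<open>Up to \<open>pi / 3\<close> the derivative of the sine is at least
    \<open>1 / 2\<close>. In the other case the sine is at least \<open>1 / 2\<close>, while
    \<open>x / 4\<close> is at most \<open>pi / 8\<close>.\<close>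
  have "\<exists>D. ((\<lambda>x. sin x - x / 4) has_real_derivative D) (at t) \<and> 0 \<le> D" if "0 \<le> t" "t \<le> x" for t
  proof -
    have "cos (pi / 3) \<le> cos t" using that True by (intro cos_monotone_0_pi_le) auto
    then show ?thesis by (intro exI[of _ "cos t - 1/4"]) (auto intro!: derivative_eq_intros simp: cos_60)
  qed
  from DERIV_nonneg_imp_nondecreasing[OF assms(1) this] show ?thesis by simp
next
  case False
  have "x / 4 \<le> 1 / 2" using assms(2) pi_less_4 by simp
  also have "\<dots> = sin (pi / 6)" by (simp add: sin_30)
  also have "\<dots> \<le> sin x" using False assms(2) pi_gt_zero by (intro sin_monotone_2pi_le) auto
  finally show ?thesis .
qed

text \<open>Subtracting the nearest multiple of \<open>pi\<close> leaves the modulus of the sine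
  unchanged and brings the argument to modulus at most \<open>pi / 2\<close>, where
  \<open>sin_ge_quarter\<close> applies; hence the factor 4.\<close>

lemma small_sin_near_multiple:
  assumes "\<bar>sin \<phi>\<bar> < \<delta>"
  shows "\<bar>\<phi> - pi * of_int (round (\<phi> / pi))\<bar> \<le> 4 * \<delta>"
proof -
  define k where "k = round (\<phi> / pi)"
  have "\<bar>of_int k - \<phi> / pi\<bar> \<le> 1 / 2" unfolding k_def by (rule of_int_round_abs_le)
  then have "pi * \<bar>of_int k - \<phi> / pi\<bar> \<le> pi * (1 / 2)" by (intro mult_left_mono) auto
  moreover have "pi * \<bar>of_int k - \<phi> / pi\<bar> = \<bar>\<phi> - pi * of_int k\<bar>"
  proof -
    have "pi * \<bar>of_int k - \<phi> / pi\<bar> = \<bar>pi * (of_int k - \<phi> / pi)\<bar>" by (simp add: abs_mult)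
    then show ?thesis by (simp add: right_diff_distrib abs_minus_commute)
  qed
  ultimately have half: "\<bar>\<phi> - pi * of_int k\<bar> \<le> pi / 2" by simp
  have "\<bar>sin (\<phi> - pi * of_int k)\<bar> = \<bar>sin \<phi>\<bar> * \<bar>cos (pi * of_int k)\<bar>"
    by (simp add: sin_diff abs_mult del: cos_npi_int)
  also have "\<bar>cos (pi * of_int k)\<bar> = 1" by simp
  finally have "\<bar>sin (\<phi> - pi * of_int k)\<bar> = \<bar>sin \<phi>\<bar>" by simp
  moreover have "\<bar>\<phi> - pi * of_int k\<bar> / 4 \<le> \<bar>sin (\<phi> - pi * of_int k)\<bar>"
  proof (cases "\<phi> - pi * of_int k \<ge> 0")
    case True then show ?thesis using sin_ge_quarter[of "\<phi> - pi * of_int k"] half by simp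
  next
    case False
    then have "- (\<phi> - pi * of_int k) / 4 \<le> sin (- (\<phi> - pi * of_int k))"
      using half by (intro sin_ge_quarter) auto
    with False show ?thesis unfolding sin_minus by linarith
  qed
  ultimately show ?thesis using assms unfolding k_def by simp
qed

text \<open>The phase runs through an interval of length \<open>2 * pi\<close>, so after rounding
  only the four multiples of \<open>pi\<close> from \<open>k0\<close> to \<open>k0 + 3\<close> can
  be nearest. Each accounts for an interval of length \<open>2 * L * \<delta>\<close>: the phase
  distance \<open>4 * \<delta>\<close> becomes \<open>2 * L * \<delta> / pi\<close>, at most
  \<open>L * \<delta>\<close>, in \<open>y\<close>.\<close>

lemma small_sin_cover:
  fixes L b \<delta> :: real
  assumes L: "L > 0" and \<delta>: "\<delta> > 0"
  obtains B where "B \<in> sets borel" "emeasure lborel B \<le> ennreal (8 * L * \<delta>)"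
    "\<And>y. \<lbrakk>y \<in> {0..L}; \<bar>sin (2 * pi / L * y + b)\<bar> < \<delta>\<rbrakk> \<Longrightarrow> y \<in> B"
proof -
  define k0 where "k0 = \<lfloor>b / pi\<rfloor>"
  define I where "I k = {L / (2 * pi) * (pi * of_int k - b) - L * \<delta> .. L / (2 * pi) * (pi * of_int k - b) + L * \<delta>}" for k :: int
  define B where "B = (\<Union>k\<in>{k0..k0 + 3}. I k)"
  have "emeasure lborel B \<le> (\<Sum>k\<in>{k0..k0 + 3}. emeasure lborel (I k))"
    unfolding B_def by (rule emeasure_subadditive_finite) (auto simp: I_def)
  also have "\<dots> = (\<Sum>k\<in>{k0..k0 + 3}. ennreal (2 * L * \<delta>))"
    using L \<delta> by (intro sum.cong) (auto simp: I_def)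
  also have "\<dots> = ennreal (\<Sum>k\<in>{k0..k0 + 3}. 2 * L * \<delta>)"
    using L \<delta> by (intro sum_ennreal) auto
  also have "(\<Sum>k\<in>{k0..k0 + 3}. 2 * L * \<delta>) = 8 * L * \<delta>" by simp
  finally have "emeasure lborel B \<le> ennreal (8 * L * \<delta>)" .
  moreover have "B \<in> sets borel" unfolding B_def I_def by auto
  moreover have "y \<in> B" if y: "y \<in> {0..L}" "\<bar>sin (2 * pi / L * y + b)\<bar> < \<delta>" for y
  proof -
    define \<phi> where "\<phi> = 2 * pi / L * y + b"
    define k where "k = round (\<phi> / pi)"
    have near: "\<bar>\<phi> - pi * of_int k\<bar> \<le> 4 * \<delta>"
      unfolding k_def by (rule small_sin_near_multiple) (use y in \<open>simp add: \<phi>_def\<close>)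
    have "\<phi> / pi = 2 * (y / L) + b / pi" by (simp add: \<phi>_def add_divide_distrib)
    moreover have "0 \<le> y / L" "y / L \<le> 1" using y L by auto
    ultimately have "b / pi \<le> \<phi> / pi" "\<phi> / pi \<le> b / pi + 2" by linarith+
    moreover have "\<bar>of_int k - \<phi> / pi\<bar> \<le> 1 / 2" unfolding k_def by (rule of_int_round_abs_le)
    moreover have "of_int k0 \<le> b / pi" "b / pi < of_int k0 + 1" unfolding k0_def by linarith+
    ultimately have "of_int k0 - 1 < (of_int k :: real)" "(of_int k :: real) < of_int k0 + 4" by linarith+
    then have k: "k \<in> {k0..k0 + 3}" by auto
    have "y - L / (2 * pi) * (pi * of_int k - b) = L / (2 * pi) * (\<phi> - pi * of_int k)"
      using L by (simp add: \<phi>_def field_simps)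
    then have "\<bar>y - L / (2 * pi) * (pi * of_int k - b)\<bar> = L / (2 * pi) * \<bar>\<phi> - pi * of_int k\<bar>"
      using L by (simp add: abs_mult)
    also have "\<dots> \<le> L / (2 * pi) * (4 * \<delta>)" using L near by (intro mult_left_mono) auto
    also have "\<dots> = L * \<delta> * (2 / pi)" by simp
    also have "\<dots> \<le> L * \<delta> * 1" using L \<delta> pi_ge_two by (intro mult_left_mono) auto
    finally have "y \<in> I k" unfolding I_def by (auto simp: abs_le_iff)
    with k show ?thesis unfolding B_def by blast
  qed
  ultimately show thesis using that by blast
qed

lemma sgn_diff_cong:
  fixes a b c d :: real
  assumes "a < b \<longleftrightarrow> c < d" "b < a \<longleftrightarrow> d < c"
  shows "sgn (a - b) = sgn (c - d)"
  using assms by (auto simp: sgn_if)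

text \<open>\<open>\<psi>\<close> is a product of two smoothed signs whose sines vanish on the two
  families of solutions of \<open>u y = s ^ m\<close>, where \<open>s ^ m\<close> is the attained
  level that stands for \<open>c\<close>. It has the sign of \<open>u - s ^ m\<close> everywhere,
  and \<open>B\<close> collects the points within order \<open>\<delta>\<close> of either family.
  The constants are fixed before \<open>c\<close> and \<open>\<delta>\<close>.\<close>

lemma smooth_multiplier:
  fixes L :: real and m :: nat
  assumes L: "L > 0" and m: "m \<ge> 1"
  defines "u \<equiv> \<lambda>y. sin (2 * pi * y / L) ^ m"
  obtains C c0 where "C > 0" "c0 > 0"
    "\<And>c \<delta>. \<lbrakk>0 < \<delta>; \<delta> \<le> 1\<rbrakk> \<Longrightarrow> \<exists>\<psi> \<psi>' \<psi>'' B.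
      (\<forall>y. (\<psi> has_real_derivative \<psi>' y) (at y)) \<and> (\<forall>y. (\<psi>' has_real_derivative \<psi>'' y) (at y)) \<and>
      continuous_on UNIV \<psi>'' \<and> \<psi> L = \<psi> 0 \<and> \<psi>' L = \<psi>' 0 \<and>
      (\<forall>y. \<bar>\<psi> y\<bar> \<le> 1) \<and> (\<forall>y. \<bar>\<psi>' y\<bar> \<le> C / \<delta>) \<and> (\<forall>y. \<bar>\<psi>'' y\<bar> \<le> C / \<delta>\<^sup>2) \<and>
      (\<forall>y. 0 \<le> (u y - c) * \<psi> y) \<and> B \<in> sets borel \<and> emeasure lborel B \<le> ennreal (16 * L * \<delta>) \<and>
      (\<forall>y\<in>{0..L} - B. c0 * \<delta> ^ max 2 m \<le> (u y - c) * \<psi> y)"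
proof -
  \<comment> \<open>The product rule gives at most \<open>2 * \<bar>r\<bar> / \<delta>\<close> for
    the first derivative and \<open>8 * \<bar>r\<bar>\<^sup>2 / \<delta>\<^sup>2\<close> for the
    second, with \<open>\<bar>r\<bar> \<le> 2 * pi / L\<close>.\<close>
  define C where "C = 4 * pi / L + 32 * (pi / L)\<^sup>2 + 1"
  define \<tau> where "\<tau> = tanh (1/2 :: real)"
  have \<tau>: "\<tau> > 0" by (simp add: \<tau>_def)
  \<comment> \<open>Off \<open>B\<close> each smoothed sign has modulus at least
    \<open>\<tau>\<close>, and \<open>power_gap\<close> contributes the factor
    \<open>1 / 2\<close>.\<close>
  define c0 where "c0 = \<tau>\<^sup>2 / 2"
  have C1: "4 * pi / L \<le> C" and C2: "32 * (pi / L)\<^sup>2 \<le> C" and Cpos: "C > 0"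
    using L by (auto simp: C_def intro: add_nonneg_pos)
  have main: "\<exists>\<psi> \<psi>' \<psi>'' B.
      (\<forall>y. (\<psi> has_real_derivative \<psi>' y) (at y)) \<and> (\<forall>y. (\<psi>' has_real_derivative \<psi>'' y) (at y)) \<and>
      continuous_on UNIV \<psi>'' \<and> \<psi> L = \<psi> 0 \<and> \<psi>' L = \<psi>' 0 \<and>
      (\<forall>y. \<bar>\<psi> y\<bar> \<le> 1) \<and> (\<forall>y. \<bar>\<psi>' y\<bar> \<le> C / \<delta>) \<and> (\<forall>y. \<bar>\<psi>'' y\<bar> \<le> C / \<delta>\<^sup>2) \<and>
      (\<forall>y. 0 \<le> (u y - c) * \<psi> y) \<and> B \<in> sets borel \<and> emeasure lborel B \<le> ennreal (16 * L * \<delta>) \<and>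
      (\<forall>y\<in>{0..L} - B. c0 * \<delta> ^ max 2 m \<le> (u y - c) * \<psi> y)" if \<delta>: "0 < \<delta>" "\<delta> \<le> 1" for c \<delta> :: real
  proof -
    obtain s where s1: "\<bar>s\<bar> \<le> 1" and s: "c = s ^ m \<or> (s ^ m < c \<and> (\<forall>x. \<bar>x\<bar> \<le> 1 \<longrightarrow> x ^ m \<le> s ^ m)) \<or> (c < s ^ m \<and> (\<forall>x. \<bar>x\<bar> \<le> 1 \<longrightarrow> s ^ m \<le> x ^ m))"
      using power_level[OF m] by blast
    define \<alpha> where "\<alpha> = arcsin s"
    have \<alpha>: "sin \<alpha> = s" using s1 by (simp add: \<alpha>_def abs_le_iff)
    define \<theta> where "\<theta> y = 2 * pi / L * y" for y
    have u: "u y = sin (\<theta> y) ^ m" for y by (simp add: u_def \<theta>_def)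
    \<comment> \<open>For odd \<open>m\<close> the sign of \<open>u - s ^ m\<close> is that of \<open>sin \<theta> - sin \<alpha>\<close>,
      for even \<open>m\<close> that of \<open>(sin \<theta>)\<^sup>2 - (sin \<alpha>)\<^sup>2\<close>; both factor into two sines.\<close>
    define r where "r = (if odd m then pi / L else 2 * pi / L)"
    define b1 where "b1 = (if odd m then - \<alpha> / 2 else - \<alpha>)"
    define b2 where "b2 = (if odd m then \<alpha> / 2 + pi / 2 else \<alpha>)"
    define A where "A y = sin (r * y + b1)" for y
    define A' where "A' y = sin (r * y + b2)" for y
    define D where "D y = u y - s ^ m" for y
    have sq: "(sin (\<theta> y))\<^sup>2 - s\<^sup>2 = sin (\<theta> y + - \<alpha>) * sin (\<theta> y + \<alpha>)" for y
    proof -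
      have "sin (\<theta> y + - \<alpha>) * sin (\<theta> y + \<alpha>) = (sin (\<theta> y))\<^sup>2 * (cos \<alpha>)\<^sup>2 - (cos (\<theta> y))\<^sup>2 * (sin \<alpha>)\<^sup>2"
        by (simp add: sin_add sin_diff power2_eq_square algebra_simps)
      also have "\<dots> = (sin (\<theta> y))\<^sup>2 - (sin \<alpha>)\<^sup>2"
        by (simp add: cos_squared_eq algebra_simps)
      finally show ?thesis by (simp add: \<alpha>)
    qed
    have oddA: "odd m \<Longrightarrow> A y = sin ((\<theta> y - \<alpha>) / 2)" "odd m \<Longrightarrow> A' y = cos ((\<theta> y + \<alpha>) / 2)" for y
    proof -
      assume o: "odd m"
      have *: "r * y + b1 = (\<theta> y - \<alpha>) / 2" "r * y + b2 = (\<theta> y + \<alpha>) / 2 + pi / 2"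
        using o by (simp_all add: r_def b1_def b2_def \<theta>_def field_simps)
      show "A y = sin ((\<theta> y - \<alpha>) / 2)" "A' y = cos ((\<theta> y + \<alpha>) / 2)"
        unfolding A_def A'_def * by (simp_all add: sin_add)
    qed
    have evenA: "even m \<Longrightarrow> A y = sin (\<theta> y + - \<alpha>)" "even m \<Longrightarrow> A' y = sin (\<theta> y + \<alpha>)" for y
      by (simp_all add: A_def A'_def r_def b1_def b2_def \<theta>_def)
    have sgnD: "sgn (D y) = sgn (A y) * sgn (A' y)" for y
    proof (cases "odd m")
      case True
      have "sin (\<theta> y) - s = 2 * A y * A' y"
        unfolding oddA[OF True] \<alpha>[symmetric] by (simp add: sin_diff_sin)
      then have "sgn (sin (\<theta> y) - s) = sgn (A y) * sgn (A' y)" by (simp add: sgn_mult)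
      moreover have "sgn (D y) = sgn (sin (\<theta> y) - s)"
      proof -
        have "s ^ m < sin (\<theta> y) ^ m \<longleftrightarrow> s < sin (\<theta> y)" "sin (\<theta> y) ^ m < s ^ m \<longleftrightarrow> sin (\<theta> y) < s"
          using real_root_less_iff[of m "s ^ m" "sin (\<theta> y) ^ m"]
            real_root_less_iff[of m "sin (\<theta> y) ^ m" "s ^ m"] m
          by (simp_all add: odd_real_root_power_cancel[OF True])
        then show ?thesis unfolding D_def u by (intro sgn_diff_cong) auto
      qed
      ultimately show ?thesis by simp
    next
      case False
      then have m2: "even m" by simp
      have "sgn ((sin (\<theta> y))\<^sup>2 - s\<^sup>2) = sgn (A y) * sgn (A' y)"
        unfolding sq evenA[OF m2] by (simp add: sgn_mult)
      moreover have "sgn (D y) = sgn ((sin (\<theta> y))\<^sup>2 - s\<^sup>2)"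
      proof -
        obtain n where n: "m = 2 * n" "n > 0" using m2 m by (auto elim!: evenE)
        have lt: "a ^ m < b ^ m \<longleftrightarrow> a\<^sup>2 < b\<^sup>2" for a b :: real
          using n(2) power_mono_iff[of "b\<^sup>2" "a\<^sup>2" n]
          by (simp only: n(1) power_mult linorder_not_le[symmetric]) simp
        show ?thesis unfolding D_def u by (intro sgn_diff_cong lt)
      qed
      ultimately show ?thesis by simp
    qed
    define S1 where "S1 = smooth_sign r b1 \<delta>"
    define S2 where "S2 = smooth_sign r b2 \<delta>"
    define S1' where "S1' = smooth_sign' r b1 \<delta>"
    define S2' where "S2' = smooth_sign' r b2 \<delta>"
    define S1'' where "S1'' = smooth_sign'' r b1 \<delta>"
    define S2'' where "S2'' = smooth_sign'' r b2 \<delta>"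
    note S_defs = S1_def S2_def S1'_def S2'_def S1''_def S2''_def
    define \<psi> where "\<psi> y = S1 y * S2 y" for y
    define \<psi>' where "\<psi>' y = S1' y * S2 y + S1 y * S2' y" for y
    define \<psi>'' where "\<psi>'' y = S1'' y * S2 y + 2 * (S1' y * S2' y) + S1 y * S2'' y" for y
    have d1: "(\<psi> has_real_derivative \<psi>' y) (at y)" for y
      unfolding \<psi>_def[abs_def] \<psi>'_def S_defs
      by (auto intro!: derivative_eq_intros smooth_sign_deriv)
    have d2: "(\<psi>' has_real_derivative \<psi>'' y) (at y)" for y
      unfolding \<psi>'_def[abs_def] \<psi>''_def S_defs
      by (auto intro!: derivative_eq_intros smooth_sign_deriv smooth_sign'_deriv)
    have cont: "continuous_on UNIV \<psi>''"
      unfolding \<psi>''_def[abs_def] S_defs by (intro continuous_intros smooth_sign_continuous)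
    have per: "\<psi> L = \<psi> 0" "\<psi>' L = \<psi>' 0"
    proof -
      \<comment> \<open>For odd \<open>m\<close> the frequency is halved and each factor changes
        sign over \<open>[0, L]\<close>; the two signs cancel in the product and in its
        derivative.\<close>
      define \<sigma> :: real where "\<sigma> = (if odd m then -1 else 1)"
      have sc: "sin (r * L + b) = \<sigma> * sin (r * 0 + b)" "cos (r * L + b) = \<sigma> * cos (r * 0 + b)" for b
        using L by (auto simp: r_def \<sigma>_def sin_add cos_add)
      have t: "smooth_sign r b \<delta> L = \<sigma> * smooth_sign r b \<delta> 0" for b
        unfolding smooth_sign_def sc by (simp add: \<sigma>_def)
      have t': "smooth_sign' r b \<delta> L = \<sigma> * smooth_sign' r b \<delta> 0" for b
        unfolding smooth_sign'_def sc t by (simp add: \<sigma>_def)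
      show "\<psi> L = \<psi> 0" "\<psi>' L = \<psi>' 0"
        unfolding \<psi>_def \<psi>'_def S_defs t t' by (simp_all add: \<sigma>_def)
    qed
    have b0: "\<bar>S1 y\<bar> \<le> 1" "\<bar>S2 y\<bar> \<le> 1" for y by (simp_all add: S_defs smooth_sign_abs_le)
    have r: "\<bar>r\<bar> \<le> 2 * pi / L" "0 \<le> \<bar>r\<bar>" using L by (auto simp: r_def divide_right_mono)
    have b1': "\<bar>S1' y\<bar> \<le> \<bar>r\<bar> / \<delta>" "\<bar>S2' y\<bar> \<le> \<bar>r\<bar> / \<delta>" for y
      using smooth_sign'_abs_le[OF \<delta>(1)] by (simp_all add: S_defs)
    have b2': "\<bar>S1'' y\<bar> \<le> 3 * r\<^sup>2 / \<delta>\<^sup>2" "\<bar>S2'' y\<bar> \<le> 3 * r\<^sup>2 / \<delta>\<^sup>2" for y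
      using smooth_sign''_abs_le[OF \<delta>] by (simp_all add: S_defs)
    have c0': "\<bar>\<psi> y\<bar> \<le> 1" for y
      unfolding \<psi>_def abs_mult using b0[of y] by (simp add: mult_le_one)
    have c1': "\<bar>\<psi>' y\<bar> \<le> C / \<delta>" for y
    proof -
      have "\<bar>\<psi>' y\<bar> \<le> \<bar>S1' y\<bar> * \<bar>S2 y\<bar> + \<bar>S1 y\<bar> * \<bar>S2' y\<bar>"
        unfolding \<psi>'_def abs_mult[symmetric] by (rule abs_triangle_ineq)
      also have "\<dots> \<le> \<bar>r\<bar> / \<delta> * 1 + 1 * (\<bar>r\<bar> / \<delta>)"
        using b0[of y] b1'[of y] \<delta> by (intro add_mono mult_mono) auto
      also have "\<dots> = (2 * \<bar>r\<bar>) / \<delta>" by simp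
      also have "\<dots> \<le> (2 * (2 * pi / L)) / \<delta>" using r \<delta> by (intro divide_right_mono mult_left_mono) auto
      also have "2 * (2 * pi / L) = 4 * pi / L" by simp
      also have "(4 * pi / L) / \<delta> \<le> C / \<delta>" using C1 \<delta> by (intro divide_right_mono) auto
      finally show ?thesis .
    qed
    have c2': "\<bar>\<psi>'' y\<bar> \<le> C / \<delta>\<^sup>2" for y
    proof -
      have "\<bar>\<psi>'' y\<bar> \<le> \<bar>S1'' y\<bar> * \<bar>S2 y\<bar> + 2 * (\<bar>S1' y\<bar> * \<bar>S2' y\<bar>) + \<bar>S1 y\<bar> * \<bar>S2'' y\<bar>"
        unfolding \<psi>''_def abs_mult[symmetric] by linarith
      also have "\<dots> \<le> 3 * r\<^sup>2 / \<delta>\<^sup>2 * 1 + 2 * ((\<bar>r\<bar> / \<delta>) * (\<bar>r\<bar> / \<delta>)) + 1 * (3 * r\<^sup>2 / \<delta>\<^sup>2)"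
      proof (intro add_mono mult_left_mono)
        show "\<bar>S1'' y\<bar> * \<bar>S2 y\<bar> \<le> 3 * r\<^sup>2 / \<delta>\<^sup>2 * 1" by (intro mult_mono b0 b2') auto
        show "\<bar>S1 y\<bar> * \<bar>S2'' y\<bar> \<le> 1 * (3 * r\<^sup>2 / \<delta>\<^sup>2)" by (intro mult_mono b0 b2') auto
        show "\<bar>S1' y\<bar> * \<bar>S2' y\<bar> \<le> (\<bar>r\<bar> / \<delta>) * (\<bar>r\<bar> / \<delta>)"
          by (intro mult_mono b1') (use \<delta> in auto)
      qed simp
      also have "\<dots> = 8 * \<bar>r\<bar>\<^sup>2 / \<delta>\<^sup>2" by (simp add: power2_eq_square)
      also have "\<dots> \<le> 8 * (2 * pi / L)\<^sup>2 / \<delta>\<^sup>2"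
        using r \<delta> by (intro divide_right_mono mult_left_mono power_mono) auto
      also have "8 * (2 * pi / L)\<^sup>2 = 32 * (pi / L)\<^sup>2" by (simp add: power2_eq_square)
      also have "\<dots> / \<delta>\<^sup>2 \<le> C / \<delta>\<^sup>2" using C2 by (intro divide_right_mono) auto
      finally show ?thesis .
    qed
    have sgn\<psi>: "sgn (\<psi> y) = sgn (D y)" for y
      unfolding \<psi>_def sgnD S_defs sgn_mult smooth_sign_sgn[OF \<delta>(1)] A_def A'_def ..
    have D\<psi>: "D y * \<psi> y = \<bar>D y\<bar> * \<bar>\<psi> y\<bar>" for y
      using sgn\<psi>[of y] by (auto simp: sgn_if abs_if split: if_splits)
    \<comment> \<open>If \<open>c\<close> is not attained, moving it to the nearest attained level
      can only decrease the product, because \<open>D\<close> and with it \<open>\<psi>\<close> then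
      has a constant sign.\<close>
    have cmp: "D y * \<psi> y \<le> (u y - c) * \<psi> y" for y
    proof -
      have "0 \<le> (s ^ m - c) * \<psi> y"
        using s
      proof (elim disjE conjE)
        assume *: "s ^ m < c" "\<forall>x. \<bar>x\<bar> \<le> 1 \<longrightarrow> x ^ m \<le> s ^ m"
        then have "D y \<le> 0" by (simp add: D_def u)
        then have "\<psi> y \<le> 0" using sgn\<psi>[of y] by (auto simp: sgn_if split: if_splits)
        then show ?thesis using *(1) by (intro mult_nonpos_nonpos) auto
      next
        assume *: "c < s ^ m" "\<forall>x. \<bar>x\<bar> \<le> 1 \<longrightarrow> s ^ m \<le> x ^ m"
        then have "D y \<ge> 0" by (simp add: D_def u)
        then have "\<psi> y \<ge> 0" using sgn\<psi>[of y] by (auto simp: sgn_if split: if_splits)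
        then show ?thesis using *(1) by simp
      qed simp
      then show ?thesis by (simp add: D_def left_diff_distrib)
    qed
    have pos: "0 \<le> (u y - c) * \<psi> y" for y
      using cmp[of y] D\<psi>[of y] by (metis abs_ge_zero mult_nonneg_nonneg order_trans)
    obtain B1 where B1: "B1 \<in> sets borel" "emeasure lborel B1 \<le> ennreal (8 * L * \<delta>)"
        "\<And>y. \<lbrakk>y \<in> {0..L}; \<bar>sin (2 * pi / L * y + - \<alpha>)\<bar> < \<delta>\<rbrakk> \<Longrightarrow> y \<in> B1"
      using small_sin_cover[OF L \<delta>(1)] by blast
    obtain B2 where B2: "B2 \<in> sets borel" "emeasure lborel B2 \<le> ennreal (8 * L * \<delta>)"
        "\<And>y. \<lbrakk>y \<in> {0..L}; \<bar>sin (2 * pi / L * y + \<alpha>)\<bar> < \<delta>\<rbrakk> \<Longrightarrow> y \<in> B2"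
      using small_sin_cover[OF L \<delta>(1)] by blast
    define B where "B = B1 \<union> B2"
    have "emeasure lborel B \<le> emeasure lborel B1 + emeasure lborel B2"
      unfolding B_def using B1(1) B2(1) by (intro emeasure_subadditive) auto
    also have "\<dots> \<le> ennreal (8 * L * \<delta>) + ennreal (8 * L * \<delta>)" by (intro add_mono B1 B2)
    also have "\<dots> = ennreal (16 * L * \<delta>)" using L \<delta> by (subst ennreal_plus[symmetric]) auto
    finally have mB: "emeasure lborel B \<le> ennreal (16 * L * \<delta>)" .
    have good: "c0 * \<delta> ^ max 2 m \<le> (u y - c) * \<psi> y" if y: "y \<in> {0..L} - B" for y
    proof -
      have g: "\<delta> \<le> \<bar>sin (\<theta> y + - \<alpha>)\<bar>" "\<delta> \<le> \<bar>sin (\<theta> y + \<alpha>)\<bar>"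
        using y B1(3)[of y] B2(3)[of y] unfolding B_def \<theta>_def
        by (meson DiffE UnI1 UnI2 linorder_not_less)+
      have "\<delta> * \<delta> \<le> \<bar>sin (\<theta> y + - \<alpha>)\<bar> * \<bar>sin (\<theta> y + \<alpha>)\<bar>" using g \<delta> by (intro mult_mono) auto
      then have "\<delta>\<^sup>2 \<le> \<bar>(sin (\<theta> y))\<^sup>2 - s\<^sup>2\<bar>" unfolding sq abs_mult by (simp add: power2_eq_square)
      then have Dge: "\<delta> ^ max 2 m / 2 \<le> \<bar>D y\<bar>"
        unfolding D_def u by (intro power_gap s1 \<delta> m) auto
      \<comment> \<open>For odd \<open>m\<close> the sines use half angles; the double angle formula
        turns \<open>\<delta>\<close> into \<open>\<delta> / 2\<close>, which explains the threshold
        in \<open>smooth_sign_ge\<close>.\<close>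
      have "\<delta> / 2 \<le> \<bar>A y\<bar> \<and> \<delta> / 2 \<le> \<bar>A' y\<bar>"
      proof (cases "odd m")
        case True
        have "sin (\<theta> y + - \<alpha>) = 2 * sin ((\<theta> y - \<alpha>) / 2) * cos ((\<theta> y - \<alpha>) / 2)"
          "sin (\<theta> y + \<alpha>) = 2 * sin ((\<theta> y + \<alpha>) / 2) * cos ((\<theta> y + \<alpha>) / 2)"
        proof -
          have h: "2 * ((\<theta> y - \<alpha>) / 2) = \<theta> y + - \<alpha>" "2 * ((\<theta> y + \<alpha>) / 2) = \<theta> y + \<alpha>" by simp_all
          show "sin (\<theta> y + - \<alpha>) = 2 * sin ((\<theta> y - \<alpha>) / 2) * cos ((\<theta> y - \<alpha>) / 2)"
            "sin (\<theta> y + \<alpha>) = 2 * sin ((\<theta> y + \<alpha>) / 2) * cos ((\<theta> y + \<alpha>) / 2)"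
            using sin_double[of "(\<theta> y - \<alpha>) / 2"] sin_double[of "(\<theta> y + \<alpha>) / 2"]
            unfolding h by blast+
        qed
        then have "\<bar>sin (\<theta> y + - \<alpha>)\<bar> = 2 * \<bar>A y\<bar> * \<bar>cos ((\<theta> y - \<alpha>) / 2)\<bar>"
          "\<bar>sin (\<theta> y + \<alpha>)\<bar> = 2 * \<bar>A' y\<bar> * \<bar>sin ((\<theta> y + \<alpha>) / 2)\<bar>"
          by (simp_all add: oddA[OF True] abs_mult)
        moreover have "2 * \<bar>A y\<bar> * \<bar>cos ((\<theta> y - \<alpha>) / 2)\<bar> \<le> 2 * \<bar>A y\<bar> * 1"
          "2 * \<bar>A' y\<bar> * \<bar>sin ((\<theta> y + \<alpha>) / 2)\<bar> \<le> 2 * \<bar>A' y\<bar> * 1"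
          by (intro mult_left_mono; simp)+
        ultimately show ?thesis using g by simp
      next
        case False
        then show ?thesis using g \<delta> by (simp add: evenA)
      qed
      then have "\<tau> \<le> \<bar>S1 y\<bar>" "\<tau> \<le> \<bar>S2 y\<bar>"
        unfolding S_defs \<tau>_def A_def A'_def using smooth_sign_ge[OF \<delta>(1)] by auto
      then have "\<tau> * \<tau> \<le> \<bar>\<psi> y\<bar>" unfolding \<psi>_def abs_mult using \<tau> by (intro mult_mono) auto
      then have "(\<delta> ^ max 2 m / 2) * (\<tau> * \<tau>) \<le> \<bar>D y\<bar> * \<bar>\<psi> y\<bar>" using Dge \<delta> \<tau> by (intro mult_mono) auto
      then show ?thesis using cmp[of y] unfolding D\<psi> c0_def by (simp add: power2_eq_square mult.commute)
    qed
    show ?thesis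
      using d1 d2 cont per c0' c1' c2' pos mB good B1(1) B2(1)
      by (intro exI[of _ \<psi>] exI[of _ \<psi>'] exI[of _ \<psi>''] exI[of _ B]) (auto simp: B_def)
  qed
  have "c0 > 0" using \<tau> by (simp add: c0_def)
  from that[OF Cpos this main] show thesis .
qed

section \<open>The resolvent estimate\<close>

text \<open>Based on the gauge integral over an interval, to which the fundamental theorem of
  calculus applies directly; \<open>interval_norm_eq_norm2\<close> transfers Cauchy--Schwarz from
  the Lebesgue side.\<close>

definition interval_norm :: "real \<Rightarrow> (real \<Rightarrow> complex) \<Rightarrow> real" where
  "interval_norm L f = sqrt (integral {0..L} (\<lambda>y. (cmod (f y))\<^sup>2))"

lemma integral_cmod_square_nonneg: "0 \<le> integral {0..L} (\<lambda>y. (cmod (f y))\<^sup>2)"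
proof (cases "(\<lambda>y. (cmod (f y))\<^sup>2) integrable_on {0..L}")
  case True then show ?thesis by (rule integral_nonneg) simp
qed (simp add: not_integrable_integral)

lemma interval_norm_nonneg [simp]: "0 \<le> interval_norm L f"
  by (simp add: interval_norm_def integral_cmod_square_nonneg)

lemma integral_restrict_interval:
  fixes f :: "real \<Rightarrow> 'b::euclidean_space"
  assumes "continuous_on {0..L} f"
  shows "integrable (restrict_space lborel {0..L}) f"
    "integral\<^sup>L (restrict_space lborel {0..L}) f = integral {0..L} f"
  using set_integral_continuous[OF assms]
  by (simp_all add: integrable_restrict_space integral_restrict_space set_lebesgue_integral_def set_integrable_def)

lemma interval_norm_eq_norm2:
  assumes "continuous_on {0..L} f"
  shows "interval_norm L f = norm2 (restrict_space lborel {0..L}) f"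
    "f \<in> square_integrable (restrict_space lborel {0..L})"
proof -
  have c: "continuous_on {0..L} (\<lambda>y. (cmod (f y))\<^sup>2)" by (intro continuous_intros assms)
  show "interval_norm L f = norm2 (restrict_space lborel {0..L}) f"
    unfolding interval_norm_def norm2_def integral_restrict_interval(2)[OF c] ..
  show "f \<in> square_integrable (restrict_space lborel {0..L})"
    using integral_restrict_interval(1)[OF assms] integral_restrict_interval(1)[OF c]
    by (intro square_integrableI) auto
qed

lemma interval_Cauchy_Schwarz:
  assumes "continuous_on {0..L} f" "continuous_on {0..L} g"
  shows "cmod (integral {0..L} (\<lambda>y. f y * g y)) \<le> interval_norm L f * interval_norm L g"
    and "integral {0..L} (\<lambda>y. cmod (f y) * cmod (g y)) \<le> interval_norm L f * interval_norm L g"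
proof -
  have c: "continuous_on {0..L} (\<lambda>y. f y * g y)" "continuous_on {0..L} (\<lambda>y. cmod (f y) * cmod (g y))"
    by (intro continuous_intros assms)+
  show "cmod (integral {0..L} (\<lambda>y. f y * g y)) \<le> interval_norm L f * interval_norm L g"
    using norm2_Cauchy_Schwarz[OF interval_norm_eq_norm2(2)[OF assms(1)] interval_norm_eq_norm2(2)[OF assms(2)]]
    by (simp add: interval_norm_eq_norm2 assms integral_restrict_interval[OF c(1)])
  show "integral {0..L} (\<lambda>y. cmod (f y) * cmod (g y)) \<le> interval_norm L f * interval_norm L g"
    using norm2_Cauchy_Schwarz_abs[OF interval_norm_eq_norm2(2)[OF assms(1)] interval_norm_eq_norm2(2)[OF assms(2)]]
    by (simp add: interval_norm_eq_norm2 assms integral_restrict_interval[OF c(2)])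
qed

lemma interval_norm_power2: "(interval_norm L f)\<^sup>2 = integral {0..L} (\<lambda>y. (cmod (f y))\<^sup>2)"
  by (simp add: interval_norm_def integral_cmod_square_nonneg)

text \<open>The increment of \<open>\<bar>W\<bar>^2\<close> between two points is an integral of
  \<open>2 * Re (W * cnj W')\<close>, controlled by Cauchy--Schwarz; averaging over the second point
  gives the bound.\<close>

lemma sup_le_interval_norm:
  assumes L: "L > 0"
    and W: "\<And>y. (W has_vector_derivative W' y) (at y)" and c': "continuous_on UNIV W'"
    and y: "y \<in> {0..L}"
  shows "(cmod (W y))\<^sup>2 \<le> (interval_norm L W)\<^sup>2 / L + 2 * interval_norm L W * interval_norm L W'"
proof -
  have c: "continuous_on A W" for A
    by (rule continuous_on_vector_derivative[OF has_vector_derivative_at_within[OF W]])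
  have c'A: "continuous_on A W'" for A using c' continuous_on_subset by blast
  define g where "g t = 2 * (Re (W t) * Re (W' t) + Im (W t) * Im (W' t))" for t
  have dg: "((\<lambda>t. (cmod (W t))\<^sup>2) has_vector_derivative g t) (at t within A)" for t A
  proof -
    note W' = has_vector_derivative_at_within[OF W[of t], of A]
    have "((\<lambda>t. Re (W t) * Re (W t) + Im (W t) * Im (W t)) has_real_derivative
        (Re (W' t) * Re (W t) + Re (W' t) * Re (W t)) + (Im (W' t) * Im (W t) + Im (W' t) * Im (W t))) (at t within A)"
      by (intro DERIV_add DERIV_mult has_field_derivative_Re[OF W'] has_field_derivative_Im[OF W'])
    then have "((\<lambda>t. (Re (W t))\<^sup>2 + (Im (W t))\<^sup>2) has_real_derivative g t) (at t within A)"
      by (simp add: g_def power2_eq_square algebra_simps)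
    then show ?thesis by (simp add: cmod_power2 has_real_derivative_iff_has_vector_derivative)
  qed
  have gle: "\<bar>g t\<bar> \<le> 2 * (cmod (W t) * cmod (W' t))" for t
  proof -
    have "g t = 2 * Re (W t * cnj (W' t))" by (simp add: g_def)
    then show ?thesis using abs_Re_le_cmod[of "W t * cnj (W' t)"] by (simp add: norm_mult)
  qed
  define K where "K = 2 * interval_norm L W * interval_norm L W'"
  have K: "integral S (\<lambda>t. 2 * (cmod (W t) * cmod (W' t))) \<le> K" if S: "S = {a..b}" "S \<subseteq> {0..L}" for S a b
  proof -
    have "integral S (\<lambda>t. 2 * (cmod (W t) * cmod (W' t))) \<le> integral {0..L} (\<lambda>t. 2 * (cmod (W t) * cmod (W' t)))"
      unfolding S(1) using S
      by (intro integral_subset_le integrable_continuous_interval continuous_intros c c'A) auto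
    also have "\<dots> \<le> 2 * (interval_norm L W * interval_norm L W')"
      using interval_Cauchy_Schwarz(2)[OF c c'A, of L] by simp
    finally show ?thesis by (simp add: K_def)
  qed
  have diff: "(cmod (W y))\<^sup>2 \<le> (cmod (W z))\<^sup>2 + K" if z: "z \<in> {0..L}" for z
  proof -
    define a b where "a = min y z" and "b = max y z"
    have ab: "a \<le> b" "{a..b} \<subseteq> {0..L}" using y z by (auto simp: a_def b_def)
    have gi: "(g has_integral ((cmod (W b))\<^sup>2 - (cmod (W a))\<^sup>2)) {a..b}"
      by (rule fundamental_theorem_of_calculus[OF ab(1) dg])
    have "(\<lambda>t. 2 * (cmod (W t) * cmod (W' t))) integrable_on {a..b}"
      by (intro integrable_continuous_interval continuous_intros c c'A)
    from integral_norm_bound_integral[OF has_integral_integrable[OF gi] this]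
    have "\<bar>(cmod (W b))\<^sup>2 - (cmod (W a))\<^sup>2\<bar> \<le> integral {a..b} (\<lambda>t. 2 * (cmod (W t) * cmod (W' t)))"
      using gle by (simp add: integral_unique[OF gi])
    also have "\<dots> \<le> K" by (rule K[OF refl ab(2)])
    finally show ?thesis by (auto simp: a_def b_def min_def max_def split: if_splits)
  qed
  have "integral {0..L} (\<lambda>z. (cmod (W y))\<^sup>2) \<le> integral {0..L} (\<lambda>z. (cmod (W z))\<^sup>2 + K)"
    by (intro integral_le integrable_continuous_interval continuous_intros c) (use diff in auto)
  also have "\<dots> = (interval_norm L W)\<^sup>2 + L * K"
    using L by (subst integral_add)
      (auto intro!: integrable_continuous_interval continuous_intros c simp: interval_norm_power2)
  finally have "L * (cmod (W y))\<^sup>2 \<le> (interval_norm L W)\<^sup>2 + L * K" using L by simp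
  then show ?thesis using L by (simp add: K_def field_simps)
qed

text \<open>The difference of the two integrands is the derivative of
  \<open>f' * g - f * g'\<close>, which takes equal values at both ends.\<close>

lemma integration_by_parts_periodic2:
  fixes f g :: "real \<Rightarrow> complex"
  assumes L: "L \<ge> 0"
    and f: "\<And>y. (f has_vector_derivative f' y) (at y)" "\<And>y. (f' has_vector_derivative f'' y) (at y)"
    and g: "\<And>y. (g has_vector_derivative g' y) (at y)" "\<And>y. (g' has_vector_derivative g'' y) (at y)"
    and cf: "continuous_on UNIV f''" and cg: "continuous_on UNIV g''"
    and per: "f L = f 0" "f' L = f' 0" "g L = g 0" "g' L = g' 0"
  shows "integral {0..L} (\<lambda>y. f'' y * g y) = integral {0..L} (\<lambda>y. f y * g'' y)"
proof -
  have c: "continuous_on A f" "continuous_on A g" "continuous_on A f''" "continuous_on A g''" for A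
    using continuous_on_vector_derivative[OF has_vector_derivative_at_within[OF f(1)]]
      continuous_on_vector_derivative[OF has_vector_derivative_at_within[OF g(1)]] cf cg
      continuous_on_subset by blast+
  have "((\<lambda>y. f' y * g y - f y * g' y) has_vector_derivative (f'' y * g y - f y * g'' y)) (at y within {0..L})" for y
    using f[of y, THEN has_vector_derivative_at_within] g[of y, THEN has_vector_derivative_at_within]
    by (auto intro!: derivative_eq_intros)
  from fundamental_theorem_of_calculus[OF L this]
  have "((\<lambda>y. f'' y * g y - f y * g'' y) has_integral 0) {0..L}" by (simp add: per)
  then have "integral {0..L} (\<lambda>y. f'' y * g y - f y * g'' y) = 0" by (rule integral_unique)
  then show ?thesis
    by (subst (asm) integral_diff)
      (auto intro!: integrable_continuous_interval continuous_intros c)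
qed

text \<open>Isolates the real-number part of the resolvent estimate, so that
  \<open>\<epsilon>\<close> is visibly chosen before all other quantities. There \<open>n\<close>,
  \<open>D\<close>, \<open>f\<close>, \<open>w1\<close> are the norms of \<open>w\<close>,
  \<open>(\<kappa>^2 - \<partial>^2) w\<close>, the right-hand side and \<open>w'\<close>, and
  \<open>I\<close> is the integral of \<open>(u - c) * \<psi> * \<bar>w\<bar>^2\<close>; moreover
  \<open>\<nu> = \<mu> ^ (p + 4)\<close> and \<open>\<delta> = \<mu> / 64\<close>. If
  \<open>f\<close> were too small, both terms on the right of the last hypothesis would be small
  multiples of its left side.\<close>

lemma resolvent_arith:
  fixes C c0 L \<kappa>0 :: real and p :: nat
  assumes pos: "C > 0" "c0 > 0" "L > 0" "\<kappa>0 > 0"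
  obtains \<epsilon> where "\<epsilon> > 0"
    "\<And>\<mu> n D f w1 I. \<lbrakk>0 < \<mu>; \<mu> < 1; 0 \<le> n; 0 \<le> D; 0 \<le> f; 0 \<le> w1;
       \<mu> ^ (p + 4) * D\<^sup>2 \<le> f * n; w1\<^sup>2 \<le> D * n;
       \<kappa>0 * I \<le> f * n + \<mu> ^ (p + 4) * D * (2 * (C / (\<mu> / 64)) * w1 + C / (\<mu> / 64)\<^sup>2 * n);
       c0 * (\<mu> / 64) ^ p * n\<^sup>2 \<le> I + c0 * (\<mu> / 64) ^ p * (16 * L * (\<mu> / 64)) * (n\<^sup>2 / L + 2 * n * w1)\<rbrakk>
      \<Longrightarrow> \<epsilon> * \<mu> ^ p * n \<le> f"
proof -
  \<comment> \<open>\<open>128\<close> and \<open>4096\<close> are \<open>2 * 64\<close> and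
    \<open>64 * 64\<close> from the derivative bounds at scale \<open>\<mu> / 64\<close>;
    \<open>64 ^ p\<close> converts \<open>\<mu> ^ p\<close> into the power of
    \<open>\<mu> / 64\<close>.\<close>
  define K where "K = (1 + 128 * C + 4096 * C) * 64 ^ p / (c0 * \<kappa>0)"
  have K: "K > 0" using pos by (auto simp: K_def intro!: divide_pos_pos mult_pos_pos add_pos_pos)
  define e where "e = min 1 (min (1 / (2 * L)) (1 / (4 * K)))"
  have e: "e > 0" "e \<le> 1" "e * L \<le> 1 / 2" "e * K \<le> 1 / 4"
    using pos K by (auto simp: e_def min_def field_simps)
  have main: "e ^ 4 * \<mu> ^ p * n \<le> f" if \<mu>: "0 < \<mu>" "\<mu> < 1" and nn: "0 \<le> n" "0 \<le> D" "0 \<le> f" "0 \<le> w1"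
    and h1: "\<mu> ^ (p + 4) * D\<^sup>2 \<le> f * n" and h2: "w1\<^sup>2 \<le> D * n"
    and h3: "\<kappa>0 * I \<le> f * n + \<mu> ^ (p + 4) * D * (2 * (C / (\<mu> / 64)) * w1 + C / (\<mu> / 64)\<^sup>2 * n)"
    and h4: "c0 * (\<mu> / 64) ^ p * n\<^sup>2 \<le> I + c0 * (\<mu> / 64) ^ p * (16 * L * (\<mu> / 64)) * (n\<^sup>2 / L + 2 * n * w1)"
    for \<mu> n D f w1 I
  proof (rule ccontr)
    assume "\<not> e ^ 4 * \<mu> ^ p * n \<le> f"
    \<comment> \<open>Two interpolations follow, each taking a square root: \<open>e ^ 4\<close>
      becomes \<open>e\<^sup>2\<close> in the bound for \<open>\<mu>\<^sup>2 * D\<close>, and then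
      \<open>e\<close> in the bound for \<open>\<mu> * w1\<close>.\<close>
    then have f: "f < e ^ 4 * \<mu> ^ p * n" by simp
    with nn have n: "n > 0" by (cases "n = 0") auto
    have "\<mu> ^ p * (\<mu> ^ 4 * D\<^sup>2) \<le> \<mu> ^ p * (e ^ 4 * n\<^sup>2)"
    proof -
      have "\<mu> ^ (p + 4) * D\<^sup>2 \<le> e ^ 4 * \<mu> ^ p * n * n"
        using h1 f n by (meson less_imp_le mult_right_mono nn(1) order_trans)
      then show ?thesis by (simp add: power_add power2_eq_square mult_ac)
    qed
    then have "(\<mu>\<^sup>2 * D)\<^sup>2 \<le> (e\<^sup>2 * n)\<^sup>2" using \<mu> by (simp add: power_mult_distrib)
    then have D: "\<mu>\<^sup>2 * D \<le> e\<^sup>2 * n" using n e by (intro power2_le_imp_le[of "\<mu>\<^sup>2 * D"]) auto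
    have "(\<mu> * w1)\<^sup>2 \<le> \<mu>\<^sup>2 * D * n" using h2 \<mu> by (simp add: power_mult_distrib mult_left_mono mult.assoc)
    also have "\<dots> \<le> e\<^sup>2 * n * n" using D nn(1) by (rule mult_right_mono)
    also have "\<dots> = (e * n)\<^sup>2" by (simp add: power2_eq_square)
    finally have w1: "\<mu> * w1 \<le> e * n" using n e by (intro power2_le_imp_le[of "\<mu> * w1"]) auto
    have "\<mu> ^ (p + 4) * D * (2 * (C / (\<mu> / 64)) * w1 + C / (\<mu> / 64)\<^sup>2 * n)
        = \<mu> ^ p * ((\<mu>\<^sup>2 * D) * (128 * C * (\<mu> * w1) + 4096 * C * n))"
      using \<mu> by (simp add: power_add power2_eq_square field_simps power4_eq_xxxx)
    also have "\<dots> \<le> \<mu> ^ p * ((e\<^sup>2 * n) * (128 * C * (1 * n) + 4096 * C * n))"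
    proof -
      have "\<mu> * w1 \<le> 1 * n" using w1 e n by (meson mult_right_mono nn(1) order_trans)
      then have "128 * C * (\<mu> * w1) + 4096 * C * n \<le> 128 * C * (1 * n) + 4096 * C * n"
        using pos by simp
      moreover have "0 \<le> 128 * C * (\<mu> * w1) + 4096 * C * n" using pos \<mu> nn by simp
      moreover have "0 \<le> e\<^sup>2 * n" using n by simp
      ultimately have "(\<mu>\<^sup>2 * D) * (128 * C * (\<mu> * w1) + 4096 * C * n) \<le> (e\<^sup>2 * n) * (128 * C * (1 * n) + 4096 * C * n)"
        by (intro mult_mono[OF D])
      then show ?thesis using \<mu> by (intro mult_left_mono) auto
    qed
    also have "\<dots> = \<mu> ^ p * n\<^sup>2 * (e\<^sup>2 * (128 * C + 4096 * C))" by (simp add: power2_eq_square algebra_simps)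
    finally have t2: "\<mu> ^ (p + 4) * D * (2 * (C / (\<mu> / 64)) * w1 + C / (\<mu> / 64)\<^sup>2 * n)
      \<le> \<mu> ^ p * n\<^sup>2 * (e\<^sup>2 * (128 * C + 4096 * C))" .
    have "f * n \<le> e ^ 4 * \<mu> ^ p * n * n" using f nn by (intro mult_right_mono) auto
    also have "\<dots> = \<mu> ^ p * n\<^sup>2 * e ^ 4" by (simp add: power2_eq_square)
    also have "\<dots> \<le> \<mu> ^ p * n\<^sup>2 * e\<^sup>2"
      using \<mu> e by (intro mult_left_mono power_decreasing) auto
    finally have "\<kappa>0 * I \<le> \<mu> ^ p * n\<^sup>2 * (e\<^sup>2 * (1 + 128 * C + 4096 * C))"
      using h3 t2 by (simp add: algebra_simps)
    also have "\<dots> \<le> \<mu> ^ p * n\<^sup>2 * (e * (1 + 128 * C + 4096 * C))"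
      using \<mu> e pos by (intro mult_left_mono mult_right_mono) (auto simp: power2_eq_square mult_le_cancel_left1)
    also have "\<dots> = \<kappa>0 * (c0 * (\<mu> / 64) ^ p * n\<^sup>2 * (e * K))"
      using pos by (simp add: K_def power_divide)
    also have "\<dots> \<le> \<kappa>0 * (c0 * (\<mu> / 64) ^ p * n\<^sup>2 * (1 / 4))"
      using pos \<mu> e by (intro mult_left_mono) auto
    finally have I: "I \<le> c0 * (\<mu> / 64) ^ p * n\<^sup>2 * (1 / 4)" using pos by simp
    \<comment> \<open>The divisor 64 makes the exceptional set contribute at most
      \<open>n\<^sup>2 / 4\<close> through \<open>n\<^sup>2 / L\<close>; the term with
      \<open>w1\<close> adds another quarter because \<open>e * L \<le> 1 / 2\<close>. With the
      quarter from \<open>I\<close> the total is three quarters of the left side.\<close>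
    have "16 * L * (\<mu> / 64) * (n\<^sup>2 / L + 2 * n * w1) = \<mu> * n\<^sup>2 / 4 + L / 2 * n * (\<mu> * w1)"
      using pos by (simp add: field_simps)
    also have "\<dots> \<le> 1 * n\<^sup>2 / 4 + L / 2 * n * (e * n)"
      using \<mu> w1 n pos by (intro add_mono divide_right_mono mult_right_mono mult_left_mono) auto
    also have "\<dots> = n\<^sup>2 / 4 + (e * L) * n\<^sup>2 / 2" by (simp add: power2_eq_square)
    also have "\<dots> \<le> n\<^sup>2 / 4 + (1 / 2) * n\<^sup>2 / 2"
      using e by (intro add_mono divide_right_mono mult_right_mono) auto
    finally have "16 * L * (\<mu> / 64) * (n\<^sup>2 / L + 2 * n * w1) \<le> n\<^sup>2 / 2" by simp
    then have "c0 * (\<mu> / 64) ^ p * (16 * L * (\<mu> / 64) * (n\<^sup>2 / L + 2 * n * w1)) \<le> c0 * (\<mu> / 64) ^ p * (n\<^sup>2 / 2)"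
      using pos \<mu> by (intro mult_left_mono) auto
    moreover have "c0 * (\<mu> / 64) ^ p * (16 * L * (\<mu> / 64)) * (n\<^sup>2 / L + 2 * n * w1)
        = c0 * (\<mu> / 64) ^ p * (16 * L * (\<mu> / 64) * (n\<^sup>2 / L + 2 * n * w1))" by (rule mult.assoc)
    moreover have "c0 * (\<mu> / 64) ^ p * (n\<^sup>2 / 2) = c0 * (\<mu> / 64) ^ p * n\<^sup>2 * (1 / 4) * 2" by simp
    moreover have "c0 * (\<mu> / 64) ^ p * n\<^sup>2 = c0 * (\<mu> / 64) ^ p * n\<^sup>2 * (1 / 4) * 4" by simp
    ultimately have "c0 * (\<mu> / 64) ^ p * n\<^sup>2 * (1 / 4) \<le> 0" using h4 I by linarith
    moreover have "0 < c0 * (\<mu> / 64) ^ p * n\<^sup>2 * (1 / 4)" using pos \<mu> n by simp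
    ultimately show False by linarith
  qed
  show thesis by (rule that[of "e ^ 4"]) (use e main in auto)
qed

lemma interval_norm_triangle:
  assumes "continuous_on {0..L} f" "continuous_on {0..L} g"
  shows "interval_norm L (\<lambda>y. f y + g y) \<le> interval_norm L f + interval_norm L g"
  using norm2_triangle[OF interval_norm_eq_norm2(2)[OF assms(1)] interval_norm_eq_norm2(2)[OF assms(2)]]
  by (simp add: interval_norm_eq_norm2(1) assms continuous_on_add)

text \<open>\<open>W j\<close> stands for the \<open>j\<close>-th derivative of one smooth periodic
  function. The number \<open>\<omega>\<close> makes the bound uniform along the imaginary axis. The
  proof supplies the four inequalities \<open>h1\<close> to \<open>h4\<close> to
  \<open>resolvent_arith\<close>.\<close>

theorem resolvent_estimate:
  fixes L \<kappa>0 :: real and m :: nat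
  assumes L: "L > 0" and m: "m \<ge> 1" and \<kappa>0: "\<kappa>0 > 0"
  defines "u \<equiv> \<lambda>y. sin (2 * pi * y / L) ^ m"
  obtains \<epsilon> where "\<epsilon> > 0"
    "\<And>\<nu> \<kappa> \<omega> (W :: nat \<Rightarrow> real \<Rightarrow> complex).
      \<lbrakk>0 < \<nu>; \<nu> < 1; \<kappa>0 \<le> \<bar>\<kappa>\<bar>; \<And>j y. (W j has_vector_derivative W (Suc j) y) (at y); \<And>j. W j L = W j 0\<rbrakk>
      \<Longrightarrow> \<epsilon> * \<nu> powr (real (max 2 m) / (real (max 2 m) + 4)) * interval_norm L (W 0)
        \<le> interval_norm L (\<lambda>y. \<nu> * (W 4 y - 2 * \<kappa>\<^sup>2 * W 2 y + \<kappa> ^ 4 * W 0 y)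
            + \<i> * of_real (\<kappa> * u y + \<omega>) * W 0 y)"
proof -
  define p where "p = max 2 m"
  obtain C c0 where C: "C > 0" "c0 > 0" and mult: "\<And>c \<delta>. \<lbrakk>0 < \<delta>; \<delta> \<le> 1\<rbrakk> \<Longrightarrow> \<exists>\<psi> \<psi>' \<psi>'' B.
      (\<forall>y. (\<psi> has_real_derivative \<psi>' y) (at y)) \<and> (\<forall>y. (\<psi>' has_real_derivative \<psi>'' y) (at y)) \<and>
      continuous_on UNIV \<psi>'' \<and> \<psi> L = \<psi> 0 \<and> \<psi>' L = \<psi>' 0 \<and>
      (\<forall>y. \<bar>\<psi> y\<bar> \<le> 1) \<and> (\<forall>y. \<bar>\<psi>' y\<bar> \<le> C / \<delta>) \<and> (\<forall>y. \<bar>\<psi>'' y\<bar> \<le> C / \<delta>\<^sup>2) \<and>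
      (\<forall>y. 0 \<le> (u y - c) * \<psi> y) \<and> B \<in> sets borel \<and> emeasure lborel B \<le> ennreal (16 * L * \<delta>) \<and>
      (\<forall>y\<in>{0..L} - B. c0 * \<delta> ^ p \<le> (u y - c) * \<psi> y)"
    unfolding u_def p_def using smooth_multiplier[OF L m] by blast
  obtain \<epsilon> where \<epsilon>: "\<epsilon> > 0" and arith:
    "\<And>\<mu> n D f w1 I. \<lbrakk>0 < \<mu>; \<mu> < 1; 0 \<le> n; 0 \<le> D; 0 \<le> f; 0 \<le> w1;
       \<mu> ^ (p + 4) * D\<^sup>2 \<le> f * n; w1\<^sup>2 \<le> D * n;
       \<kappa>0 * I \<le> f * n + \<mu> ^ (p + 4) * D * (2 * (C / (\<mu> / 64)) * w1 + C / (\<mu> / 64)\<^sup>2 * n);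
       c0 * (\<mu> / 64) ^ p * n\<^sup>2 \<le> I + c0 * (\<mu> / 64) ^ p * (16 * L * (\<mu> / 64)) * (n\<^sup>2 / L + 2 * n * w1)\<rbrakk>
      \<Longrightarrow> \<epsilon> * \<mu> ^ p * n \<le> f"
    using resolvent_arith[OF C L \<kappa>0] by blast
  have main: "\<epsilon> * \<nu> powr (real p / (real p + 4)) * interval_norm L (W 0)
        \<le> interval_norm L (\<lambda>y. \<nu> * (W 4 y - 2 * \<kappa>\<^sup>2 * W 2 y + \<kappa> ^ 4 * W 0 y) + \<i> * of_real (\<kappa> * u y + \<omega>) * W 0 y)"
    if \<nu>: "0 < \<nu>" "\<nu> < 1" and \<kappa>: "\<kappa>0 \<le> \<bar>\<kappa>\<bar>"
      and dW: "\<And>j y. (W j has_vector_derivative W (Suc j) y) (at y)" and per: "\<And>j. W j L = W j 0"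
    for \<nu> \<kappa> \<omega> and W :: "nat \<Rightarrow> real \<Rightarrow> complex"
  proof -
    \<comment> \<open>At length scale \<open>\<mu>\<close> the dissipation
      \<open>\<nu> * \<mu> powr (-4)\<close> and the gain \<open>\<mu> ^ p\<close> from the shear
      agree.\<close>
    define \<mu> where "\<mu> = \<nu> powr (1 / real (p + 4))"
    have \<mu>: "0 < \<mu>" "\<mu> < 1"
      using \<nu> powr_less_mono2[of "1 / real (p + 4)" \<nu> 1] by (auto simp: \<mu>_def)
    have \<mu>p: "\<mu> ^ (p + 4) = \<nu>"
      unfolding \<mu>_def using \<nu> by (simp add: powr_realpow[symmetric] powr_powr)
    have \<mu>p': "\<nu> powr (real p / (real p + 4)) = \<mu> ^ p"
      unfolding \<mu>_def using \<nu> by (simp add: powr_realpow[symmetric] powr_powr)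
    define \<delta> where "\<delta> = \<mu> / 64"
    have \<delta>: "0 < \<delta>" "\<delta> \<le> 1" using \<mu> by (auto simp: \<delta>_def)
    \<comment> \<open>The spectral parameter is absorbed into the level:
      \<open>\<kappa> * u + \<omega>\<close> equals \<open>\<kappa> * (u - c)\<close>.\<close>
    define c where "c = - \<omega> / \<kappa>"
    have "\<kappa> \<noteq> 0" using \<kappa> \<kappa>0 by auto
    then have kc: "\<kappa> * u y + \<omega> = \<kappa> * (u y - c)" for y by (simp add: c_def field_simps)
    from mult[OF \<delta>, of c] obtain \<psi> \<psi>' \<psi>'' B where
      d1: "\<And>y. (\<psi> has_real_derivative \<psi>' y) (at y)" and d2: "\<And>y. (\<psi>' has_real_derivative \<psi>'' y) (at y)"
      and c\<psi>'': "continuous_on UNIV \<psi>''" and per\<psi>: "\<psi> L = \<psi> 0" "\<psi>' L = \<psi>' 0"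
      and b0: "\<And>y. \<bar>\<psi> y\<bar> \<le> 1" and b1: "\<And>y. \<bar>\<psi>' y\<bar> \<le> C / \<delta>" and b2: "\<And>y. \<bar>\<psi>'' y\<bar> \<le> C / \<delta>\<^sup>2"
      and nonneg: "\<And>y. 0 \<le> (u y - c) * \<psi> y"
      and B: "B \<in> sets borel" "emeasure lborel B \<le> ennreal (16 * L * \<delta>)"
      and good: "\<And>y. y \<in> {0..L} - B \<Longrightarrow> c0 * \<delta> ^ p \<le> (u y - c) * \<psi> y" by blast
    have cW [continuous_intros]: "continuous_on A (W j)" for A j
      by (rule continuous_on_vector_derivative[OF has_vector_derivative_at_within[OF dW]])
    have cu [continuous_intros]: "continuous_on A u" for A unfolding u_def divide_inverse by (intro continuous_intros)
    have c\<psi> [continuous_intros]: "continuous_on A \<psi>" "continuous_on A \<psi>'" "continuous_on A \<psi>''" for A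
      using DERIV_continuous_on[of A, OF has_field_derivative_at_within[OF d1]]
        DERIV_continuous_on[of A, OF has_field_derivative_at_within[OF d2]]
        continuous_on_subset[OF c\<psi>''] by auto
    \<comment> \<open>\<open>V\<close> is \<open>(\<kappa>^2 - \<partial>^2) w\<close>; the fourth
      order operator is the square of this factor.\<close>
    define V where "V y = \<kappa>\<^sup>2 * W 0 y - W 2 y" for y
    define V1 where "V1 y = \<kappa>\<^sup>2 * W 1 y - W 3 y" for y
    define V2 where "V2 y = \<kappa>\<^sup>2 * W 2 y - W 4 y" for y
    define F where "F y = \<nu> * (W 4 y - 2 * \<kappa>\<^sup>2 * W 2 y + \<kappa> ^ 4 * W 0 y) + \<i> * of_real (\<kappa> * u y + \<omega>) * W 0 y" for y
    have F: "F y = \<nu> * (\<kappa>\<^sup>2 * V y - V2 y) + \<i> * of_real (\<kappa> * u y + \<omega>) * W 0 y" for y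
      by (simp add: F_def V_def V2_def algebra_simps power4_eq_xxxx power2_eq_square)
    have cV [continuous_intros]: "continuous_on A V" "continuous_on A V2" for A
      unfolding V_def[abs_def] V2_def[abs_def] by (intro continuous_intros)+
    have cF [continuous_intros]: "continuous_on A F" for A
      unfolding F_def[abs_def] by (intro continuous_intros)
    have dV: "(V has_vector_derivative V1 y) (at y)" "(V1 has_vector_derivative V2 y) (at y)" for y
      unfolding V_def[abs_def] V1_def[abs_def] V2_def
      using dW[of 0 y] dW[of 1 y] dW[of 2 y] dW[of 3 y]
      by (auto intro!: derivative_eq_intros simp: numeral_2_eq_2 numeral_3_eq_3 eval_nat_numeral)
    define n where "n = interval_norm L (W 0)"
    define D where "D = interval_norm L V"
    define f where "f = interval_norm L F"
    define w1 where "w1 = interval_norm L (W 1)"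
    have nn: "0 \<le> n" "0 \<le> D" "0 \<le> f" "0 \<le> w1" by (simp_all add: n_def D_def f_def w1_def)

    \<comment> \<open>Only one of the two factors \<open>\<kappa>^2 - \<partial>^2\<close> is moved
      to the test function, so two derivatives of the multiplier are enough.\<close>
    have weak: "integral {0..L} (\<lambda>y. F y * \<phi> y) = \<nu> * integral {0..L} (\<lambda>y. V y * (\<kappa>\<^sup>2 * \<phi> y - \<phi>'' y))
        + \<i> * integral {0..L} (\<lambda>y. of_real (\<kappa> * u y + \<omega>) * W 0 y * \<phi> y)"
      if d\<phi>: "\<And>y. (\<phi> has_vector_derivative \<phi>' y) (at y)" "\<And>y. (\<phi>' has_vector_derivative \<phi>'' y) (at y)"
        and c\<phi>: "continuous_on UNIV \<phi>''" and p\<phi>: "\<phi> L = \<phi> 0" "\<phi>' L = \<phi>' 0" for \<phi> \<phi>' \<phi>'' :: "real \<Rightarrow> complex"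
    proof -
      have c [continuous_intros]: "continuous_on A \<phi>" "continuous_on A \<phi>''" for A
        using continuous_on_vector_derivative[OF has_vector_derivative_at_within[OF d\<phi>(1)]] c\<phi> continuous_on_subset by blast+
      have ibp: "integral {0..L} (\<lambda>y. V2 y * \<phi> y) = integral {0..L} (\<lambda>y. V y * \<phi>'' y)"
        by (rule integration_by_parts_periodic2[OF _ dV d\<phi> _ c\<phi> _ _ p\<phi>])
          (use L per in \<open>auto intro: continuous_intros simp: V_def V1_def\<close>)
      have "(\<lambda>y. F y * \<phi> y) = (\<lambda>y. \<nu> * (\<kappa>\<^sup>2 * (V y * \<phi> y) - V2 y * \<phi> y) + \<i> * (of_real (\<kappa> * u y + \<omega>) * W 0 y * \<phi> y))"
        unfolding F by (simp add: fun_eq_iff algebra_simps)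
      moreover have "integral {0..L} (\<lambda>y. \<nu> * (\<kappa>\<^sup>2 * (V y * \<phi> y) - V2 y * \<phi> y) + \<i> * (of_real (\<kappa> * u y + \<omega>) * W 0 y * \<phi> y))
        = \<nu> * (\<kappa>\<^sup>2 * integral {0..L} (\<lambda>y. V y * \<phi> y) - integral {0..L} (\<lambda>y. V2 y * \<phi> y))
        + \<i> * integral {0..L} (\<lambda>y. of_real (\<kappa> * u y + \<omega>) * W 0 y * \<phi> y)"
        by (intro integral_unique has_integral_add has_integral_diff has_integral_mult_right integrable_integral
            integrable_continuous_interval continuous_intros)
      moreover have "integral {0..L} (\<lambda>y. V y * (\<kappa>\<^sup>2 * \<phi> y - \<phi>'' y))
         = \<kappa>\<^sup>2 * integral {0..L} (\<lambda>y. V y * \<phi> y) - integral {0..L} (\<lambda>y. V y * \<phi>'' y)"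
      proof -
        have "integral {0..L} (\<lambda>y. \<kappa>\<^sup>2 * (V y * \<phi> y) - V y * \<phi>'' y)
           = \<kappa>\<^sup>2 * integral {0..L} (\<lambda>y. V y * \<phi> y) - integral {0..L} (\<lambda>y. V y * \<phi>'' y)"
          by (intro integral_unique has_integral_diff has_integral_mult_right integrable_integral
            integrable_continuous_interval continuous_intros)
        then show ?thesis by (simp add: algebra_simps)
      qed
      ultimately show ?thesis by (simp add: ibp)
    qed
    have dcW: "((\<lambda>y. cnj (W j y)) has_vector_derivative cnj (W (Suc j) y)) (at y)" for j y
      by (rule has_vector_derivative_cnj[OF dW])
    have dcW01: "((\<lambda>y. cnj (W 0 y)) has_vector_derivative cnj (W 1 y)) (at y)"
       "((\<lambda>y. cnj (W 1 y)) has_vector_derivative cnj (W 2 y)) (at y)" for y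
      using dcW[of 0 y] dcW[of 1 y] by (simp_all add: numeral_2_eq_2)
    have cs: "continuous_on {0..L} (\<lambda>y. cnj (W j y))" "interval_norm L (\<lambda>y. cnj (W j y)) = interval_norm L (W j)" for j
      by (auto intro!: continuous_intros simp: interval_norm_def)

    \<comment> \<open>Pairing with \<open>w\<close> itself: the shear term is purely imaginary, so
      the real part is the dissipation alone.\<close>
    have h1: "\<mu> ^ (p + 4) * D\<^sup>2 \<le> f * n"
    proof -
      have "integral {0..L} (\<lambda>y. F y * cnj (W 0 y)) = \<nu> * integral {0..L} (\<lambda>y. V y * (\<kappa>\<^sup>2 * cnj (W 0 y) - cnj (W 2 y)))
        + \<i> * integral {0..L} (\<lambda>y. of_real (\<kappa> * u y + \<omega>) * W 0 y * cnj (W 0 y))"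
        by (rule weak[OF dcW01]) (auto intro!: continuous_intros simp: per)
      also have "integral {0..L} (\<lambda>y. V y * (\<kappa>\<^sup>2 * cnj (W 0 y) - cnj (W 2 y))) = of_real (integral {0..L} (\<lambda>y. (cmod (V y))\<^sup>2))"
      proof -
        have "(\<lambda>y. V y * (\<kappa>\<^sup>2 * cnj (W 0 y) - cnj (W 2 y))) = (\<lambda>y. of_real ((cmod (V y))\<^sup>2))"
          unfolding fun_eq_iff complex_norm_square by (simp add: V_def)
        then show ?thesis
          by (simp only:) (intro integral_unique has_integral_of_real integrable_integral integrable_continuous_interval continuous_intros)
      qed
      also have "integral {0..L} (\<lambda>y. of_real (\<kappa> * u y + \<omega>) * W 0 y * cnj (W 0 y)) = of_real (integral {0..L} (\<lambda>y. (\<kappa> * u y + \<omega>) * (cmod (W 0 y))\<^sup>2))"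
      proof -
        have "(\<lambda>y. of_real (\<kappa> * u y + \<omega>) * W 0 y * cnj (W 0 y)) = (\<lambda>y. of_real ((\<kappa> * u y + \<omega>) * (cmod (W 0 y))\<^sup>2))"
          unfolding fun_eq_iff of_real_mult complex_norm_square by simp
        then show ?thesis
          by (simp only:) (intro integral_unique has_integral_of_real integrable_integral integrable_continuous_interval continuous_intros)
      qed
      finally have "Re (integral {0..L} (\<lambda>y. F y * cnj (W 0 y))) = \<nu> * D\<^sup>2"
        by (simp add: D_def interval_norm_power2)
      then have "\<nu> * D\<^sup>2 \<le> cmod (integral {0..L} (\<lambda>y. F y * cnj (W 0 y)))" by (metis complex_Re_le_cmod)
      also have "\<dots> \<le> f * n"
        using interval_Cauchy_Schwarz(1)[OF cF cs(1)[of 0]] by (simp add: f_def n_def cs(2))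
      finally show ?thesis by (simp add: \<mu>p)
    qed

    \<comment> \<open>Integrating the derivative of \<open>w' * cnj w\<close> over a period gives
      \<open>w1\<^sup>2 + \<kappa>\<^sup>2 * n\<^sup>2\<close> as the pairing of \<open>V\<close>
      with \<open>w\<close>.\<close>
    have h2: "w1\<^sup>2 \<le> D * n"
    proof -
      have dW1: "(W 1 has_vector_derivative W 2 y) (at y)" for y
        using dW[of 1 y] by (simp add: numeral_2_eq_2)
      have "((\<lambda>y. W 1 y * cnj (W 0 y)) has_vector_derivative (W 1 y * cnj (W 1 y) + W 2 y * cnj (W 0 y))) (at y within {0..L})" for y
        by (rule has_vector_derivative_at_within[OF has_vector_derivative_mult[OF dW1 dcW01(1)]])
      from fundamental_theorem_of_calculus[OF _ this] L
      have "((\<lambda>y. W 1 y * cnj (W 1 y) + W 2 y * cnj (W 0 y)) has_integral 0) {0..L}" by (simp add: per)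
      moreover have "(\<lambda>y. W 1 y * cnj (W 1 y) + W 2 y * cnj (W 0 y)) =
          (\<lambda>y. of_real ((cmod (W 1 y))\<^sup>2 + \<kappa>\<^sup>2 * (cmod (W 0 y))\<^sup>2) - V y * cnj (W 0 y))"
        unfolding fun_eq_iff of_real_add of_real_mult complex_norm_square by (simp add: V_def algebra_simps)
      ultimately have "((\<lambda>y. of_real ((cmod (W 1 y))\<^sup>2 + \<kappa>\<^sup>2 * (cmod (W 0 y))\<^sup>2) - V y * cnj (W 0 y)) has_integral 0) {0..L}" by simp
      moreover have "((\<lambda>y. of_real ((cmod (W 1 y))\<^sup>2 + \<kappa>\<^sup>2 * (cmod (W 0 y))\<^sup>2) - V y * cnj (W 0 y)) has_integral
          of_real (w1\<^sup>2 + \<kappa>\<^sup>2 * n\<^sup>2) - integral {0..L} (\<lambda>y. V y * cnj (W 0 y))) {0..L}"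
        unfolding w1_def n_def interval_norm_power2
        by (intro has_integral_diff has_integral_of_real has_integral_add has_integral_mult_right integrable_integral
            integrable_continuous_interval continuous_intros)
      ultimately have "0 = of_real (w1\<^sup>2 + \<kappa>\<^sup>2 * n\<^sup>2) - integral {0..L} (\<lambda>y. V y * cnj (W 0 y))"
        by (rule has_integral_unique)
      then have "of_real (w1\<^sup>2 + \<kappa>\<^sup>2 * n\<^sup>2) = integral {0..L} (\<lambda>y. V y * cnj (W 0 y))" by simp
      then have "cmod (of_real (w1\<^sup>2 + \<kappa>\<^sup>2 * n\<^sup>2)) \<le> D * n"
        using interval_Cauchy_Schwarz(1)[OF cV(1) cs(1)[of 0]] by (simp only: D_def n_def cs(2))
      moreover have "w1\<^sup>2 + \<kappa>\<^sup>2 * n\<^sup>2 \<le> cmod (of_real (w1\<^sup>2 + \<kappa>\<^sup>2 * n\<^sup>2))" by (simp only: norm_of_real abs_ge_self)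
      moreover have "0 \<le> \<kappa>\<^sup>2 * n\<^sup>2" by simp
      ultimately show ?thesis by linarith
    qed

    define I where "I = integral {0..L} (\<lambda>y. (u y - c) * \<psi> y * (cmod (W 0 y))\<^sup>2)"
    have I_nonneg: "0 \<le> I" unfolding I_def
      by (intro integral_nonneg integrable_continuous_interval continuous_intros) (use nonneg in simp)
    \<comment> \<open>Pairing with \<open>\<psi> w\<close> and taking the imaginary part: the
      leading dissipative term \<open>\<psi> * \<bar>V\<bar>^2\<close> is real and drops out,
      although \<open>\<psi>\<close> changes sign; only terms with derivatives of
      \<open>\<psi>\<close> remain next to \<open>\<kappa> * I\<close>.\<close>
    have h3: "\<kappa>0 * I \<le> f * n + \<mu> ^ (p + 4) * D * (2 * (C / (\<mu> / 64)) * w1 + C / (\<mu> / 64)\<^sup>2 * n)"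
    proof -
      define \<phi> where "\<phi> y = of_real (\<psi> y) * cnj (W 0 y)" for y
      define \<phi>' where "\<phi>' y = of_real (\<psi>' y) * cnj (W 0 y) + of_real (\<psi> y) * cnj (W 1 y)" for y
      define \<phi>'' where "\<phi>'' y = of_real (\<psi>'' y) * cnj (W 0 y) + 2 * of_real (\<psi>' y) * cnj (W 1 y) + of_real (\<psi> y) * cnj (W 2 y)" for y
      have o1: "((\<lambda>y. complex_of_real (\<psi> y)) has_vector_derivative of_real (\<psi>' y)) (at y)"
        "((\<lambda>y. complex_of_real (\<psi>' y)) has_vector_derivative of_real (\<psi>'' y)) (at y)" for y
        using d1[of y] d2[of y] by (simp_all add: has_vector_derivative_of_real has_real_derivative_iff_has_vector_derivative)
      have p1: "(\<phi> has_vector_derivative \<phi>' y) (at y)" for y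
        using has_vector_derivative_mult[OF o1(1)[of y] dcW01(1)[of y]]
        unfolding \<phi>_def[abs_def] \<phi>'_def by (simp add: add.commute)
      have p2: "(\<phi>' has_vector_derivative \<phi>'' y) (at y)" for y
        using has_vector_derivative_add[OF has_vector_derivative_mult[OF o1(2)[of y] dcW01(1)[of y]]
          has_vector_derivative_mult[OF o1(1)[of y] dcW01(2)[of y]]]
        unfolding \<phi>'_def[abs_def] \<phi>''_def by (simp add: algebra_simps)
      \<comment> \<open>The commutator part: \<open>(\<kappa>^2 - \<partial>^2)\<close> applied to
        \<open>\<psi> * cnj w\<close> equals \<open>\<psi> * cnj V - R\<close>.\<close>
      define R where "R y = 2 * of_real (\<psi>' y) * cnj (W 1 y) + of_real (\<psi>'' y) * cnj (W 0 y)" for y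
      have cR [continuous_intros]: "continuous_on A R" for A unfolding R_def[abs_def] by (intro continuous_intros)
      have c\<phi> [continuous_intros]: "continuous_on A \<phi>" "continuous_on A \<phi>''" for A
        unfolding \<phi>_def[abs_def] \<phi>''_def[abs_def] by (intro continuous_intros)+
      have "integral {0..L} (\<lambda>y. F y * \<phi> y) = \<nu> * integral {0..L} (\<lambda>y. V y * (\<kappa>\<^sup>2 * \<phi> y - \<phi>'' y))
        + \<i> * integral {0..L} (\<lambda>y. of_real (\<kappa> * u y + \<omega>) * W 0 y * \<phi> y)"
        by (rule weak[OF p1 p2]) (auto intro!: continuous_intros simp: \<phi>_def \<phi>'_def per per\<psi>)
      also have "integral {0..L} (\<lambda>y. V y * (\<kappa>\<^sup>2 * \<phi> y - \<phi>'' y))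
         = of_real (integral {0..L} (\<lambda>y. \<psi> y * (cmod (V y))\<^sup>2)) - integral {0..L} (\<lambda>y. V y * R y)"
      proof -
        have "(\<lambda>y. V y * (\<kappa>\<^sup>2 * \<phi> y - \<phi>'' y)) = (\<lambda>y. of_real (\<psi> y * (cmod (V y))\<^sup>2) - V y * R y)"
          unfolding fun_eq_iff of_real_mult complex_norm_square
          by (simp add: V_def \<phi>_def \<phi>''_def R_def algebra_simps)
        then show ?thesis
          by (simp only:) (intro integral_unique has_integral_diff has_integral_of_real integrable_integral integrable_continuous_interval continuous_intros)
      qed
      also have "integral {0..L} (\<lambda>y. of_real (\<kappa> * u y + \<omega>) * W 0 y * \<phi> y) = of_real (\<kappa> * I)"
      proof -
        have "(\<lambda>y. of_real (\<kappa> * u y + \<omega>) * W 0 y * \<phi> y) = (\<lambda>y. of_real (\<kappa> * ((u y - c) * \<psi> y * (cmod (W 0 y))\<^sup>2)))"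
          unfolding fun_eq_iff of_real_mult complex_norm_square kc \<phi>_def by (simp add: algebra_simps)
        then show ?thesis unfolding I_def
          by (simp only:) (intro integral_unique has_integral_mult_right has_integral_of_real integrable_integral integrable_continuous_interval continuous_intros)
      qed
      finally have "Im (integral {0..L} (\<lambda>y. F y * \<phi> y)) = - \<nu> * Im (integral {0..L} (\<lambda>y. V y * R y)) + \<kappa> * I" by simp
      then have "\<bar>\<kappa> * I\<bar> \<le> \<bar>Im (integral {0..L} (\<lambda>y. F y * \<phi> y))\<bar> + \<bar>\<nu> * Im (integral {0..L} (\<lambda>y. V y * R y))\<bar>" by linarith
      also have "\<dots> \<le> cmod (integral {0..L} (\<lambda>y. F y * \<phi> y)) + \<nu> * cmod (integral {0..L} (\<lambda>y. V y * R y))"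
        unfolding abs_mult using \<nu> by (intro add_mono mult_mono abs_Im_le_cmod) auto
      also have "\<dots> \<le> f * interval_norm L \<phi> + \<nu> * (D * interval_norm L R)"
        unfolding f_def D_def using \<nu>
        by (intro add_mono mult_left_mono interval_Cauchy_Schwarz(1) continuous_intros) auto
      also have "\<dots> \<le> f * n + \<nu> * (D * (2 * (C / \<delta>) * w1 + C / \<delta>\<^sup>2 * n))"
      proof -
        have "interval_norm L \<phi> \<le> n"
          unfolding interval_norm_def n_def
          by (intro real_sqrt_le_mono integral_le integrable_continuous_interval continuous_intros)
            (use b0 in \<open>simp add: \<phi>_def norm_mult power_mult_distrib mult_left_le_one_le abs_square_le_1\<close>)
        moreover have "interval_norm L R \<le> 2 * (C / \<delta>) * w1 + C / \<delta>\<^sup>2 * n"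
        proof -
          have sc: "interval_norm L (\<lambda>y. of_real (g y) * cnj (W j y)) \<le> K * interval_norm L (W j)"
            if g: "continuous_on UNIV g" and K: "\<And>y. \<bar>g y\<bar> \<le> K" for g K j
          proof -
            have K0: "0 \<le> K" using K[of 0] by linarith
            have g' [continuous_intros]: "continuous_on A g" for A using g continuous_on_subset by blast
            have "integral {0..L} (\<lambda>y. (cmod (of_real (g y) * cnj (W j y)))\<^sup>2) \<le> integral {0..L} (\<lambda>y. K\<^sup>2 * (cmod (W j y))\<^sup>2)"
            proof (intro integral_le integrable_continuous_interval continuous_intros)
              fix y
              have "(cmod (of_real (g y) * cnj (W j y)))\<^sup>2 = \<bar>g y\<bar>\<^sup>2 * (cmod (W j y))\<^sup>2"
                by (simp add: norm_mult power_mult_distrib)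
              also have "\<dots> \<le> K\<^sup>2 * (cmod (W j y))\<^sup>2" by (intro mult_right_mono power_mono K) auto
              finally show "(cmod (of_real (g y) * cnj (W j y)))\<^sup>2 \<le> K\<^sup>2 * (cmod (W j y))\<^sup>2" .
            qed
            then have "interval_norm L (\<lambda>y. of_real (g y) * cnj (W j y)) \<le> sqrt (K\<^sup>2 * integral {0..L} (\<lambda>y. (cmod (W j y))\<^sup>2))"
              unfolding interval_norm_def by simp
            then show ?thesis unfolding interval_norm_def real_sqrt_mult using K0 by simp
          qed
          have "interval_norm L R \<le> interval_norm L (\<lambda>y. of_real (2 * \<psi>' y) * cnj (W 1 y)) + interval_norm L (\<lambda>y. of_real (\<psi>'' y) * cnj (W 0 y))"
          proof -
            have c: "continuous_on {0..L} (\<lambda>y. of_real (2 * \<psi>' y) * cnj (W 1 y))" "continuous_on {0..L} (\<lambda>y. of_real (\<psi>'' y) * cnj (W 0 y))"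
              by (intro continuous_intros)+
            have "R = (\<lambda>y. of_real (2 * \<psi>' y) * cnj (W 1 y) + of_real (\<psi>'' y) * cnj (W 0 y))" by (simp add: R_def fun_eq_iff)
            then show ?thesis using interval_norm_triangle[OF c] by simp
          qed
          also have "interval_norm L (\<lambda>y. of_real (2 * \<psi>' y) * cnj (W 1 y)) \<le> (2 * (C / \<delta>)) * interval_norm L (W 1)"
          proof (rule sc)
            show "\<bar>2 * \<psi>' y\<bar> \<le> 2 * (C / \<delta>)" for y using b1[of y] by linarith
          qed (intro continuous_intros)
          also have "interval_norm L (\<lambda>y. of_real (\<psi>'' y) * cnj (W 0 y)) \<le> C / \<delta>\<^sup>2 * interval_norm L (W 0)"
            by (rule sc) (use b2 in \<open>auto intro!: continuous_intros\<close>)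
          finally show ?thesis by (simp add: n_def w1_def)
        qed
        ultimately show ?thesis using nn \<nu> by (intro add_mono mult_left_mono) auto
      qed
      finally have "\<bar>\<kappa>\<bar> * I \<le> f * n + \<nu> * (D * (2 * (C / \<delta>) * w1 + C / \<delta>\<^sup>2 * n))"
        using I_nonneg by (simp add: abs_mult)
      moreover have "\<kappa>0 * I \<le> \<bar>\<kappa>\<bar> * I" using \<kappa> I_nonneg by (rule mult_right_mono)
      ultimately show ?thesis unfolding \<mu>p \<delta>_def[symmetric] by (simp only: mult.assoc)
    qed

    \<comment> \<open>Off \<open>B\<close> the weight in \<open>I\<close> is bounded below; on
      \<open>B\<close> the squared modulus of \<open>w\<close> is replaced by its supremum, times
      the measure \<open>16 * L * \<delta>\<close>.\<close>
    have h4: "c0 * (\<mu> / 64) ^ p * n\<^sup>2 \<le> I + c0 * (\<mu> / 64) ^ p * (16 * L * (\<mu> / 64)) * (n\<^sup>2 / L + 2 * n * w1)"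
      unfolding \<delta>_def[symmetric]
    proof -
      define S where "S = n\<^sup>2 / L + 2 * n * w1"
      define k where "k = c0 * \<delta> ^ p"
      have k: "k > 0" using C \<delta> by (simp add: k_def)
      have S0: "0 \<le> S" using nn L by (simp add: S_def)
      have sup: "(cmod (W 0 y))\<^sup>2 \<le> S" if "y \<in> {0..L}" for y
        unfolding S_def n_def w1_def
        by (rule sup_le_interval_norm[OF L _ _ that]) (use dW[of 0] in \<open>auto intro: continuous_intros\<close>)
      let ?w = "\<lambda>y. (cmod (W 0 y))\<^sup>2"
      let ?h = "\<lambda>y. (u y - c) * \<psi> y * ?w y"
      have cw: "continuous_on {0..L} (\<lambda>y. k * ?w y)" "continuous_on {0..L} ?h" by (intro continuous_intros)+
      have Bfin: "emeasure lborel B < \<infinity>" using B(2) by (rule le_less_trans) simp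
      have iB: "integrable lborel (\<lambda>y. k * S * indicator B y)"
        using B(1) Bfin by (intro integrable_mult_right integrable_real_indicator) auto
      have "(LINT y:{0..L}|lborel. k * ?w y) \<le> (\<integral>y. indicator {0..L} y *\<^sub>R ?h y + k * S * indicator B y \<partial>lborel)"
        unfolding set_lebesgue_integral_def
      proof (rule integral_mono)
        show "integrable lborel (\<lambda>y. indicator {0..L} y *\<^sub>R (k * ?w y))"
          using set_integral_continuous(1)[OF cw(1)] by (simp add: set_integrable_def)
        show "integrable lborel (\<lambda>y. indicator {0..L} y *\<^sub>R ?h y + k * S * indicator B y)"
          using set_integral_continuous(1)[OF cw(2)] iB unfolding set_integrable_def by (intro Bochner_Integration.integrable_add)
        fix y :: real
        show "indicator {0..L} y *\<^sub>R (k * ?w y) \<le> indicator {0..L} y *\<^sub>R ?h y + k * S * indicator B y"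
        proof (cases "y \<in> {0..L}")
          case True
          show ?thesis
          proof (cases "y \<in> B")
            case False
            have "k * ?w y \<le> ?h y" unfolding k_def using good[of y] True False by (intro mult_right_mono) auto
            with True False show ?thesis by simp
          next
            case yB: True
            have "k * ?w y \<le> k * S" using sup[OF True] k by (intro mult_left_mono) auto
            moreover have "0 \<le> ?h y" using nonneg[of y] by simp
            ultimately show ?thesis using True yB by simp
          qed
        qed (use k S0 in \<open>auto simp: indicator_def\<close>)
      qed
      also have "\<dots> = (LINT y:{0..L}|lborel. ?h y) + k * S * measure lborel B"
        using set_integral_continuous(1)[OF cw(2)] iB Bfin B(1) unfolding set_lebesgue_integral_def set_integrable_def
        by (subst Bochner_Integration.integral_add) auto
      also have "(LINT y:{0..L}|lborel. ?h y) = I" unfolding I_def by (rule set_integral_continuous(2)[OF cw(2)])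
      also have "(LINT y:{0..L}|lborel. k * ?w y) = k * n\<^sup>2"
        unfolding set_integral_continuous(2)[OF cw(1)] n_def interval_norm_power2 by simp
      finally have "k * n\<^sup>2 \<le> I + k * S * measure lborel B" .
      also have "k * S * measure lborel B \<le> k * S * (16 * L * \<delta>)"
        using B(2) L \<delta> k S0 by (intro mult_left_mono) (auto simp: measure_def intro!: enn2real_leI)
      finally show "c0 * \<delta> ^ p * n\<^sup>2 \<le> I + c0 * \<delta> ^ p * (16 * L * \<delta>) * (n\<^sup>2 / L + 2 * n * w1)"
        by (simp add: k_def S_def mult_ac)
    qed
    have "\<epsilon> * \<mu> ^ p * n \<le> f" by (rule arith[OF \<mu> nn h1 h2 h3 h4])
    then show ?thesis by (simp add: \<mu>p' n_def f_def F_def[abs_def])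
  qed
  show thesis using that[OF \<epsilon>] main unfolding p_def by blast
qed

section \<open>The resolvent estimate on the Fourier side\<close>

text \<open>The recursion is multiplication by
  \<open>sin = (wave 1 - wave (-1)) / (2 * \<i>)\<close> read on Fourier coefficients.\<close>

primrec sin_power_coeff :: "nat \<Rightarrow> int \<Rightarrow> complex" where
  "sin_power_coeff 0 j = (if j = 0 then 1 else 0)"
| "sin_power_coeff (Suc m) j = (sin_power_coeff m (j - 1) - sin_power_coeff m (j + 1)) / (2 * \<i>)"

lemma sin_power_coeff_support: "\<bar>j\<bar> > int m \<Longrightarrow> sin_power_coeff m j = 0"
  by (induction m arbitrary: j) auto

lemma sin_power_coeff_le_1: "cmod (sin_power_coeff m j) \<le> 1"
proof (induction m arbitrary: j)
  case (Suc m)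
  have "cmod (sin_power_coeff m (j - 1) - sin_power_coeff m (j + 1)) \<le> 1 + 1"
    by (rule order_trans[OF norm_triangle_ineq4 add_mono[OF Suc Suc]])
  then show ?case by (simp add: norm_divide norm_mult)
qed simp

text \<open>Expresses that powers of the sine are real; this symmetry makes \<open>sin_conv\<close>
  self-adjoint, so that the shear conserves energy.\<close>

lemma sin_power_coeff_cnj: "cnj (sin_power_coeff m j) = sin_power_coeff m (- j)"
proof (induction m arbitrary: j)
  case (Suc m)
  have e: "- (j - 1) = - j + 1" "- (j + 1) = - j - 1" by simp_all
  show ?case
    by (simp only: sin_power_coeff.simps complex_cnj_divide complex_cnj_diff complex_cnj_mult
        complex_cnj_numeral complex_cnj_i Suc e) (simp add: algebra_simps, subst minus_divide_left, simp)
qed simp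

lemma sum_shift_int:
  fixes f :: "int \<Rightarrow> 'a :: comm_monoid_add"
  shows "(\<Sum>l\<in>{a..b}. f (l + c)) = (\<Sum>l\<in>{a + c..b + c}. f l)"
  by (rule sum.reindex_bij_witness[of _ "\<lambda>l. l - c" "\<lambda>l. l + c"]) auto

lemma wave_sin:
  "wave L 1 y - wave L (-1) y = 2 * \<i> * of_real (sin (2 * pi * y / L))"
  by (simp add: wave_def complex_eq_iff)

lemma sin_power_wave:
  "complex_of_real (sin (2 * pi * y / L) ^ m) = (\<Sum>j\<in>{- int m..int m}. sin_power_coeff m j * wave L j y)"
proof (induction m)
  case (Suc m)
  define s where "s = complex_of_real (sin (2 * pi * y / L))"
  have s: "s = (wave L 1 y - wave L (-1) y) / (2 * \<i>)" by (simp add: s_def wave_sin)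
  let ?c = "sin_power_coeff m" and ?w = "\<lambda>j. wave L j y"
  have A: "(\<Sum>j\<in>{- int m..int m}. ?c j * ?w j) * ?w 1 = (\<Sum>j\<in>{- int (Suc m)..int (Suc m)}. ?c (j - 1) * ?w j)"
  proof -
    have "(\<Sum>j\<in>{- int m..int m}. ?c j * ?w j) * ?w 1 = (\<Sum>j\<in>{- int m..int m}. ?c ((j + 1) - 1) * ?w (j + 1))"
      by (simp add: sum_distrib_right wave_add mult.assoc)
    also have "\<dots> = (\<Sum>j\<in>{- int m + 1..int m + 1}. ?c (j - 1) * ?w j)"
      by (rule sum_shift_int[of "\<lambda>j. ?c (j - 1) * ?w j"])
    also have "\<dots> = (\<Sum>j\<in>{- int (Suc m)..int (Suc m)}. ?c (j - 1) * ?w j)"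
      by (rule sum.mono_neutral_left) (auto simp: sin_power_coeff_support)
    finally show ?thesis .
  qed
  have B: "(\<Sum>j\<in>{- int m..int m}. ?c j * ?w j) * ?w (-1) = (\<Sum>j\<in>{- int (Suc m)..int (Suc m)}. ?c (j + 1) * ?w j)"
  proof -
    have "(\<Sum>j\<in>{- int m..int m}. ?c j * ?w j) * ?w (-1) = (\<Sum>j\<in>{- int m..int m}. ?c ((j + -1) + 1) * ?w (j + -1))"
      unfolding wave_add by (simp add: sum_distrib_right mult.assoc)
    also have "\<dots> = (\<Sum>j\<in>{- int m + -1..int m + -1}. ?c (j + 1) * ?w j)"
      by (rule sum_shift_int[of "\<lambda>j. ?c (j + 1) * ?w j"])
    also have "\<dots> = (\<Sum>j\<in>{- int (Suc m)..int (Suc m)}. ?c (j + 1) * ?w j)"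
      by (rule sum.mono_neutral_left) (auto simp: sin_power_coeff_support)
    finally show ?thesis .
  qed
  have "complex_of_real (sin (2 * pi * y / L) ^ Suc m) = (\<Sum>j\<in>{- int m..int m}. ?c j * ?w j) * s"
    using Suc by (simp add: s_def mult.commute)
  also have "\<dots> = ((\<Sum>j\<in>{- int m..int m}. ?c j * ?w j) * ?w 1 - (\<Sum>j\<in>{- int m..int m}. ?c j * ?w j) * ?w (-1)) / (2 * \<i>)"
    unfolding s by (simp add: right_diff_distrib)
  also have "\<dots> = (\<Sum>j\<in>{- int (Suc m)..int (Suc m)}. sin_power_coeff (Suc m) j * ?w j)"
    unfolding A B sum_subtractf[symmetric] sum_divide_distrib
    by (intro sum.cong) (auto simp: left_diff_distrib)
  finally show ?case .
qed simp

text \<open>Multiplication by the power of the sine, on the Fourier side. The sum runs over the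
  finitely many offsets, so it makes sense for arbitrary sequences.\<close>

definition sin_conv :: "nat \<Rightarrow> (int \<Rightarrow> complex) \<Rightarrow> int \<Rightarrow> complex" where
  "sin_conv m w l = (\<Sum>j\<in>{- int m..int m}. sin_power_coeff m j * w (l - j))"

lemma interval_norm_wave_sum:
  assumes L: "L > 0" and F: "finite F"
  shows "(interval_norm L (\<lambda>y. \<Sum>l\<in>F. c l * wave L l y))\<^sup>2 = L * (\<Sum>l\<in>F. (cmod (c l))\<^sup>2)"
proof -
  let ?f = "\<lambda>y. \<Sum>l\<in>F. c l * wave L l y"
  have "complex_of_real ((interval_norm L ?f)\<^sup>2) = integral {0..L} (\<lambda>y. of_real ((cmod (?f y))\<^sup>2))"
    unfolding interval_norm_power2
    by (rule integral_unique[symmetric], intro has_integral_of_real integrable_integral integrable_continuous_interval continuous_intros continuous_on_id)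
  also have "(\<lambda>y. complex_of_real ((cmod (?f y))\<^sup>2)) = (\<lambda>y. \<Sum>l\<in>F. \<Sum>k\<in>F. (c l * cnj (c k)) * wave L (l - k) y)"
  proof
    fix y
    have "complex_of_real ((cmod (?f y))\<^sup>2) = ?f y * cnj (?f y)" by (rule complex_norm_square)
    also have "\<dots> = (\<Sum>l\<in>F. \<Sum>k\<in>F. (c l * wave L l y) * (cnj (c k) * wave L (- k) y))"
      unfolding sum_product[symmetric] by (simp add: cnj_wave)
    also have "\<dots> = (\<Sum>l\<in>F. \<Sum>k\<in>F. (c l * cnj (c k)) * wave L (l - k) y)"
      using wave_add[of L _ "- _" y] by (intro sum.cong) (auto simp: mult_ac)
    finally show "complex_of_real ((cmod (?f y))\<^sup>2) = (\<Sum>l\<in>F. \<Sum>k\<in>F. (c l * cnj (c k)) * wave L (l - k) y)" .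
  qed
  also have "integral {0..L} (\<lambda>y. \<Sum>l\<in>F. \<Sum>k\<in>F. (c l * cnj (c k)) * wave L (l - k) y)
     = (\<Sum>l\<in>F. \<Sum>k\<in>F. (c l * cnj (c k)) * integral {0..L} (wave L (l - k)))"
    by (intro integral_unique has_integral_sum F has_integral_mult_right integrable_integral
        integrable_continuous_interval continuous_intros continuous_on_id)
  also have "\<dots> = (\<Sum>l\<in>F. \<Sum>k\<in>F. if k = l then of_real L * (c l * cnj (c l)) else 0)"
  proof (intro sum.cong refl)
    fix l k
    have "continuous_on {0..L} (wave L (l - k))" by (intro continuous_intros continuous_on_id)
    then have "integral {0..L} (wave L (l - k)) = (if l - k = 0 then of_real L else 0)"
      using integral_wave[OF L, of "l - k"] by (simp add: set_integral_continuous(2))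
    then show "(c l * cnj (c k)) * integral {0..L} (wave L (l - k)) = (if k = l then of_real L * (c l * cnj (c l)) else 0)"
      by simp
  qed
  also have "\<dots> = of_real (L * (\<Sum>l\<in>F. (cmod (c l))\<^sup>2))"
    using F by (simp add: sum_distrib_left complex_norm_square[symmetric])
  finally show ?thesis by (simp only: of_real_eq_iff)
qed

text \<open>The symbol of \<open>\<nu> (\<kappa>\<^sup>2 - \<partial>\<^sub>y\<^sup>2)\<^sup>2\<close>.\<close>

definition symbol :: "real \<Rightarrow> real \<Rightarrow> real \<Rightarrow> int \<Rightarrow> real" where
  "symbol L \<nu> \<kappa> l = \<nu> * (\<kappa>\<^sup>2 + (2 * pi * of_int l / L)\<^sup>2)\<^sup>2"

text \<open>A finite sum of waves has all derivatives in closed form, so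
  \<open>resolvent_estimate\<close> applies to it. Multiplication by the shear widens the frequency
  support by \<open>m\<close>, which is why the right-hand sum extends to
  \<open>N + m\<close>.\<close>

lemma resolvent_estimate_finite:
  fixes L \<kappa>0 :: real and m :: nat
  assumes L: "L > 0" and m: "m \<ge> 1" and \<kappa>0: "\<kappa>0 > 0"
  obtains \<epsilon> where "\<epsilon> > 0"
    "\<And>\<nu> \<kappa> \<omega> (w :: int \<Rightarrow> complex) N.
      \<lbrakk>0 < \<nu>; \<nu> < 1; \<kappa>0 \<le> \<bar>\<kappa>\<bar>; \<And>l. \<bar>l\<bar> > int N \<Longrightarrow> w l = 0\<rbrakk>
      \<Longrightarrow> (\<epsilon> * \<nu> powr (real (max 2 m) / (real (max 2 m) + 4)))\<^sup>2 * (\<Sum>l\<in>{- int N..int N}. (cmod (w l))\<^sup>2)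
        \<le> (\<Sum>l\<in>{- int (N + m)..int (N + m)}.
            (cmod ((of_real (symbol L \<nu> \<kappa> l) + \<i> * of_real \<omega>) * w l + \<i> * of_real \<kappa> * sin_conv m w l))\<^sup>2)"
proof -
  define u where "u = (\<lambda>y. sin (2 * pi * y / L) ^ m)"
  obtain \<epsilon> where \<epsilon>: "\<epsilon> > 0" and est: "\<And>\<nu> \<kappa> \<omega> (W :: nat \<Rightarrow> real \<Rightarrow> complex).
      \<lbrakk>0 < \<nu>; \<nu> < 1; \<kappa>0 \<le> \<bar>\<kappa>\<bar>; \<And>j y. (W j has_vector_derivative W (Suc j) y) (at y); \<And>j. W j L = W j 0\<rbrakk>
      \<Longrightarrow> \<epsilon> * \<nu> powr (real (max 2 m) / (real (max 2 m) + 4)) * interval_norm L (W 0)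
        \<le> interval_norm L (\<lambda>y. \<nu> * (W 4 y - 2 * \<kappa>\<^sup>2 * W 2 y + \<kappa> ^ 4 * W 0 y)
            + \<i> * of_real (\<kappa> * u y + \<omega>) * W 0 y)"
    unfolding u_def using resolvent_estimate[OF L m \<kappa>0] by blast
  have "(\<epsilon> * \<nu> powr (real (max 2 m) / (real (max 2 m) + 4)))\<^sup>2 * (\<Sum>l\<in>{- int N..int N}. (cmod (w l))\<^sup>2)
        \<le> (\<Sum>l\<in>{- int (N + m)..int (N + m)}.
            (cmod ((of_real (symbol L \<nu> \<kappa> l) + \<i> * of_real \<omega>) * w l + \<i> * of_real \<kappa> * sin_conv m w l))\<^sup>2)"
    if \<nu>: "0 < \<nu>" "\<nu> < 1" and \<kappa>: "\<kappa>0 \<le> \<bar>\<kappa>\<bar>" and w: "\<And>l. \<bar>l\<bar> > int N \<Longrightarrow> w l = 0" for \<nu> \<kappa> \<omega> w N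
  proof -
    define \<eta> where "\<eta> l = 2 * pi * of_int l / L" for l
    let ?B = "{- int N..int N}" and ?C = "{- int (N + m)..int (N + m)}"
    define W where "W j y = (\<Sum>l\<in>?B. (\<i> * of_real (\<eta> l)) ^ j * w l * wave L l y)" for j :: nat and y
    have dW: "(W j has_vector_derivative W (Suc j) y) (at y)" for j y
    proof -
      have d: "((\<lambda>y. (\<i> * of_real (\<eta> l)) ^ j * w l * wave L l y) has_vector_derivative
          (\<i> * of_real (\<eta> l)) ^ j * w l * (\<i> * of_real (\<eta> l) * wave L l y)) (at y)" for l
        unfolding \<eta>_def by (rule has_vector_derivative_mult_right[OF wave_has_vector_derivative])
      have "(\<Sum>l\<in>?B. (\<i> * of_real (\<eta> l)) ^ j * w l * (\<i> * of_real (\<eta> l) * wave L l y)) = W (Suc j) y"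
        unfolding W_def by (intro sum.cong) (simp_all add: mult_ac)
      moreover have "(W j has_vector_derivative (\<Sum>l\<in>?B. (\<i> * of_real (\<eta> l)) ^ j * w l * (\<i> * of_real (\<eta> l) * wave L l y))) (at y)"
        unfolding W_def[abs_def] by (rule has_vector_derivative_sum) (rule d)
      ultimately show ?thesis by simp
    qed
    have pW: "W j L = W j 0" for j using L by (simp add: W_def wave_L) (simp add: wave_def)
    define c where "c l = (of_real (symbol L \<nu> \<kappa> l) + \<i> * of_real \<omega>) * w l + \<i> * of_real \<kappa> * sin_conv m w l" for l
    have uW: "of_real (u y) * W 0 y = (\<Sum>l\<in>?C. sin_conv m w l * wave L l y)" for y
    proof -
      have "of_real (u y) * W 0 y = (\<Sum>j\<in>{- int m..int m}. \<Sum>l\<in>?B. sin_power_coeff m j * w l * wave L (l + j) y)"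
        unfolding u_def sin_power_wave W_def sum_product wave_add by (simp add: mult_ac)
      also have "\<dots> = (\<Sum>j\<in>{- int m..int m}. \<Sum>l\<in>?C. sin_power_coeff m j * w (l - j) * wave L l y)"
      proof (rule sum.cong[OF refl])
        fix j assume j: "j \<in> {- int m..int m}"
        have "(\<Sum>l\<in>?B. sin_power_coeff m j * w l * wave L (l + j) y) = (\<Sum>l\<in>?B. sin_power_coeff m j * w ((l + j) - j) * wave L (l + j) y)" by simp
        also have "\<dots> = (\<Sum>l\<in>{- int N + j..int N + j}. sin_power_coeff m j * w (l - j) * wave L l y)"
          by (rule sum_shift_int[of "\<lambda>l. sin_power_coeff m j * w (l - j) * wave L l y"])
        also have "\<dots> = (\<Sum>l\<in>?C. sin_power_coeff m j * w (l - j) * wave L l y)"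
          by (rule sum.mono_neutral_left) (use j in \<open>auto intro!: w\<close>)
        finally show "(\<Sum>l\<in>?B. sin_power_coeff m j * w l * wave L (l + j) y) = (\<Sum>l\<in>?C. sin_power_coeff m j * w (l - j) * wave L l y)" .
      qed
      also have "\<dots> = (\<Sum>l\<in>?C. sin_conv m w l * wave L l y)"
        unfolding sin_conv_def sum_distrib_right by (rule sum.swap)
      finally show ?thesis .
    qed
    have ext: "(\<Sum>l\<in>?B. g l * w l * wave L l y) = (\<Sum>l\<in>?C. g l * w l * wave L l y)" for g y
      by (rule sum.mono_neutral_left) (auto intro!: w)
    have Feq: "(\<lambda>y. \<nu> * (W 4 y - 2 * \<kappa>\<^sup>2 * W 2 y + \<kappa> ^ 4 * W 0 y) + \<i> * of_real (\<kappa> * u y + \<omega>) * W 0 y)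
       = (\<lambda>y. \<Sum>l\<in>?C. c l * wave L l y)"
    proof
      fix y
      have "\<nu> * (W 4 y - 2 * \<kappa>\<^sup>2 * W 2 y + \<kappa> ^ 4 * W 0 y) + \<i> * of_real \<omega> * W 0 y
         = (\<Sum>l\<in>?B. (\<nu> * ((\<i> * of_real (\<eta> l)) ^ 4 - 2 * \<kappa>\<^sup>2 * (\<i> * of_real (\<eta> l)) ^ 2 + \<kappa> ^ 4) + \<i> * of_real \<omega>) * w l * wave L l y)"
        unfolding W_def sum_distrib_left sum_subtractf[symmetric] sum.distrib[symmetric]
        by (intro sum.cong) (auto simp: algebra_simps)
      also have "\<dots> = (\<Sum>l\<in>?B. (of_real (symbol L \<nu> \<kappa> l) + \<i> * of_real \<omega>) * w l * wave L l y)"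
      proof -
        have "\<nu> * ((\<i> * of_real (\<eta> l)) ^ 4 - 2 * \<kappa>\<^sup>2 * (\<i> * of_real (\<eta> l)) ^ 2 + \<kappa> ^ 4) = complex_of_real (symbol L \<nu> \<kappa> l)" for l
          unfolding symbol_def \<eta>_def[symmetric] power_mult_distrib
          by (simp add: power4_eq_xxxx power2_eq_square algebra_simps)
        then show ?thesis by simp
      qed
      also have "\<dots> = (\<Sum>l\<in>?C. (of_real (symbol L \<nu> \<kappa> l) + \<i> * of_real \<omega>) * w l * wave L l y)" by (rule ext)
      finally have 1: "\<nu> * (W 4 y - 2 * \<kappa>\<^sup>2 * W 2 y + \<kappa> ^ 4 * W 0 y) + \<i> * of_real \<omega> * W 0 y
         = (\<Sum>l\<in>?C. (of_real (symbol L \<nu> \<kappa> l) + \<i> * of_real \<omega>) * w l * wave L l y)" .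
      have 2: "\<i> * of_real \<kappa> * (of_real (u y) * W 0 y) = (\<Sum>l\<in>?C. \<i> * of_real \<kappa> * sin_conv m w l * wave L l y)"
        unfolding uW sum_distrib_left by (simp add: mult.assoc)
      show "\<nu> * (W 4 y - 2 * \<kappa>\<^sup>2 * W 2 y + \<kappa> ^ 4 * W 0 y) + \<i> * of_real (\<kappa> * u y + \<omega>) * W 0 y = (\<Sum>l\<in>?C. c l * wave L l y)"
        using arg_cong2[OF 1 2, of "(+)"] unfolding sum.distrib[symmetric] c_def
        by (simp add: algebra_simps)
    qed
    have W0: "W 0 = (\<lambda>y. \<Sum>l\<in>?B. w l * wave L l y)" by (simp add: W_def fun_eq_iff)
    let ?e = "\<epsilon> * \<nu> powr (real (max 2 m) / (real (max 2 m) + 4))"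
    have "?e * interval_norm L (W 0) \<le> interval_norm L (\<lambda>y. \<Sum>l\<in>?C. c l * wave L l y)"
      unfolding Feq[symmetric] using est[of \<nu> \<kappa> W \<omega>, OF \<nu> \<kappa> dW pW] by simp
    then have "(?e * interval_norm L (W 0))\<^sup>2 \<le> (interval_norm L (\<lambda>y. \<Sum>l\<in>?C. c l * wave L l y))\<^sup>2"
      using \<epsilon> by (intro power_mono mult_nonneg_nonneg) auto
    then have "L * (?e\<^sup>2 * (\<Sum>l\<in>?B. (cmod (w l))\<^sup>2)) \<le> L * (\<Sum>l\<in>?C. (cmod (c l))\<^sup>2)"
      unfolding power_mult_distrib[of ?e] W0 interval_norm_wave_sum[OF L finite_atLeastAtMost_int]
      by (simp add: mult.left_commute)
    then show ?thesis using L unfolding c_def by simp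
  qed
  then show thesis using that[OF \<epsilon>] by blast
qed

text \<open>The triangular Fejer weights. Their Lipschitz constant \<open>1 / R\<close> makes
  commutators with finite-range convolutions vanish in the limit, which a sharp truncation would not
  do.\<close>

definition cutoff :: "nat \<Rightarrow> int \<Rightarrow> real" where
  "cutoff R l = max 0 (1 - \<bar>real_of_int l\<bar> / real R)"

lemma cutoff_bounds: "0 \<le> cutoff R l" "cutoff R l \<le> 1"
  by (auto simp: cutoff_def)

lemma cutoff_eq_0: "R > 0 \<Longrightarrow> \<bar>l\<bar> > int R \<Longrightarrow> cutoff R l = 0"
  by (auto simp: cutoff_def field_simps)

lemma cutoff_lipschitz:
  assumes "R > 0" shows "\<bar>cutoff R k - cutoff R l\<bar> \<le> \<bar>real_of_int (k - l)\<bar> / real R"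
proof -
  have "\<bar>max 0 (1 - x) - max 0 (1 - y)\<bar> \<le> \<bar>x - y\<bar>" for x y :: real by linarith
  from this[of "\<bar>real_of_int k\<bar> / real R" "\<bar>real_of_int l\<bar> / real R"]
  have "\<bar>cutoff R k - cutoff R l\<bar> \<le> \<bar>\<bar>real_of_int k\<bar> / real R - \<bar>real_of_int l\<bar> / real R\<bar>"
    unfolding cutoff_def .
  also have "\<dots> = \<bar>\<bar>real_of_int k\<bar> - \<bar>real_of_int l\<bar>\<bar> / real R"
    using assms by (simp add: diff_divide_distrib[symmetric])
  also have "\<dots> \<le> \<bar>real_of_int k - real_of_int l\<bar> / real R"
    by (intro divide_right_mono abs_triangle_ineq3) auto
  finally show ?thesis by simp
qed

lemma cutoff_tendsto: "(\<lambda>R. cutoff R l) \<longlonglongrightarrow> 1"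
proof -
  have "(\<lambda>R. \<bar>real_of_int l\<bar> / real R) \<longlonglongrightarrow> 0" by (rule lim_const_over_n)
  then have "(\<lambda>R. max 0 (1 - \<bar>real_of_int l\<bar> / real R)) \<longlonglongrightarrow> max 0 (1 - 0)"
    by (intro tendsto_intros)
  then show ?thesis by (simp add: cutoff_def)
qed

text \<open>Apply the finite estimate to the truncated sequence. The diagonal factor commutes with
  the truncation however fast it grows, and the convolution leaves an error of order
  \<open>1 / R\<close> in \<open>l^2\<close>; then let \<open>R\<close> tend to infinity.\<close>

lemma resolvent_estimate_l2:
  fixes d w :: "int \<Rightarrow> complex" and \<kappa> \<Psi> :: real and m :: nat
  defines "A \<equiv> \<lambda>w l. d l * w l + \<i> * of_real \<kappa> * sin_conv m w l"
  assumes fin: "\<And>w N. (\<And>l. \<bar>l\<bar> > int N \<Longrightarrow> w l = 0) \<Longrightarrow>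
      \<Psi>\<^sup>2 * (\<Sum>l\<in>{- int N..int N}. (cmod (w l))\<^sup>2) \<le> (\<Sum>l\<in>{- int (N + m)..int (N + m)}. (cmod (A w l))\<^sup>2)"
    and w: "\<And>F. finite F \<Longrightarrow> (\<Sum>l\<in>F. (cmod (w l))\<^sup>2) \<le> B"
    and g: "\<And>F. finite F \<Longrightarrow> (\<Sum>l\<in>F. (cmod (A w l))\<^sup>2) \<le> g"
    and F: "finite F"
  shows "\<Psi>\<^sup>2 * (\<Sum>l\<in>F. (cmod (w l))\<^sup>2) \<le> g"
proof -
  have B0: "0 \<le> B" using w[of "{}"] by simp
  have g0: "0 \<le> g" using g[of "{}"] by simp
  define J where "J = {- int m..int m}"
  have J: "finite J" "real (card J) = 2 * real m + 1" by (simp_all add: J_def)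
  \<comment> \<open>One factor \<open>2 * real m + 1\<close> under the square root comes from
    Cauchy--Schwarz over the offsets, another from the number of shifted copies of
    \<open>w\<close>.\<close>
  define q where "q = \<bar>\<kappa>\<bar> * real m * (2 * real m + 1) * sqrt B"
  have q0: "q \<ge> 0" using B0 by (simp add: q_def)
  have main: "\<Psi>\<^sup>2 * (\<Sum>l\<in>F. (cutoff R l)\<^sup>2 * (cmod (w l))\<^sup>2) \<le> (sqrt g + q / real R)\<^sup>2" if R: "R > 0" for R
  proof -
    let ?\<rho> = "cutoff R"
    define v where "v l = of_real (?\<rho> l) * w l" for l
    \<comment> \<open>The commutator of the convolution with the cutoff.\<close>
    define E where "E l = \<i> * of_real \<kappa> * (\<Sum>j\<in>J. sin_power_coeff m j * of_real (?\<rho> (l - j) - ?\<rho> l) * w (l - j))" for l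
    let ?C = "{- int (R + m)..int (R + m)}"
    have v0: "\<bar>l\<bar> > int R \<Longrightarrow> v l = 0" for l using cutoff_eq_0[OF R] by (simp add: v_def)
    have Av: "A v l = of_real (?\<rho> l) * A w l + E l" for l
      unfolding A_def E_def v_def sin_conv_def J_def
      by (simp add: sum_distrib_left sum_subtractf algebra_simps)
    have El: "(cmod (E l))\<^sup>2 \<le> (\<bar>\<kappa>\<bar> * (real m / real R))\<^sup>2 * ((2 * real m + 1) * (\<Sum>j\<in>J. (cmod (w (l - j)))\<^sup>2))" for l
    proof -
      have "cmod (\<Sum>j\<in>J. sin_power_coeff m j * of_real (?\<rho> (l - j) - ?\<rho> l) * w (l - j)) \<le> (\<Sum>j\<in>J. (real m / real R) * cmod (w (l - j)))"
      proof (rule sum_norm_le)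
        fix j assume j: "j \<in> J"
        have "\<bar>?\<rho> (l - j) - ?\<rho> l\<bar> \<le> \<bar>real_of_int ((l - j) - l)\<bar> / real R" by (rule cutoff_lipschitz[OF R])
        also have "\<dots> \<le> real m / real R" using j R by (intro divide_right_mono) (auto simp: J_def)
        finally have "\<bar>?\<rho> (l - j) - ?\<rho> l\<bar> \<le> real m / real R" .
        then have "cmod (sin_power_coeff m j) * \<bar>?\<rho> (l - j) - ?\<rho> l\<bar> \<le> 1 * (real m / real R)"
          by (intro mult_mono sin_power_coeff_le_1) auto
        then show "cmod (sin_power_coeff m j * of_real (?\<rho> (l - j) - ?\<rho> l) * w (l - j)) \<le> real m / real R * cmod (w (l - j))"
          unfolding norm_mult norm_of_real by (intro mult_right_mono) auto
      qed
      then have "cmod (\<Sum>j\<in>J. sin_power_coeff m j * of_real (?\<rho> (l - j) - ?\<rho> l) * w (l - j))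
          \<le> (real m / real R) * (\<Sum>j\<in>J. cmod (w (l - j)))"
        by (simp only: sum_distrib_left)
      from mult_left_mono[OF this abs_ge_zero, of \<kappa>]
      have "cmod (E l) \<le> \<bar>\<kappa>\<bar> * ((real m / real R) * (\<Sum>j\<in>J. cmod (w (l - j))))"
        unfolding E_def by (simp only: norm_mult norm_ii norm_of_real mult_1_left)
      then have "(cmod (E l))\<^sup>2 \<le> (\<bar>\<kappa>\<bar> * ((real m / real R) * (\<Sum>j\<in>J. cmod (w (l - j)))))\<^sup>2" by (intro power_mono) auto
      also have "\<dots> = (\<bar>\<kappa>\<bar> * (real m / real R))\<^sup>2 * (\<Sum>j\<in>J. cmod (w (l - j)))\<^sup>2" by (simp add: power_mult_distrib power_divide)
      also have "\<dots> \<le> (\<bar>\<kappa>\<bar> * (real m / real R))\<^sup>2 * ((\<Sum>j\<in>J. (cmod (w (l - j)))\<^sup>2) * real (card J))"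
        by (intro mult_left_mono sum_squared_le_sum_of_squares J) auto
      finally show ?thesis by (simp add: J(2) mult.commute)
    qed
    have "(\<Sum>l\<in>?C. (cmod (E l))\<^sup>2) \<le> (\<Sum>l\<in>?C. (\<bar>\<kappa>\<bar> * (real m / real R))\<^sup>2 * ((2 * real m + 1) * (\<Sum>j\<in>J. (cmod (w (l - j)))\<^sup>2)))"
      by (intro sum_mono El)
    also have "\<dots> = (\<bar>\<kappa>\<bar> * (real m / real R))\<^sup>2 * ((2 * real m + 1) * (\<Sum>j\<in>J. \<Sum>l\<in>?C. (cmod (w (l - j)))\<^sup>2))"
      unfolding sum_distrib_left[symmetric] by (subst sum.swap) simp
    also have "\<dots> \<le> (\<bar>\<kappa>\<bar> * (real m / real R))\<^sup>2 * ((2 * real m + 1) * (\<Sum>j\<in>J. B))"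
    proof (intro mult_left_mono sum_mono)
      fix j
      have "(\<Sum>l\<in>?C. (cmod (w (l + - j)))\<^sup>2) = (\<Sum>l\<in>{- int (R + m) + - j..int (R + m) + - j}. (cmod (w l))\<^sup>2)"
        by (rule sum_shift_int[of "\<lambda>l. (cmod (w l))\<^sup>2"])
      also have "\<dots> \<le> B" by (rule w) simp
      finally show "(\<Sum>l\<in>?C. (cmod (w (l - j)))\<^sup>2) \<le> B" by simp
    qed auto
    also have "\<dots> = (q / real R)\<^sup>2"
      using B0 J(2) by (simp add: q_def power_mult_distrib power_divide) (simp add: power2_eq_square)
    finally have "L2_set (\<lambda>l. cmod (E l)) ?C \<le> sqrt ((q / real R)\<^sup>2)"
      unfolding L2_set_def by (rule real_sqrt_le_mono)
    then have E: "L2_set (\<lambda>l. cmod (E l)) ?C \<le> q / real R" using q0 by simp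
    have "L2_set (\<lambda>l. cmod (A v l)) ?C \<le> L2_set (\<lambda>l. cmod (A w l) + cmod (E l)) ?C"
    proof (rule L2_set_mono)
      fix l
      have "cmod (A v l) \<le> ?\<rho> l * cmod (A w l) + cmod (E l)"
        unfolding Av using cutoff_bounds(1)[of R l] norm_triangle_ineq[of "of_real (?\<rho> l) * A w l" "E l"]
        by (simp add: norm_mult)
      also have "?\<rho> l * cmod (A w l) \<le> 1 * cmod (A w l)" by (intro mult_right_mono cutoff_bounds) auto
      finally show "cmod (A v l) \<le> cmod (A w l) + cmod (E l)" by simp
    qed auto
    also have "\<dots> \<le> L2_set (\<lambda>l. cmod (A w l)) ?C + L2_set (\<lambda>l. cmod (E l)) ?C" by (rule L2_set_triangle_ineq)
    also have "L2_set (\<lambda>l. cmod (A w l)) ?C \<le> sqrt g"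
      unfolding L2_set_def by (intro real_sqrt_le_mono g) simp
    finally have "L2_set (\<lambda>l. cmod (A v l)) ?C \<le> sqrt g + q / real R" using E by simp
    then have "(L2_set (\<lambda>l. cmod (A v l)) ?C)\<^sup>2 \<le> (sqrt g + q / real R)\<^sup>2" by (intro power_mono) auto
    then have "(\<Sum>l\<in>?C. (cmod (A v l))\<^sup>2) \<le> (sqrt g + q / real R)\<^sup>2" by (simp add: L2_set_def sum_nonneg)
    with fin[of R v, OF v0] have "\<Psi>\<^sup>2 * (\<Sum>l\<in>{- int R..int R}. (cmod (v l))\<^sup>2) \<le> (sqrt g + q / real R)\<^sup>2" by linarith
    moreover have "(\<Sum>l\<in>F. (cutoff R l)\<^sup>2 * (cmod (w l))\<^sup>2) \<le> (\<Sum>l\<in>{- int R..int R}. (cmod (v l))\<^sup>2)"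
    proof -
      have "(\<Sum>l\<in>F. (cutoff R l)\<^sup>2 * (cmod (w l))\<^sup>2) = (\<Sum>l\<in>F. (cmod (v l))\<^sup>2)"
        by (simp add: v_def norm_mult power_mult_distrib)
      also have "\<dots> = (\<Sum>l\<in>F \<inter> {- int R..int R}. (cmod (v l))\<^sup>2)"
      proof (rule sum.mono_neutral_right[OF F])
        have "v l = 0" if "l \<notin> {- int R..int R}" for l using that by (intro v0) auto
        then show "\<forall>l\<in>F - F \<inter> {- int R..int R}. (cmod (v l))\<^sup>2 = 0" by auto
      qed auto
      also have "\<dots> \<le> (\<Sum>l\<in>{- int R..int R}. (cmod (v l))\<^sup>2)" by (rule sum_mono2) auto
      finally show ?thesis .
    qed
    ultimately show ?thesis by (meson mult_left_mono order_trans zero_le_power2)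
  qed
  have "(\<lambda>R. \<Psi>\<^sup>2 * (\<Sum>l\<in>F. (cutoff R l)\<^sup>2 * (cmod (w l))\<^sup>2)) \<longlonglongrightarrow> \<Psi>\<^sup>2 * (\<Sum>l\<in>F. 1\<^sup>2 * (cmod (w l))\<^sup>2)"
    by (intro tendsto_intros cutoff_tendsto)
  moreover have "(\<lambda>R. (sqrt g + q / real R)\<^sup>2) \<longlonglongrightarrow> (sqrt g + 0)\<^sup>2"
    by (intro tendsto_intros lim_const_over_n)
  ultimately have "\<Psi>\<^sup>2 * (\<Sum>l\<in>F. 1\<^sup>2 * (cmod (w l))\<^sup>2) \<le> (sqrt g + 0)\<^sup>2"
    by (rule LIMSEQ_le) (use main in \<open>auto intro!: exI[of _ 1]\<close>)
  then show ?thesis using g0 by simp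
qed

section \<open>Energy decay of a single frequency in x\<close>

text \<open>The symmetrisation behind the energy identity: the cutoff commutes with the multiplication
  operator up to an error of size \<open>1/R\<close>, and the multiplication operator itself is self-adjoint.\<close>

lemma cutoff_flux_bound:
  fixes w :: "int \<Rightarrow> complex"
  assumes R: "R > 0" and w: "\<And>F. finite F \<Longrightarrow> (\<Sum>l\<in>F. (cmod (w l))\<^sup>2) \<le> B"
  shows "\<bar>Im (\<Sum>l\<in>{- int R..int R}. of_real (cutoff R l) * (sin_conv m w l * cnj (w l)))\<bar>
    \<le> real m * (2 * real m + 1) * B / real R"
proof -
  let ?\<rho> = "cutoff R"
  define J where "J = {- int m..int m}"
  \<comment> \<open>The index set is larger than the support of the cutoff in order to be invariant
    under the involution \<open>(l, j) \<mapsto> (l - j, - j)\<close>, which exchanges the two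
    factors of \<open>w\<close>.\<close>
  define P where "P = {(l, j). j \<in> J \<and> (\<bar>l\<bar> \<le> int R \<or> \<bar>l - j\<bar> \<le> int R)}"
  define X where "X = (\<Sum>(l, j)\<in>P. of_real (?\<rho> l) * (sin_power_coeff m j * w (l - j) * cnj (w l)))"
  have sub: "P \<subseteq> {- int (R + m)..int (R + m)} \<times> J" by (auto simp: P_def J_def)
  then have finP: "finite P" by (rule finite_subset) (simp add: J_def)
  have X: "(\<Sum>l\<in>{- int R..int R}. of_real (?\<rho> l) * (sin_conv m w l * cnj (w l))) = X"
  proof -
    have "(\<Sum>l\<in>{- int R..int R}. of_real (?\<rho> l) * (sin_conv m w l * cnj (w l)))
       = (\<Sum>(l, j)\<in>{- int R..int R} \<times> J. of_real (?\<rho> l) * (sin_power_coeff m j * w (l - j) * cnj (w l)))"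
      unfolding sum.cartesian_product[symmetric] sin_conv_def J_def sum_distrib_left sum_distrib_right ..
    also have "\<dots> = X" unfolding X_def
    proof (rule sum.mono_neutral_left[OF finP])
      have "cutoff R l = 0" if "l \<notin> {- int R..int R}" for l
        using that by (intro cutoff_eq_0[OF R]) auto
      then show "\<forall>p\<in>P - {- int R..int R} \<times> J. (case p of (l, j) \<Rightarrow> of_real (?\<rho> l) * (sin_power_coeff m j * w (l - j) * cnj (w l))) = 0"
        unfolding P_def by (intro ballI) (clarsimp simp del: atLeastAtMost_iff, blast)
    qed (auto simp: P_def)
    finally show ?thesis .
  qed
  have inv: "bij_betw (\<lambda>(l, j). (l - j, - j)) P P"
    by (rule bij_betw_byWitness[where f'="\<lambda>(l, j). (l - j, - j)"]) (auto simp: P_def J_def)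
  have cX: "cnj X = (\<Sum>(l, j)\<in>P. of_real (?\<rho> (l - j)) * (sin_power_coeff m j * w (l - j) * cnj (w l)))"
  proof -
    have "cnj X = (\<Sum>(l, j)\<in>P. of_real (?\<rho> l) * (sin_power_coeff m (- j) * cnj (w (l - j)) * w l))"
      unfolding X_def by (simp add: case_prod_unfold sin_power_coeff_cnj)
    also have "\<dots> = (\<Sum>(l, j)\<in>P. of_real (?\<rho> (l - j)) * (sin_power_coeff m j * w (l - j) * cnj (w l)))"
      by (subst sum.reindex_bij_betw[OF inv, symmetric]) (simp add: case_prod_unfold mult_ac)
    finally show ?thesis .
  qed
  \<comment> \<open>In \<open>X - cnj X\<close> each cutoff value appears only through its
    difference with a neighbour at distance at most \<open>m\<close>, hence the gain
    \<open>1 / R\<close>.\<close>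
  have "2 * \<bar>Im X\<bar> = cmod (X - cnj X)" by (simp add: complex_diff_cnj norm_mult)
  also have "X - cnj X = (\<Sum>(l, j)\<in>P. of_real (?\<rho> l - ?\<rho> (l - j)) * (sin_power_coeff m j * w (l - j) * cnj (w l)))"
    unfolding cX unfolding X_def sum_subtractf[symmetric] case_prod_unfold by (simp add: left_diff_distrib)
  also have "cmod \<dots> \<le> (\<Sum>(l, j)\<in>P. real m / real R * (((cmod (w (l - j)))\<^sup>2 + (cmod (w l))\<^sup>2) / 2))"
    unfolding case_prod_unfold
  proof (rule sum_norm_le)
    fix p assume "p \<in> P"
    then obtain l j where p: "p = (l, j)" and j: "j \<in> J" by (cases p) (auto simp: P_def)
    have "\<bar>?\<rho> l - ?\<rho> (l - j)\<bar> \<le> \<bar>real_of_int (l - (l - j))\<bar> / real R" by (rule cutoff_lipschitz[OF R])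
    also have "\<dots> \<le> real m / real R" using j R by (intro divide_right_mono) (auto simp: J_def)
    finally have 1: "\<bar>?\<rho> l - ?\<rho> (l - j)\<bar> \<le> real m / real R" .
    have "cmod (sin_power_coeff m j) * cmod (w (l - j)) * cmod (w l) \<le> 1 * cmod (w (l - j)) * cmod (w l)"
      by (intro mult_right_mono sin_power_coeff_le_1) auto
    also have "\<dots> \<le> ((cmod (w (l - j)))\<^sup>2 + (cmod (w l))\<^sup>2) / 2"
      using sum_squares_bound[of "cmod (w (l - j))" "cmod (w l)"] by simp
    finally have 2: "cmod (sin_power_coeff m j) * cmod (w (l - j)) * cmod (w l) \<le> ((cmod (w (l - j)))\<^sup>2 + (cmod (w l))\<^sup>2) / 2" .
    have "cmod (of_real (?\<rho> l - ?\<rho> (l - j)) * (sin_power_coeff m j * w (l - j) * cnj (w l)))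
        = \<bar>?\<rho> l - ?\<rho> (l - j)\<bar> * (cmod (sin_power_coeff m j) * cmod (w (l - j)) * cmod (w l))"
      by (simp only: norm_mult norm_of_real complex_mod_cnj)
    also have "\<dots> \<le> real m / real R * (((cmod (w (l - j)))\<^sup>2 + (cmod (w l))\<^sup>2) / 2)"
      using 1 2 by (intro mult_mono) auto
    finally show "cmod (of_real (?\<rho> (fst p) - ?\<rho> (fst p - snd p)) * (sin_power_coeff m (snd p) * w (fst p - snd p) * cnj (w (fst p))))
      \<le> real m / real R * (((cmod (w (fst p - snd p)))\<^sup>2 + (cmod (w (fst p)))\<^sup>2) / 2)" by (simp add: p)
  qed
  also have "\<dots> = real m / real R * ((\<Sum>(l, j)\<in>P. (cmod (w (l - j)))\<^sup>2) + (\<Sum>(l, j)\<in>P. (cmod (w l))\<^sup>2)) / 2"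
    unfolding case_prod_unfold sum_distrib_left[symmetric] sum_divide_distrib[symmetric] sum.distrib by simp
  also have "(\<Sum>(l, j)\<in>P. (cmod (w (l - j)))\<^sup>2) = (\<Sum>(l, j)\<in>P. (cmod (w l))\<^sup>2)"
    by (subst sum.reindex_bij_betw[OF inv, symmetric]) (simp add: case_prod_unfold)
  also have "(\<Sum>(l, j)\<in>P. (cmod (w l))\<^sup>2) \<le> (\<Sum>(l, j)\<in>{- int (R + m)..int (R + m)} \<times> J. (cmod (w l))\<^sup>2)"
    by (rule sum_mono2[OF _ sub]) (auto simp: J_def)
  also have "\<dots> = real (card J) * (\<Sum>l\<in>{- int (R + m)..int (R + m)}. (cmod (w l))\<^sup>2)"
    unfolding sum.cartesian_product[symmetric] by (simp add: sum_distrib_left)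
  also have "\<dots> \<le> real (card J) * B" by (intro mult_left_mono w) auto
  finally have "2 * \<bar>Im X\<bar> \<le> real m / real R * (real (card J) * B + real (card J) * B) / 2"
    by (simp add: mult_left_mono divide_right_mono)
  also have "\<dots> = real m * real (card J) * B / real R" by simp
  also have "real (card J) = 2 * real m + 1" by (simp add: J_def)
  finally have "2 * \<bar>Im X\<bar> \<le> real m * (2 * real m + 1) * B / real R" .
  then show ?thesis unfolding X by linarith
qed

lemma Im_complex_of_real_mult: "Im (of_real c * z) = c * Im z"
  by simp

text \<open>One row of Fourier coefficients, at fixed frequency \<open>\<kappa>\<close> in
  \<open>x\<close>. The equation is required coefficientwise, one-sided at time 0, and the
  \<open>l^2\<close> bound is expressed through finite partial sums, locally uniformly in
  time.\<close>

locale shear_system =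
  fixes m :: nat and \<kappa> :: real and d :: "int \<Rightarrow> real" and a :: "real \<Rightarrow> int \<Rightarrow> complex"
  assumes d_nonneg: "0 \<le> d l"
    and ode: "0 \<le> t \<Longrightarrow> ((\<lambda>t. a t l) has_vector_derivative
        - (of_real (d l) * a t l + \<i> * of_real \<kappa> * sin_conv m (a t) l)) (at t within {0..})"
    and bounded: "\<exists>B. \<forall>t\<in>{0..T}. \<forall>F. finite F \<longrightarrow> (\<Sum>l\<in>F. (cmod (a t l))\<^sup>2) \<le> B"
begin

lemma a_continuous: "continuous_on {0..} (\<lambda>t. a t l)"
  by (rule continuous_on_vector_derivative[OF ode]) simp

lemma a_continuous' [continuous_intros]: "A \<subseteq> {0..} \<Longrightarrow> continuous_on A (\<lambda>t. a t l)"
  by (rule continuous_on_subset[OF a_continuous])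

lemma shift:
  assumes "s \<ge> 0" shows "shear_system m \<kappa> d (\<lambda>t. a (s + t))"
proof
  show "0 \<le> d l" for l by (rule d_nonneg)
  show "((\<lambda>t. a (s + t) l) has_vector_derivative
        - (of_real (d l) * a (s + t) l + \<i> * of_real \<kappa> * sin_conv m (a (s + t)) l)) (at t within {0..})"
    if t: "0 \<le> t" for t l
  proof -
    have "((\<lambda>t. a t l) has_vector_derivative
        - (of_real (d l) * a (s + t) l + \<i> * of_real \<kappa> * sin_conv m (a (s + t)) l)) (at (s + t) within (\<lambda>t. s + t) ` {0..})"
      by (rule has_vector_derivative_within_subset[OF ode]) (use assms t in auto)
    moreover have "((\<lambda>t. s + t) has_vector_derivative 1) (at t within {0..})"
      by (auto intro!: derivative_eq_intros)
    ultimately show ?thesis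
      using vector_diff_chain_within[of "\<lambda>t. s + t" 1 t "{0..}" "\<lambda>t. a t l"] by (simp add: o_def)
  qed
  show "\<exists>B. \<forall>t\<in>{0..T}. \<forall>F. finite F \<longrightarrow> (\<Sum>l\<in>F. (cmod (a (s + t) l))\<^sup>2) \<le> B" for T
    using bounded[of "s + T"] assms by (metis add_increasing add_left_mono atLeastAtMost_iff)
qed

text \<open>The energy weighted by \<open>cutoff R\<close> is a finite sum of differentiable
  functions. Its derivative is at most the flux through the cutoff, which is \<open>O(1/R)\<close>
  uniformly on the time interval; the mean value theorem and the limit in \<open>R\<close> remove
  the weight.\<close>

lemma energy_nonincreasing:
  assumes st: "0 \<le> s" "s \<le> t" and K: "\<And>F. finite F \<Longrightarrow> (\<Sum>l\<in>F. (cmod (a s l))\<^sup>2) \<le> K"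
    and F: "finite F"
  shows "(\<Sum>l\<in>F. (cmod (a t l))\<^sup>2) \<le> K"
proof (cases "s = t")
  case True then show ?thesis using K F by simp
next
  case False
  with st have lt: "s < t" by simp
  obtain B where B: "\<And>\<tau> F. \<tau> \<in> {0..t} \<Longrightarrow> finite F \<Longrightarrow> (\<Sum>l\<in>F. (cmod (a \<tau> l))\<^sup>2) \<le> B"
    using bounded[of t] by blast
  define c where "c = 2 * \<bar>\<kappa>\<bar> * (real m * (2 * real m + 1) * B) * (t - s)"
  have main: "(\<Sum>l\<in>F. cutoff R l * (cmod (a t l))\<^sup>2) \<le> K + c / real R" if R: "R > 0" for R
  proof -
    let ?D = "{- int R..int R}"
    define E where "E \<tau> = (\<Sum>l\<in>?D. cutoff R l * (cmod (a \<tau> l))\<^sup>2)" for \<tau>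
    define a' where "a' \<tau> l = - (of_real (d l) * a \<tau> l + \<i> * of_real \<kappa> * sin_conv m (a \<tau>) l)" for \<tau> l
    define E' where "E' \<tau> = (\<Sum>l\<in>?D. cutoff R l * (2 * Re (a' \<tau> l * cnj (a \<tau> l))))" for \<tau>
    have dE: "(E has_real_derivative E' \<tau>) (at \<tau> within {s..t})" if \<tau>: "\<tau> \<in> {s..t}" for \<tau>
    proof -
      have "((\<lambda>\<tau>. (cmod (a \<tau> l))\<^sup>2) has_real_derivative 2 * Re (a' \<tau> l * cnj (a \<tau> l))) (at \<tau> within {s..t})" for l
      proof -
        have da: "((\<lambda>t. a t l) has_vector_derivative a' \<tau> l) (at \<tau> within {s..t})"
          unfolding a'_def by (rule has_vector_derivative_within_subset[OF ode]) (use \<tau> st in auto)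
        have "((\<lambda>\<tau>. Re (a \<tau> l) * Re (a \<tau> l) + Im (a \<tau> l) * Im (a \<tau> l)) has_real_derivative
            (Re (a' \<tau> l) * Re (a \<tau> l) + Re (a' \<tau> l) * Re (a \<tau> l)) + (Im (a' \<tau> l) * Im (a \<tau> l) + Im (a' \<tau> l) * Im (a \<tau> l))) (at \<tau> within {s..t})"
          by (intro DERIV_add DERIV_mult has_field_derivative_Re[OF da] has_field_derivative_Im[OF da])
        then show ?thesis unfolding cmod_power2 by (simp add: power2_eq_square algebra_simps)
      qed
      then show ?thesis unfolding E_def[abs_def] E'_def
        by (intro DERIV_sum DERIV_cmult)
    qed
    have E'_le: "E' \<tau> \<le> 2 * \<bar>\<kappa>\<bar> * (real m * (2 * real m + 1) * B / real R)" if \<tau>: "\<tau> \<in> {s..t}" for \<tau>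
    proof -
      define X where "X = (\<Sum>l\<in>?D. of_real (cutoff R l) * (sin_conv m (a \<tau>) l * cnj (a \<tau> l)))"
      \<comment> \<open>The diagonal part enters with the sign of dissipation and is
        dropped.\<close>
      have pt: "cutoff R l * (2 * Re (a' \<tau> l * cnj (a \<tau> l)))
          \<le> 2 * \<kappa> * Im (of_real (cutoff R l) * (sin_conv m (a \<tau>) l * cnj (a \<tau> l)))" for l
      proof -
        have R': "Re (a' \<tau> l * cnj (a \<tau> l)) = - d l * (cmod (a \<tau> l))\<^sup>2 + \<kappa> * Im (sin_conv m (a \<tau>) l * cnj (a \<tau> l))"
          unfolding cmod_power2 by (simp add: a'_def power2_eq_square algebra_simps)
        have "cutoff R l * (2 * Re (a' \<tau> l * cnj (a \<tau> l)))
            = 2 * \<kappa> * (cutoff R l * Im (sin_conv m (a \<tau>) l * cnj (a \<tau> l))) - 2 * (cutoff R l * (d l * (cmod (a \<tau> l))\<^sup>2))"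
          unfolding R' by algebra
        moreover have "0 \<le> cutoff R l * (d l * (cmod (a \<tau> l))\<^sup>2)" using d_nonneg cutoff_bounds(1)[of R l] by simp
        moreover have "Im (of_real (cutoff R l) * (sin_conv m (a \<tau>) l * cnj (a \<tau> l))) = cutoff R l * Im (sin_conv m (a \<tau>) l * cnj (a \<tau> l))"
          by (rule Im_complex_of_real_mult)
        ultimately show ?thesis by simp
      qed
      have "E' \<tau> \<le> (\<Sum>l\<in>?D. 2 * \<kappa> * Im (of_real (cutoff R l) * (sin_conv m (a \<tau>) l * cnj (a \<tau> l))))"
        unfolding E'_def by (rule sum_mono[OF pt])
      also have "\<dots> = 2 * \<kappa> * Im X" unfolding X_def Im_sum sum_distrib_left ..
      also have "\<dots> \<le> 2 * \<bar>\<kappa>\<bar> * \<bar>Im X\<bar>"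
        by (metis abs_ge_self abs_mult abs_numeral)
      also have "\<dots> \<le> 2 * \<bar>\<kappa>\<bar> * (real m * (2 * real m + 1) * B / real R)"
        unfolding X_def using \<tau> st by (intro mult_left_mono cutoff_flux_bound R B) auto
      finally show ?thesis .
    qed
    obtain \<xi> where \<xi>: "\<xi> \<in> {s<..<t}" "E t - E s = E' \<xi> * (t - s)"
      using mvt_simple[OF lt, of E "\<lambda>\<tau> x. E' \<tau> * x"] dE unfolding has_field_derivative_def by auto
    have "E t - E s \<le> 2 * \<bar>\<kappa>\<bar> * (real m * (2 * real m + 1) * B / real R) * (t - s)"
      unfolding \<xi>(2) using E'_le[of \<xi>] \<xi>(1) lt by (intro mult_right_mono) auto
    also have "\<dots> = c / real R" by (simp add: c_def)
    finally have "E t \<le> E s + c / real R" by simp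
    also have "E s \<le> (\<Sum>l\<in>?D. 1 * (cmod (a s l))\<^sup>2)"
      unfolding E_def by (intro sum_mono mult_right_mono cutoff_bounds) auto
    also have "\<dots> \<le> K" using K[of ?D] by simp
    finally have "E t \<le> K + c / real R" by simp
    moreover have "(\<Sum>l\<in>F. cutoff R l * (cmod (a t l))\<^sup>2) \<le> E t"
    proof -
      have "(\<Sum>l\<in>F. cutoff R l * (cmod (a t l))\<^sup>2) = (\<Sum>l\<in>F \<inter> ?D. cutoff R l * (cmod (a t l))\<^sup>2)"
      proof (rule sum.mono_neutral_right[OF F])
        have "cutoff R l = 0" if "l \<notin> ?D" for l using that by (intro cutoff_eq_0[OF R]) auto
        then show "\<forall>l\<in>F - F \<inter> ?D. cutoff R l * (cmod (a t l))\<^sup>2 = 0" by auto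
      qed auto
      also have "\<dots> \<le> E t" unfolding E_def by (rule sum_mono2) (auto simp: cutoff_bounds)
      finally show ?thesis .
    qed
    ultimately show ?thesis by linarith
  qed
  have "(\<lambda>R. \<Sum>l\<in>F. cutoff R l * (cmod (a t l))\<^sup>2) \<longlonglongrightarrow> (\<Sum>l\<in>F. 1 * (cmod (a t l))\<^sup>2)"
    by (intro tendsto_intros cutoff_tendsto)
  moreover have "(\<lambda>R. K + c / real R) \<longlonglongrightarrow> K + 0"
    by (intro tendsto_intros lim_const_over_n)
  ultimately have "(\<Sum>l\<in>F. 1 * (cmod (a t l))\<^sup>2) \<le> K + 0"
    by (rule LIMSEQ_le) (use main in \<open>auto intro!: exI[of _ 1]\<close>)
  then show ?thesis by simp
qed

definition energy :: "real \<Rightarrow> real" where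
  "energy t = infsum (\<lambda>l. (cmod (a t l))\<^sup>2) UNIV"

lemma energy_has_sum:
  assumes "t \<ge> 0" shows "((\<lambda>l. (cmod (a t l))\<^sup>2) has_sum energy t) UNIV"
proof -
  from bounded[of t] obtain B where "\<forall>t'\<in>{0..t}. \<forall>F. finite F \<longrightarrow> (\<Sum>l\<in>F. (cmod (a t' l))\<^sup>2) \<le> B"
    by blast
  with assms have "(\<Sum>l\<in>F. (cmod (a t l))\<^sup>2) \<le> B" if "finite F" for F using that by simp
  then have "(\<lambda>l. (cmod (a t l))\<^sup>2) summable_on UNIV"
    by (intro nonneg_bdd_above_summable_on bdd_aboveI2[where M=B]) auto
  then show ?thesis by (simp add: energy_def)
qed

lemma sum_le_energy:
  assumes "t \<ge> 0" "finite F" shows "(\<Sum>l\<in>F. (cmod (a t l))\<^sup>2) \<le> energy t"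
  unfolding energy_def
  by (rule finite_sum_le_infsum[OF has_sum_imp_summable[OF energy_has_sum[OF assms(1)]] assms(2)]) auto

lemma energy_le:
  assumes "t \<ge> 0" "\<And>F. finite F \<Longrightarrow> (\<Sum>l\<in>F. (cmod (a t l))\<^sup>2) \<le> K" shows "energy t \<le> K"
  unfolding energy_def
  by (rule infsum_le_finite_sums[OF has_sum_imp_summable[OF energy_has_sum[OF assms(1)]]]) (use assms(2) in auto)

lemma energy_mono: "\<lbrakk>0 \<le> s; s \<le> t\<rbrakk> \<Longrightarrow> energy t \<le> energy s"
  by (intro energy_le energy_nonincreasing[of s t "energy s"] sum_le_energy) auto

end

section \<open>Unordered sums, and elementary integrals for the cutoff in time\<close>

lemma has_sum_finite_sum:
  fixes f :: "'n \<Rightarrow> 'l \<Rightarrow> real"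
  assumes "finite Q" "\<And>n. n \<in> Q \<Longrightarrow> (f n has_sum s n) A"
  shows "((\<lambda>l. \<Sum>n\<in>Q. f n l) has_sum (\<Sum>n\<in>Q. s n)) A"
  using assms by (induction Q rule: finite_induct) (auto intro: has_sum_add has_sum_0)

lemma has_sum_le_of_finite_sums:
  fixes f :: "'l \<Rightarrow> real"
  assumes "(f has_sum s) UNIV" "\<And>F. finite F \<Longrightarrow> sum f F \<le> b"
  shows "s \<le> b"
  using infsum_le_finite_sums[OF has_sum_imp_summable[OF assms(1)], of b] assms infsumI by auto

text \<open>Symmetric intervals are cofinal among finite sets of integers; this turns an unordered
  sum into a sequence, as monotone convergence requires.\<close>

lemma has_sum_int_exhaustion:
  fixes f :: "int \<Rightarrow> real"
  assumes "(f has_sum S) UNIV"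
  shows "(\<lambda>n. \<Sum>l\<in>{- int n..int n}. f l) \<longlonglongrightarrow> S"
proof -
  have "filterlim (\<lambda>n. {- int n..int n}) (finite_subsets_at_top UNIV) sequentially"
    unfolding filterlim_finite_subsets_at_top
  proof (intro allI impI)
    fix X :: "int set" assume X: "finite X \<and> X \<subseteq> UNIV"
    define N where "N = nat (Max (insert 0 (abs ` X)))"
    have "\<bar>x\<bar> \<le> int N" if "x \<in> X" for x
    proof -
      have "\<bar>x\<bar> \<le> Max (insert 0 (abs ` X))" using X that by (intro Max_ge) auto
      then show ?thesis unfolding N_def by linarith
    qed
    then have "X \<subseteq> {- int n..int n}" if "n \<ge> N" for n
      using that by (fastforce simp: abs_le_iff)
    then show "\<forall>\<^sub>F n in sequentially. finite {- int n..int n} \<and> X \<subseteq> {- int n..int n} \<and> {- int n..int n} \<subseteq> UNIV"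
      unfolding eventually_sequentially by auto
  qed
  then show ?thesis
    using assms unfolding has_sum_def by (rule filterlim_compose[rotated])
qed

lemma integral_sin_cos_square:
  assumes "T > 0"
  shows "((\<lambda>t. (sin (pi * t / T))\<^sup>2) has_integral (T / 2)) {0..T}"
    "((\<lambda>t. (cos (pi * t / T))\<^sup>2) has_integral (T / 2)) {0..T}"
proof -
  \<comment> \<open>An antiderivative for both cases: \<open>\<sigma> = -1\<close> belongs to the
    sine, \<open>\<sigma> = 1\<close> to the cosine.\<close>
  define G where "G \<sigma> t = t / 2 + \<sigma> * (T / (4 * pi)) * sin (2 * pi * t / T)" for \<sigma> t :: real
  have d: "(G \<sigma> has_vector_derivative (1 / 2 + \<sigma> * (cos (2 * pi * t / T) / 2))) (at t within {0..T})" for \<sigma> t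
    unfolding G_def has_real_derivative_iff_has_vector_derivative[symmetric]
    by (rule derivative_eq_intros refl | use assms in \<open>simp add: field_simps\<close>)+
  have I: "((\<lambda>t. 1 / 2 + \<sigma> * (cos (2 * pi * t / T) / 2)) has_integral (G \<sigma> T - G \<sigma> 0)) {0..T}" for \<sigma>
    by (rule fundamental_theorem_of_calculus) (use assms d in auto)
  have v: "G \<sigma> T - G \<sigma> 0 = T / 2" for \<sigma> using assms by (simp add: G_def)
  have *: "cos (2 * pi * t / T) = 1 - 2 * (sin (pi * t / T))\<^sup>2" "cos (2 * pi * t / T) = 2 * (cos (pi * t / T))\<^sup>2 - 1" for t
    using cos_double_sin[of "pi * t / T"] cos_double_cos[of "pi * t / T"] by (simp_all add: mult.assoc)
  have "1 / 2 + (-1) * (cos (2 * pi * t / T) / 2) = (sin (pi * t / T))\<^sup>2"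
    "1 / 2 + 1 * (cos (2 * pi * t / T) / 2) = (cos (pi * t / T))\<^sup>2" for t
    using *(1)[of t] *(2)[of t] by linarith+
  with I[of "-1"] I[of 1] v show "((\<lambda>t. (sin (pi * t / T))\<^sup>2) has_integral (T / 2)) {0..T}"
    "((\<lambda>t. (cos (pi * t / T))\<^sup>2) has_integral (T / 2)) {0..T}" by simp_all
qed

lemma exp_two_ln_2: "exp (2 * ln 2 :: real) = 4"
proof -
  have "exp (2 * ln 2 :: real) = exp (ln 2) * exp (ln 2)" unfolding mult_2 by (rule exp_add)
  then show ?thesis by simp
qed

lemma quarter_power: "(1 / 4 :: real) ^ n = exp (- (2 * ln 2) * real n)"
proof -
  have "exp (- (2 * ln 2 :: real)) = 1 / 4" unfolding exp_minus exp_two_ln_2 by (simp only: inverse_eq_divide)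
  then show ?thesis using exp_of_nat2_mult[of "- (2 * ln 2 :: real)" n] by (simp only:)
qed

context shear_system
begin

text \<open>The Gearhart--Pruess argument with the cutoff \<open>sin (\<pi> t / T)\<close>, which vanishes at both ends
  of \<open>[0, T]\<close>: a Fourier expansion in time turns the resolvent bound into a decay estimate.\<close>

lemma energy_decay_step:
  assumes T: "T > 0" and \<Psi>: "\<Psi> > 0"
    and fin: "\<And>\<omega> w N. (\<And>l. \<bar>l\<bar> > int N \<Longrightarrow> w l = 0) \<Longrightarrow>
      \<Psi>\<^sup>2 * (\<Sum>l\<in>{- int N..int N}. (cmod (w l))\<^sup>2)
      \<le> (\<Sum>l\<in>{- int (N + m)..int (N + m)}. (cmod ((of_real (d l) + \<i> * of_real \<omega>) * w l + \<i> * of_real \<kappa> * sin_conv m w l))\<^sup>2)"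
  shows "energy T \<le> (pi / (\<Psi> * T))\<^sup>2 * energy 0"
proof -
  define K where "K = energy 0"
  have leK: "(\<Sum>l\<in>F. (cmod (a t l))\<^sup>2) \<le> K" if "0 \<le> t" "finite F" for t F
    using sum_le_energy[OF that] energy_mono[of 0 t] that by (simp add: K_def)
  \<comment> \<open>\<open>f\<close> is the solution cut off in time and solves the same equation
    with forcing \<open>g\<close>, the derivative of the cutoff times the solution.\<close>
  define f where "f l t = of_real (sin (pi * t / T)) * a t l" for l t
  define g where "g l t = of_real (pi / T * cos (pi * t / T)) * a t l" for l t
  have sub: "{0..T} \<subseteq> {0..}" by auto
  have cf [continuous_intros]: "continuous_on {0..T} (f l)" for l
    unfolding f_def[abs_def] divide_inverse by (intro continuous_intros sub)
  have cg [continuous_intros]: "continuous_on {0..T} (g l)" for l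
    unfolding g_def[abs_def] divide_inverse by (intro continuous_intros sub)
  define fh where "fh n l = integral {0..T} (\<lambda>t. f l t * wave T (- n) t)" for n l
  define gh where "gh n l = integral {0..T} (\<lambda>t. g l t * wave T (- n) t)" for n l
  define If where "If l = T * integral {0..T} (\<lambda>t. (cmod (f l t))\<^sup>2)" for l
  define Ig where "Ig l = T * integral {0..T} (\<lambda>t. (cmod (g l t))\<^sup>2)" for l
  have Pf: "((\<lambda>n. (cmod (fh n l))\<^sup>2) has_sum If l) UNIV" for l
    unfolding fh_def If_def by (rule wave_Parseval[OF T cf])
  have Pg: "((\<lambda>n. (cmod (gh n l))\<^sup>2) has_sum Ig l) UNIV" for l
    unfolding gh_def Ig_def by (rule wave_Parseval[OF T cg])
  \<comment> \<open>Integration by parts in time has no boundary terms since \<open>f\<close>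
    vanishes at both ends. The time frequency \<open>2 * pi * n / T\<close> plays the role of
    \<open>\<omega>\<close> in the resolvent bound.\<close>
  have eq: "gh n l = (of_real (d l) + \<i> * of_real (2 * pi * of_int n / T)) * fh n l + \<i> * of_real \<kappa> * sin_conv m (fh n) l" for n l
  proof -
    let ?w = "wave T (- n)"
    define f' where "f' t = g l t - (of_real (d l) * f l t + \<i> * of_real \<kappa> * sin_conv m (\<lambda>l. f l t) l)" for t
    have cw [continuous_intros]: "continuous_on A ?w" for A by (intro continuous_intros continuous_on_id)
    have scf: "sin_conv m (\<lambda>l. f l t) l = of_real (sin (pi * t / T)) * sin_conv m (a t) l" for t
      by (simp add: f_def sin_conv_def sum_distrib_left mult_ac)
    have df: "(f l has_vector_derivative f' t) (at t within {0..T})" if t: "t \<in> {0..T}" for t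
    proof -
      have s: "((\<lambda>t. complex_of_real (sin (pi * t / T))) has_vector_derivative of_real (pi / T * cos (pi * t / T))) (at t within {0..T})"
        by (rule has_vector_derivative_of_real) (use T in \<open>auto intro!: derivative_eq_intros simp flip: has_real_derivative_iff_has_vector_derivative\<close>)
      have at: "((\<lambda>t. a t l) has_vector_derivative - (of_real (d l) * a t l + \<i> * of_real \<kappa> * sin_conv m (a t) l)) (at t within {0..T})"
        by (rule has_vector_derivative_within_subset[OF ode]) (use t in auto)
      have "f' t = of_real (sin (pi * t / T)) * - (of_real (d l) * a t l + \<i> * of_real \<kappa> * sin_conv m (a t) l)
          + of_real (pi / T * cos (pi * t / T)) * a t l"
        by (simp add: f'_def scf) (simp add: f_def g_def algebra_simps)
      then show ?thesis using has_vector_derivative_mult[OF s at] by (simp add: f_def[abs_def])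
    qed
    have "((\<lambda>t. f l t * (\<i> * of_real (2 * pi * of_int (- n) / T) * ?w t) + f' t * ?w t) has_integral
       (f l T * ?w T - f l 0 * ?w 0)) {0..T}"
    proof (rule fundamental_theorem_of_calculus)
      show "0 \<le> T" using T by simp
      show "((\<lambda>t. f l t * ?w t) has_vector_derivative f l t * (\<i> * of_real (2 * pi * of_int (- n) / T) * ?w t) + f' t * ?w t)
          (at t within {0..T})" if "t \<in> {0..T}" for t
        by (rule has_vector_derivative_mult[OF df[OF that] wave_has_vector_derivative])
    qed
    moreover have "f l T = 0" "f l 0 = 0" using T by (simp_all add: f_def)
    ultimately have z: "((\<lambda>t. f l t * (\<i> * of_real (2 * pi * of_int (- n) / T) * ?w t) + f' t * ?w t) has_integral 0) {0..T}" by simp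
    have "(\<lambda>t. f l t * (\<i> * of_real (2 * pi * of_int (- n) / T) * ?w t) + f' t * ?w t)
       = (\<lambda>t. g l t * ?w t - ((of_real (d l) + \<i> * of_real (2 * pi * of_int n / T)) * (f l t * ?w t)
            + \<i> * of_real \<kappa> * (\<Sum>j\<in>{- int m..int m}. sin_power_coeff m j * (f (l - j) t * ?w t))))"
      unfolding f'_def sin_conv_def by (simp add: fun_eq_iff sum_distrib_right sum_distrib_left algebra_simps)
    moreover have "((\<lambda>t. g l t * ?w t - ((of_real (d l) + \<i> * of_real (2 * pi * of_int n / T)) * (f l t * ?w t)
            + \<i> * of_real \<kappa> * (\<Sum>j\<in>{- int m..int m}. sin_power_coeff m j * (f (l - j) t * ?w t)))) has_integral
        (gh n l - ((of_real (d l) + \<i> * of_real (2 * pi * of_int n / T)) * fh n l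
            + \<i> * of_real \<kappa> * (\<Sum>j\<in>{- int m..int m}. sin_power_coeff m j * fh n (l - j))))) {0..T}"
      unfolding gh_def fh_def
      by (intro has_integral_diff has_integral_add has_integral_mult_right has_integral_sum integrable_integral
          integrable_continuous_interval continuous_intros finite_atLeastAtMost_int)
    ultimately have "0 = gh n l - ((of_real (d l) + \<i> * of_real (2 * pi * of_int n / T)) * fh n l
            + \<i> * of_real \<kappa> * (\<Sum>j\<in>{- int m..int m}. sin_power_coeff m j * fh n (l - j)))"
      using z by (metis (no_types, lifting) has_integral_unique)
    then show ?thesis by (simp add: sin_conv_def)
  qed
  have sumint: "(\<Sum>l\<in>F. integral {0..T} (\<lambda>t. (cmod (h t * a t l))\<^sup>2)) = integral {0..T} (\<lambda>t. (cmod (h t))\<^sup>2 * (\<Sum>l\<in>F. (cmod (a t l))\<^sup>2))"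
    if "continuous_on {0..T} h" "finite F" for h F
  proof -
    have "integral {0..T} (\<lambda>t. \<Sum>l\<in>F. (cmod (h t * a t l))\<^sup>2) = (\<Sum>l\<in>F. integral {0..T} (\<lambda>t. (cmod (h t * a t l))\<^sup>2))"
      by (intro integral_sum that integrable_continuous_interval continuous_intros sub)
    then show ?thesis by (simp add: norm_mult power_mult_distrib sum_distrib_left)
  qed
  have cs: "continuous_on {0..T} (\<lambda>t. complex_of_real (sin (pi * t / T)))" "continuous_on {0..T} (\<lambda>t. complex_of_real (pi / T * cos (pi * t / T)))"
    unfolding divide_inverse by (intro continuous_intros)+
  have If_sum: "(\<Sum>l\<in>F. If l) = T * integral {0..T} (\<lambda>t. (sin (pi * t / T))\<^sup>2 * (\<Sum>l\<in>F. (cmod (a t l))\<^sup>2))" if "finite F" for F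
    using sumint[OF cs(1) that] by (simp add: If_def f_def sum_distrib_left[symmetric])
  have cF: "continuous_on {0..T} (\<lambda>t. \<Sum>l\<in>F. (cmod (a t l))\<^sup>2)" for F by (intro continuous_intros sub)
  \<comment> \<open>The value is \<open>T * ((pi / T)\<^sup>2 * K * (T / 2))\<close>: Parseval's
    factor \<open>T\<close>, the squared amplitude of the cutoff's derivative, and the integral of
    the squared cosine.\<close>
  have Ig_sum: "(\<Sum>l\<in>F. Ig l) \<le> pi\<^sup>2 * K / 2" if "finite F" for F
  proof -
    have "(\<Sum>l\<in>F. Ig l) = T * integral {0..T} (\<lambda>t. (cmod (complex_of_real (pi / T * cos (pi * t / T))))\<^sup>2 * (\<Sum>l\<in>F. (cmod (a t l))\<^sup>2))"
      using sumint[OF cs(2) that] by (simp add: Ig_def g_def sum_distrib_left[symmetric])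
    also have "integral {0..T} (\<lambda>t. (cmod (complex_of_real (pi / T * cos (pi * t / T))))\<^sup>2 * (\<Sum>l\<in>F. (cmod (a t l))\<^sup>2))
        \<le> integral {0..T} (\<lambda>t. (pi / T)\<^sup>2 * K * (cos (pi * t / T))\<^sup>2)"
    proof (rule integral_le)
      show "(\<lambda>t. (cmod (complex_of_real (pi / T * cos (pi * t / T))))\<^sup>2 * (\<Sum>l\<in>F. (cmod (a t l))\<^sup>2)) integrable_on {0..T}"
        by (intro integrable_continuous_interval continuous_intros cs cF)
      show "(\<lambda>t. (pi / T)\<^sup>2 * K * (cos (pi * t / T))\<^sup>2) integrable_on {0..T}"
        unfolding divide_inverse by (intro integrable_continuous_interval continuous_intros)
      fix t assume t: "t \<in> {0..T}"
      have "(pi / T * cos (pi * t / T))\<^sup>2 * (\<Sum>l\<in>F. (cmod (a t l))\<^sup>2) \<le> (pi / T * cos (pi * t / T))\<^sup>2 * K"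
        using t that by (intro mult_left_mono leK) auto
      then show "(cmod (complex_of_real (pi / T * cos (pi * t / T))))\<^sup>2 * (\<Sum>l\<in>F. (cmod (a t l))\<^sup>2) \<le> (pi / T)\<^sup>2 * K * (cos (pi * t / T))\<^sup>2"
        by (simp only: norm_of_real power2_abs power_mult_distrib mult_ac)
    qed
    also have "\<dots> = (pi / T)\<^sup>2 * K * (T / 2)"
      by (rule integral_unique[OF has_integral_mult_right[OF integral_sin_cos_square(2)[OF T]]])
    finally have "(\<Sum>l\<in>F. Ig l) \<le> T * ((pi / T)\<^sup>2 * K * (T / 2))" using T by (simp add: mult_left_mono)
    also have "\<dots> = pi\<^sup>2 * K / 2" using T by (simp add: power2_eq_square)
    finally show ?thesis .
  qed
  have gh_le: "(\<Sum>n\<in>Q. (cmod (gh n l))\<^sup>2) \<le> Ig l" "(cmod (fh n l))\<^sup>2 \<le> If l" if "finite Q" for Q n l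
  proof -
    show "(\<Sum>n\<in>Q. (cmod (gh n l))\<^sup>2) \<le> Ig l"
      by (rule has_sum_mono_neutral[OF has_sum_finite[OF that] Pg]) auto
    have "(\<Sum>n\<in>{n}. (cmod (fh n l))\<^sup>2) \<le> If l"
      by (rule has_sum_mono_neutral[OF has_sum_finite Pf]) auto
    then show "(cmod (fh n l))\<^sup>2 \<le> If l" by simp
  qed
  have If_bound: "(\<Sum>l\<in>F. If l) \<le> T * (K * (T / 2))" if "finite F" for F
  proof -
    have "integral {0..T} (\<lambda>t. (sin (pi * t / T))\<^sup>2 * (\<Sum>l\<in>F. (cmod (a t l))\<^sup>2)) \<le> integral {0..T} (\<lambda>t. K * (sin (pi * t / T))\<^sup>2)"
    proof (rule integral_le)
      show "(\<lambda>t. (sin (pi * t / T))\<^sup>2 * (\<Sum>l\<in>F. (cmod (a t l))\<^sup>2)) integrable_on {0..T}"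
        "(\<lambda>t. K * (sin (pi * t / T))\<^sup>2) integrable_on {0..T}"
        unfolding divide_inverse by (intro integrable_continuous_interval continuous_intros cF)+
    qed (use leK that in \<open>auto simp: mult.commute[of K] intro!: mult_left_mono\<close>)
    also have "\<dots> = K * (T / 2)"
      by (rule integral_unique[OF has_integral_mult_right[OF integral_sin_cos_square(1)[OF T]]])
    finally show ?thesis unfolding If_sum[OF that] using T by (simp add: mult_left_mono)
  qed
  have gsum: "(\<lambda>l. (cmod (gh n l))\<^sup>2) summable_on UNIV" for n
  proof (rule nonneg_bdd_above_summable_on[OF _ bdd_aboveI2[where M="pi\<^sup>2 * K / 2"]])
    fix F :: "int set" assume "F \<in> {F. F \<subseteq> UNIV \<and> finite F}"
    then have F: "finite F" by simp
    have "(\<Sum>l\<in>F. (cmod (gh n l))\<^sup>2) \<le> (\<Sum>l\<in>F. Ig l)" using gh_le(1)[of "{n}"] by (intro sum_mono) simp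
    with Ig_sum[OF F] show "(\<Sum>l\<in>F. (cmod (gh n l))\<^sup>2) \<le> pi\<^sup>2 * K / 2" by linarith
  qed simp
  \<comment> \<open>The squared \<open>l^2\<close> norm of the forcing at time frequency
    \<open>n\<close>; the resolvent bound is applied for each \<open>n\<close> separately and then
    summed.\<close>
  define \<gamma> where "\<gamma> n = infsum (\<lambda>l. (cmod (gh n l))\<^sup>2) UNIV" for n
  have \<gamma>: "(\<Sum>n\<in>Q. \<gamma> n) \<le> pi\<^sup>2 * K / 2" if Q: "finite Q" for Q
  proof -
    have hs: "((\<lambda>l. \<Sum>n\<in>Q. (cmod (gh n l))\<^sup>2) has_sum (\<Sum>n\<in>Q. \<gamma> n)) UNIV"
      unfolding \<gamma>_def by (intro has_sum_finite_sum has_sum_infsum gsum Q)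
    have "(\<Sum>l\<in>F. \<Sum>n\<in>Q. (cmod (gh n l))\<^sup>2) \<le> pi\<^sup>2 * K / 2" if "finite F" for F
      by (rule order_trans[OF sum_mono[OF gh_le(1)[OF Q]] Ig_sum[OF that]])
    then show ?thesis by (rule has_sum_le_of_finite_sums[OF hs])
  qed
  have point: "\<Psi>\<^sup>2 * (\<Sum>l\<in>F. (cmod (fh n l))\<^sup>2) \<le> \<gamma> n" if "finite F" for F n
  proof (rule resolvent_estimate_l2[where d="\<lambda>l. of_real (d l) + \<i> * of_real (2 * pi * of_int n / T)" and \<kappa>=\<kappa> and m=m and B="T * (K * (T / 2))"])
    show "(\<Sum>l\<in>F. (cmod (fh n l))\<^sup>2) \<le> T * (K * (T / 2))" if "finite F" for F
      by (rule order_trans[OF sum_mono[OF gh_le(2)[OF that]] If_bound[OF that]])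
    show "(\<Sum>l\<in>F. (cmod ((of_real (d l) + \<i> * of_real (2 * pi * of_int n / T)) * fh n l + \<i> * of_real \<kappa> * sin_conv m (fh n) l))\<^sup>2) \<le> \<gamma> n"
      if "finite F" for F
      unfolding eq[symmetric] \<gamma>_def by (rule finite_sum_le_infsum[OF gsum that]) auto
    show "\<Psi>\<^sup>2 * (\<Sum>l\<in>{- int N..int N}. (cmod (w l))\<^sup>2) \<le> (\<Sum>l\<in>{- int (N + m)..int (N + m)}.
        (cmod ((of_real (d l) + \<i> * of_real (2 * pi * of_int n / T)) * w l + \<i> * of_real \<kappa> * sin_conv m w l))\<^sup>2)"
      if "\<And>l. \<bar>l\<bar> > int N \<Longrightarrow> w l = 0" for w N by (rule fin[OF that])
  qed (rule that)
  have bd0: "\<Psi>\<^sup>2 * (\<Sum>l\<in>F. If l) \<le> pi\<^sup>2 * K / 2" if F: "finite F" for F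
  proof -
    have "((\<lambda>n. \<Psi>\<^sup>2 * (\<Sum>l\<in>F. (cmod (fh n l))\<^sup>2)) has_sum (\<Psi>\<^sup>2 * (\<Sum>l\<in>F. If l))) UNIV"
      by (intro has_sum_cmult_right has_sum_finite_sum Pf F)
    moreover have "(\<Sum>n\<in>Q. \<Psi>\<^sup>2 * (\<Sum>l\<in>F. (cmod (fh n l))\<^sup>2)) \<le> pi\<^sup>2 * K / 2" if "finite Q" for Q
      by (rule order_trans[OF sum_mono[OF point[OF F]] \<gamma>[OF that]])
    ultimately show ?thesis by (rule has_sum_le_of_finite_sums)
  qed
  have bd: "\<Psi>\<^sup>2 * (T * integral {0..T} (\<lambda>t. (sin (pi * t / T))\<^sup>2 * (\<Sum>l\<in>F. (cmod (a t l))\<^sup>2))) \<le> pi\<^sup>2 * K / 2"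
    if "finite F" for F using bd0[OF that] unfolding If_sum[OF that] .
  define S where "S k t = (sin (pi * t / T))\<^sup>2 * (\<Sum>l\<in>{- int k..int k}. (cmod (a t l))\<^sup>2)" for k :: nat and t
  define C where "C = pi\<^sup>2 * K / 2 / (\<Psi>\<^sup>2 * T)"
  have SC: "integral {0..T} (S k) \<le> C" for k
    using bd[of "{- int k..int k}"] T \<Psi> by (simp add: C_def S_def[abs_def] field_simps)
  have cS: "S k integrable_on {0..T}" for k
    unfolding S_def[abs_def] divide_inverse by (intro integrable_continuous_interval continuous_intros cF)
  have S0: "0 \<le> S k t" for k t unfolding S_def by (intro mult_nonneg_nonneg sum_nonneg) auto
  \<comment> \<open>Monotone convergence in the number of coefficients supplies both the
    integrability of the weighted energy and the limit of the bounds.\<close>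
  have mc: "(\<lambda>t. (sin (pi * t / T))\<^sup>2 * energy t) integrable_on {0..T} \<and>
      (\<lambda>k. integral {0..T} (S k)) \<longlonglongrightarrow> integral {0..T} (\<lambda>t. (sin (pi * t / T))\<^sup>2 * energy t)"
  proof (rule monotone_convergence_increasing[OF cS])
    show "S k t \<le> S (Suc k) t" for k t unfolding S_def
      by (intro mult_left_mono sum_mono2) auto
    show "(\<lambda>k. S k t) \<longlonglongrightarrow> (sin (pi * t / T))\<^sup>2 * energy t" if "t \<in> {0..T}" for t
      unfolding S_def using that by (intro tendsto_mult tendsto_const has_sum_int_exhaustion energy_has_sum) auto
    show "bounded (range (\<lambda>k. integral {0..T} (S k)))"
      unfolding bounded_iff
    proof (intro exI[of _ C] ballI)
      fix x assume "x \<in> range (\<lambda>k. integral {0..T} (S k))"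
      then obtain k where "x = integral {0..T} (S k)" by auto
      then show "norm x \<le> C" using SC[of k] integral_nonneg[OF cS, of k] S0 by simp
    qed
  qed
  have "energy T * (T / 2) = integral {0..T} (\<lambda>t. energy T * (sin (pi * t / T))\<^sup>2)"
    by (rule integral_unique[OF has_integral_mult_right[OF integral_sin_cos_square(1)[OF T]], symmetric])
  \<comment> \<open>The energy is nonincreasing, so its final value may replace it under the
    integral.\<close>
  also have "\<dots> \<le> integral {0..T} (\<lambda>t. (sin (pi * t / T))\<^sup>2 * energy t)"
  proof (rule integral_le)
    show "(\<lambda>t. energy T * (sin (pi * t / T))\<^sup>2) integrable_on {0..T}"
      unfolding divide_inverse by (intro integrable_continuous_interval continuous_intros)
    show "(\<lambda>t. (sin (pi * t / T))\<^sup>2 * energy t) integrable_on {0..T}" using mc by blast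
    show "energy T * (sin (pi * t / T))\<^sup>2 \<le> (sin (pi * t / T))\<^sup>2 * energy t" if "t \<in> {0..T}" for t
      using energy_mono[of t T] that by (subst mult.commute) (intro mult_left_mono, auto)
  qed
  also have "\<dots> \<le> C" using mc SC by (intro LIMSEQ_le_const2[of _ _ C]) auto
  finally have "energy T * (T / 2) \<le> pi\<^sup>2 * K / 2 / (\<Psi>\<^sup>2 * T)" by (simp add: C_def)
  then have "energy T * (T / 2) * (2 / T) \<le> pi\<^sup>2 * K / 2 / (\<Psi>\<^sup>2 * T) * (2 / T)"
    using T by (intro mult_right_mono) auto
  then show ?thesis using T \<Psi> by (simp add: K_def power_mult_distrib power_divide power2_eq_square mult_ac)
qed

text \<open>A block of length \<open>T = 2 * pi / \<Psi>\<close> makes the factor of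
  \<open>energy_decay_step\<close> equal to \<open>1 / 4\<close>. Iterating over the whole blocks in
  \<open>[0, t]\<close> and discarding the incomplete one costs a factor 4 in energy, that is 2 in
  norm, with rate \<open>ln 2 / T\<close>.\<close>

lemma energy_decay:
  assumes \<Psi>: "\<Psi> > 0"
    and fin: "\<And>\<omega> w N. (\<And>l. \<bar>l\<bar> > int N \<Longrightarrow> w l = 0) \<Longrightarrow>
      \<Psi>\<^sup>2 * (\<Sum>l\<in>{- int N..int N}. (cmod (w l))\<^sup>2)
      \<le> (\<Sum>l\<in>{- int (N + m)..int (N + m)}. (cmod ((of_real (d l) + \<i> * of_real \<omega>) * w l + \<i> * of_real \<kappa> * sin_conv m w l))\<^sup>2)"
    and t: "t \<ge> 0"
  shows "energy t \<le> (2 * exp (- (ln 2 / (2 * pi) * \<Psi>) * t))\<^sup>2 * energy 0"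
proof -
  define T where "T = 2 * pi / \<Psi>"
  have T: "T > 0" using \<Psi> by (simp add: T_def)
  have step: "energy (s + T) \<le> (1 / 4) * energy s" if s: "s \<ge> 0" for s
  proof -
    \<comment> \<open>The system is autonomous, so the decay over the first block applies to any
      later one.\<close>
    have "shear_system.energy (\<lambda>t. a (s + t)) T \<le> (pi / (\<Psi> * T))\<^sup>2 * shear_system.energy (\<lambda>t. a (s + t)) 0"
      by (rule shear_system.energy_decay_step[OF shift[OF s] T \<Psi> fin])
    moreover have "pi / (\<Psi> * T) = 1 / 2" using \<Psi> by (simp add: T_def)
    ultimately show ?thesis
      unfolding shear_system.energy_def[OF shift[OF s]] energy_def by (simp add: power2_eq_square)
  qed
  have iter: "energy (real n * T) \<le> (1 / 4) ^ n * energy 0" for n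
  proof (induction n)
    case (Suc n)
    have "energy (real (Suc n) * T) = energy (real n * T + T)" by (simp add: algebra_simps)
    also have "\<dots> \<le> (1 / 4) * energy (real n * T)" using T by (intro step) simp
    also have "\<dots> \<le> (1 / 4) * ((1 / 4) ^ n * energy 0)" by (intro mult_left_mono Suc) simp
    finally show ?case by simp
  qed simp
  define n where "n = nat \<lfloor>t / T\<rfloor>"
  have "t / T \<ge> 0" using t T by simp
  then have n: "real n \<le> t / T" "t / T - 1 \<le> real n" unfolding n_def by linarith+
  have "real n * T \<le> t" using n(1) T by (simp add: field_simps)
  then have "energy t \<le> energy (real n * T)" using T by (intro energy_mono) auto
  also have "\<dots> \<le> (1 / 4) ^ n * energy 0" by (rule iter)
  also have "(1 / 4 :: real) ^ n \<le> (2 * exp (- (ln 2 / (2 * pi) * \<Psi>) * t))\<^sup>2"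
  proof -
    have "(1 / 4 :: real) ^ n = exp (- (2 * ln 2) * real n)"
      by (rule quarter_power)
    also have "\<dots> \<le> exp (- (2 * ln 2) * (t / T - 1))" using n(2) by simp
    also have "\<dots> = exp (2 * ln 2 + (- (ln 2 / (2 * pi) * \<Psi>) * t + - (ln 2 / (2 * pi) * \<Psi>) * t))"
      unfolding T_def using \<Psi> by (intro arg_cong[where f=exp]) (simp add: field_simps)
    also have "\<dots> = (2 * exp (- (ln 2 / (2 * pi) * \<Psi>) * t))\<^sup>2"
      unfolding exp_add exp_two_ln_2 power_mult_distrib by (simp only: power2_eq_square)
    finally show ?thesis .
  qed
  then have "(1 / 4) ^ n * energy 0 \<le> (2 * exp (- (ln 2 / (2 * pi) * \<Psi>) * t))\<^sup>2 * energy 0"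
    using sum_le_energy[of 0 "{}"] by (intro mult_right_mono) auto
  finally show ?thesis .
qed

end

section \<open>Semigroups on the torus\<close>

locale torus_semigroup = torus_lengths +
  fixes S :: "real \<Rightarrow> (real \<times> real \<Rightarrow> complex) \<Rightarrow> (real \<times> real \<Rightarrow> complex)"
  assumes C0: "C0_semigroup L1 L2 S"
begin

abbreviation "X \<equiv> square_integrable \<TT>"
abbreviation nrm ("\<parallel>_\<parallel>") where "nrm f \<equiv> norm2 \<TT> f"

lemma S_sq: "\<lbrakk>0 \<le> t; f \<in> X\<rbrakk> \<Longrightarrow> S t f \<in> X"
  using C0 unfolding C0_semigroup_def torus_L2 by blast

lemma S_linear: "\<lbrakk>0 \<le> t; f \<in> X; g \<in> X\<rbrakk> \<Longrightarrow> AE z in \<TT>. S t (\<lambda>w. a * f w + b * g w) z = a * S t f z + b * S t g z"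
  using C0 unfolding C0_semigroup_def torus_L2 by blast

lemma S_bounded: "0 \<le> t \<Longrightarrow> \<exists>C. \<forall>f\<in>X. \<parallel>S t f\<parallel> \<le> C * \<parallel>f\<parallel>"
  using C0 unfolding C0_semigroup_def torus_L2 torus_norm by blast

lemma S_0: "f \<in> X \<Longrightarrow> AE z in \<TT>. S 0 f z = f z"
  using C0 unfolding C0_semigroup_def torus_L2 by blast

lemma S_add: "\<lbrakk>0 \<le> s; 0 \<le> t; f \<in> X\<rbrakk> \<Longrightarrow> AE z in \<TT>. S (s + t) f z = S s (S t f) z"
  using C0 unfolding C0_semigroup_def torus_L2 by blast

lemma S_tendsto: "f \<in> X \<Longrightarrow> ((\<lambda>t. \<parallel>\<lambda>z. S t f z - f z\<parallel>) \<longlongrightarrow> 0) (at_right 0)"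
  using C0 unfolding C0_semigroup_def torus_L2 torus_norm by blast

lemma meas: "f \<in> X \<Longrightarrow> f \<in> borel_measurable \<TT>"
  by (rule square_integrableD(1))

lemma norm_cong_AE: "\<lbrakk>AE z in \<TT>. f z = g z; f \<in> X; g \<in> X\<rbrakk> \<Longrightarrow> \<parallel>f\<parallel> = \<parallel>g\<parallel>"
  by (intro norm2_cong_AE meas)

lemmas X_intros = square_integrable_add square_integrable_diff square_integrable_scale square_integrable_minus S_sq

lemma S_diff: "\<lbrakk>0 \<le> t; f \<in> X; g \<in> X\<rbrakk> \<Longrightarrow> AE z in \<TT>. S t (\<lambda>w. f w - g w) z = S t f z - S t g z"
  using S_linear[of t f g 1 "-1"] by simp

lemma S_plus: "\<lbrakk>0 \<le> t; f \<in> X; g \<in> X\<rbrakk> \<Longrightarrow> AE z in \<TT>. S t (\<lambda>w. f w + g w) z = S t f z + S t g z"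
  using S_linear[of t f g 1 1] by simp

lemma S_scale: "\<lbrakk>0 \<le> t; f \<in> X\<rbrakk> \<Longrightarrow> AE z in \<TT>. S t (\<lambda>w. c * f w) z = c * S t f z"
  using S_linear[of t f f c 0] by simp

lemma norm_S_diff: "\<lbrakk>0 \<le> t; f \<in> X; g \<in> X\<rbrakk> \<Longrightarrow> \<parallel>\<lambda>z. S t f z - S t g z\<parallel> = \<parallel>S t (\<lambda>w. f w - g w)\<parallel>"
  by (rule norm_cong_AE[OF _ _ _, symmetric]) (auto intro: S_diff X_intros)

lemma norm_S_add: "\<lbrakk>0 \<le> s; 0 \<le> t; f \<in> X\<rbrakk> \<Longrightarrow> \<parallel>S (s + t) f\<parallel> = \<parallel>S s (S t f)\<parallel>"
  by (rule norm_cong_AE) (auto intro: S_add X_intros)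

text \<open>A real supremum, meaningful for \<open>t \<ge> 0\<close> by \<open>opnorm_bdd\<close>;
  it packages the bound that \<open>C0_semigroup\<close> grants for each time separately.\<close>

definition opnorm :: "real \<Rightarrow> real" where
  "opnorm t = (SUP f\<in>{f\<in>X. \<parallel>f\<parallel> \<le> 1}. \<parallel>S t f\<parallel>)"

lemma opnorm_bdd:
  assumes "0 \<le> t" shows "bdd_above ((\<lambda>f. \<parallel>S t f\<parallel>) ` {f\<in>X. \<parallel>f\<parallel> \<le> 1})"
proof -
  obtain C where C: "\<And>f. f \<in> X \<Longrightarrow> \<parallel>S t f\<parallel> \<le> C * \<parallel>f\<parallel>" using S_bounded[OF assms] by blast
  have "\<parallel>S t f\<parallel> \<le> \<bar>C\<bar>" if "f \<in> X" "\<parallel>f\<parallel> \<le> 1" for f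
  proof -
    have "\<parallel>S t f\<parallel> \<le> \<bar>C\<bar> * \<parallel>f\<parallel>" using C[OF that(1)] by (meson abs_ge_self mult_right_mono norm2_nonneg order_trans)
    also have "\<dots> \<le> \<bar>C\<bar> * 1" using that(2) by (intro mult_left_mono) auto
    finally show ?thesis by simp
  qed
  then show ?thesis by (intro bdd_aboveI2[where M="\<bar>C\<bar>"]) auto
qed

lemma opnorm_upper: "\<lbrakk>0 \<le> t; f \<in> X; \<parallel>f\<parallel> \<le> 1\<rbrakk> \<Longrightarrow> \<parallel>S t f\<parallel> \<le> opnorm t"
  unfolding opnorm_def by (rule cSUP_upper[OF _ opnorm_bdd]) auto

lemma opnorm_le:
  assumes t: "0 \<le> t" and f: "f \<in> X" shows "\<parallel>S t f\<parallel> \<le> opnorm t * \<parallel>f\<parallel>"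
proof (cases "\<parallel>f\<parallel> = 0")
  case True
  obtain C where "\<parallel>S t f\<parallel> \<le> C * \<parallel>f\<parallel>" using S_bounded[OF t] f by blast
  with True show ?thesis by simp
next
  case False
  define r where "r = \<parallel>f\<parallel>"
  have r: "r > 0" using False norm2_nonneg[of \<TT> f] by (simp add: r_def less_le)
  define g where "g z = complex_of_real (1 / r) * f z" for z
  have g: "g \<in> X" unfolding g_def[abs_def] by (intro X_intros f)
  have "\<parallel>g\<parallel> = 1" unfolding g_def[abs_def] norm2_scale using r by (simp add: r_def[symmetric] norm_divide)
  then have "\<parallel>S t g\<parallel> \<le> opnorm t" by (intro opnorm_upper t g) simp
  moreover have "\<parallel>S t g\<parallel> = \<parallel>\<lambda>z. complex_of_real (1 / r) * S t f z\<parallel>"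
  proof (rule norm_cong_AE)
    show "AE z in \<TT>. S t g z = complex_of_real (1 / r) * S t f z"
      unfolding g_def[abs_def] by (rule S_scale[OF t f])
  qed (intro X_intros t f g)+
  ultimately have "1 / r * \<parallel>S t f\<parallel> \<le> opnorm t" using r unfolding norm2_scale by (simp add: norm_divide)
  then show ?thesis using r by (simp add: r_def[symmetric] field_simps)
qed

lemma opnorm_less:
  assumes "0 \<le> t" "c < opnorm t"
  obtains f where "f \<in> X" "\<parallel>f\<parallel> \<le> 1" "c < \<parallel>S t f\<parallel>"
proof -
  have "\<exists>f\<in>{f\<in>X. \<parallel>f\<parallel> \<le> 1}. c < \<parallel>S t f\<parallel>"
    using assms(2) unfolding opnorm_def
    by (subst (asm) less_cSUP_iff[OF _ opnorm_bdd[OF assms(1)]]) (auto intro!: exI[of _ "\<lambda>z. 0"])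
  then show thesis using that by blast
qed

text \<open>Uniform boundedness near \<open>t = 0\<close>, by Sokal's gliding hump argument.\<close>

lemma opnorm_locally_bounded: "\<exists>\<delta>>0. \<exists>C. \<forall>t\<in>{0..\<delta>}. opnorm t \<le> C"
proof (rule ccontr)
  assume contr: "\<not> ?thesis"
  \<comment> \<open>Without a local bound there are times tending to 0 with norms beyond
    \<open>4 ^ n\<close>. Steps of size \<open>(1 / 3) ^ n\<close> are then summable, while their
    images still grow like \<open>(4 / 3) ^ n\<close>.\<close>
  have "\<forall>n::nat. \<exists>t. t \<in> {0..1 / real (Suc n)} \<and> opnorm t > 4 ^ n"
  proof
    fix n :: nat
    have "1 / real (Suc n) > 0" by simp
    with contr show "\<exists>t. t \<in> {0..1 / real (Suc n)} \<and> opnorm t > 4 ^ n" by (meson not_le)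
  qed
  from choice[OF this] obtain \<tau> where \<tau>: "\<And>n. \<tau> n \<in> {0..1 / real (Suc n)}" "\<And>n. opnorm (\<tau> n) > 4 ^ n" by blast
  have \<tau>0: "0 \<le> \<tau> n" for n using \<tau>(1)[of n] by simp
  have op_pos: "opnorm (\<tau> n) > 0" for n by (rule less_trans[OF _ \<tau>(2)]) simp
  \<comment> \<open>The ratio \<open>2 / 3\<close> has to exceed the tail ratio \<open>1 / 2\<close>
    found in \<open>close\<close>.\<close>
  have "\<forall>n. \<exists>f. f \<in> X \<and> \<parallel>f\<parallel> \<le> 1 \<and> 2 / 3 * opnorm (\<tau> n) < \<parallel>S (\<tau> n) f\<parallel>"
  proof
    fix n
    have "2 / 3 * opnorm (\<tau> n) < opnorm (\<tau> n)" using op_pos[of n] by simp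
    from opnorm_less[OF \<tau>0 this] show "\<exists>f. f \<in> X \<and> \<parallel>f\<parallel> \<le> 1 \<and> 2 / 3 * opnorm (\<tau> n) < \<parallel>S (\<tau> n) f\<parallel>" by blast
  qed
  from choice[OF this] obtain f where f: "\<And>n. f n \<in> X" "\<And>n. \<parallel>f n\<parallel> \<le> 1" "\<And>n. 2 / 3 * opnorm (\<tau> n) < \<parallel>S (\<tau> n) (f n)\<parallel>" by blast
  define e where "e n z = complex_of_real ((1 / 3) ^ n) * f n z" for n z
  have e: "e n \<in> X" for n unfolding e_def[abs_def] by (intro X_intros f)
  have e_norm: "\<parallel>e n\<parallel> \<le> (1 / 3) ^ n" for n
    unfolding e_def[abs_def] norm2_scale using f(2)[of n] by (simp add: norm_power norm_divide mult_left_le)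
  have Se: "\<parallel>S (\<tau> n) (e n)\<parallel> \<ge> 2 / 3 * opnorm (\<tau> n) * (1 / 3) ^ n" for n
  proof -
    have "\<parallel>S (\<tau> n) (e n)\<parallel> = \<parallel>\<lambda>z. complex_of_real ((1 / 3) ^ n) * S (\<tau> n) (f n) z\<parallel>"
      using S_scale[OF \<tau>0 f(1), of n "complex_of_real ((1 / 3) ^ n)" n]
      by (intro norm_cong_AE) (auto simp: e_def[abs_def] intro!: X_intros \<tau>0 f)
    also have "\<dots> = (1 / 3) ^ n * \<parallel>S (\<tau> n) (f n)\<parallel>" unfolding norm2_scale by (simp add: norm_power norm_divide)
    finally show ?thesis using f(3)[of n] by (simp add: mult.commute mult_left_mono)
  qed
  \<comment> \<open>The sign of each step can be chosen so that nothing cancels: the images of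
    \<open>x n + e n\<close> and \<open>x n - e n\<close> differ by twice the image of
    \<open>e n\<close>, so one of them is at least as large as it.\<close>
  have "\<exists>x. \<forall>n. x n \<in> X \<and> (\<exists>s\<in>{1, -1}. x (Suc n) = (\<lambda>z. x n z + s * e n z) \<and> \<parallel>S (\<tau> n) (x (Suc n))\<parallel> \<ge> \<parallel>S (\<tau> n) (e n)\<parallel>)"
  proof (rule dependent_nat_choice)
    show "\<exists>x. x \<in> X" using square_integrable_zero by blast
    fix x n assume x: "x \<in> X"
    let ?p = "\<lambda>z. x z + e n z" and ?q = "\<lambda>z. x z - e n z"
    have pq: "?p \<in> X" "?q \<in> X" by (intro X_intros x e)+
    have "2 * \<parallel>S (\<tau> n) (e n)\<parallel> = \<parallel>\<lambda>z. 2 * S (\<tau> n) (e n) z\<parallel>" by (simp add: norm2_scale)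
    also have "\<dots> = \<parallel>\<lambda>z. S (\<tau> n) ?p z - S (\<tau> n) ?q z\<parallel>"
    proof (rule norm_cong_AE)
      show "AE z in \<TT>. 2 * S (\<tau> n) (e n) z = S (\<tau> n) ?p z - S (\<tau> n) ?q z"
        using S_plus[OF \<tau>0 x e, of n n] S_diff[OF \<tau>0 x e, of n n] by eventually_elim simp
    qed (intro X_intros \<tau>0 x e)+
    also have "\<dots> \<le> \<parallel>S (\<tau> n) ?p\<parallel> + \<parallel>S (\<tau> n) ?q\<parallel>" by (intro norm2_triangle_diff S_sq \<tau>0 pq)
    finally have "\<parallel>S (\<tau> n) (e n)\<parallel> \<le> \<parallel>S (\<tau> n) ?p\<parallel> \<or> \<parallel>S (\<tau> n) (e n)\<parallel> \<le> \<parallel>S (\<tau> n) ?q\<parallel>" by linarith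
    then show "\<exists>y. y \<in> X \<and> (\<exists>s\<in>{1, -1}. y = (\<lambda>z. x z + s * e n z) \<and> \<parallel>S (\<tau> n) y\<parallel> \<ge> \<parallel>S (\<tau> n) (e n)\<parallel>)"
    proof
      assume "\<parallel>S (\<tau> n) (e n)\<parallel> \<le> \<parallel>S (\<tau> n) ?p\<parallel>"
      with pq show ?thesis by (intro exI[of _ ?p]) auto
    next
      assume "\<parallel>S (\<tau> n) (e n)\<parallel> \<le> \<parallel>S (\<tau> n) ?q\<parallel>"
      with pq show ?thesis by (intro exI[of _ ?q]) auto
    qed
  qed
  then obtain x where x: "\<And>n. x n \<in> X" and xs: "\<And>n. \<exists>s\<in>{1, -1}. x (Suc n) = (\<lambda>z. x n z + s * e n z) \<and> \<parallel>S (\<tau> n) (x (Suc n))\<parallel> \<ge> \<parallel>S (\<tau> n) (e n)\<parallel>" by blast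
  have Sx: "\<parallel>S (\<tau> n) (x (Suc n))\<parallel> \<ge> \<parallel>S (\<tau> n) (e n)\<parallel>" for n using xs[of n] by auto
  define d where "d n z = x (Suc n) z - x n z" for n z
  have d: "d n \<in> X" for n unfolding d_def[abs_def] by (intro X_intros x)
  have d_norm: "\<parallel>d n\<parallel> \<le> (1 / 3) ^ n" for n
  proof -
    from xs[of n] obtain s where s: "s \<in> {1, -1}" "x (Suc n) = (\<lambda>z. x n z + s * e n z)" by blast
    have "d n = (\<lambda>z. s * e n z)" unfolding d_def[abs_def] s(2) by simp
    moreover have "cmod s = 1" using s(1) by auto
    ultimately show ?thesis using e_norm[of n] by (simp add: norm2_scale)
  qed
  have "summable (\<lambda>n. \<parallel>d n\<parallel>)"
    by (rule summable_comparison_test[where g="\<lambda>n. (1/3)^n"]) (auto simp: d_norm)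
  from square_integrable_complete[OF d this] obtain h where
    h: "h \<in> X" and lim: "(\<lambda>n. \<parallel>\<lambda>z. (\<Sum>i<n. d i z) - h z\<parallel>) \<longlonglongrightarrow> 0" by blast
  define y where "y z = h z + x 0 z" for z
  have y: "y \<in> X" unfolding y_def[abs_def] by (intro X_intros h x)
  have tele: "(\<Sum>i<n. d i z) = x n z - x 0 z" for n z unfolding d_def by (rule sum_lessThan_telescope)
  have "(\<lambda>z. (\<Sum>i<n. d i z) - h z) = (\<lambda>z. x n z - y z)" for n
    unfolding tele by (simp add: y_def fun_eq_iff)
  then have lim': "(\<lambda>n. \<parallel>\<lambda>z. x n z - y z\<parallel>) \<longlonglongrightarrow> 0" using lim by (simp only:)
  \<comment> \<open>The partial sum of the geometric tail starting at
    \<open>(1 / 3) ^ Suc n\<close>.\<close>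
  have step: "\<parallel>\<lambda>z. x (Suc n + k) z - x (Suc n) z\<parallel> \<le> (1 / 3) ^ n / 2 * (1 - (1 / 3) ^ k)" for n k
  proof (induction k)
    case (Suc k)
    have "\<parallel>\<lambda>z. x (Suc n + Suc k) z - x (Suc n) z\<parallel>
       \<le> \<parallel>\<lambda>z. x (Suc n + Suc k) z - x (Suc n + k) z\<parallel> + \<parallel>\<lambda>z. x (Suc n + k) z - x (Suc n) z\<parallel>"
      by (intro norm2_triangle3 x)
    also have "\<parallel>\<lambda>z. x (Suc n + Suc k) z - x (Suc n + k) z\<parallel> \<le> (1 / 3) ^ (Suc n + k)"
      using d_norm[of "Suc n + k"] by (simp add: d_def[abs_def])
    finally have "\<parallel>\<lambda>z. x (Suc n + Suc k) z - x (Suc n) z\<parallel> \<le> (1 / 3) ^ (Suc n + k) + (1 / 3) ^ n / 2 * (1 - (1 / 3) ^ k)"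
      using Suc by linarith
    also have "\<dots> = (1 / 3) ^ n / 2 * (1 - (1 / 3) ^ Suc k)"
      by (simp add: power_add field_simps)
    finally show ?case .
  qed simp
  have close: "\<parallel>\<lambda>z. y z - x (Suc n) z\<parallel> \<le> (1 / 3) ^ n / 2" for n
  proof -
    have "(\<lambda>k. \<parallel>\<lambda>z. x (k + Suc n) z - y z\<parallel> + (1 / 3) ^ n / 2) \<longlonglongrightarrow> 0 + (1 / 3) ^ n / 2"
      by (intro tendsto_intros LIMSEQ_ignore_initial_segment[OF lim'])
    moreover have "\<parallel>\<lambda>z. y z - x (Suc n) z\<parallel> \<le> \<parallel>\<lambda>z. x (k + Suc n) z - y z\<parallel> + (1 / 3) ^ n / 2" for k
    proof -
      have "\<parallel>\<lambda>z. y z - x (Suc n) z\<parallel> \<le> \<parallel>\<lambda>z. y z - x (Suc n + k) z\<parallel> + \<parallel>\<lambda>z. x (Suc n + k) z - x (Suc n) z\<parallel>"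
        by (intro norm2_triangle3 x y)
      moreover have "(1 / 3) ^ n / 2 * (1 - (1 / 3) ^ k) \<le> (1 / 3) ^ n / 2 * (1 :: real)" by (intro mult_left_mono) auto
      ultimately show ?thesis using step[of n k] norm2_minus_commute[of \<TT> y "x (Suc n + k)"]
        by (simp only: add.commute[of k])
    qed
    ultimately have "\<parallel>\<lambda>z. y z - x (Suc n) z\<parallel> \<le> 0 + (1 / 3) ^ n / 2" using LIMSEQ_le_const by blast
    then show ?thesis by simp
  qed
  \<comment> \<open>The gain \<open>2 / 3\<close> minus the tail \<open>1 / 2\<close> leaves
    \<open>1 / 6\<close>, and the norm exceeds \<open>4 ^ n\<close>. This contradicts continuity of
    the orbit of \<open>y\<close> at time 0.\<close>
  have big: "(4 / 3) ^ n / 6 \<le> \<parallel>S (\<tau> n) y\<parallel>" for n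
  proof -
    have "\<parallel>S (\<tau> n) (x (Suc n))\<parallel> - \<parallel>S (\<tau> n) y\<parallel> \<le> \<parallel>\<lambda>z. S (\<tau> n) (x (Suc n)) z - S (\<tau> n) y z\<parallel>"
      using norm2_reverse_triangle[OF S_sq[OF \<tau>0 x] S_sq[OF \<tau>0 y], of n "Suc n" n] by linarith
    also have "\<dots> = \<parallel>S (\<tau> n) (\<lambda>z. x (Suc n) z - y z)\<parallel>" by (rule norm_S_diff[OF \<tau>0 x y])
    also have "\<dots> \<le> opnorm (\<tau> n) * \<parallel>\<lambda>z. x (Suc n) z - y z\<parallel>" by (intro opnorm_le \<tau>0 X_intros x y)
    also have "\<dots> \<le> opnorm (\<tau> n) * ((1 / 3) ^ n / 2)"
      using close[of n] op_pos[of n] by (subst norm2_minus_commute) (intro mult_left_mono; simp)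
    finally have "2 / 3 * opnorm (\<tau> n) * (1 / 3) ^ n - opnorm (\<tau> n) * ((1 / 3) ^ n / 2) \<le> \<parallel>S (\<tau> n) y\<parallel>"
      using Se[of n] Sx[of n] by linarith
    moreover have "2 / 3 * opnorm (\<tau> n) * (1 / 3) ^ n - opnorm (\<tau> n) * ((1 / 3) ^ n / 2) = opnorm (\<tau> n) * ((1 / 3) ^ n / 6)"
      by (simp add: field_simps)
    moreover have "4 ^ n * ((1 / 3) ^ n / 6) \<le> opnorm (\<tau> n) * ((1 / 3) ^ n / 6)" using \<tau>(2)[of n] by (intro mult_right_mono) auto
    moreover have "4 ^ n * ((1 / 3) ^ n / 6) = (4 / 3 :: real) ^ n / 6" by (simp add: power_divide)
    ultimately show ?thesis by linarith
  qed
  have "\<forall>\<^sub>F t in at_right 0. \<parallel>\<lambda>z. S t y z - y z\<parallel> < 1"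
    using S_tendsto[OF y] by (rule order_tendstoD) simp
  then obtain \<delta> where \<delta>: "\<delta> > 0" "\<And>t. 0 < t \<Longrightarrow> t < \<delta> \<Longrightarrow> \<parallel>\<lambda>z. S t y z - y z\<parallel> < 1"
    unfolding eventually_at_right_field by blast
  obtain N1 :: nat where N1: "1 / real (Suc N1) < \<delta>" using reals_Archimedean[OF \<delta>(1)] by (auto simp: inverse_eq_divide)
  obtain N2 where N2: "6 * (\<parallel>y\<parallel> + 1) < (4 / 3) ^ N2" using real_arch_pow[of "4 / 3 :: real"] by auto
  define n where "n = max N1 N2"
  have "(4 / 3 :: real) ^ N2 \<le> (4 / 3) ^ n" by (intro power_increasing) (auto simp: n_def)
  with N2 have "6 * (\<parallel>y\<parallel> + 1) < (4 / 3) ^ n" by (rule less_le_trans)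
  then have "6 * (\<parallel>y\<parallel> + 1) / 6 < (4 / 3) ^ n / 6" by (rule divide_strict_right_mono) simp
  moreover have "6 * (\<parallel>y\<parallel> + 1) / 6 = \<parallel>y\<parallel> + 1" by simp
  ultimately have n2: "\<parallel>y\<parallel> + 1 < (4 / 3) ^ n / 6" by (simp only:)
  have "1 / real (Suc n) \<le> 1 / real (Suc N1)" by (intro divide_left_mono) (auto simp: n_def)
  then have \<tau>n: "\<tau> n < \<delta>" using \<tau>(1)[of n] N1 by simp
  \<comment> \<open>The limit at 0 speaks only of positive times, so a time equal to 0 goes through
    \<open>S_0\<close>.\<close>
  have "\<parallel>\<lambda>z. S (\<tau> n) y z - y z\<parallel> < 1"
  proof (cases "\<tau> n = 0")
    case True
    have "\<parallel>\<lambda>z. S 0 y z - y z\<parallel> = \<parallel>\<lambda>z. 0\<parallel>"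
      using S_0[OF y] by (intro norm_cong_AE) (auto intro!: X_intros y)
    then show ?thesis by (simp add: True)
  next
    case False
    then show ?thesis using \<tau>0[of n] \<tau>n by (intro \<delta>) auto
  qed
  moreover have "\<parallel>S (\<tau> n) y\<parallel> - \<parallel>y\<parallel> \<le> \<parallel>\<lambda>z. S (\<tau> n) y z - y z\<parallel>"
    using norm2_reverse_triangle[OF S_sq[OF \<tau>0 y] y, of n] by linarith
  ultimately show False using big[of n] n2 by linarith
qed

text \<open>Splitting a time into steps of length \<open>\<delta>\<close> multiplies the local
  bound; taking \<open>D\<close> at least 1 keeps its powers increasing.\<close>

lemma compact_bound: "\<exists>C\<ge>0. \<forall>t\<in>{0..R}. \<forall>f\<in>X. \<parallel>S t f\<parallel> \<le> C * \<parallel>f\<parallel>"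
proof -
  obtain \<delta> C where \<delta>: "\<delta> > 0" and C: "\<And>t. t \<in> {0..\<delta>} \<Longrightarrow> opnorm t \<le> C" using opnorm_locally_bounded by blast
  define D where "D = max 1 C"
  have D: "\<parallel>S t f\<parallel> \<le> D * \<parallel>f\<parallel>" if "t \<in> {0..\<delta>}" "f \<in> X" for t f
  proof -
    have "\<parallel>S t f\<parallel> \<le> opnorm t * \<parallel>f\<parallel>" using that by (intro opnorm_le) auto
    also have "\<dots> \<le> D * \<parallel>f\<parallel>" using C[OF that(1)] by (intro mult_right_mono) (auto simp: D_def)
    finally show ?thesis .
  qed
  have D1: "1 \<le> D" by (simp add: D_def)
  have ind: "\<forall>t\<in>{0..real k * \<delta>}. \<forall>f\<in>X. \<parallel>S t f\<parallel> \<le> D ^ Suc k * \<parallel>f\<parallel>" for k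
  proof (induction k)
    case 0
    then show ?case using D[of 0] \<delta> by auto
  next
    case (Suc k)
    show ?case
    proof (intro ballI)
      fix t f assume t: "t \<in> {0..real (Suc k) * \<delta>}" and f: "f \<in> X"
      show "\<parallel>S t f\<parallel> \<le> D ^ Suc (Suc k) * \<parallel>f\<parallel>"
      proof (cases "t \<le> \<delta>")
        case True
        have "\<parallel>S t f\<parallel> \<le> D ^ 1 * \<parallel>f\<parallel>" using D[of t f] t f True by simp
        also have "\<dots> \<le> D ^ Suc (Suc k) * \<parallel>f\<parallel>" using D1 by (intro mult_right_mono power_increasing) auto
        finally show ?thesis .
      next
        case False
        have t': "t - \<delta> \<in> {0..real k * \<delta>}" using t False by (auto simp: algebra_simps)
        have "\<parallel>S t f\<parallel> = \<parallel>S \<delta> (S (t - \<delta>) f)\<parallel>" using norm_S_add[of \<delta> "t - \<delta>" f] \<delta> t' f by simp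
        also have "\<dots> \<le> D * \<parallel>S (t - \<delta>) f\<parallel>" using \<delta> t' f by (intro D S_sq) auto
        also have "\<dots> \<le> D * (D ^ Suc k * \<parallel>f\<parallel>)" using Suc t' f D1 by (intro mult_left_mono) auto
        finally show ?thesis by (simp add: mult_ac)
      qed
    qed
  qed
  obtain k :: nat where "R / \<delta> \<le> real k" using real_arch_simple by blast
  then have "R \<le> real k * \<delta>" using \<delta> by (simp add: field_simps)
  then show ?thesis using ind[of k] D1 by (intro exI[of _ "D ^ Suc k"]) auto
qed

section \<open>Differentiating Fourier coefficients along the semigroup\<close>

lemma S_commute:
  assumes "0 \<le> s" "0 \<le> t" "f \<in> X" shows "AE z in \<TT>. S s (S t f) z = S t (S s f) z"
  using S_add[OF assms] S_add[OF assms(2,1,3)] by eventually_elim (simp add: add.commute)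

text \<open>\<open>S s\<close> is bounded and commutes with the difference quotients at time 0. The
  orbit therefore stays in the domain, and the generator can be evaluated at every time.\<close>

lemma generator_S:
  assumes g: "generator L1 L2 S g h" and s: "0 \<le> s"
  shows "generator L1 L2 S (S s g) (S s h)"
proof -
  have gh: "g \<in> X" "h \<in> X" and lim: "((\<lambda>t. \<parallel>\<lambda>z. (1 / t) *\<^sub>R (S t g z - g z) - h z\<parallel>) \<longlongrightarrow> 0) (at_right 0)"
    using g by (auto simp: generator_def torus_L2 torus_norm)
  obtain C where C: "C \<ge> 0" "\<And>f. f \<in> X \<Longrightarrow> \<parallel>S s f\<parallel> \<le> C * \<parallel>f\<parallel>" using compact_bound[of s] s by auto
  have le: "\<parallel>\<lambda>z. (1 / t) *\<^sub>R (S t (S s g) z - S s g z) - S s h z\<parallel> \<le> C * \<parallel>\<lambda>z. (1 / t) *\<^sub>R (S t g z - g z) - h z\<parallel>" if t: "t > 0" for t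
  proof -
    define q where "q z = complex_of_real (1 / t) * (S t g z - g z) - h z" for z
    have q: "q \<in> X" unfolding q_def[abs_def] using t by (intro X_intros gh) auto
    have "\<parallel>\<lambda>z. (1 / t) *\<^sub>R (S t (S s g) z - S s g z) - S s h z\<parallel> = \<parallel>S s q\<parallel>"
    proof (rule norm_cong_AE)
      have t0: "0 \<le> t" using t by simp
      have S1: "S t g \<in> X" by (intro X_intros gh t0)
      have "AE z in \<TT>. S s q z = S s (\<lambda>w. complex_of_real (1 / t) * (S t g w - g w)) z - S s h z"
        unfolding q_def[abs_def] by (intro S_diff s gh X_intros t0)
      moreover have "AE z in \<TT>. S s (\<lambda>w. complex_of_real (1 / t) * (S t g w - g w)) z = complex_of_real (1 / t) * S s (\<lambda>w. S t g w - g w) z"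
        by (intro S_scale s gh X_intros t0)
      ultimately show "AE z in \<TT>. (1 / t) *\<^sub>R (S t (S s g) z - S s g z) - S s h z = S s q z"
        using S_diff[OF s S1 gh(1)] S_commute[OF s t0 gh(1)]
        by eventually_elim (simp add: scaleR_conv_of_real)
      show "S s q \<in> X" by (intro X_intros q s)
      show "(\<lambda>z. (1 / t) *\<^sub>R (S t (S s g) z - S s g z) - S s h z) \<in> X"
        unfolding scaleR_conv_of_real by (intro X_intros s t0 gh)
    qed
    also have "\<dots> \<le> C * \<parallel>q\<parallel>" by (rule C(2)[OF q])
    finally show ?thesis by (simp add: q_def[abs_def] scaleR_conv_of_real)
  qed
  have "((\<lambda>t. \<parallel>\<lambda>z. (1 / t) *\<^sub>R (S t (S s g) z - S s g z) - S s h z\<parallel>) \<longlongrightarrow> 0) (at_right 0)"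
  proof (rule tendsto_sandwich[of "\<lambda>_. 0"])
    show "((\<lambda>t. C * \<parallel>\<lambda>z. (1 / t) *\<^sub>R (S t g z - g z) - h z\<parallel>) \<longlongrightarrow> 0) (at_right 0)"
      using tendsto_mult_left[OF lim, of C] by simp
    show "\<forall>\<^sub>F t in at_right 0. \<parallel>\<lambda>z. (1 / t) *\<^sub>R (S t (S s g) z - S s g z) - S s h z\<parallel> \<le> C * \<parallel>\<lambda>z. (1 / t) *\<^sub>R (S t g z - g z) - h z\<parallel>"
      using le by (auto simp: eventually_at_right_field intro!: exI[of _ 1])
  qed auto
  then show ?thesis using gh s by (auto simp: generator_def torus_L2 torus_norm intro: X_intros)
qed

text \<open>To the right of \<open>t\<close> the difference quotient is the one at time 0,
  transported by \<open>S t\<close>. To the left it is transported by \<open>S y\<close> with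
  \<open>y < t\<close>, where the uniform bound on \<open>{0..t + 1}\<close> and strong continuity
  are needed to replace \<open>S y h\<close> by \<open>S t h\<close>.\<close>

lemma fc_S_has_vector_derivative:
  assumes g: "generator L1 L2 S g h" and t: "0 \<le> t"
  shows "((\<lambda>t. fc (S t g) k l) has_vector_derivative fc (S t h) k l) (at t within {0..})"
proof -
  have gh: "g \<in> X" "h \<in> X" and lim: "((\<lambda>t. \<parallel>\<lambda>z. (1 / t) *\<^sub>R (S t g z - g z) - h z\<parallel>) \<longlongrightarrow> 0) (at_right 0)"
    using g by (auto simp: generator_def torus_L2 torus_norm)
  define A where "A = sqrt (L1 * L2)"
  have A: "A > 0" using area_pos by (simp add: A_def)
  obtain C where C: "C \<ge> 0" "\<And>s f. s \<in> {0..t + 1} \<Longrightarrow> f \<in> X \<Longrightarrow> \<parallel>S s f\<parallel> \<le> C * \<parallel>f\<parallel>" using compact_bound[of "t + 1"] by auto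
  \<comment> \<open>\<open>r\<close> is the error of the difference quotient at time 0 and
    \<open>q\<close> the modulus of continuity of the orbit of \<open>h\<close> there; both tend to
    0 and control all other times.\<close>
  define r where "r \<epsilon> = \<parallel>\<lambda>z. (1 / \<epsilon>) *\<^sub>R (S \<epsilon> g z - g z) - h z\<parallel>" for \<epsilon>
  define q where "q \<epsilon> = \<parallel>\<lambda>z. S \<epsilon> h z - h z\<parallel>" for \<epsilon>
  have F1: "cmod (fc (S (s + \<epsilon>) g) k l - fc (S s g) k l - of_real \<epsilon> * fc (S s h) k l) \<le> A * C * \<epsilon> * r \<epsilon>"
    if s: "0 \<le> s" "s \<le> t + 1" and \<epsilon>: "\<epsilon> > 0" for s \<epsilon>
  proof -
    have s\<epsilon>: "0 \<le> s + \<epsilon>" "0 \<le> \<epsilon>" using s \<epsilon> by auto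
    define p where "p z = complex_of_real (1 / \<epsilon>) * (S \<epsilon> g z - g z) - h z" for z
    have p: "p \<in> X" unfolding p_def[abs_def] by (intro X_intros gh s\<epsilon>)
    have "fc (S (s + \<epsilon>) g) k l - fc (S s g) k l - of_real \<epsilon> * fc (S s h) k l
       = fc (\<lambda>z. S (s + \<epsilon>) g z - S s g z) k l - fc (\<lambda>z. of_real \<epsilon> * S s h z) k l"
      by (simp add: fc_diff fc_scale X_intros gh s s\<epsilon>)
    also have "cmod \<dots> \<le> A * \<parallel>\<lambda>z. (S (s + \<epsilon>) g z - S s g z) - of_real \<epsilon> * S s h z\<parallel>"
      unfolding A_def by (intro fc_diff_le X_intros gh s s\<epsilon>)
    also have "\<parallel>\<lambda>z. (S (s + \<epsilon>) g z - S s g z) - of_real \<epsilon> * S s h z\<parallel> = \<parallel>\<lambda>z. of_real \<epsilon> * S s p z\<parallel>"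
    proof (rule norm_cong_AE)
      have S1: "S \<epsilon> g \<in> X" by (intro X_intros gh s\<epsilon>)
      have "AE z in \<TT>. S s p z = S s (\<lambda>w. complex_of_real (1 / \<epsilon>) * (S \<epsilon> g w - g w)) z - S s h z"
        unfolding p_def[abs_def] by (intro S_diff s gh X_intros s\<epsilon>)
      moreover have "AE z in \<TT>. S s (\<lambda>w. complex_of_real (1 / \<epsilon>) * (S \<epsilon> g w - g w)) z = complex_of_real (1 / \<epsilon>) * S s (\<lambda>w. S \<epsilon> g w - g w) z"
        by (intro S_scale s gh X_intros s\<epsilon>)
      ultimately show "AE z in \<TT>. (S (s + \<epsilon>) g z - S s g z) - of_real \<epsilon> * S s h z = of_real \<epsilon> * S s p z"
        using S_diff[OF s(1) S1 gh(1)] S_add[OF s(1) s\<epsilon>(2) gh(1)]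
      proof eventually_elim
        case (elim z)
        have "of_real \<epsilon> * S s p z = of_real \<epsilon> * (complex_of_real (1 / \<epsilon>) * S s (\<lambda>w. S \<epsilon> g w - g w) z - S s h z)"
          by (simp only: elim(1,2))
        also have "\<dots> = S s (\<lambda>w. S \<epsilon> g w - g w) z - of_real \<epsilon> * S s h z"
          using \<epsilon> by (simp add: right_diff_distrib)
        finally show ?case using elim(3,4) by simp
      qed
    qed (intro X_intros gh s s\<epsilon> p)+
    also have "\<dots> = \<epsilon> * \<parallel>S s p\<parallel>" using \<epsilon> by (simp add: norm2_scale)
    also have "\<parallel>S s p\<parallel> \<le> C * \<parallel>p\<parallel>" using s by (intro C p) auto
    also have "\<parallel>p\<parallel> = r \<epsilon>" by (simp add: r_def p_def[abs_def] scaleR_conv_of_real)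
    finally show ?thesis using A \<epsilon> by (simp add: mult_ac mult_left_mono)
  qed
  have F2: "cmod (fc (S (s + \<epsilon>) h) k l - fc (S s h) k l) \<le> A * C * q \<epsilon>"
    if s: "0 \<le> s" "s \<le> t + 1" and \<epsilon>: "\<epsilon> > 0" for s \<epsilon>
  proof -
    have s\<epsilon>: "0 \<le> s + \<epsilon>" "0 \<le> \<epsilon>" using s \<epsilon> by auto
    have "cmod (fc (S (s + \<epsilon>) h) k l - fc (S s h) k l) \<le> A * \<parallel>\<lambda>z. S (s + \<epsilon>) h z - S s h z\<parallel>"
      unfolding A_def by (intro fc_diff_le X_intros gh s s\<epsilon>)
    also have "\<parallel>\<lambda>z. S (s + \<epsilon>) h z - S s h z\<parallel> = \<parallel>S s (\<lambda>z. S \<epsilon> h z - h z)\<parallel>"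
    proof (rule norm_cong_AE)
      have S1: "S \<epsilon> h \<in> X" by (intro X_intros gh s\<epsilon>)
      show "AE z in \<TT>. S (s + \<epsilon>) h z - S s h z = S s (\<lambda>z. S \<epsilon> h z - h z) z"
        using S_diff[OF s(1) S1 gh(2)] S_add[OF s(1) s\<epsilon>(2) gh(2)] by eventually_elim simp
    qed (intro X_intros gh s s\<epsilon>)+
    also have "\<dots> \<le> C * q \<epsilon>" unfolding q_def using s by (intro C X_intros gh s\<epsilon>) auto
    finally show ?thesis using A by (simp add: mult_ac mult_left_mono)
  qed
  have main: "cmod (fc (S y g) k l - fc (S t g) k l - of_real (y - t) * fc (S t h) k l) \<le> A * C * (r \<bar>y - t\<bar> + q \<bar>y - t\<bar>) * \<bar>y - t\<bar>"
    if y: "y \<ge> 0" "y < t + 1" for y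
  proof -
    have nn: "0 \<le> r x" "0 \<le> q x" for x by (simp_all add: r_def q_def)
    consider "y = t" | "y > t" | "y < t" by linarith
    then show ?thesis
    proof cases
      case 2
      then have "cmod (fc (S y g) k l - fc (S t g) k l - of_real (y - t) * fc (S t h) k l) \<le> A * C * (y - t) * r (y - t)"
        using F1[of t "y - t"] t by simp
      also have "\<dots> \<le> A * C * (r (y - t) + q (y - t)) * (y - t)"
      proof -
        have "0 \<le> A * C * q (y - t) * (y - t)" using 2 nn(2)[of "y - t"] A C(1) by simp
        moreover have "A * C * (r (y - t) + q (y - t)) * (y - t) = A * C * (y - t) * r (y - t) + A * C * q (y - t) * (y - t)"
          by algebra
        ultimately show ?thesis by linarith
      qed
      finally show ?thesis using 2 by simp
    next
      case 3
      define \<epsilon> where "\<epsilon> = t - y"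
      have \<epsilon>: "\<epsilon> > 0" "y + \<epsilon> = t" using 3 by (auto simp: \<epsilon>_def)
      have a: "cmod (fc (S t g) k l - fc (S y g) k l - of_real \<epsilon> * fc (S y h) k l) \<le> A * C * \<epsilon> * r \<epsilon>"
        "cmod (fc (S t h) k l - fc (S y h) k l) \<le> A * C * q \<epsilon>"
        using F1[of y \<epsilon>] F2[of y \<epsilon>] y \<epsilon> by auto
      have "fc (S y g) k l - fc (S t g) k l - of_real (y - t) * fc (S t h) k l
         = of_real \<epsilon> * (fc (S t h) k l - fc (S y h) k l) - (fc (S t g) k l - fc (S y g) k l - of_real \<epsilon> * fc (S y h) k l)"
        by (simp add: \<epsilon>_def algebra_simps)
      also have "cmod \<dots> \<le> \<epsilon> * cmod (fc (S t h) k l - fc (S y h) k l) + cmod (fc (S t g) k l - fc (S y g) k l - of_real \<epsilon> * fc (S y h) k l)"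
        using norm_triangle_ineq4[of "of_real \<epsilon> * (fc (S t h) k l - fc (S y h) k l)"] \<epsilon>(1)
        by (metis abs_of_pos norm_mult norm_of_real)
      also have "\<dots> \<le> \<epsilon> * (A * C * q \<epsilon>) + A * C * \<epsilon> * r \<epsilon>" using a \<epsilon>(1) by (intro add_mono mult_left_mono) auto
      finally show ?thesis using 3 by (simp add: \<epsilon>_def algebra_simps)
    qed simp
  qed
  have "((\<lambda>\<epsilon>. A * C * (r \<epsilon> + q \<epsilon>)) \<longlongrightarrow> A * C * (0 + 0)) (at_right 0)"
    unfolding r_def q_def by (intro tendsto_intros lim S_tendsto gh)
  then have small: "\<forall>\<^sub>F \<epsilon> in at_right 0. A * C * (r \<epsilon> + q \<epsilon>) < e" if "e > 0" for e
    using that by (intro order_tendstoD(2)[where a=e]) auto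
  show ?thesis
    unfolding has_vector_derivative_def has_derivative_within_alt
  proof (intro conjI allI impI)
    show "bounded_linear (\<lambda>x. x *\<^sub>R fc (S t h) k l)" by (rule bounded_linear_scaleR_left)
    fix e :: real assume "e > 0"
    from small[OF this] obtain \<delta> where \<delta>: "\<delta> > 0" "\<And>\<epsilon>. 0 < \<epsilon> \<Longrightarrow> \<epsilon> < \<delta> \<Longrightarrow> A * C * (r \<epsilon> + q \<epsilon>) < e"
      unfolding eventually_at_right_field by blast
    show "\<exists>\<delta>>0. \<forall>y\<in>{0..}. norm (y - t) < \<delta> \<longrightarrow> cmod (fc (S y g) k l - fc (S t g) k l - (y - t) *\<^sub>R fc (S t h) k l) \<le> e * norm (y - t)"
    proof (intro exI[of _ "min \<delta> 1"] conjI ballI impI)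
      fix y assume y: "y \<in> {0..}" "norm (y - t) < min \<delta> 1"
      show "cmod (fc (S y g) k l - fc (S t g) k l - (y - t) *\<^sub>R fc (S t h) k l) \<le> e * norm (y - t)"
      proof (cases "y = t")
        case False
        then have "A * C * (r \<bar>y - t\<bar> + q \<bar>y - t\<bar>) \<le> e" using y by (intro less_imp_le \<delta>) auto
        then have "A * C * (r \<bar>y - t\<bar> + q \<bar>y - t\<bar>) * \<bar>y - t\<bar> \<le> e * \<bar>y - t\<bar>" by (intro mult_right_mono) auto
        moreover have "\<bar>y - t\<bar> < 1" using y(2) by simp
        then have "y < t + 1" by linarith
        ultimately show ?thesis using main[of y] y(1) by (simp add: scaleR_conv_of_real)
      qed simp
    qed (use \<delta> in simp)
  qed
qed

end

section \<open>The operator on Fourier modes\<close>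

lemma frechet_partials:
  assumes "(f has_derivative f') (at z)"
  shows "partial_x f z = f' (1, 0)" "partial_y f z = f' (0, 1)"
  unfolding partial_x_def partial_y_def frechet_derivative_at[OF assms, symmetric] by simp_all

lemma wave_comp_has_derivative:
  "((\<lambda>z. wave L k (fst z)) has_derivative (\<lambda>v. fst v *\<^sub>R (\<i> * of_real (2 * pi * of_int k / L) * wave L k (fst z)))) (at z)"
  "((\<lambda>z. wave L k (snd z)) has_derivative (\<lambda>v. snd v *\<^sub>R (\<i> * of_real (2 * pi * of_int k / L) * wave L k (snd z)))) (at z)"
  using has_derivative_compose[OF has_derivative_fst[OF has_derivative_ident] wave_has_vector_derivative[of L k "fst z" UNIV, unfolded has_vector_derivative_def]]
    has_derivative_compose[OF has_derivative_snd[OF has_derivative_ident] wave_has_vector_derivative[of L k "snd z" UNIV, unfolded has_vector_derivative_def]]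
  by simp_all

lemma mode_has_derivative:
  "(mode L1 L2 k l has_derivative (\<lambda>v. (\<i> * of_real (fst v * (2 * pi * of_int k / L1) + snd v * (2 * pi * of_int l / L2))) * mode L1 L2 k l z)) (at z)"
proof -
  have "(mode L1 L2 k l has_derivative (\<lambda>v. wave L1 k (fst z) * (snd v *\<^sub>R (\<i> * of_real (2 * pi * of_int l / L2) * wave L2 l (snd z)))
      + (fst v *\<^sub>R (\<i> * of_real (2 * pi * of_int k / L1) * wave L1 k (fst z))) * wave L2 l (snd z))) (at z)"
    unfolding mode_def[abs_def] by (rule has_derivative_mult[OF wave_comp_has_derivative])
  then show ?thesis
    by (rule has_derivative_eq_rhs) (simp add: fun_eq_iff mode_def scaleR_conv_of_real algebra_simps)
qed

lemma partial_mode: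
  "partial_x (\<lambda>z. c * mode L1 L2 k l z) = (\<lambda>z. c * (\<i> * of_real (2 * pi * of_int k / L1)) * mode L1 L2 k l z)"
  "partial_y (\<lambda>z. c * mode L1 L2 k l z) = (\<lambda>z. c * (\<i> * of_real (2 * pi * of_int l / L2)) * mode L1 L2 k l z)"
  using frechet_partials[OF has_derivative_mult_right[OF mode_has_derivative, of c L1 L2 k l]]
  by (simp_all add: fun_eq_iff mult.assoc)

text \<open>Differentiation only changes the constant \<open>c\<close>, so the induction runs over
  all constants.\<close>

lemma Ck_mode: "Ck n (\<lambda>z. c * mode L1 L2 k l z)"
proof (induction n arbitrary: c)
  case 0
  show ?case by (auto intro!: continuous_intros)
next
  case (Suc n)
  have "(\<lambda>z. c * mode L1 L2 k l z) differentiable (at z)" for z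
    using has_derivative_mult_right[OF mode_has_derivative, of c] unfolding differentiable_def by blast
  then show ?case unfolding Ck.simps partial_mode using Suc by blast
qed

lemma mode_test_function:
  assumes "L1 > 0" "L2 > 0" shows "mode L1 L2 k l \<in> test_functions L1 L2"
proof -
  have "Ck n (mode L1 L2 k l)" for n using Ck_mode[of n 1 L1 L2 k l] by simp
  moreover have "mode L1 L2 k l (x + L1, y) = mode L1 L2 k l (x, y)" "mode L1 L2 k l (x, y + L2) = mode L1 L2 k l (x, y)" for x y
    using assms by (simp_all add: mode_def wave_period)
  ultimately show ?thesis unfolding test_functions_def by blast
qed

lemma laplacian_mode:
  "laplacian (\<lambda>z. c * mode L1 L2 k l z)
    = (\<lambda>z. - c * of_real ((2 * pi * of_int k / L1)\<^sup>2 + (2 * pi * of_int l / L2)\<^sup>2) * mode L1 L2 k l z)"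
  unfolding laplacian_def[abs_def] partial_mode
  by (simp add: fun_eq_iff algebra_simps power2_eq_square)

lemma Ck_Suc_D:
  assumes "Ck (Suc n) f"
  shows "f differentiable (at z)" "Ck n (partial_x f)" "Ck n (partial_y f)"
  using assms by (simp_all del: split_paired_All)

lemma Ck_continuous: "Ck n f \<Longrightarrow> continuous_on UNIV f"
proof (cases n)
  case (Suc k)
  assume "Ck n f"
  then have "f differentiable (at z)" for z using Suc Ck_Suc_D(1) by blast
  then show ?thesis by (simp add: continuous_at_imp_continuous_on differentiable_imp_continuous_within)
qed simp

lemma Ck_Suc_imp_Ck: "Ck (Suc n) f \<Longrightarrow> Ck n f"
proof (induction n arbitrary: f)
  case 0 then show ?case using Ck_continuous[OF 0] by (simp only: Ck.simps)
next
  case (Suc n)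
  then show ?case using Ck_Suc_D[OF Suc.prems] Ck.simps(2) by blast
qed

lemma partial_has_vector_derivative:
  assumes "f differentiable (at (x, y))"
  shows "((\<lambda>x. f (x, y)) has_vector_derivative partial_x f (x, y)) (at x)"
    "((\<lambda>y. f (x, y)) has_vector_derivative partial_y f (x, y)) (at y)"
proof -
  let ?D = "frechet_derivative f (at (x, y))"
  have D: "(f has_derivative ?D) (at (x, y))" using assms by (simp add: frechet_derivative_works)
  then interpret bounded_linear ?D by (rule has_derivative_bounded_linear)
  have sc: "?D (h, 0) = h *\<^sub>R ?D (1, 0)" "?D (0, h) = h *\<^sub>R ?D (0, 1)" for h
    using scale[of h "(1, 0)"] scale[of h "(0, 1)"] by simp_all
  have "((\<lambda>x. (x, y)) has_derivative (\<lambda>h. (h, 0))) (at x)" "((\<lambda>y. (x, y)) has_derivative (\<lambda>h. (0, h))) (at y)"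
    by (auto intro!: derivative_eq_intros)
  from has_derivative_compose[OF this(1) D] has_derivative_compose[OF this(2) D]
  show "((\<lambda>x. f (x, y)) has_vector_derivative partial_x f (x, y)) (at x)"
    "((\<lambda>y. f (x, y)) has_vector_derivative partial_y f (x, y)) (at y)"
    unfolding has_vector_derivative_def partial_x_def partial_y_def sc(1)[symmetric] sc(2)[symmetric] by simp_all
qed

lemma integral_mult_left_commute:
  fixes c :: complex
  shows "(\<integral>z. g z * (c * f z) \<partial>M) = c * (\<integral>z. g z * f z \<partial>M)"
  by (simp add: mult.left_commute[of _ c])

section \<open>Modes tested against periodic functions, and the operator on Fourier
  coefficients\<close>

context torus_lengths
begin

definition periodic :: "(real \<times> real \<Rightarrow> complex) \<Rightarrow> bool" where
  "periodic f \<longleftrightarrow> (\<forall>x y. f (x + L1, y) = f (x, y) \<and> f (x, y + L2) = f (x, y))"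

text \<open>The derivative commutes with translations, here by a period in either variable.\<close>

lemma periodic_partial:
  assumes p: "periodic f" and d: "\<And>z. f differentiable (at z)"
  shows "periodic (partial_x f)" "periodic (partial_y f)"
proof -
  have "frechet_derivative f (at ((x, y) + c)) = frechet_derivative f (at (x, y))"
    if c: "\<And>z. f (z + c) = f z" for x y c
  proof -
    have D: "(f has_derivative frechet_derivative f (at ((x, y) + c))) (at ((x, y) + c))"
      using d by (simp add: frechet_derivative_works)
    have "((\<lambda>z. z + c) has_derivative (\<lambda>h. h)) (at (x, y))" by (auto intro!: derivative_eq_intros)
    from has_derivative_compose[OF this D] have "(f has_derivative frechet_derivative f (at ((x, y) + c))) (at (x, y))"
      by (simp add: c)
    then show ?thesis by (rule frechet_derivative_at)
  qed
  from this[of "(L1, 0)"] this[of "(0, L2)"] p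
  show "periodic (partial_x f)" "periodic (partial_y f)"
    unfolding periodic_def partial_x_def partial_y_def by (auto simp: split_paired_all)
qed

text \<open>Integration by parts in one variable inside the iterated integral, with boundary terms
  cancelled by periodicity. It verifies the weak derivatives of trigonometric sums.\<close>

lemma integral_mode_partial:
  assumes p: "periodic f" and C: "Ck 1 f"
  shows "(\<integral>z. mode L1 L2 k l z * partial_x f z \<partial>\<TT>) = - (\<i> * of_real (2 * pi * of_int k / L1)) * (\<integral>z. mode L1 L2 k l z * f z \<partial>\<TT>)"
    "(\<integral>z. mode L1 L2 k l z * partial_y f z \<partial>\<TT>) = - (\<i> * of_real (2 * pi * of_int l / L2)) * (\<integral>z. mode L1 L2 k l z * f z \<partial>\<TT>)"
proof -
  have d: "f differentiable (at z)" and cx: "continuous_on UNIV (partial_x f)" and cy: "continuous_on UNIV (partial_y f)" for z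
    using Ck_Suc_D[OF C[unfolded One_nat_def]] by simp_all
  have cf: "continuous_on UNIV f" by (rule Ck_continuous[OF C])
  let ?m = "mode L1 L2 k l"
  have I: "integrable \<TT> (\<lambda>z. ?m z * f z)" "integrable \<TT> (\<lambda>z. ?m z * partial_x f z)" "integrable \<TT> (\<lambda>z. ?m z * partial_y f z)"
    by (intro integrable_torus_continuous continuous_intros cf cx cy)+
  let ?a = "\<i> * of_real (2 * pi * of_int k / L1)" and ?b = "\<i> * of_real (2 * pi * of_int l / L2)"
  have dmx: "((\<lambda>x. ?m (x, y)) has_vector_derivative ?a * ?m (x, y)) (at x within A)" for x y A
    using has_vector_derivative_mult_left[OF wave_has_vector_derivative[of L1 k x A], of "wave L2 l y"]
    by (simp add: mode_def mult.assoc)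
  have dmy: "((\<lambda>y. ?m (x, y)) has_vector_derivative ?b * ?m (x, y)) (at y within A)" for x y A
    using has_vector_derivative_mult_right[OF wave_has_vector_derivative[of L2 l y A], of "wave L1 k x"]
    by (simp add: mode_def mult_ac)
  have z1: "(LINT x:{0..L1}|lborel. ?m (x, y) * partial_x f (x, y) + ?a * (?m (x, y) * f (x, y))) = 0" for y
  proof -
    have c: "continuous_on {0..L1} (\<lambda>x. ?m (x, y) * partial_x f (x, y) + ?a * (?m (x, y) * f (x, y)))"
      by (intro continuous_intros continuous_on_compose2[OF cx] continuous_on_compose2[OF cf] continuous_on_compose2[OF mode_continuous[of UNIV]]) auto
    have "((\<lambda>x. ?m (x, y) * partial_x f (x, y) + (?a * ?m (x, y)) * f (x, y)) has_integral (?m (L1, y) * f (L1, y) - ?m (0, y) * f (0, y))) {0..L1}"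
      using L1_pos by (intro fundamental_theorem_of_calculus has_vector_derivative_mult dmx has_vector_derivative_at_within[OF partial_has_vector_derivative(1)[OF d]]) auto
    moreover have "f (L1, y) = f (0, y)" using p unfolding periodic_def by (metis add_0)
    moreover have "?m (L1, y) = ?m (0, y)" using wave_L[of L1 k] L1_pos by (simp add: mode_def) (simp add: wave_def)
    ultimately have "((\<lambda>x. ?m (x, y) * partial_x f (x, y) + ?a * (?m (x, y) * f (x, y))) has_integral 0) {0..L1}" by (simp add: mult.assoc)
    then show ?thesis using set_integral_continuous(2)[OF c] by (simp add: integral_unique)
  qed
  have z2: "(LINT y:{0..L2}|lborel. ?m (x, y) * partial_y f (x, y) + ?b * (?m (x, y) * f (x, y))) = 0" for x
  proof -
    have c: "continuous_on {0..L2} (\<lambda>y. ?m (x, y) * partial_y f (x, y) + ?b * (?m (x, y) * f (x, y)))"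
      by (intro continuous_intros continuous_on_compose2[OF cy] continuous_on_compose2[OF cf] continuous_on_compose2[OF mode_continuous[of UNIV]]) auto
    have "((\<lambda>y. ?m (x, y) * partial_y f (x, y) + (?b * ?m (x, y)) * f (x, y)) has_integral (?m (x, L2) * f (x, L2) - ?m (x, 0) * f (x, 0))) {0..L2}"
      using L2_pos by (intro fundamental_theorem_of_calculus has_vector_derivative_mult dmy has_vector_derivative_at_within[OF partial_has_vector_derivative(2)[OF d]]) auto
    moreover have "f (x, L2) = f (x, 0)" using p unfolding periodic_def by (metis add_0)
    moreover have "?m (x, L2) = ?m (x, 0)" using wave_L[of L2 l] L2_pos by (simp add: mode_def) (simp add: wave_def)
    ultimately have "((\<lambda>y. ?m (x, y) * partial_y f (x, y) + ?b * (?m (x, y) * f (x, y))) has_integral 0) {0..L2}" by (simp add: mult.assoc)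
    then show ?thesis using set_integral_continuous(2)[OF c] by (simp add: integral_unique)
  qed
  have "(\<integral>z. ?m z * partial_x f z + ?a * (?m z * f z) \<partial>\<TT>) = 0"
    by (subst integral_torus_iterated') (use I z1 in auto)
  then show "(\<integral>z. ?m z * partial_x f z \<partial>\<TT>) = - ?a * (\<integral>z. ?m z * f z \<partial>\<TT>)"
    using I by (simp add: eq_neg_iff_add_eq_0)
  have "(\<integral>z. ?m z * partial_y f z + ?b * (?m z * f z) \<partial>\<TT>) = 0"
    by (subst integral_torus_iterated) (use I z2 in auto)
  then show "(\<integral>z. ?m z * partial_y f z \<partial>\<TT>) = - ?b * (\<integral>z. ?m z * f z \<partial>\<TT>)"
    using I by (simp add: eq_neg_iff_add_eq_0)
qed

text \<open>The eigenvalue of minus the Laplacian on a mode.\<close>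

definition freq2 :: "int \<Rightarrow> int \<Rightarrow> real" where
  "freq2 k l = (2 * pi * of_int k / L1)\<^sup>2 + (2 * pi * of_int l / L2)\<^sup>2"

lemma Ck_add:
  assumes "Ck n f" "Ck n g" shows "Ck n (\<lambda>z. f z + g z)"
  using assms
proof (induction n arbitrary: f g)
  case 0 then show ?case by (auto intro: continuous_intros)
next
  case (Suc n)
  have D: "((\<lambda>z. f z + g z) has_derivative (\<lambda>v. frechet_derivative f (at z) v + frechet_derivative g (at z) v)) (at z)" for z
    by (intro has_derivative_add frechet_derivative_works[THEN iffD1] Ck_Suc_D(1)[OF Suc.prems(1)] Ck_Suc_D(1)[OF Suc.prems(2)])
  have "partial_x (\<lambda>z. f z + g z) = (\<lambda>z. partial_x f z + partial_x g z)" "partial_y (\<lambda>z. f z + g z) = (\<lambda>z. partial_y f z + partial_y g z)"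
    using frechet_partials[OF D] by (auto simp: partial_x_def partial_y_def fun_eq_iff)
  moreover have "(\<lambda>z. f z + g z) differentiable (at z)" for z using D unfolding differentiable_def by blast
  ultimately show ?case using Suc by simp
qed

lemma integral_mode_laplacian:
  assumes p: "periodic f" and C: "Ck 2 f"
  shows "(\<integral>z. mode L1 L2 k l z * laplacian f z \<partial>\<TT>) = - of_real (freq2 k l) * (\<integral>z. mode L1 L2 k l z * f z \<partial>\<TT>)"
proof -
  have C2: "Ck (Suc 1) f" using C by (simp only: Suc_1)
  have C1: "Ck 1 f" by (rule Ck_Suc_imp_Ck[OF C2])
  note Cp = Ck_Suc_D(2,3)[OF C2] and d = Ck_Suc_D(1)[OF C2]
  have pp: "periodic (partial_x f)" "periodic (partial_y f)" by (rule periodic_partial[OF p d])+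
  have "integrable \<TT> (\<lambda>z. mode L1 L2 k l z * partial_x (partial_x f) z)" "integrable \<TT> (\<lambda>z. mode L1 L2 k l z * partial_y (partial_y f) z)"
    using Ck_Suc_D(2)[OF Cp(1)[unfolded One_nat_def]] Ck_Suc_D(3)[OF Cp(2)[unfolded One_nat_def]]
    by (auto intro!: integrable_torus_continuous continuous_intros)
  then have "(\<integral>z. mode L1 L2 k l z * laplacian f z \<partial>\<TT>)
      = (\<integral>z. mode L1 L2 k l z * partial_x (partial_x f) z \<partial>\<TT>) + (\<integral>z. mode L1 L2 k l z * partial_y (partial_y f) z \<partial>\<TT>)"
    by (simp add: laplacian_def distrib_left)
  also have "\<dots> = - of_real (freq2 k l) * (\<integral>z. mode L1 L2 k l z * f z \<partial>\<TT>)"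
    unfolding integral_mode_partial(1)[OF pp(1) Cp(1)] integral_mode_partial(2)[OF pp(2) Cp(2)]
      integral_mode_partial(1)[OF p C1] integral_mode_partial(2)[OF p C1] freq2_def
    by (simp add: algebra_simps power2_eq_square)
  finally show ?thesis .
qed

lemma test_function_facts:
  assumes "\<phi> \<in> test_functions L1 L2"
  shows "periodic \<phi>" "Ck n \<phi>" "periodic (laplacian \<phi>)" "Ck n (laplacian \<phi>)" "\<phi> \<in> square_integrable \<TT>"
    "laplacian (laplacian \<phi>) \<in> square_integrable \<TT>" "partial_x \<phi> \<in> square_integrable \<TT>"
proof -
  show p: "periodic \<phi>" and C: "Ck n \<phi>" for n using assms by (auto simp: test_functions_def periodic_def)
  note d = Ck_Suc_D(1)[OF C]
  have pp: "periodic (partial_x \<phi>)" "periodic (partial_y \<phi>)" by (rule periodic_partial[OF p d])+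
  note Cp = Ck_Suc_D(2,3)[OF C]
  have "periodic (partial_x (partial_x \<phi>))" "periodic (partial_y (partial_y \<phi>))"
    by (intro periodic_partial pp Ck_Suc_D(1)[OF Cp(1)] Ck_Suc_D(1)[OF Cp(2)])+
  then show "periodic (laplacian \<phi>)" by (simp add: laplacian_def periodic_def)
  have Cl: "Ck n (\<lambda>z. partial_x (partial_x f) z + partial_y (partial_y f) z)" if "\<And>n. Ck n f" for n f
    by (intro Ck_add Ck_Suc_D(2)[OF Ck_Suc_D(2)[OF that]] Ck_Suc_D(3)[OF Ck_Suc_D(3)[OF that]])
  show Cl1: "Ck n (laplacian \<phi>)" for n using Cl[OF C] by (simp add: laplacian_def[abs_def])
  show "\<phi> \<in> square_integrable \<TT>" "laplacian (laplacian \<phi>) \<in> square_integrable \<TT>" "partial_x \<phi> \<in> square_integrable \<TT>"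
    using Cl[OF Cl1, of 0] C[of 0] Cp(1)[of 0] by (auto intro!: square_integrable_torus_continuous simp: laplacian_def[abs_def])
qed

text \<open>Modes are themselves test functions, so the weak formulation tested with the conjugate
  mode yields the multiplier.\<close>

lemma weak_bilaplacian_fc:
  assumes "weak_bilaplacian L1 L2 g q"
  shows "fc q k l = of_real ((freq2 k l)\<^sup>2) * fc g k l"
proof -
  have "fc q k l = (\<integral>z. g z * laplacian (laplacian (mode L1 L2 (- k) (- l))) z \<partial>\<TT>)"
    using assms mode_test_function[OF L1_pos L2_pos, of "- k" "- l"] unfolding weak_bilaplacian_def mode_coeff_def by blast
  also have "laplacian (laplacian (mode L1 L2 (- k) (- l))) = (\<lambda>z. of_real ((freq2 k l)\<^sup>2) * mode L1 L2 (- k) (- l) z)"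
  proof -
    have fr: "(2 * pi * of_int (- k) / L1)\<^sup>2 + (2 * pi * of_int (- l) / L2)\<^sup>2 = freq2 k l"
      by (simp add: freq2_def)
    note lap = laplacian_mode[of _ L1 L2 "- k" "- l", unfolded fr]
    have "laplacian (mode L1 L2 (- k) (- l)) = (\<lambda>z. (- 1 * of_real (freq2 k l)) * mode L1 L2 (- k) (- l) z)"
      using lap[of 1] by (simp only: mult_1_left)
    then show ?thesis using lap[of "- 1 * of_real (freq2 k l)"] by (simp add: power2_eq_square)
  qed
  finally show ?thesis by (simp only: mode_coeff_def integral_mult_left_commute)
qed

lemma weak_partial_x_fc:
  assumes "weak_partial_x L1 L2 g p"
  shows "fc p k l = \<i> * of_real (2 * pi * of_int k / L1) * fc g k l"
proof -
  define c where "c = \<i> * complex_of_real (2 * pi * of_int k / L1)"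
  have "fc p k l = - (\<integral>z. g z * partial_x (mode L1 L2 (- k) (- l)) z \<partial>\<TT>)"
    using assms mode_test_function[OF L1_pos L2_pos, of "- k" "- l"] unfolding weak_partial_x_def mode_coeff_def by blast
  also have "partial_x (mode L1 L2 (- k) (- l)) = (\<lambda>z. - c * mode L1 L2 (- k) (- l) z)"
    using partial_mode(1)[of 1 L1 L2 "- k" "- l"] by (simp add: c_def)
  finally show ?thesis unfolding c_def[symmetric] by (simp only: mode_coeff_def integral_mult_left_commute) simp
qed

lemma fc_sin_power_mult:
  assumes p: "p \<in> square_integrable \<TT>"
  shows "fc (\<lambda>z. of_real (sin (2 * pi * snd z / L2) ^ m) * p z) k l = sin_conv m (fc p k) l"
proof -
  have "(of_real (sin (2 * pi * snd z / L2) ^ m) * p z) * mode L1 L2 (- k) (- l) z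
      = (\<Sum>j\<in>{- int m..int m}. sin_power_coeff m j * (p z * mode L1 L2 (- k) (- (l - j)) z))" for z
  proof -
    have "wave L2 j (snd z) * mode L1 L2 (- k) (- l) z = mode L1 L2 (- k) (- (l - j)) z" for j
    proof -
      have "wave L2 (j - l) (snd z) = wave L2 j (snd z) * wave L2 (- l) (snd z)"
        using wave_add[of L2 j "- l" "snd z"] by simp
      then show ?thesis by (simp add: mode_def)
    qed
    then show ?thesis unfolding sin_power_wave sum_distrib_right
      by (intro sum.cong) (auto simp: mult_ac)
  qed
  then have "fc (\<lambda>z. of_real (sin (2 * pi * snd z / L2) ^ m) * p z) k l
     = (\<integral>z. (\<Sum>j\<in>{- int m..int m}. sin_power_coeff m j * (p z * mode L1 L2 (- k) (- (l - j)) z)) \<partial>\<TT>)"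
    unfolding mode_coeff_def by simp
  also have "\<dots> = sin_conv m (fc p k) l"
    unfolding sin_conv_def mode_coeff_def
    by (subst Bochner_Integration.integral_sum) (auto intro!: integrable_mult_right integrable_mode_mult p)
  finally show ?thesis .
qed

lemma sin_power_mult_sq:
  assumes p: "p \<in> square_integrable \<TT>"
  shows "(\<lambda>z. of_real (sin (2 * pi * snd z / L2) ^ m) * p z) \<in> square_integrable \<TT>"
proof (rule integrable_square_bound)
  have "(\<lambda>z :: real \<times> real. complex_of_real (sin (2 * pi * snd z / L2) ^ m)) \<in> borel_measurable \<TT>"
    by (intro borel_measurable_torus_continuous) (auto intro!: continuous_intros simp: divide_inverse)
  then show "(\<lambda>z :: real \<times> real. of_real (sin (2 * pi * snd z / L2) ^ m) * p z) \<in> borel_measurable \<TT>"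
    using square_integrableD(1)[OF p] by (rule borel_measurable_times)
  show "integrable \<TT> (\<lambda>z. (cmod (p z))\<^sup>2)" by (rule square_integrableD(2)[OF p])
  fix z :: "real \<times> real"
  have "\<bar>sin (2 * pi * snd z / L2)\<bar> ^ m \<le> 1" by (intro power_le_one) auto
  then have "cmod (complex_of_real (sin (2 * pi * snd z / L2) ^ m) * p z) \<le> 1 * cmod (p z)"
    unfolding norm_mult norm_of_real power_abs by (intro mult_right_mono) auto
  then have "(cmod (complex_of_real (sin (2 * pi * snd z / L2) ^ m) * p z))\<^sup>2 \<le> (1 * cmod (p z))\<^sup>2" by (intro power_mono) auto
  then show "(cmod (complex_of_real (sin (2 * pi * snd z / L2) ^ m) * p z))\<^sup>2 \<le> (cmod (p z))\<^sup>2" by simp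
qed

text \<open>Connects the weakly defined operator with the infinite matrix of
  \<open>shear_system\<close>: a diagonal symbol plus a convolution within each row.\<close>

lemma H_op_fc:
  assumes "H_op L1 L2 (\<lambda>y. sin (2 * pi * y / L2) ^ m) \<nu> g h"
  shows "fc h k l = of_real (symbol L2 \<nu> (2 * pi * of_int k / L1) l) * fc g k l
    + \<i> * of_real (2 * pi * of_int k / L1) * sin_conv m (fc g k) l"
proof -
  from assms obtain p q where pq: "p \<in> square_integrable \<TT>" "q \<in> square_integrable \<TT>"
    and wp: "weak_partial_x L1 L2 g p" and wq: "weak_bilaplacian L1 L2 g q"
    and h: "h \<in> square_integrable \<TT>" and AE: "AE z in \<TT>. h z = \<nu> *\<^sub>R q z + (sin (2 * pi * snd z / L2) ^ m) *\<^sub>R p z"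
    unfolding H_op_def torus_L2 by blast
  have up: "(\<lambda>z. of_real (sin (2 * pi * snd z / L2) ^ m) * p z) \<in> square_integrable \<TT>" by (rule sin_power_mult_sq[OF pq(1)])
  have nq: "(\<lambda>z. of_real \<nu> * q z) \<in> square_integrable \<TT>" by (rule square_integrable_scale[OF pq(2)])
  have "fc h k l = fc (\<lambda>z. of_real \<nu> * q z + of_real (sin (2 * pi * snd z / L2) ^ m) * p z) k l"
    unfolding mode_coeff_def
  proof (rule integral_cong_AE)
    show "AE z in \<TT>. h z * mode L1 L2 (- k) (- l) z = (of_real \<nu> * q z + of_real (sin (2 * pi * snd z / L2) ^ m) * p z) * mode L1 L2 (- k) (- l) z"
      using AE by eventually_elim (simp add: scaleR_conv_of_real)
  qed (use square_integrableD(1)[OF h] square_integrableD(1)[OF square_integrable_add[OF nq up]] square_integrableD(1)[OF mode_sq] in \<open>auto intro!: borel_measurable_times\<close>)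
  also have "\<dots> = of_real \<nu> * fc q k l + sin_conv m (fc p k) l"
    by (simp only: fc_add[OF nq up] fc_scale fc_sin_power_mult[OF pq(1)])
  also have "sin_conv m (fc p k) l = \<i> * of_real (2 * pi * of_int k / L1) * sin_conv m (fc g k) l"
    by (simp add: sin_conv_def weak_partial_x_fc[OF wp] sum_distrib_left mult_ac)
  also have "of_real \<nu> * fc q k l = of_real (symbol L2 \<nu> (2 * pi * of_int k / L1) l) * fc g k l"
    by (simp add: weak_bilaplacian_fc[OF wq] symbol_def freq2_def)
  finally show ?thesis .
qed

text \<open>Provides a dense set inside the domain; its weak derivatives are obtained by multiplying
  coefficients.\<close>

lemma H_op_trig_sum:
  assumes F: "finite F"
  shows "\<exists>h. H_op L1 L2 (\<lambda>y. sin (2 * pi * y / L2) ^ m) \<nu> (trig_sum F c) h"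
proof -
  define p where "p = trig_sum F (\<lambda>k l. \<i> * of_real (2 * pi * of_int k / L1) * c k l)"
  define q where "q = trig_sum F (\<lambda>k l. of_real ((freq2 k l)\<^sup>2) * c k l)"
  define h where "h z = \<nu> *\<^sub>R q z + (sin (2 * pi * snd z / L2) ^ m) *\<^sub>R p z" for z
  have sq: "p \<in> square_integrable \<TT>" "q \<in> square_integrable \<TT>" by (simp_all add: p_def q_def trig_sum_sq)
  have sum: "(\<integral>z. trig_sum F b z * \<psi> z \<partial>\<TT>) = (\<Sum>(k, l)\<in>F. b k l * (\<integral>z. mode L1 L2 k l z * \<psi> z \<partial>\<TT>))"
    if "\<psi> \<in> square_integrable \<TT>" for b \<psi>
  proof -
    have "(\<integral>z. trig_sum F b z * \<psi> z \<partial>\<TT>) = (\<integral>z. (\<Sum>p\<in>F. b (fst p) (snd p) * (mode L1 L2 (fst p) (snd p) z * \<psi> z)) \<partial>\<TT>)"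
      by (simp add: trig_sum_def case_prod_unfold sum_distrib_right mult.assoc)
    also have "\<dots> = (\<Sum>p\<in>F. b (fst p) (snd p) * (\<integral>z. mode L1 L2 (fst p) (snd p) z * \<psi> z \<partial>\<TT>))"
      by (subst Bochner_Integration.integral_sum)
        (auto intro!: integrable_mult_right integrable_mult_square_integrable mode_sq that)
    finally show ?thesis by (simp add: case_prod_unfold)
  qed
  have "weak_partial_x L1 L2 (trig_sum F c) p" unfolding weak_partial_x_def
  proof
    fix \<phi> assume \<phi>: "\<phi> \<in> test_functions L1 L2"
    note facts = test_function_facts[OF \<phi>]
    show "(\<integral>z. p z * \<phi> z \<partial>\<TT>) = - (\<integral>z. trig_sum F c z * partial_x \<phi> z \<partial>\<TT>)"
      unfolding p_def sum[OF facts(5)] sum[OF facts(7)] integral_mode_partial(1)[OF facts(1,2)] case_prod_unfold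
      by (simp add: sum_negf[symmetric] mult_ac)
  qed
  moreover have "weak_bilaplacian L1 L2 (trig_sum F c) q" unfolding weak_bilaplacian_def
  proof
    fix \<phi> assume \<phi>: "\<phi> \<in> test_functions L1 L2"
    note facts = test_function_facts[OF \<phi>]
    show "(\<integral>z. q z * \<phi> z \<partial>\<TT>) = (\<integral>z. trig_sum F c z * laplacian (laplacian \<phi>) z \<partial>\<TT>)"
      unfolding q_def sum[OF facts(5)] sum[OF facts(6)] integral_mode_laplacian[OF facts(3,4)] integral_mode_laplacian[OF facts(1,2)]
      by (simp add: case_prod_unfold power2_eq_square mult_ac)
  qed
  moreover have "h \<in> square_integrable \<TT>"
    unfolding h_def[abs_def] scaleR_conv_of_real
    by (intro square_integrable_add square_integrable_scale sin_power_mult_sq sq)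
  ultimately have "H_op L1 L2 (\<lambda>y. sin (2 * pi * y / L2) ^ m) \<nu> (trig_sum F c) h"
    unfolding H_op_def torus_L2 using sq trig_sum_sq by (auto simp: h_def)
  then show ?thesis by blast
qed

text \<open>Cauchy--Schwarz against the indicator of \<open>{0..L1}\<close> bounds the squared mean
  by the mean of the square on each slice, and Tonelli integrates this over \<open>y\<close>. The
  estimate is made in \<open>ennreal\<close>, since individual slices may fail to be square
  integrable.\<close>

lemma x_mean_snd_sq:
  assumes g: "g \<in> square_integrable \<TT>"
  shows "(\<lambda>z. x_mean L1 g (snd z)) \<in> square_integrable \<TT>"
proof -
  let ?R = "{0..L1} \<times> {0..L2}"
  \<comment> \<open>Extension by zero to the plane makes the product-measure theorems
    available.\<close>
  define G where "G z = indicator ?R z *\<^sub>R g z" for z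
  have Gm: "G \<in> borel_measurable (lborel \<Otimes>\<^sub>M lborel)"
    using square_integrableD(1)[OF g] unfolding torus_def G_def[abs_def] lborel_prod
    by (subst (asm) borel_measurable_restrict_space_iff) auto
  have Gi: "integrable lborel (\<lambda>z. (cmod (G z))\<^sup>2)"
  proof -
    have "(\<lambda>z. (cmod (G z))\<^sup>2) = (\<lambda>z. indicator ?R z *\<^sub>R (cmod (g z))\<^sup>2)"
      by (auto simp: G_def fun_eq_iff indicator_def)
    then show ?thesis using square_integrableD(2)[OF g] by (simp add: integrable_torus_iff)
  qed
  define M where "M y = (1 / L1) *\<^sub>R (\<integral>x. G (x, y) \<partial>lborel)" for y
  have swap: "(\<lambda>(y, x). G (x, y)) \<in> borel_measurable (lborel \<Otimes>\<^sub>M lborel)"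
    using measurable_compose[OF measurable_pair_swap' Gm] by (simp add: case_prod_unfold)
  have Mm: "M \<in> borel_measurable lborel"
    unfolding M_def[abs_def] using lborel.borel_measurable_lebesgue_integral[OF swap] by (intro borel_measurable_scaleR) auto
  have Mx: "x_mean L1 g y = M y" if "y \<in> {0..L2}" for y
    unfolding x_mean_def M_def set_lebesgue_integral_def G_def using that by (simp add: indicator_times)
  have sp: "space \<TT> = ?R" by (simp add: torus_def space_restrict_space)
  have Ms: "(\<lambda>z. M (snd z)) \<in> borel_measurable (lborel :: (real \<times> real) measure)"
    using Mm by (simp add: lborel_prod[symmetric])
  then have "(\<lambda>z. M (snd z)) \<in> borel_measurable \<TT>"
    unfolding torus_def by (rule measurable_restrict_space1)
  then have meas: "(\<lambda>z. x_mean L1 g (snd z)) \<in> borel_measurable \<TT>"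
    by (rule measurable_cong[THEN iffD1, rotated]) (auto simp: sp Mx)
  have pt: "ennreal ((cmod (M y))\<^sup>2) \<le> ennreal (1 / L1) * (\<integral>\<^sup>+x. ennreal ((cmod (G (x, y)))\<^sup>2) \<partial>lborel)" for y
  \<comment> \<open>On a slice with infinite right-hand side the bound is trivial, whatever default
    value the Bochner integral takes there.\<close>
  proof (cases "(\<integral>\<^sup>+x. ennreal ((cmod (G (x, y)))\<^sup>2) \<partial>lborel) < \<infinity>")
    case True
    have Gy: "(\<lambda>x. G (x, y)) \<in> borel_measurable lborel" using Gm by measurable
    have Gs: "(\<lambda>x. G (x, y)) \<in> square_integrable lborel"
      using Gy True by (intro square_integrableI integrableI_bounded) auto
    have Is: "(indicator {0..L1} :: real \<Rightarrow> complex) \<in> square_integrable lborel"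
    proof (rule square_integrableI)
      have "(\<lambda>x. (cmod (indicator {0..L1} x))\<^sup>2) = (\<lambda>x. indicator {0..L1} x :: real)" by (auto simp: indicator_def)
      moreover have "integrable lborel (indicator {0..L1} :: real \<Rightarrow> real)"
        by (rule integrable_real_indicator) (use L1_pos in auto)
      ultimately show "integrable lborel (\<lambda>x. (cmod (indicator {0..L1} x))\<^sup>2)" by simp
    qed simp
    have In: "norm2 lborel (indicator {0..L1} :: real \<Rightarrow> complex) = sqrt L1"
    proof -
      have "(\<lambda>x. (cmod (indicator {0..L1} x))\<^sup>2) = (\<lambda>x. indicator {0..L1} x :: real)" by (auto simp: indicator_def)
      then show ?thesis unfolding norm2_def using L1_pos by simp
    qed
    have "(\<integral>x. G (x, y) \<partial>lborel) = (\<integral>x. G (x, y) * indicator {0..L1} x \<partial>lborel)"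
      by (intro Bochner_Integration.integral_cong) (auto simp: G_def indicator_def)
    then have "cmod (\<integral>x. G (x, y) \<partial>lborel) \<le> norm2 lborel (\<lambda>x. G (x, y)) * sqrt L1"
      using norm2_Cauchy_Schwarz[OF Gs Is] by (simp add: In)
    then have "(cmod (\<integral>x. G (x, y) \<partial>lborel))\<^sup>2 \<le> (norm2 lborel (\<lambda>x. G (x, y)) * sqrt L1)\<^sup>2" by (intro power_mono) auto
    also have "\<dots> = (norm2 lborel (\<lambda>x. G (x, y)))\<^sup>2 * L1" using L1_pos by (simp add: power_mult_distrib)
    finally have "(1 / L1)\<^sup>2 * (cmod (\<integral>x. G (x, y) \<partial>lborel))\<^sup>2 \<le> (1 / L1)\<^sup>2 * ((norm2 lborel (\<lambda>x. G (x, y)))\<^sup>2 * L1)"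
      by (intro mult_left_mono) auto
    then have "(cmod (M y))\<^sup>2 \<le> 1 / L1 * (\<integral>x. (cmod (G (x, y)))\<^sup>2 \<partial>lborel)"
      unfolding M_def norm2_power2 using L1_pos by (simp add: norm_scaleR power_mult_distrib power2_eq_square field_simps)
    then have "ennreal ((cmod (M y))\<^sup>2) \<le> ennreal (1 / L1 * (\<integral>x. (cmod (G (x, y)))\<^sup>2 \<partial>lborel))" by (rule ennreal_leI)
    also have "\<dots> = ennreal (1 / L1) * (\<integral>\<^sup>+x. ennreal ((cmod (G (x, y)))\<^sup>2) \<partial>lborel)"
    proof -
      have "ennreal (1 / L1 * (\<integral>x. (cmod (G (x, y)))\<^sup>2 \<partial>lborel)) = ennreal (1 / L1) * ennreal (\<integral>x. (cmod (G (x, y)))\<^sup>2 \<partial>lborel)"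
        using L1_pos by (intro ennreal_mult) auto
      then show ?thesis using nn_integral_eq_integral[OF square_integrableD(2)[OF Gs]] by (simp only: zero_le_power2 AE_I2)
    qed
    finally show ?thesis .
  next
    case False
    then have "(\<integral>\<^sup>+x. ennreal ((cmod (G (x, y)))\<^sup>2) \<partial>lborel) = \<infinity>" by (simp add: top.not_eq_extremum[symmetric])
    then show ?thesis using L1_pos by (simp add: ennreal_mult_top)
  qed
  have Gsq: "(\<lambda>z. ennreal ((cmod (G z))\<^sup>2)) \<in> borel_measurable (lborel \<Otimes>\<^sub>M lborel)" using Gm by measurable
  have "(\<integral>\<^sup>+z. ennreal (norm ((cmod (x_mean L1 g (snd z)))\<^sup>2)) \<partial>\<TT>)
     = (\<integral>\<^sup>+z. ennreal ((cmod (M (snd z)))\<^sup>2) * indicator ?R z \<partial>lborel)"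
    unfolding torus_def by (subst nn_integral_restrict_space) (auto intro!: nn_integral_cong simp: Mx indicator_def)
  also have "\<dots> = (\<integral>\<^sup>+y. \<integral>\<^sup>+x. ennreal ((cmod (M y))\<^sup>2) * indicator ?R (x, y) \<partial>lborel \<partial>lborel)"
    unfolding lborel_prod[symmetric]
  proof (subst lborel_pair.nn_integral_snd[symmetric])
    have "?R \<in> sets borel" by (intro borel_closed closed_Times) auto
    then show "(\<lambda>z. ennreal ((cmod (M (snd z)))\<^sup>2) * indicator ?R z) \<in> borel_measurable (lborel \<Otimes>\<^sub>M lborel)"
      using Ms unfolding lborel_prod by simp
  qed simp
  also have "\<dots> \<le> (\<integral>\<^sup>+y. \<integral>\<^sup>+x. ennreal ((cmod (G (x, y)))\<^sup>2) \<partial>lborel \<partial>lborel)"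
  proof (rule nn_integral_mono)
    fix y :: real
    have "(\<integral>\<^sup>+x. ennreal ((cmod (M y))\<^sup>2) * indicator ?R (x, y) \<partial>lborel) \<le> (\<integral>\<^sup>+x. ennreal ((cmod (M y))\<^sup>2) * indicator {0..L1} x \<partial>lborel)"
      by (intro nn_integral_mono) (auto simp: indicator_def)
    also have "\<dots> = ennreal ((cmod (M y))\<^sup>2) * ennreal L1"
      using L1_pos by (subst nn_integral_cmult_indicator) auto
    also have "\<dots> \<le> ennreal (1 / L1) * (\<integral>\<^sup>+x. ennreal ((cmod (G (x, y)))\<^sup>2) \<partial>lborel) * ennreal L1"
      by (intro mult_right_mono pt) simp
    also have "\<dots> = ennreal (1 / L1 * L1) * (\<integral>\<^sup>+x. ennreal ((cmod (G (x, y)))\<^sup>2) \<partial>lborel)"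
      using L1_pos by (subst ennreal_mult) (auto simp: mult_ac)
    also have "\<dots> = (\<integral>\<^sup>+x. ennreal ((cmod (G (x, y)))\<^sup>2) \<partial>lborel)" using L1_pos by simp
    finally show "(\<integral>\<^sup>+x. ennreal ((cmod (M y))\<^sup>2) * indicator ?R (x, y) \<partial>lborel) \<le> (\<integral>\<^sup>+x. ennreal ((cmod (G (x, y)))\<^sup>2) \<partial>lborel)" .
  qed
  also have "\<dots> = (\<integral>\<^sup>+z. ennreal ((cmod (G z))\<^sup>2) \<partial>lborel)"
    using lborel_pair.nn_integral_snd[OF Gsq] by (simp add: lborel_prod)
  also have "\<dots> < \<infinity>" using Gi nn_integral_eq_integral[OF Gi] by simp
  finally show ?thesis using meas by (intro square_integrableI integrableI_bounded) auto
qed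

lemma nonzero_modes_sq:
  assumes "g \<in> square_integrable \<TT>" shows "nonzero_modes L1 g \<in> square_integrable \<TT>"
  using square_integrable_diff[OF assms x_mean_snd_sq[OF assms]]
  by (simp add: nonzero_modes_def case_prod_unfold)

text \<open>Modes with zero \<open>x\<close>-frequency depend on \<open>y\<close> alone, so
  integrating in \<open>x\<close> first sees only the mean of \<open>g\<close>.\<close>

lemma fc_nonzero_modes:
  assumes g: "g \<in> square_integrable \<TT>" shows "fc (nonzero_modes L1 g) 0 l = 0"
proof -
  have m0: "mode L1 L2 0 (- l) (x, y) = wave L2 (- l) y" for x y by (simp add: mode_def)
  have "nonzero_modes L1 g = (\<lambda>z. g z - x_mean L1 g (snd z))" by (simp add: nonzero_modes_def case_prod_unfold)
  then have "fc (nonzero_modes L1 g) 0 l = fc g 0 l - fc (\<lambda>z. x_mean L1 g (snd z)) 0 l"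
    by (simp add: fc_diff[OF g x_mean_snd_sq[OF g]])
  also have "fc g 0 l = (LINT y:{0..L2}|lborel. of_real L1 * x_mean L1 g y * wave L2 (- l) y)"
    unfolding mode_coeff_def
    by (subst integral_torus_iterated') (use integrable_mode_mult[OF g] L1_pos in \<open>auto simp: m0 x_mean_def scaleR_conv_of_real\<close>)
  also have "fc (\<lambda>z. x_mean L1 g (snd z)) 0 l = (LINT y:{0..L2}|lborel. of_real L1 * x_mean L1 g y * wave L2 (- l) y)"
    unfolding mode_coeff_def
    by (subst integral_torus_iterated')
      (use integrable_mode_mult[OF x_mean_snd_sq[OF g]] L1_pos in \<open>auto simp: m0 set_lebesgue_integral_def scaleR_conv_of_real mult_ac\<close>)
  finally show ?thesis by simp
qed

lemma sum_fc_le: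
  assumes f: "f \<in> square_integrable \<TT>" and P: "finite P"
  shows "(\<Sum>(k, l)\<in>P. (cmod (fc f k l))\<^sup>2) \<le> L1 * L2 * (norm2 \<TT> f)\<^sup>2"
  by (rule has_sum_mono_neutral[OF has_sum_finite[OF P] mode_Parseval[OF f]]) auto

lemma sum_fc_row_le:
  assumes f: "f \<in> square_integrable \<TT>" and F: "finite F"
  shows "(\<Sum>l\<in>F. (cmod (fc f k l))\<^sup>2) \<le> L1 * L2 * (norm2 \<TT> f)\<^sup>2"
proof -
  have "(\<Sum>l\<in>F. (cmod (fc f k l))\<^sup>2) = (\<Sum>(k', l)\<in>{k} \<times> F. (cmod (fc f k' l))\<^sup>2)"
    unfolding sum.cartesian_product[symmetric] by simp
  also have "\<dots> \<le> L1 * L2 * (norm2 \<TT> f)\<^sup>2" by (rule sum_fc_le[OF f]) (use F in simp)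
  finally show ?thesis .
qed

end

text \<open>Both directions of \<open>gen\<close> matter: from the operator to the generator for
  trigonometric sums, and back from the generator to the operator along the orbit.\<close>

locale kolmogorov_semigroup = torus_semigroup +
  fixes m :: nat and \<nu> :: real
  assumes \<nu>_nonneg: "0 \<le> \<nu>"
    and gen: "generator L1 L2 S g (\<lambda>z. - h z) \<longleftrightarrow> H_op L1 L2 (\<lambda>y. sin (2 * pi * y / L2) ^ m) \<nu> g h"
begin

abbreviation "xfreq k \<equiv> 2 * pi * of_int k / L1"

text \<open>The orbit of a domain element stays in the domain, so \<open>H_op_fc\<close> rewrites
  the time derivative of its coefficients at every time.\<close>

lemma shear_system_fc:
  assumes H: "H_op L1 L2 (\<lambda>y. sin (2 * pi * y / L2) ^ m) \<nu> g h"
  shows "shear_system m (xfreq k) (symbol L2 \<nu> (xfreq k)) (\<lambda>t. fc (S t g) k)"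
proof
  have gX: "g \<in> X" using H by (simp add: H_op_def torus_L2)
  show "0 \<le> symbol L2 \<nu> (xfreq k) l" for l using \<nu>_nonneg by (simp add: symbol_def)
  show "((\<lambda>t. fc (S t g) k l) has_vector_derivative
      - (of_real (symbol L2 \<nu> (xfreq k) l) * fc (S t g) k l + \<i> * of_real (xfreq k) * sin_conv m (fc (S t g) k) l)) (at t within {0..})"
    if t: "0 \<le> t" for t l
  proof -
    have G: "generator L1 L2 S g (\<lambda>z. - h z)" using H gen by blast
    \<comment> \<open>The two signs fit the form \<open>\<lambda>z. - h z\<close> in which
      \<open>gen\<close> speaks of the generator.\<close>
    define h' where "h' z = - S t (\<lambda>z. - h z) z" for z
    have "generator L1 L2 S (S t g) (\<lambda>z. - h' z)" using generator_S[OF G t] by (simp add: h'_def)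
    then have "H_op L1 L2 (\<lambda>y. sin (2 * pi * y / L2) ^ m) \<nu> (S t g) h'" using gen by blast
    from H_op_fc[OF this, of k l]
    have "fc h' k l = of_real (symbol L2 \<nu> (xfreq k) l) * fc (S t g) k l + \<i> * of_real (xfreq k) * sin_conv m (fc (S t g) k) l" .
    moreover have "fc h' k l = - fc (S t (\<lambda>z. - h z)) k l" by (simp add: h'_def[abs_def] mode_coeff_def)
    ultimately have "fc (S t (\<lambda>z. - h z)) k l = - (of_real (symbol L2 \<nu> (xfreq k) l) * fc (S t g) k l + \<i> * of_real (xfreq k) * sin_conv m (fc (S t g) k) l)"
      by (metis minus_minus)
    with fc_S_has_vector_derivative[OF G t, of k l] show ?thesis by simp
  qed
  show "\<exists>B. \<forall>t\<in>{0..T}. \<forall>F. finite F \<longrightarrow> (\<Sum>l\<in>F. (cmod (fc (S t g) k l))\<^sup>2) \<le> B" for T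
  proof -
    obtain C where C: "C \<ge> 0" "\<And>t f. t \<in> {0..T} \<Longrightarrow> f \<in> X \<Longrightarrow> \<parallel>S t f\<parallel> \<le> C * \<parallel>f\<parallel>" using compact_bound[of T] by auto
    have "(\<Sum>l\<in>F. (cmod (fc (S t g) k l))\<^sup>2) \<le> L1 * L2 * (C * \<parallel>g\<parallel>)\<^sup>2" if t: "t \<in> {0..T}" and F: "finite F" for t F
    proof -
      have "(\<Sum>l\<in>F. (cmod (fc (S t g) k l))\<^sup>2) \<le> L1 * L2 * \<parallel>S t g\<parallel>\<^sup>2" using t by (intro sum_fc_row_le F S_sq gX) auto
      also have "\<dots> \<le> L1 * L2 * (C * \<parallel>g\<parallel>)\<^sup>2" using area_pos by (intro mult_left_mono power_mono C t gX) auto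
      finally show ?thesis .
    qed
    then show ?thesis by blast
  qed
qed

text \<open>Rows of different \<open>x\<close>-frequency evolve independently; their energies decay
  at a common rate and are added up by Parseval.\<close>

lemma decay_trig_sum:
  assumes \<Psi>: "\<Psi> > 0"
    and fin: "\<And>\<kappa> \<omega> w N. 2 * pi / L1 \<le> \<bar>\<kappa>\<bar> \<Longrightarrow> (\<And>l. \<bar>l\<bar> > int N \<Longrightarrow> w l = 0) \<Longrightarrow>
      \<Psi>\<^sup>2 * (\<Sum>l\<in>{- int N..int N}. (cmod (w l))\<^sup>2)
      \<le> (\<Sum>l\<in>{- int (N + m)..int (N + m)}.
          (cmod ((of_real (symbol L2 \<nu> \<kappa> l) + \<i> * of_real \<omega>) * w l + \<i> * of_real \<kappa> * sin_conv m w l))\<^sup>2)"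
    and F: "finite F" and c0: "\<And>l. c 0 l = 0" and t: "t \<ge> 0"
  shows "\<parallel>S t (trig_sum F c)\<parallel> \<le> 2 * exp (- (ln 2 / (2 * pi) * \<Psi>) * t) * \<parallel>trig_sum F c\<parallel>"
proof -
  define g where "g = trig_sum F c"
  have gX: "g \<in> X" by (simp add: g_def trig_sum_sq)
  obtain h where H: "H_op L1 L2 (\<lambda>y. sin (2 * pi * y / L2) ^ m) \<nu> g h"
    unfolding g_def using H_op_trig_sum[OF F] by blast
  define r where "r = 2 * exp (- (ln 2 / (2 * pi) * \<Psi>) * t)"
  have r: "r > 0" by (simp add: r_def)
  define e where "e k s = infsum (\<lambda>l. (cmod (fc (S s g) k l))\<^sup>2) UNIV" for k s
  note sys = shear_system_fc[OF H]
  have e_eq: "shear_system.energy (\<lambda>t. fc (S t g) k) s = e k s" for k s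
    unfolding shear_system.energy_def[OF sys] e_def ..
  have e_sum: "((\<lambda>l. (cmod (fc (S s g) k l))\<^sup>2) has_sum e k s) UNIV" if "s \<ge> 0" for k s
    using shear_system.energy_has_sum[OF sys that] by (simp add: e_eq)
  have S0: "fc (S 0 g) k l = fc g k l" for k l
    unfolding mode_coeff_def
  proof (rule integral_cong_AE)
    show "AE z in \<TT>. S 0 g z * mode L1 L2 (- k) (- l) z = g z * mode L1 L2 (- k) (- l) z"
      using S_0[OF gX] by eventually_elim simp
  qed (use meas[OF gX] meas[OF S_sq[of 0, OF _ gX]] meas[OF mode_sq] in auto)
  have decay: "e k t \<le> r\<^sup>2 * e k 0" for k
  proof (cases "k = 0")
    case True
    \<comment> \<open>The resolvent bound says nothing about the row \<open>k = 0\<close>, but its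
      energy starts at 0 and cannot increase.\<close>
    have "fc g 0 l = 0" for l unfolding g_def fc_trig_sum[OF F] by (simp add: c0)
    then have "e 0 0 = 0" by (simp add: e_def S0)
    moreover have "e 0 t \<le> e 0 0" using shear_system.energy_mono[OF sys, of 0 t 0] t by (simp add: e_eq)
    ultimately show ?thesis using True by simp
  next
    case False
    then have "1 \<le> \<bar>real_of_int k\<bar>" by linarith
    then have "2 * pi / L1 * 1 \<le> 2 * pi / L1 * \<bar>real_of_int k\<bar>" using L1_pos by (intro mult_left_mono) auto
    then have "2 * pi / L1 \<le> \<bar>xfreq k\<bar>" using L1_pos by (simp add: abs_mult)
    from shear_system.energy_decay[OF sys \<Psi> fin[OF this] t]
    show ?thesis unfolding e_eq r_def .
  qed
  \<comment> \<open>Each row energy is an infinite sum, so the finitely many rows are combined first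
    and then bounded through finite blocks.\<close>
  have tot0: "(\<Sum>k\<in>K. e k 0) \<le> L1 * L2 * \<parallel>g\<parallel>\<^sup>2" if K: "finite K" for K
  proof -
    have "((\<lambda>l. \<Sum>k\<in>K. (cmod (fc (S 0 g) k l))\<^sup>2) has_sum (\<Sum>k\<in>K. e k 0)) UNIV"
      by (intro has_sum_finite_sum K e_sum) simp
    moreover have "(\<Sum>l\<in>Q. \<Sum>k\<in>K. (cmod (fc (S 0 g) k l))\<^sup>2) \<le> L1 * L2 * \<parallel>g\<parallel>\<^sup>2" if "finite Q" for Q
    proof -
      have "(\<Sum>l\<in>Q. \<Sum>k\<in>K. (cmod (fc (S 0 g) k l))\<^sup>2) = (\<Sum>(k, l)\<in>K \<times> Q. (cmod (fc g k l))\<^sup>2)"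
        unfolding sum.cartesian_product[symmetric] S0 by (rule sum.swap)
      also have "\<dots> \<le> L1 * L2 * \<parallel>g\<parallel>\<^sup>2" by (rule sum_fc_le[OF gX]) (use K that in simp)
      finally show ?thesis .
    qed
    ultimately show ?thesis by (rule has_sum_le_of_finite_sums)
  qed
  have "L1 * L2 * \<parallel>S t g\<parallel>\<^sup>2 \<le> r\<^sup>2 * (L1 * L2 * \<parallel>g\<parallel>\<^sup>2)"
  proof (rule has_sum_le_of_finite_sums[OF mode_Parseval[OF S_sq[OF t gX]]])
    fix P :: "(int \<times> int) set" assume P: "finite P"
    have "(\<Sum>(k, l)\<in>P. (cmod (fc (S t g) k l))\<^sup>2) \<le> (\<Sum>(k, l)\<in>fst ` P \<times> snd ` P. (cmod (fc (S t g) k l))\<^sup>2)"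
      by (rule sum_mono2) (use P in \<open>auto intro: rev_image_eqI\<close>)
    also have "\<dots> = (\<Sum>k\<in>fst ` P. \<Sum>l\<in>snd ` P. (cmod (fc (S t g) k l))\<^sup>2)" by (rule sum.cartesian_product[symmetric])
    also have "\<dots> \<le> (\<Sum>k\<in>fst ` P. r\<^sup>2 * e k 0)"
    proof (rule sum_mono)
      fix k
      have "(\<Sum>l\<in>snd ` P. (cmod (fc (S t g) k l))\<^sup>2) \<le> e k t"
        using shear_system.sum_le_energy[OF sys t, of "snd ` P" k] P by (simp add: e_eq)
      with decay[of k] show "(\<Sum>l\<in>snd ` P. (cmod (fc (S t g) k l))\<^sup>2) \<le> r\<^sup>2 * e k 0" by linarith
    qed
    also have "\<dots> = r\<^sup>2 * (\<Sum>k\<in>fst ` P. e k 0)" by (simp add: sum_distrib_left)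
    also have "\<dots> \<le> r\<^sup>2 * (L1 * L2 * \<parallel>g\<parallel>\<^sup>2)" by (intro mult_left_mono tot0) (use P in auto)
    finally show "(\<Sum>(k, l)\<in>P. (cmod (fc (S t g) k l))\<^sup>2) \<le> r\<^sup>2 * (L1 * L2 * \<parallel>g\<parallel>\<^sup>2)" .
  qed
  then have "(L1 * L2) * \<parallel>S t g\<parallel>\<^sup>2 \<le> (L1 * L2) * (r * \<parallel>g\<parallel>)\<^sup>2" by (simp add: power_mult_distrib mult_ac)
  then have "\<parallel>S t g\<parallel>\<^sup>2 \<le> (r * \<parallel>g\<parallel>)\<^sup>2" using area_pos mult_le_cancel_left_pos by blast
  then have "\<parallel>S t g\<parallel> \<le> r * \<parallel>g\<parallel>" using r by (intro power2_le_imp_le[of "\<parallel>S t g\<parallel>"]) auto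
  then show ?thesis by (simp add: g_def r_def)
qed

text \<open>At fixed \<open>t\<close> both sides are continuous in the \<open>L^2\<close> norm, so
  the estimate passes from trigonometric sums to their limits. The approximating sums use the
  coefficients of \<open>f\<close> and thus inherit a vanishing row \<open>k = 0\<close>.\<close>

lemma decay:
  assumes \<Psi>: "\<Psi> > 0"
    and fin: "\<And>\<kappa> \<omega> w N. 2 * pi / L1 \<le> \<bar>\<kappa>\<bar> \<Longrightarrow> (\<And>l. \<bar>l\<bar> > int N \<Longrightarrow> w l = 0) \<Longrightarrow>
      \<Psi>\<^sup>2 * (\<Sum>l\<in>{- int N..int N}. (cmod (w l))\<^sup>2)
      \<le> (\<Sum>l\<in>{- int (N + m)..int (N + m)}.
          (cmod ((of_real (symbol L2 \<nu> \<kappa> l) + \<i> * of_real \<omega>) * w l + \<i> * of_real \<kappa> * sin_conv m w l))\<^sup>2)"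
    and f: "f \<in> X" and f0: "\<And>l. fc f 0 l = 0" and t: "t \<ge> 0"
  shows "\<parallel>S t f\<parallel> \<le> 2 * exp (- (ln 2 / (2 * pi) * \<Psi>) * t) * \<parallel>f\<parallel>"
proof -
  define r where "r = 2 * exp (- (ln 2 / (2 * pi) * \<Psi>) * t)"
  have r: "r > 0" by (simp add: r_def)
  obtain C where C: "C \<ge> 0" "\<And>f. f \<in> X \<Longrightarrow> \<parallel>S t f\<parallel> \<le> C * \<parallel>f\<parallel>" using compact_bound[of t] t by auto
  have "\<parallel>S t f\<parallel> \<le> r * \<parallel>f\<parallel> + e" if e: "e > 0" for e
  proof -
    \<comment> \<open>The approximation error enters once through \<open>r\<close> and once through
      the bound \<open>C\<close> on \<open>S t\<close>; the summand 1 keeps the margin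
      harmless.\<close>
    define \<delta> where "\<delta> = e / (r + C + 1)"
    have \<delta>: "\<delta> > 0" using e r C by (simp add: \<delta>_def)
    obtain F where F: "finite F" and close: "\<parallel>\<lambda>z. f z - trig_sum F (\<lambda>k l. fc f k l / (L1 * L2)) z\<parallel> < \<delta>"
      using trig_sums_dense[OF f \<delta>] by blast
    define g where "g = trig_sum F (\<lambda>k l. fc f k l / (L1 * L2))"
    have gX: "g \<in> X" by (simp add: g_def trig_sum_sq)
    have close: "\<parallel>\<lambda>z. f z - g z\<parallel> < \<delta>" using close by (simp add: g_def)
    have "\<parallel>S t g\<parallel> \<le> r * \<parallel>g\<parallel>"
      unfolding g_def r_def by (rule decay_trig_sum[OF \<Psi> fin F _ t]) (simp_all add: f0)
    moreover have "\<parallel>g\<parallel> \<le> \<parallel>f\<parallel> + \<delta>" using norm2_reverse_triangle[OF f gX] close by linarith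
    then have "r * \<parallel>g\<parallel> \<le> r * (\<parallel>f\<parallel> + \<delta>)" using r by (intro mult_left_mono) auto
    moreover have "\<parallel>S t f\<parallel> - \<parallel>S t g\<parallel> \<le> C * \<delta>"
    proof -
      have "\<parallel>S t f\<parallel> - \<parallel>S t g\<parallel> \<le> \<parallel>\<lambda>z. S t f z - S t g z\<parallel>"
        using norm2_reverse_triangle[OF S_sq[OF t f] S_sq[OF t gX]] by linarith
      also have "\<dots> = \<parallel>S t (\<lambda>z. f z - g z)\<parallel>" by (rule norm_S_diff[OF t f gX])
      also have "\<dots> \<le> C * \<parallel>\<lambda>z. f z - g z\<parallel>" by (intro C X_intros f gX)
      also have "\<dots> \<le> C * \<delta>" using close C(1) by (intro mult_left_mono) auto
      finally show ?thesis .
    qed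
    moreover have "r * \<delta> + C * \<delta> \<le> e"
    proof -
      have "r * \<delta> + C * \<delta> \<le> (r + C + 1) * \<delta>" using \<delta> by (simp add: algebra_simps)
      also have "\<dots> = e" using r C(1) by (simp add: \<delta>_def)
      finally show ?thesis .
    qed
    ultimately show ?thesis by (simp add: distrib_left)
  qed
  then have "\<parallel>S t f\<parallel> \<le> r * \<parallel>f\<parallel>" by (rule field_le_epsilon)
  then show ?thesis by (simp add: r_def)
qed

end

theorem proposition1p2:
  fixes L1 L2 :: real and m :: nat and u :: "real \<Rightarrow> real"
  assumes "L1 > 0" and "L2 > 0" and "m \<ge> 1"
    and u_def: "u = (\<lambda>y. (sin (2 * pi * y / L2)) ^ m)"
  shows "\<exists>\<epsilon>::real. \<epsilon> > 0 \<and>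
    (\<forall>\<nu> S g t. 0 < \<nu> \<and> \<nu> < 1 \<and>
       semigroup_generated_by_minus L1 L2 (H_op L1 L2 u \<nu>) S \<and>
       g \<in> L2_torus L1 L2 \<and> t \<ge> 0 \<longrightarrow>
       L2_norm L1 L2 (S t (nonzero_modes L1 g)) \<le>
         exp (- (\<epsilon> * \<nu> powr (real (max 2 m) / (real (max 2 m) + 4))) * t + pi / 2)
           * L2_norm L1 L2 (nonzero_modes L1 g))"
proof -
  have \<kappa>0: "2 * pi / L1 > 0" using assms(1) by simp
  obtain \<epsilon> where \<epsilon>: "\<epsilon> > 0" and est: "\<And>\<nu> \<kappa> \<omega> (w :: int \<Rightarrow> complex) N.
      \<lbrakk>0 < \<nu>; \<nu> < 1; 2 * pi / L1 \<le> \<bar>\<kappa>\<bar>; \<And>l. \<bar>l\<bar> > int N \<Longrightarrow> w l = 0\<rbrakk>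
      \<Longrightarrow> (\<epsilon> * \<nu> powr (real (max 2 m) / (real (max 2 m) + 4)))\<^sup>2 * (\<Sum>l\<in>{- int N..int N}. (cmod (w l))\<^sup>2)
        \<le> (\<Sum>l\<in>{- int (N + m)..int (N + m)}.
            (cmod ((of_real (symbol L2 \<nu> \<kappa> l) + \<i> * of_real \<omega>) * w l + \<i> * of_real \<kappa> * sin_conv m w l))\<^sup>2)"
    using resolvent_estimate_finite[OF assms(2,3) \<kappa>0] by blast
  \<comment> \<open>This absorbs the prefactor 2 of \<open>decay\<close> into the constant of the
    claim.\<close>
  have two: "2 \<le> exp (pi / 2)"
    using exp_ge_add_one_self[of "pi / 2"] pi_ge_two by linarith
  have main: "L2_norm L1 L2 (S t (nonzero_modes L1 g)) \<le>
         exp (- ((ln 2 / (2 * pi) * \<epsilon>) * \<nu> powr (real (max 2 m) / (real (max 2 m) + 4))) * t + pi / 2)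
           * L2_norm L1 L2 (nonzero_modes L1 g)"
    if \<nu>: "0 < \<nu>" "\<nu> < 1" and sg: "semigroup_generated_by_minus L1 L2 (H_op L1 L2 u \<nu>) S"
      and g: "g \<in> L2_torus L1 L2" and t: "t \<ge> 0" for \<nu> S g t
  proof -
    interpret kolmogorov_semigroup L1 L2 S m \<nu>
      using assms(1,2) \<nu>(1) sg unfolding u_def semigroup_generated_by_minus_def by unfold_locales auto
    define \<Psi> where "\<Psi> = \<epsilon> * \<nu> powr (real (max 2 m) / (real (max 2 m) + 4))"
    have \<Psi>: "\<Psi> > 0" using \<epsilon> \<nu> by (simp add: \<Psi>_def)
    have gX: "g \<in> X" using g by (simp add: torus_L2)
    have "\<parallel>S t (nonzero_modes L1 g)\<parallel> \<le> 2 * exp (- (ln 2 / (2 * pi) * \<Psi>) * t) * \<parallel>nonzero_modes L1 g\<parallel>"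
      by (rule decay[OF \<Psi> _ nonzero_modes_sq[OF gX] fc_nonzero_modes[OF gX] t])
        (unfold \<Psi>_def, rule est[OF \<nu>])
    also have "\<dots> \<le> exp (pi / 2) * exp (- (ln 2 / (2 * pi) * \<Psi>) * t) * \<parallel>nonzero_modes L1 g\<parallel>"
      by (intro mult_right_mono two) auto
    also have "\<dots> = exp (- (ln 2 / (2 * pi) * \<Psi>) * t + pi / 2) * \<parallel>nonzero_modes L1 g\<parallel>"
      unfolding exp_add by (simp add: mult.commute)
    finally show ?thesis by (simp add: \<Psi>_def torus_norm mult.assoc)
  qed
  have "ln 2 / (2 * pi) * \<epsilon> > 0" using \<epsilon> by simp
  with main show ?thesis by blast
qed

end
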